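(* Suppose that the set $\{x\in\Omega:\ |\bar\Phi(x)|=\alpha\}$ is finite, with elements $\bar x^1,\dots,\bar x^m$ ($m=0$ meaning that it is empty), and that $\bar z'(\bar x^i)\neq 0$ for $i=1,\dots,m$. Then there exist constants $C,h_0>0$ such that for all $h\in(0,h_0]$ the optimal controls $\bar q=\bar a+\sum_{i=1}^m\bar c^i 1_{(\bar x^i,1)}$ of (P) and $\bar q_h=\bar a_h+\sum_{i=1}^m\bar c_h^i1_{(\bar x_h^i,1)}$ of (P$_{\rm vd}$) satisfy $$\sum_{i=1}^m|\bar x^i-\bar x_h^i|\le Ch^2,\qquad \sum_{i=1}^m|\bar c^i-\bar c_h^i|\le Ch^2,\qquad |\bar a-\bar a_h|\le Ch^2,$$ and moreover $$\|\bar q-\bar q_h\|_{L^1(\Omega)}\le Ch^2\qquad\text{and}\qquad \|\bar z-\bar z_h\|_{L^\infty(\Omega)}\le Ch^2 .$$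
   Context: Continuous problem (P). Let $\Omega=(0,1)$, $V=H^1_0(\Omega)$, and let $Q=BV(\Omega)$ be the space of all $q\in L^1(\Omega)$ whose distributional derivative $q'$ is a finite signed Radon measure on $\Omega$, normed by $\|q\|_{BV(\Omega)}=\|q\|_{L^1(\Omega)}+\|q'\|_{\mathcal M(\Omega)}$, where $\|\cdot\|_{\mathcal M(\Omega)}$ is the total variation norm on the space $\mathcal M(\Omega)$ of finite signed Radon measures on $\Omega$. Fix $\alpha>0$, $u_d\in L^\infty(\Omega)$, $a\in C^{0,1}(\bar\Omega)$ with $a(x)\ge\nu>0$ on $\bar\Omega$, and $d_0\in L^\infty(\Omega)$ with $d_0\ge 0$ a.e. Let $\mathfrak a(v,w)=(av',w')_{L^2(\Omega)}+(d_0v,w)_{L^2(\Omega)}$ for $v,w\in V$. For $q\in Q$ let $Sq\in V$ be the unique solution of $\mathfrak a(Sq,w)=(q,w)_{L^2(\Omega)}$ for all $w\in V$. Problem (P) is $\min_{q\in Q}j(q)$ with $j(q)=\frac12\|Sq-u_d\|_{L^2(\Omega)}^2+\alpha\|q'\|_{\mathcal M(\Omega)}$. It has a unique solution $\bar q$; $\bar u=S\bar q$ is the optimal state, the adjoint state $\bar z\in V\cap W^{2,\infty}(\Omega)$ is the solution of $\mathfrak a(w,\bar z)=(w,\bar u-u_d)_{L^2(\Omega)}$ for all $w\in V$, and $\bar\Phi(x)=\int_0^x\bar z(s)\,ds$ for $x\in[0,1]$. Variational discretization (P$_{\rm vd}$). Take a partition $0=x_0<x_1<\dots<x_l=1$,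 $l>1$, with mesh width $h=\max_i (x_i-x_{i-1})$, and let $V_h\subset V$ be the space of continuous functions on $[0,1]$ that vanish at $0$ and $1$ and are affine on each $(x_{i-1},x_i)$. For $q\in Q$ let $S_hq\in V_h$ be the unique solution of $\mathfrak a(S_hq,w_h)=(q,w_h)_{L^2(\Omega)}$ for all $w_h\in V_h$. Problem (P$_{\rm vd}$) is $\min_{q\in Q}j_h(q)$ with $j_h(q)=\frac12\|S_hq-u_d\|_{L^2(\Omega)}^2+\alpha\|q'\|_{\mathcal M(\Omega)}$. $\bar q_h\in Q$ denotes an optimal control, $\bar u_h=S_h\bar q_h$ the optimal state, and $\bar z_h\in V_h$ the adjoint state, i.e. the solution of $\mathfrak a(w_h,\bar z_h)=(w_h,\bar u_h-u_d)_{L^2(\Omega)}$ for all $w_h\in V_h$. Representation of the controls. $1_{(x,1)}$ is the characteristic function of $(x,1)$ and $B_R(x)=(x-R,x+R)$. Under the hypothesis of the claim, $\bar q=\bar a+\sum_{i=1}^m\bar c^i1_{(\bar x^i,1)}$ with real $\bar a,\bar c^i$ (some $\bar c^i$ possibly zero). Moreover there is $R>0$ such that the balls $B_R(\bar x^i)$ are pairwise disjoint subsets of $\Omega$, $|\bar z'|$ is bounded below by a positive constant on each of them, and, for all sufficiently small $h$, $\bar z_h$ has a unique root $\bar x_h^i$ in $B_R(\bar x^i)$ for each $i$, and $\bar q_h=\bar a_h+\sum_{i=1}^m\bar c_h^i1_{(\bar x_h^i,1)}$ with real $\bar a_h,\bar c_h^i$ (some $\bar c_h^i$ possibly zero). "For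 all $h\in(0,h_0]$" means for all partitions with mesh width $h\le h_0$; the constants $C$ and $h_0$ do not depend on the partition. *)

theory Defs
  imports "HOL-Analysis.Analysis" "HOL-Probability.Essential_Supremum"
begin

text \<open>
  Elements of Lebesgue and Sobolev spaces are represented by functions of type
  \<^typ>\<open>real \<Rightarrow> real\<close>, of which only the values in the open unit interval (up to null sets)
  matter.  Membership predicates and norms are invariant under almost everywhere equality there.
\<close>

abbreviation \<Omega> :: "real set" where
  "\<Omega> \<equiv> {0<..<1}"

abbreviation leb_\<Omega> :: "real measure" where
  "leb_\<Omega> \<equiv> lebesgue_on \<Omega>"

definition L1_norm :: "(real \<Rightarrow> real) \<Rightarrow> real" where
  "L1_norm f = (LINT t|leb_\<Omega>. \<bar>f t\<bar>)"

definition in_L2 :: "(real \<Rightarrow> real) \<Rightarrow> bool" where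
  "in_L2 f \<longleftrightarrow> f \<in> borel_measurable leb_\<Omega> \<and> integrable leb_\<Omega> (\<lambda>t. (f t)\<^sup>2)"

definition L2_inner :: "(real \<Rightarrow> real) \<Rightarrow> (real \<Rightarrow> real) \<Rightarrow> real" where
  "L2_inner f g = (LINT t|leb_\<Omega>. f t * g t)"

definition L2_norm :: "(real \<Rightarrow> real) \<Rightarrow> real" where
  "L2_norm f = sqrt (L2_inner f f)"

definition Linf_norm :: "(real \<Rightarrow> real) \<Rightarrow> ereal" where
  "Linf_norm f = esssup leb_\<Omega> (\<lambda>t. ereal \<bar>f t\<bar>)"

definition in_Linf :: "(real \<Rightarrow> real) \<Rightarrow> bool" where
  "in_Linf f \<longleftrightarrow> f \<in> borel_measurable leb_\<Omega> \<and> Linf_norm f < \<infinity>"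

definition test_function :: "(real \<Rightarrow> real) \<Rightarrow> bool" where
  "test_function \<phi> \<longleftrightarrow>
     (\<forall>n. (deriv ^^ n) \<phi> differentiable_on UNIV) \<and>
     (\<exists>K. compact K \<and> K \<subseteq> \<Omega> \<and> (\<forall>t. t \<notin> K \<longrightarrow> \<phi> t = 0))"

definition locally_L1 :: "(real \<Rightarrow> real) \<Rightarrow> bool" where
  "locally_L1 f \<longleftrightarrow> (\<forall>K. compact K \<and> K \<subseteq> \<Omega> \<longrightarrow> integrable (lebesgue_on K) f)"

definition has_weak_deriv :: "(real \<Rightarrow> real) \<Rightarrow> (real \<Rightarrow> real) \<Rightarrow> bool" where
  "has_weak_deriv v g \<longleftrightarrow> locally_L1 v \<and> locally_L1 g \<and>
     (\<forall>\<phi>. test_function \<phi> \<longrightarrow> L2_inner v (deriv \<phi>) = - L2_inner g \<phi>)"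

text \<open>The weak derivative is only determined almost everywhere, hence the choice operator.\<close>

definition weak_deriv :: "(real \<Rightarrow> real) \<Rightarrow> real \<Rightarrow> real" where
  "weak_deriv v = (SOME g. has_weak_deriv v g)"

text \<open>The closure of the test functions in the norm of \<open>H\<^sup>1\<close>.\<close>

definition H10 :: "(real \<Rightarrow> real) set" where
  "H10 = {v. \<exists>g. in_L2 v \<and> in_L2 g \<and> has_weak_deriv v g \<and>
     (\<exists>\<phi>. (\<forall>n::nat. test_function (\<phi> n)) \<and>
        (\<lambda>n. L2_norm (\<lambda>t. \<phi> n t - v t)) \<longlonglongrightarrow> 0 \<and>
        (\<lambda>n. L2_norm (\<lambda>t. deriv (\<phi> n) t - g t)) \<longlonglongrightarrow> 0)}"

text \<open>
  A finite signed Radon measure on the unit interval is represented as the difference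
  \<open>M - N\<close> of two finite Borel measures (Jordan decomposition; the two need not be mutually
  singular).  The representation is not unique, but its total variation norm only depends on the
  set function \<open>M - N\<close>, and the latter is determined by the distribution it represents.
\<close>

definition finite_borel_measure_\<Omega> :: "real measure \<Rightarrow> bool" where
  "finite_borel_measure_\<Omega> M \<longleftrightarrow> finite_measure M \<and> sets M = sets (restrict_space borel \<Omega>)"

definition tv_norm :: "real measure \<times> real measure \<Rightarrow> real" where
  "tv_norm = (\<lambda>(M, N). SUP P \<in> {P. finite P \<and> partition_on \<Omega> P \<and> P \<subseteq> sets borel}.
     (\<Sum>A\<in>P. \<bar>measure M A - measure N A\<bar>))"

definition has_deriv_measure :: "(real \<Rightarrow> real) \<Rightarrow> real measure \<times> real measure \<Rightarrow> bool" where
  "has_deriv_measure q = (\<lambda>(M, N).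
     finite_borel_measure_\<Omega> M \<and> finite_borel_measure_\<Omega> N \<and>
     (\<forall>\<phi>. test_function \<phi> \<longrightarrow>
        L2_inner q (deriv \<phi>) = - ((LINT t|M. \<phi> t) - (LINT t|N. \<phi> t))))"

definition BV :: "(real \<Rightarrow> real) set" where
  "BV = {q. integrable leb_\<Omega> q \<and> (\<exists>\<mu>. has_deriv_measure q \<mu>)}"

definition deriv_tv :: "(real \<Rightarrow> real) \<Rightarrow> real" where
  "deriv_tv q = tv_norm (SOME \<mu>. has_deriv_measure q \<mu>)"

definition bform ::
  "(real \<Rightarrow> real) \<Rightarrow> (real \<Rightarrow> real) \<Rightarrow> (real \<Rightarrow> real) \<Rightarrow> (real \<Rightarrow> real) \<Rightarrow> real" where
  "bform a d v w =
     L2_inner (\<lambda>t. a t * weak_deriv v t) (weak_deriv w) + L2_inner (\<lambda>t. d t * v t) w"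

text \<open>
  The continuous and the discretized problem only differ in the space \<open>W\<close> of trial and test
  functions.  In the continuous case the state is unique up to null sets, hence the choice
  operator.
\<close>

definition is_state ::
  "(real \<Rightarrow> real) \<Rightarrow> (real \<Rightarrow> real) \<Rightarrow> (real \<Rightarrow> real) set \<Rightarrow> (real \<Rightarrow> real) \<Rightarrow> (real \<Rightarrow> real) \<Rightarrow> bool"
  where
  "is_state a d W q u \<longleftrightarrow> u \<in> W \<and> (\<forall>w\<in>W. bform a d u w = L2_inner q w)"

definition state ::
  "(real \<Rightarrow> real) \<Rightarrow> (real \<Rightarrow> real) \<Rightarrow> (real \<Rightarrow> real) set \<Rightarrow> (real \<Rightarrow> real) \<Rightarrow> real \<Rightarrow> real"
  where
  "state a d W q = (SOME u. is_state a d W q u)"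

definition cost ::
  "(real \<Rightarrow> real) \<Rightarrow> (real \<Rightarrow> real) \<Rightarrow> (real \<Rightarrow> real) set \<Rightarrow> (real \<Rightarrow> real) \<Rightarrow> real \<Rightarrow> (real \<Rightarrow> real) \<Rightarrow> real"
  where
  "cost a d W ud \<alpha> q =
     1 / 2 * (L2_norm (\<lambda>t. state a d W q t - ud t))\<^sup>2 + \<alpha> * deriv_tv q"

definition optimal_control ::
  "(real \<Rightarrow> real) \<Rightarrow> (real \<Rightarrow> real) \<Rightarrow> (real \<Rightarrow> real) set \<Rightarrow> (real \<Rightarrow> real) \<Rightarrow> real \<Rightarrow> (real \<Rightarrow> real) \<Rightarrow> bool"
  where
  "optimal_control a d W ud \<alpha> q \<longleftrightarrow>
     q \<in> BV \<and> (\<forall>p\<in>BV. cost a d W ud \<alpha> q \<le> cost a d W ud \<alpha> p)"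

definition adjoint_state ::
  "(real \<Rightarrow> real) \<Rightarrow> (real \<Rightarrow> real) \<Rightarrow> (real \<Rightarrow> real) set \<Rightarrow> (real \<Rightarrow> real) \<Rightarrow> (real \<Rightarrow> real) \<Rightarrow> (real \<Rightarrow> real) \<Rightarrow> bool"
  where
  "adjoint_state a d W ud q z \<longleftrightarrow>
     z \<in> W \<and> (\<forall>w\<in>W. bform a d w z = L2_inner w (\<lambda>t. state a d W q t - ud t))"

definition grid :: "nat \<Rightarrow> (nat \<Rightarrow> real) \<Rightarrow> bool" where
  "grid l x \<longleftrightarrow> 1 < l \<and> x 0 = 0 \<and> x l = 1 \<and> (\<forall>i<l. x i < x (Suc i))"

definition mesh_width :: "nat \<Rightarrow> (nat \<Rightarrow> real) \<Rightarrow> real" where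
  "mesh_width l x = Max ((\<lambda>i. x (Suc i) - x i) ` {..<l})"

definition Vh :: "nat \<Rightarrow> (nat \<Rightarrow> real) \<Rightarrow> (real \<Rightarrow> real) set" where
  "Vh l x = {v. continuous_on {0..1} v \<and> v 0 = 0 \<and> v 1 = 0 \<and>
     (\<forall>i<l. \<exists>b c. \<forall>t\<in>{x i<..<x (Suc i)}. v t = b + c * t)}"

definition step_fun :: "nat \<Rightarrow> real \<Rightarrow> (nat \<Rightarrow> real) \<Rightarrow> (nat \<Rightarrow> real) \<Rightarrow> real \<Rightarrow> real" where
  "step_fun m b c \<xi> t = b + (\<Sum>i=1..m. c i * indicator {\<xi> i<..<1} t)"

end

theory Submission
  imports Defs "HOL-Probability.Giry_Monad" "HOL-Computational_Algebra.Polynomial"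
begin

text \<open>
  Elements of \<^const>\<open>H10\<close> and of \<^const>\<open>Vh\<close> are primitives of their derivatives, and these have mean zero. All
  boundary value problems are therefore stated for derivatives: \<open>sol G f g\<close> says that the primitive of \<open>g\<close>
  solves the Galerkin equation with right-hand side \<open>f\<close> in the primitives of \<open>G\<close>, where \<open>G\<close> consists of all
  mean-free \<open>L\<^sup>2\<close> functions or of the piecewise constant ones. The continuous and the discretized control
  problem become two instances of one locale, and their optimality conditions are derived once.

  Structure of the controls. Varying an optimal control \<open>q\<close> with adjoint state \<open>z\<close> gives
  \<open>(q, z) + \<alpha> |q'| \<le> 0\<close> and \<open>|(p, z)| \<le> \<alpha> |p'|\<close> for all \<open>p\<close> of bounded variation, where \<open>|p'|\<close>
  is the total variation of the derivative (\<open>optimality\<close>). Taking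
  constants and jumps for \<open>p\<close> shows that \<open>\<Phi> = \<integral> z\<close> satisfies \<open>|\<Phi>| \<le> \<alpha>\<close> and vanishes at both ends. The first inequality
  then says that \<open>\<integral> \<Phi> dq'\<close> attains its largest possible value \<open>\<alpha> |q'|\<close>, so the measure \<open>q'\<close> is concentrated
  where \<open>|\<Phi>| = \<alpha>\<close>. If this happens at finitely many points, \<open>q\<close> is a step function
  (\<open>optimal_control_structure\<close>). At such points \<open>\<Phi>\<close> is extremal, hence \<open>z = 0\<close> there.

  A first estimate. Let \<open>\<delta>\<close> be the difference of the two optimal controls, \<open>S\<close> the continuous solution operator and
  \<open>s\<close> the \<open>L\<^sup>1\<close> norm of \<open>S \<delta>\<close>. Adding the optimality conditions of the two problems and using that the finite element
  error is \<open>O(h\<^sup>2)\<close> in the maximum norm (\<open>finite_element_error\<close>) gives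
  \<open>s\<^sup>2 \<le> C h\<^sup>2 (|\<delta>| + s)\<close> with \<open>|\<delta>|\<close> the \<open>L\<^sup>1\<close> norm, while the
  adjoint states differ by at most \<open>C (h\<^sup>2 + s)\<close> (\<open>convergence\<close>). As the discrete controls are bounded uniformly
  in the mesh (\<open>uniform_bounds\<close>), \<open>s = O(h)\<close>. The discrete adjoint state and its derivative are thus uniformly close to
  the continuous ones. Since \<open>z'\<close> does not vanish at the jump points, \<open>z\<^sub>h\<close> has exactly one root near each of them, at
  distance at most \<open>C (h\<^sup>2 + s)\<close> (\<open>perturbed_root\<close>), and the discrete control can jump nowhere else.

  Improvement to second order. Moving the jumps of the discrete control to those of the continuous one changes it
  by \<open>C (h\<^sup>2 + s)\<close> in \<open>L\<^sup>1\<close>, because its jump heights are bounded. After this change \<open>\<delta>\<close> is a step function with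
  fixed jump points. On this finite-dimensional space the \<open>L\<^sup>1\<close> norm of the state is a norm
  (\<open>step_fun_norm_equivalence\<close>), so all coefficients, and with them \<open>|\<delta>|\<close>, are bounded by \<open>C (h\<^sup>2 + s)\<close>. Inserted into
  the first estimate this yields \<open>s\<^sup>2 \<le> C h\<^sup>2 (h\<^sup>2 + s)\<close> and therefore \<open>s = O(h\<^sup>2)\<close>. Every
  quantity in the claim is at most a multiple of \<open>h\<^sup>2 + s\<close>.
\<close>

section \<open>Measure-theoretic preliminaries\<close>

interpretation leb: prob_space leb_\<Omega>
proof
  have "emeasure leb_\<Omega> (space leb_\<Omega>) = emeasure lebesgue {0<..<1::real}"
    by (simp add: emeasure_restrict_space)
  also have "\<dots> = 1" by simp
  finally show "emeasure leb_\<Omega> (space leb_\<Omega>) = 1" .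
qed

lemma AE_leb_\<Omega>_iff: "(AE t in leb_\<Omega>. P t) \<longleftrightarrow> (AE t in lebesgue. t \<in> \<Omega> \<longrightarrow> P t)"
  by (simp add: AE_restrict_space_iff)

lemma AE_leb_\<Omega>I: "(\<And>t. 0 < t \<Longrightarrow> t < 1 \<Longrightarrow> P t) \<Longrightarrow> AE t in leb_\<Omega>. P t"
  by (rule AE_I2) simp

lemma borel_imp_leb_\<Omega>: "f \<in> borel_measurable borel \<Longrightarrow> f \<in> borel_measurable leb_\<Omega>"
  by (simp add: measurable_completion measurable_restrict_space1)

lemma cont_imp_leb_\<Omega>: "continuous_on \<Omega> f \<Longrightarrow> (f :: real \<Rightarrow> real) \<in> borel_measurable leb_\<Omega>"
  by (rule continuous_imp_measurable_on_sets_lebesgue) auto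

lemma leb_\<Omega>_AE_eq_measurable:
  assumes "f \<in> borel_measurable leb_\<Omega>" "AE t in leb_\<Omega>. f t = g t"
  shows "(g :: real \<Rightarrow> real) \<in> borel_measurable leb_\<Omega>"
proof -
  have "(\<lambda>x. if x \<in> \<Omega> then f x else 0) \<in> borel_measurable lebesgue"
    using assms(1) by (subst borel_measurable_if) auto
  moreover have "AE x in lebesgue. (if x \<in> \<Omega> then f x else 0) = (if x \<in> \<Omega> then g x else 0)"
    using assms(2) unfolding AE_leb_\<Omega>_iff by eventually_elim auto
  ultimately have "(\<lambda>x. if x \<in> \<Omega> then g x else 0) \<in> borel_measurable lebesgue"
    by (rule borel_measurable_AE)
  then show ?thesis by (subst (asm) borel_measurable_if) auto
qed

text \<open>
  Representatives of \<open>L\<^sup>\<infinity>\<close>. Coefficients, controls, states and adjoint states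
  all lie in this algebra, and it is contained in \<open>L\<^sup>1\<close>; most integrability obligations
  reduce to it.
\<close>

definition ess_bounded :: "(real \<Rightarrow> real) \<Rightarrow> bool" where
  "ess_bounded f \<longleftrightarrow> f \<in> borel_measurable leb_\<Omega> \<and> (\<exists>B. AE t in leb_\<Omega>. \<bar>f t\<bar> \<le> B)"

lemma ess_boundedI:
  "f \<in> borel_measurable leb_\<Omega> \<Longrightarrow> (\<And>t. 0 < t \<Longrightarrow> t < 1 \<Longrightarrow> \<bar>f t\<bar> \<le> B) \<Longrightarrow> ess_bounded f"
  unfolding ess_bounded_def by (auto intro!: exI[of _ B] AE_leb_\<Omega>I)

lemma ess_bounded_AE_I:
  "f \<in> borel_measurable leb_\<Omega> \<Longrightarrow> AE t in leb_\<Omega>. \<bar>f t\<bar> \<le> B \<Longrightarrow> ess_bounded f"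
  unfolding ess_bounded_def by auto

lemma ess_bounded_measurable [measurable_dest]:
  "ess_bounded f \<Longrightarrow> f \<in> borel_measurable leb_\<Omega>"
  by (simp add: ess_bounded_def)

lemma ess_bounded_AE_cong:
  "ess_bounded f \<Longrightarrow> AE t in leb_\<Omega>. f t = g t \<Longrightarrow> ess_bounded g"
proof -
  assume f: "ess_bounded f" and fg: "AE t in leb_\<Omega>. f t = g t"
  then obtain B where "AE t in leb_\<Omega>. \<bar>f t\<bar> \<le> B" by (auto simp: ess_bounded_def)
  with fg have "AE t in leb_\<Omega>. \<bar>g t\<bar> \<le> B" by eventually_elim auto
  moreover have "g \<in> borel_measurable leb_\<Omega>"
    using f fg leb_\<Omega>_AE_eq_measurable ess_bounded_def by blast
  ultimately show ?thesis by (auto simp: ess_bounded_def)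
qed

lemma ess_bounded_const [simp, intro]: "ess_bounded (\<lambda>_. c)"
  by (rule ess_boundedI[of _ "\<bar>c\<bar>"]) auto

lemma ess_bounded_add [intro]: "ess_bounded f \<Longrightarrow> ess_bounded g \<Longrightarrow> ess_bounded (\<lambda>t. f t + g t)"
proof -
  assume f: "ess_bounded f" and g: "ess_bounded g"
  then obtain B B' where "AE t in leb_\<Omega>. \<bar>f t\<bar> \<le> B" "AE t in leb_\<Omega>. \<bar>g t\<bar> \<le> B'"
    by (auto simp: ess_bounded_def)
  then have "AE t in leb_\<Omega>. \<bar>f t + g t\<bar> \<le> B + B'" by eventually_elim auto
  with f g show ?thesis by (auto simp: ess_bounded_def)
qed

lemma ess_bounded_mult [intro]: "ess_bounded f \<Longrightarrow> ess_bounded g \<Longrightarrow> ess_bounded (\<lambda>t. f t * g t)"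
proof -
  assume f: "ess_bounded f" and g: "ess_bounded g"
  then obtain B B' where "AE t in leb_\<Omega>. \<bar>f t\<bar> \<le> B" "AE t in leb_\<Omega>. \<bar>g t\<bar> \<le> B'"
    by (auto simp: ess_bounded_def)
  then have "AE t in leb_\<Omega>. \<bar>f t * g t\<bar> \<le> B * B'"
    by eventually_elim (auto simp: abs_mult intro!: mult_mono)
  with f g show ?thesis by (auto simp: ess_bounded_def)
qed

lemma ess_bounded_minus [intro]: "ess_bounded f \<Longrightarrow> ess_bounded (\<lambda>t. - f t)"
  using ess_bounded_mult[of "\<lambda>_. -1" f] by simp

lemma ess_bounded_diff [intro]: "ess_bounded f \<Longrightarrow> ess_bounded g \<Longrightarrow> ess_bounded (\<lambda>t. f t - g t)"
  using ess_bounded_add[of f "\<lambda>t. - g t"] by auto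

lemma ess_bounded_abs [intro]: "ess_bounded f \<Longrightarrow> ess_bounded (\<lambda>t. \<bar>f t\<bar>)"
  by (auto simp: ess_bounded_def)

lemma ess_bounded_sum [intro]:
  "(\<And>i. i \<in> A \<Longrightarrow> ess_bounded (f i)) \<Longrightarrow> ess_bounded (\<lambda>t. \<Sum>i\<in>A. f i t)"
  by (induction A rule: infinite_finite_induct) (auto intro!: ess_bounded_add)

lemma ess_bounded_indicator [intro]: "A \<in> sets borel \<Longrightarrow> ess_bounded (indicator A)"
  by (rule ess_boundedI[of _ 1]) (auto simp: indicator_def intro!: borel_imp_leb_\<Omega>)

lemma ess_bounded_cont:
  assumes "continuous_on {0..1} f" shows "ess_bounded f"
proof -
  have "compact (f ` {0..1})" using assms by (intro compact_continuous_image) auto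
  then obtain B where "\<forall>x\<in>f ` {0..1}. norm x \<le> B"
    using compact_imp_bounded bounded_iff by blast
  moreover have "f \<in> borel_measurable leb_\<Omega>"
    by (rule cont_imp_leb_\<Omega>[OF continuous_on_subset[OF assms]]) auto
  ultimately show ?thesis by (intro ess_boundedI[of _ B]) auto
qed

lemma ess_bounded_integrable [intro]: "ess_bounded f \<Longrightarrow> integrable leb_\<Omega> f"
  unfolding ess_bounded_def
  using leb.integrable_const_bound[of f] by auto

lemma ess_bounded_mult_integrable:
  assumes "ess_bounded f" "integrable leb_\<Omega> g" shows "integrable leb_\<Omega> (\<lambda>t. f t * g t)"
proof -
  obtain B where B: "AE t in leb_\<Omega>. \<bar>f t\<bar> \<le> B" and [measurable]: "f \<in> borel_measurable leb_\<Omega>"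
    using assms(1) by (auto simp: ess_bounded_def)
  have [measurable]: "g \<in> borel_measurable leb_\<Omega>" using assms(2) by auto
  show ?thesis
  proof (rule Bochner_Integration.integrable_bound[of _ "\<lambda>t. B * g t"])
    show "AE t in leb_\<Omega>. norm (f t * g t) \<le> norm (B * g t)"
      using B by eventually_elim (auto simp: abs_mult intro!: mult_right_mono)
  qed (use assms in auto)
qed

section \<open>Square integrable functions\<close>

lemma in_L2_measurable [measurable_dest]: "in_L2 f \<Longrightarrow> f \<in> borel_measurable leb_\<Omega>"
  by (simp add: in_L2_def)

lemma in_L2_mult_integrable:
  assumes "in_L2 f" "in_L2 g" shows "integrable leb_\<Omega> (\<lambda>t. f t * g t)"
proof (rule Bochner_Integration.integrable_bound[of _ "\<lambda>t. (f t)\<^sup>2 + (g t)\<^sup>2"])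
  show "integrable leb_\<Omega> (\<lambda>t. (f t)\<^sup>2 + (g t)\<^sup>2)" using assms by (auto simp: in_L2_def)
  show "(\<lambda>t. f t * g t) \<in> borel_measurable leb_\<Omega>" using assms by (auto simp: in_L2_def)
  have "\<bar>x * y\<bar> \<le> x\<^sup>2 + y\<^sup>2" for x y :: real
  proof -
    have "2 * \<bar>x * y\<bar> \<le> x\<^sup>2 + y\<^sup>2"
      using sum_squares_bound[of "\<bar>x\<bar>" "\<bar>y\<bar>"] by (simp add: abs_mult)
    then show ?thesis using abs_ge_zero[of "x * y"] by linarith
  qed
  then show "AE t in leb_\<Omega>. norm (f t * g t) \<le> norm ((f t)\<^sup>2 + (g t)\<^sup>2)" by auto
qed

lemma ess_bounded_in_L2: "ess_bounded f \<Longrightarrow> in_L2 f"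
  unfolding in_L2_def power2_eq_square by (auto intro: ess_bounded_measurable)

lemma in_L2_integrable [intro]: "in_L2 f \<Longrightarrow> integrable leb_\<Omega> f"
  using in_L2_mult_integrable[of f "\<lambda>_. 1"] by (auto intro: ess_bounded_in_L2)

lemma in_L2_add [intro]: "in_L2 f \<Longrightarrow> in_L2 g \<Longrightarrow> in_L2 (\<lambda>t. f t + g t)"
proof -
  assume fg: "in_L2 f" "in_L2 g"
  have "integrable leb_\<Omega> (\<lambda>t. (f t)\<^sup>2 + (g t)\<^sup>2 + 2 * (f t * g t))"
    using fg in_L2_mult_integrable[OF fg] by (auto simp: in_L2_def)
  then show ?thesis using fg by (auto simp: in_L2_def power2_sum mult.assoc)
qed

lemma ess_bounded_mult_in_L2: "ess_bounded f \<Longrightarrow> in_L2 g \<Longrightarrow> in_L2 (\<lambda>t. f t * g t)"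
  using ess_bounded_mult_integrable[of "\<lambda>t. f t * f t" "\<lambda>t. (g t)\<^sup>2"]
  by (auto simp: in_L2_def power_mult_distrib power2_eq_square[of "f _"])

lemma in_L2_scale [intro]: "in_L2 f \<Longrightarrow> in_L2 (\<lambda>t. c * f t)"
  by (rule ess_bounded_mult_in_L2) auto

lemma in_L2_diff [intro]: "in_L2 f \<Longrightarrow> in_L2 g \<Longrightarrow> in_L2 (\<lambda>t. f t - g t)"
  using in_L2_add[of f "\<lambda>t. (-1) * g t"] in_L2_scale[of g "-1"] by simp

text \<open>
  Cauchy-Schwarz against the constant function one.
\<close>

lemma square_integral_abs_le:
  assumes "in_L2 f" shows "(LINT t|leb_\<Omega>. \<bar>f t\<bar>)\<^sup>2 \<le> (LINT t|leb_\<Omega>. (f t)\<^sup>2)"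
proof -
  define X where "X = (LINT t|leb_\<Omega>. \<bar>f t\<bar>)"
  have i: "integrable leb_\<Omega> f" "integrable leb_\<Omega> (\<lambda>t. (f t)\<^sup>2)" using assms by (auto simp: in_L2_def)
  have "0 \<le> (LINT t|leb_\<Omega>. (\<bar>f t\<bar> - X)\<^sup>2)" by (rule integral_nonneg_AE) auto
  also have "\<dots> = (LINT t|leb_\<Omega>. (f t)\<^sup>2 - 2 * X * \<bar>f t\<bar> + X\<^sup>2)"
    by (rule Bochner_Integration.integral_cong) (auto simp: power2_diff algebra_simps)
  also have "\<dots> = (LINT t|leb_\<Omega>. (f t)\<^sup>2) - 2 * X * X + X\<^sup>2"
    using i by (simp add: X_def leb.prob_space[simplified])
  finally show ?thesis by (simp add: X_def[symmetric] power2_eq_square)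
qed

section \<open>Primitives\<close>

text \<open>
  The primitive that vanishes at 0. As the integral of an indicator over the whole domain it is defined for
  every real argument, vanishes to the left of the domain and is constant to the right of it, and it has the
  form that Fubini's theorem needs below.
\<close>

definition prim :: "(real \<Rightarrow> real) \<Rightarrow> real \<Rightarrow> real" where
  "prim g t = (LINT s|leb_\<Omega>. indicator {..<t} s * g s)"

lemma integrable_ind [intro]:
  "A \<in> sets borel \<Longrightarrow> integrable leb_\<Omega> (g :: real \<Rightarrow> real) \<Longrightarrow> integrable leb_\<Omega> (\<lambda>s. indicator A s * g s)"
  by (rule ess_bounded_mult_integrable[of "indicator A"]) auto

lemma prim_0: "t \<le> 0 \<Longrightarrow> prim g t = 0"
  unfolding prim_def by (rule integral_eq_zero_AE) (auto intro!: AE_leb_\<Omega>I simp: indicator_def)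

lemma prim_ge_1: "1 \<le> t \<Longrightarrow> prim g t = (LINT s|leb_\<Omega>. g s)"
  unfolding prim_def by (rule Bochner_Integration.integral_cong) (auto simp: indicator_def)

lemma prim_1: "prim g 1 = (LINT s|leb_\<Omega>. g s)" by (rule prim_ge_1) simp

lemma prim_add: "integrable leb_\<Omega> f \<Longrightarrow> integrable leb_\<Omega> g \<Longrightarrow>
    prim (\<lambda>t. f t + g t) t = prim f t + prim g t"
  unfolding prim_def distrib_left by (rule Bochner_Integration.integral_add) auto

lemma prim_diff: "integrable leb_\<Omega> f \<Longrightarrow> integrable leb_\<Omega> g \<Longrightarrow>
    prim (\<lambda>t. f t - g t) t = prim f t - prim g t"
  unfolding prim_def right_diff_distrib by (rule Bochner_Integration.integral_diff) auto

lemma prim_cmult: "prim (\<lambda>t. c * g t) t = c * prim g t"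
  unfolding prim_def by (subst integral_mult_right_zero[symmetric]) (simp add: ac_simps)

lemma prim_zero: "prim (\<lambda>_. 0) t = 0" by (simp add: prim_def)

lemma prim_cong_AE:
  assumes "f \<in> borel_measurable leb_\<Omega>" "AE t in leb_\<Omega>. f t = g t"
  shows "prim f = prim g"
proof
  fix t
  have [measurable]: "f \<in> borel_measurable leb_\<Omega>" "g \<in> borel_measurable leb_\<Omega>"
    using assms(1) leb_\<Omega>_AE_eq_measurable[OF assms] by blast+
  have [measurable]: "indicator {..<t} \<in> borel_measurable leb_\<Omega>"
    by (rule borel_imp_leb_\<Omega>) auto
  show "prim f t = prim g t" unfolding prim_def
    by (rule integral_cong_AE) (use assms in auto)
qed

lemma prim_cong: "(\<And>t. 0 < t \<Longrightarrow> t < 1 \<Longrightarrow> f t = g t) \<Longrightarrow> prim f = prim g"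
  unfolding prim_def by (intro ext Bochner_Integration.integral_cong) auto

text \<open>
  The one-dimensional Sobolev embedding: the \<open>L\<^sup>1\<close> norm of the derivative controls the
  function uniformly.
\<close>

lemma prim_bound_integral: "integrable leb_\<Omega> g \<Longrightarrow> \<bar>prim g t\<bar> \<le> (LINT s|leb_\<Omega>. \<bar>g s\<bar>)"
proof -
  assume g: "integrable leb_\<Omega> g"
  have "\<bar>prim g t\<bar> \<le> (LINT s|leb_\<Omega>. \<bar>indicator {..<t} s * g s\<bar>)"
    unfolding prim_def by (rule integral_abs_bound)
  also have "\<dots> \<le> (LINT s|leb_\<Omega>. \<bar>g s\<bar>)"
  proof (rule integral_mono_AE)
    show "integrable leb_\<Omega> (\<lambda>s. \<bar>indicator {..<t} s * g s\<bar>)"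
      by (rule integrable_abs) (use g in auto)
  qed (use g in \<open>auto simp: indicator_def\<close>)
  finally show ?thesis .
qed

lemma prim_diff_ind:
  assumes "integrable leb_\<Omega> g" "s \<le> t"
  shows "prim g t - prim g s = (LINT r|leb_\<Omega>. indicator {s..<t} r * g r)"
proof -
  have "prim g t - prim g s = (LINT r|leb_\<Omega>. indicator {..<t} r * g r - indicator {..<s} r * g r)"
    unfolding prim_def by (rule Bochner_Integration.integral_diff[symmetric]) (use assms in auto)
  also have "\<dots> = (LINT r|leb_\<Omega>. indicator {s..<t} r * g r)"
    by (rule Bochner_Integration.integral_cong) (use assms in \<open>auto simp: indicator_def\<close>)
  finally show ?thesis .
qed

lemma integral_indicator_interval:
  assumes "0 \<le> s" "s \<le> t" "t \<le> 1"
  shows "(LINT r|leb_\<Omega>. indicator {s..<t} r) = t - s"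
proof -
  have "(LINT r|leb_\<Omega>. indicator {s..<t} r) = measure leb_\<Omega> ({s..<t} \<inter> space leb_\<Omega>)"
    by (rule Bochner_Integration.integral_indicator)
  also have "\<dots> = measure lebesgue ({s..<t} \<inter> \<Omega>)"
    by (subst measure_restrict_space) auto
  also have "\<dots> = measure lebesgue {s<..<t}"
  proof (rule measure_eq_AE)
    have "AE r in lebesgue. r \<noteq> s" 
      by (rule AE_completion) (simp add: AE_lborel_singleton)
    then show "AE x in lebesgue. (x \<in> {s..<t} \<inter> \<Omega>) = (x \<in> {s<..<t})"
      by eventually_elim (use assms in auto)
  qed auto
  finally show ?thesis using assms by simp
qed

lemma integral_indicator_bound:
  assumes "AE r in leb_\<Omega>. \<bar>g r\<bar> \<le> B" "0 \<le> s" "s \<le> t" "t \<le> 1"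
  shows "\<bar>LINT r|leb_\<Omega>. indicator {s..<t} r * g r\<bar> \<le> B * (t - s)"
proof (cases "integrable leb_\<Omega> (\<lambda>r. indicator {s..<t} r * g r)")
  case True
  have "\<bar>LINT r|leb_\<Omega>. indicator {s..<t} r * g r\<bar> \<le> (LINT r|leb_\<Omega>. \<bar>indicator {s..<t} r * g r\<bar>)"
    by (rule integral_abs_bound)
  also have "\<dots> \<le> (LINT r|leb_\<Omega>. B * indicator {s..<t} r)"
  proof (rule integral_mono_AE)
    show "AE x in leb_\<Omega>. \<bar>indicator {s..<t} x * g x\<bar> \<le> B * indicator {s..<t} x"
      using assms(1) by eventually_elim (auto simp: indicator_def)
    show "integrable leb_\<Omega> (\<lambda>r. B * indicator {s..<t} r)"
      by (intro ess_bounded_integrable ess_bounded_mult ess_bounded_indicator ess_bounded_const) auto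
  qed (use True in auto)
  also have "\<dots> = B * (t - s)" using assms integral_indicator_interval[of s t] by (simp del: integral_indicator)
  finally show ?thesis .
next
  case False
  have "AE r in leb_\<Omega>. 0 \<le> B" using assms(1) by eventually_elim auto
  then have "0 \<le> B" by (simp add: leb.AE_const)
  then show ?thesis using False assms by (simp add: not_integrable_integral_eq)
qed

lemma prim_lipschitz:
  assumes "integrable leb_\<Omega> g" "AE r in leb_\<Omega>. \<bar>g r\<bar> \<le> B" "s \<in> {0..1}" "t \<in> {0..1}"
  shows "\<bar>prim g t - prim g s\<bar> \<le> B * \<bar>t - s\<bar>"
proof (cases "s \<le> t")
  case True
  then show ?thesis using prim_diff_ind[OF assms(1) True] integral_indicator_bound[of g B s t] assms by auto
next
  case False
  then show ?thesis using prim_diff_ind[OF assms(1), of t s] integral_indicator_bound[of g B t s] assms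
    by (auto simp: abs_minus_commute)
qed

lemma continuous_prim:
  assumes g: "integrable leb_\<Omega> g" shows "continuous_on S (prim g)"
proof (rule continuous_on_subset[of UNIV])
  have [measurable]: "g \<in> borel_measurable leb_\<Omega>" using g by auto
  show "continuous_on UNIV (prim g)"
    unfolding continuous_on_sequentially comp_def
  proof (intro allI ballI impI, elim conjE)
    fix x :: "nat \<Rightarrow> real" and a :: real assume x: "x \<longlonglongrightarrow> a"
    have [measurable]: "indicator {..<t} \<in> borel_measurable leb_\<Omega>" for t :: real
      by (rule borel_imp_leb_\<Omega>) auto
    show "(\<lambda>n. prim g (x n)) \<longlonglongrightarrow> prim g a"
      unfolding prim_def
    proof (rule integral_dominated_convergence[where w="\<lambda>s. \<bar>g s\<bar>"])
      have "AE s in lebesgue. s \<noteq> a"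
        by (rule AE_completion) (simp add: AE_lborel_singleton)
      then have ne: "AE s in leb_\<Omega>. s \<noteq> a" unfolding AE_leb_\<Omega>_iff by eventually_elim auto
      have lim: "(\<lambda>n. indicator {..<x n} s * g s) \<longlonglongrightarrow> indicator {..<a} s * g s" if "s \<noteq> a" for s :: real
      proof (rule tendsto_eventually)
        show "\<forall>\<^sub>F n in sequentially. indicator {..<x n} s * g s = indicator {..<a} s * g s"
        proof (cases "s < a")
          case True
          from order_tendstoD(1)[OF x True] show ?thesis by eventually_elim (use True in auto)
        next
          case False with that have "a < s" by auto
          from order_tendstoD(2)[OF x this] show ?thesis by eventually_elim (use False in auto)
        qed
      qed
      show "AE s in leb_\<Omega>. (\<lambda>n. indicator {..<x n} s * g s) \<longlonglongrightarrow> indicator {..<a} s * g s"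
        using ne by eventually_elim (rule lim)
      show "AE s in leb_\<Omega>. norm (indicator {..<x n} s * g s) \<le> \<bar>g s\<bar>" for n
        by (auto simp: indicator_def)
    qed (use g in auto)
  qed
qed auto

lemma ess_bounded_prim [intro]: "integrable leb_\<Omega> g \<Longrightarrow> ess_bounded (prim g)"
  by (rule ess_bounded_cont) (rule continuous_prim)

lemma prim_eq_integral:
  assumes g: "integrable leb_\<Omega> g" and t: "0 \<le> t" "t \<le> 1"
  shows "prim g t = integral {0..t} g"
proof -
  have "prim g t = integral \<Omega> (\<lambda>s. indicator {..<t} s * g s)"
    unfolding prim_def by (rule lebesgue_integral_eq_integral) (use g in auto)
  also have "\<dots> = integral {0<..<t} g"
  proof -
    have "integral \<Omega> (\<lambda>s. indicator {..<t} s * g s) = integral \<Omega> (\<lambda>s. if s \<in> {0<..<t} then g s else 0)"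
      by (rule Henstock_Kurzweil_Integration.integral_cong) (auto simp: indicator_def)
    also have "\<dots> = integral ({0<..<t} \<inter> \<Omega>) g"
      by (rule Henstock_Kurzweil_Integration.integral_restrict_Int)
    also have "{0<..<t} \<inter> \<Omega> = {0<..<t}" using t by auto
    finally show ?thesis .
  qed
  also have "\<dots> = integral {0..t} g"
    using integral_open_interval_real[of 0 t g] by simp
  finally show ?thesis .
qed

lemma prim_FTC:
  assumes F: "\<And>t. t \<in> {0..1} \<Longrightarrow> (F has_real_derivative f t) (at t within {0..1})"
    and f: "integrable leb_\<Omega> f" and t: "t \<in> {0..1}"
  shows "prim f t = F t - F 0"
proof -
  have "(f has_integral (F t - F 0)) {0..t}"
  proof (rule fundamental_theorem_of_calculus)
    fix x assume "x \<in> {0..t}"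
    then have "(F has_real_derivative f x) (at x within {0..t})"
      using F[of x] t by (intro has_field_derivative_subset[of F "f x" x "{0..1}" "{0..t}"]) auto
    then show "(F has_vector_derivative f x) (at x within {0..t})"
      by (simp add: has_real_derivative_iff_has_vector_derivative)
  qed (use t in auto)
  then show ?thesis using prim_eq_integral[OF f] t by (simp add: integral_unique)
qed

lemma prim_has_derivative:
  assumes g: "continuous_on {0..1} g" and t: "0 < t" "t < 1"
  shows "(prim g has_real_derivative g t) (at t)"
proof -
  have "((\<lambda>u. integral {0..u} g) has_real_derivative g t) (at t within {0..1})"
    by (rule integral_has_real_derivative) (use assms in auto)
  then have "((\<lambda>u. integral {0..u} g) has_real_derivative g t) (at t within {0<..<1})"
    by (rule has_field_derivative_subset) auto
  then have "((\<lambda>u. integral {0..u} g) has_real_derivative g t) (at t)"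
    using t by (subst (asm) at_within_open) auto
  then show ?thesis
  proof (rule DERIV_cong_ev[THEN iffD1, rotated -1])
    have "\<forall>\<^sub>F u in nhds t. u \<in> {0<..<1}" using t by (intro eventually_nhds_in_open) auto
    then show "\<forall>\<^sub>F u in nhds t. integral {0..u} g = prim g u"
      by eventually_elim (use prim_eq_integral[OF ess_bounded_integrable[OF ess_bounded_cont[OF g]]] in auto)
  qed auto
qed

text \<open>
  Fubini's theorem on the triangle \<open>s < t\<close>. The inner measure is arbitrary because the
  statement is used twice: for Lebesgue measure it is integration by parts, and for a derivative measure it
  identifies the distributional derivative of its distribution function.
\<close>

lemma triangle_Fubini:
  assumes M: "finite_measure M" and MO: "space M = \<Omega>" and id: "(\<lambda>s. s) \<in> borel_measurable M"
    and f: "integrable M f" and k: "integrable leb_\<Omega> k"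
  shows "(LINT t|leb_\<Omega>. k t * (LINT s|M. indicator {..<t} s * f s)) =
         (LINT s|M. f s * ((LINT t|leb_\<Omega>. k t) - prim k s))"
proof -
  interpret M: finite_measure M by fact
  interpret P: pair_sigma_finite leb_\<Omega> M ..
  note id[measurable]
  have [measurable]: "f \<in> borel_measurable M" "k \<in> borel_measurable leb_\<Omega>" using f k by auto
  have [measurable]: "(\<lambda>t. t) \<in> borel_measurable leb_\<Omega>" by (rule borel_imp_leb_\<Omega>) auto
  define F where "F = (\<lambda>(t::real, s::real). k t * f s * (if s < t then 1 else 0))"
  have F_meas: "F \<in> borel_measurable (leb_\<Omega> \<Otimes>\<^sub>M M)" unfolding F_def by measurable
  have "integrable (leb_\<Omega> \<Otimes>\<^sub>M M) (\<lambda>(t, s). k t * f s)"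
  proof (rule P.Fubini_integrable)
    show "integrable leb_\<Omega> (\<lambda>t. LINT s|M. norm (case (t, s) of (t, s) \<Rightarrow> k t * f s))"
      using k by (simp add: abs_mult)
  qed (use f in auto)
  then have F_int: "integrable (leb_\<Omega> \<Otimes>\<^sub>M M) F"
    by (rule Bochner_Integration.integrable_bound) (use F_meas in \<open>auto simp: F_def\<close>)
  have "(LINT t|leb_\<Omega>. k t * (LINT s|M. indicator {..<t} s * f s)) = (LINT t|leb_\<Omega>. LINT s|M. F (t, s))"
    by (intro Bochner_Integration.integral_cong refl, subst integral_mult_right_zero[symmetric],
        intro Bochner_Integration.integral_cong) (auto simp: F_def indicator_def)
  also have "\<dots> = (LINT s|M. LINT t|leb_\<Omega>. F (t, s))"
    using P.Fubini_integral[of "\<lambda>t s. F (t, s)"] F_int by simp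
  also have "\<dots> = (LINT s|M. f s * ((LINT t|leb_\<Omega>. k t) - prim k s))"
  proof (intro Bochner_Integration.integral_cong refl)
    fix s assume "s \<in> space M"
    have ne: "AE t in leb_\<Omega>. t \<noteq> s" unfolding AE_leb_\<Omega>_iff
      using AE_completion[OF AE_lborel_singleton[of s]] by eventually_elim auto
    have "(LINT t|leb_\<Omega>. k t) - prim k s = (LINT t|leb_\<Omega>. k t - indicator {..<s} t * k t)"
      unfolding prim_def by (rule Bochner_Integration.integral_diff[symmetric]) (use k in auto)
    also have "\<dots> = (LINT t|leb_\<Omega>. (if s < t then k t else 0))"
    proof (rule integral_cong_AE)
      show "(\<lambda>t. k t - indicator {..<s} t * k t) \<in> borel_measurable leb_\<Omega>"
        using k by (intro borel_measurable_integrable Bochner_Integration.integrable_diff) auto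
      show "AE x in leb_\<Omega>. k x - indicator {..<s} x * k x = (if s < x then k x else 0)"
        using ne by eventually_elim (auto simp: indicator_def)
    qed measurable
    finally have "f s * ((LINT t|leb_\<Omega>. k t) - prim k s) = (LINT t|leb_\<Omega>. f s * (if s < t then k t else 0))"
      by simp
    also have "\<dots> = (LINT t|leb_\<Omega>. F (t, s))"
      by (intro Bochner_Integration.integral_cong) (auto simp: F_def)
    finally show "(LINT t|leb_\<Omega>. F (t, s)) = f s * ((LINT t|leb_\<Omega>. k t) - prim k s)" by simp
  qed
  finally show ?thesis .
qed

lemma prim_by_parts:
  assumes f: "integrable leb_\<Omega> f" and k: "integrable leb_\<Omega> k"
  shows "(LINT t|leb_\<Omega>. k t * prim f t) = (LINT s|leb_\<Omega>. f s) * (LINT s|leb_\<Omega>. k s) - (LINT s|leb_\<Omega>. f s * prim k s)"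
proof -
  have "(LINT t|leb_\<Omega>. k t * prim f t) = (LINT s|leb_\<Omega>. f s * ((LINT t|leb_\<Omega>. k t) - prim k s))"
    unfolding prim_def[of f]
    by (rule triangle_Fubini) (use f k in \<open>auto intro: leb.finite_measure_axioms borel_imp_leb_\<Omega>\<close>)
  also have "\<dots> = (LINT s|leb_\<Omega>. f s * (LINT t|leb_\<Omega>. k t) - f s * prim k s)"
    by (simp add: algebra_simps)
  also have "\<dots> = (LINT s|leb_\<Omega>. f s) * (LINT s|leb_\<Omega>. k s) - (LINT s|leb_\<Omega>. f s * prim k s)"
    using ess_bounded_mult_integrable[OF ess_bounded_prim[OF k] f] f
    by (subst Bochner_Integration.integral_diff) (auto simp: ac_simps)
  finally show ?thesis .
qed

section \<open>Test functions\<close>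

definition smooth :: "(real \<Rightarrow> real) \<Rightarrow> bool" where
  "smooth f \<longleftrightarrow> (\<forall>n. (deriv ^^ n) f differentiable_on UNIV)"

text \<open>
  Membership in a class that is closed under differentiation is enough, so no formulas for higher
  derivatives are ever needed.
\<close>

lemma smooth_coinduct:
  assumes f: "f \<in> S"
    and S: "\<And>g. g \<in> S \<Longrightarrow> \<exists>g'\<in>S. \<forall>x. (g has_real_derivative g' x) (at x)"
  shows "smooth f"
proof -
  have "(deriv ^^ n) f \<in> S" for n
  proof (induction n)
    case (Suc n)
    obtain g' where g': "g' \<in> S" "\<And>x. ((deriv ^^ n) f has_real_derivative g' x) (at x)"
      using S[OF Suc] by blast
    have "deriv ((deriv ^^ n) f) = g'" by (rule ext) (rule DERIV_imp_deriv[OF g'(2)])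
    then show ?case using g' by simp
  qed (use f in simp)
  then have "(deriv ^^ n) f differentiable_on UNIV" for n
    using S[of "(deriv ^^ n) f"] unfolding differentiable_on_def real_differentiable_def by auto
  then show ?thesis by (simp add: smooth_def)
qed

lemma smooth_has_derivative: "smooth f \<Longrightarrow> (f has_real_derivative deriv f x) (at x)"
  unfolding smooth_def
  by (drule spec[of _ 0]) (auto simp: differentiable_on_def DERIV_deriv_iff_real_differentiable)

lemma smooth_deriv: "smooth f \<Longrightarrow> smooth (deriv f)"
  unfolding smooth_def by (metis comp_apply funpow_Suc_right)

lemma smooth_antiderivative:
  assumes "smooth f" "\<And>x. (F has_real_derivative f x) (at x)" shows "smooth F"
proof (rule smooth_coinduct[of F "insert F {f. smooth f}"])
  fix g assume "g \<in> insert F {f. smooth f}"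
  then show "\<exists>g'\<in>insert F {f. smooth f}. \<forall>x. (g has_real_derivative g' x) (at x)"
    using assms smooth_has_derivative smooth_deriv by (cases "g = F") blast+
qed simp

lemma smooth_continuous: "smooth f \<Longrightarrow> continuous_on S f"
  by (rule continuous_on_subset[of UNIV])
     (auto intro!: continuous_at_imp_continuous_on DERIV_isCont smooth_has_derivative)

lemma smooth_const [simp]: "smooth (\<lambda>_. c)"
  by (rule smooth_coinduct[of _ "range (\<lambda>c _. c)"]) (auto intro!: exI[of _ 0])

lemma smooth_ident [simp]: "smooth (\<lambda>x. x)"
  by (rule smooth_antiderivative[of "\<lambda>_. 1"]) auto

lemma smooth_add: assumes "smooth f" "smooth g" shows "smooth (\<lambda>x. f x + g x)"
proof (rule smooth_coinduct)
  show "(\<lambda>x. f x + g x) \<in> {\<lambda>x. f x + g x | f g. smooth f \<and> smooth g}" using assms by auto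
  fix h assume "h \<in> {\<lambda>x. f x + g x | f g. smooth f \<and> smooth g}"
  then obtain f g where h: "h = (\<lambda>x. f x + g x)" "smooth f" "smooth g" by auto
  show "\<exists>g'\<in>{\<lambda>x. f x + g x | f g. smooth f \<and> smooth g}. \<forall>x. (h has_real_derivative g' x) (at x)"
    by (rule bexI[of _ "\<lambda>x. deriv f x + deriv g x"])
       (use h smooth_deriv smooth_has_derivative in \<open>auto intro!: DERIV_add\<close>)
qed

inductive_set product_sums :: "(real \<Rightarrow> real) set" where
  prod: "smooth f \<Longrightarrow> smooth g \<Longrightarrow> (\<lambda>x. f x * g x) \<in> product_sums"
| sum: "f \<in> product_sums \<Longrightarrow> g \<in> product_sums \<Longrightarrow> (\<lambda>x. f x + g x) \<in> product_sums"

lemma smooth_mult: assumes "smooth f" "smooth g" shows "smooth (\<lambda>x. f x * g x)"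
proof (rule smooth_coinduct)
  show "(\<lambda>x. f x * g x) \<in> product_sums" using assms by (rule product_sums.prod)
  fix h assume "h \<in> product_sums"
  then show "\<exists>h'\<in>product_sums. \<forall>x. (h has_real_derivative h' x) (at x)"
  proof induction
    case (prod f g)
    show ?case
      by (rule bexI[of _ "\<lambda>x. deriv f x * g x + deriv g x * f x"])
         (use prod smooth_deriv smooth_has_derivative in
           \<open>auto intro!: DERIV_mult product_sums.sum product_sums.prod\<close>)
  next
    case (sum f g)
    then obtain f' g' where "f' \<in> product_sums" "\<forall>x. (f has_real_derivative f' x) (at x)"
      "g' \<in> product_sums" "\<forall>x. (g has_real_derivative g' x) (at x)" by blast
    then show ?case
      by (intro bexI[of _ "\<lambda>x. f' x + g' x"]) (auto intro!: DERIV_add product_sums.sum)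
  qed
qed

lemma smooth_affine: assumes "smooth f" shows "smooth (\<lambda>x. f (a * x + b))"
proof (rule smooth_coinduct)
  let ?S = "{\<lambda>x. c * f (a * x + b) | c f. smooth f}"
  show "(\<lambda>x. f (a * x + b)) \<in> ?S" using assms by (auto intro!: exI[of _ 1] exI[of _ f])
  fix h assume "h \<in> ?S"
  then obtain c f where h: "h = (\<lambda>x. c * f (a * x + b))" "smooth f" by auto
  have "(h has_real_derivative (c * a) * deriv f (a * x + b)) (at x)" for x
    unfolding h
    by (auto intro!: derivative_eq_intros DERIV_chain2[OF smooth_has_derivative[OF h(2)]])
  then show "\<exists>h'\<in>?S. \<forall>x. (h has_real_derivative h' x) (at x)"
    using smooth_deriv[OF h(2)] by (intro bexI[of _ "\<lambda>x. (c * a) * deriv f (a * x + b)"]) auto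
qed

lemma smooth_polynomial: "real_polynomial_function p \<Longrightarrow> smooth p"
proof (induction rule: real_polynomial_function.induct)
  case (linear f)
  then obtain c where "f = (\<lambda>x. x * c)" by (auto simp: real_bounded_linear)
  then show ?case by (simp add: smooth_mult)
qed (auto intro: smooth_add smooth_mult)

text \<open>
  The classical smooth function that vanishes to infinite order at the origin.
\<close>

definition flat :: "real \<Rightarrow> real" where
  "flat x = (if 0 < x then exp (- 1 / x) else 0)"

lemma tendsto_poly_exp: "((\<lambda>y::real. poly p y * exp (- y)) \<longlongrightarrow> 0) at_top"
proof -
  have "((\<lambda>y::real. \<Sum>i\<le>degree p. coeff p i * (y ^ i / exp y)) \<longlongrightarrow> (\<Sum>i\<le>degree p. coeff p i * 0)) at_top"
    by (intro tendsto_intros tendsto_power_div_exp_0)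
  then show ?thesis
    by (simp add: poly_altdef exp_minus divide_inverse sum_distrib_right mult.assoc)
qed

text \<open>
  The functions \<open>p (1 / x) * exp (- 1 / x)\<close> with a polynomial \<open>p\<close>, extended by
  zero, form a class closed under differentiation: away from the origin by the product rule, at the origin
  because the exponential decays faster than any power grows.
\<close>

lemma smooth_flat: "smooth flat"
proof (rule smooth_coinduct)
  define G where "G = (\<lambda>(p :: real poly) x. if 0 < x then poly p (1 / x) * exp (- 1 / x) else 0)"
  show "flat \<in> range G"
    by (rule image_eqI[of _ _ 1]) (auto simp: G_def flat_def)
  fix g assume "g \<in> range G"
  then obtain p where g: "g = G p" by auto
  \<comment> \<open>With \<open>y = 1 / x\<close> the derivative of \<open>p y * exp (- y)\<close> is \<open>y\<^sup>2 * (p y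
    - p' y) * exp (- y)\<close>.\<close>
  define q where "q = [:0, 0, 1:] * (p - pderiv p)"
  have "(G p has_real_derivative G q x) (at x)" for x
  proof (cases x "0 :: real" rule: linorder_cases)
    case less
    have "((\<lambda>_. 0) has_real_derivative G q x) (at x)" using less by (simp add: G_def)
    then show ?thesis
    proof (rule DERIV_cong_ev[THEN iffD1, rotated -1])
      have "\<forall>\<^sub>F u in nhds x. u \<in> {..<0}" using less by (intro eventually_nhds_in_open) auto
      then show "\<forall>\<^sub>F u in nhds x. 0 = G p u" by eventually_elim (auto simp: G_def)
    qed auto
  next
    case greater
    have "((\<lambda>u. poly p (1 / u) * exp (- 1 / u)) has_real_derivative G q x) (at x)"
      using greater
      by (auto intro!: derivative_eq_intros DERIV_chain2[OF poly_DERIV] simp: G_def q_def field_simps power2_eq_square)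
    then show ?thesis
    proof (rule DERIV_cong_ev[THEN iffD1, rotated -1])
      have "\<forall>\<^sub>F u in nhds x. u \<in> {0<..}" using greater by (intro eventually_nhds_in_open) auto
      then show "\<forall>\<^sub>F u in nhds x. poly p (1 / u) * exp (- 1 / u) = G p u"
        by eventually_elim (auto simp: G_def)
    qed auto
  next
    case equal
    have "((\<lambda>h. G p h / h) \<longlongrightarrow> 0) (at_left 0)"
    proof (rule tendsto_eventually)
      show "\<forall>\<^sub>F h in at_left 0. G p h / h = 0"
        unfolding eventually_at_filter by (auto simp: G_def)
    qed
    moreover have "((\<lambda>h. G p h / h) \<longlongrightarrow> 0) (at_right 0)"
    proof -
      have "((\<lambda>h. poly ([:0, 1:] * p) (inverse h) * exp (- inverse h)) \<longlongrightarrow> 0) (at_right 0)"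
        by (rule filterlim_compose[OF tendsto_poly_exp filterlim_inverse_at_top_right])
      moreover have "\<forall>\<^sub>F h in at_right 0. poly ([:0, 1:] * p) (inverse h) * exp (- inverse h) = G p h / h"
        unfolding eventually_at_filter by (auto simp: G_def field_simps)
      ultimately show ?thesis by (rule Lim_transform_eventually)
    qed
    ultimately have "((\<lambda>h. G p h / h) \<longlongrightarrow> 0) (at 0)" by (rule filterlim_split_at)
    then show ?thesis unfolding DERIV_def equal by (simp add: G_def)
  qed
  then show "\<exists>g'\<in>range G. \<forall>x. (g has_real_derivative g' x) (at x)" using g by blast
qed

lemma flat_bounds: "0 \<le> flat x" "flat x \<le> 1" by (auto simp: flat_def)

lemma flat_tendsto: "filterlim f at_top F \<Longrightarrow> ((\<lambda>n. flat (f n)) \<longlongrightarrow> 1) F"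
proof -
  assume f: "filterlim f at_top F"
  have "((\<lambda>x. exp (- inverse x)) \<longlongrightarrow> exp (- 0 :: real)) at_top"
    by (intro tendsto_intros tendsto_inverse_0_at_top filterlim_ident)
  moreover have "\<forall>\<^sub>F x in at_top. exp (- inverse x) = flat x"
    using eventually_gt_at_top[of 0] by eventually_elim (auto simp: flat_def field_simps)
  ultimately have "(flat \<longlongrightarrow> 1) at_top" by (auto dest: Lim_transform_eventually)
  then show ?thesis using f by (rule filterlim_compose)
qed

text \<open>
  Each factor switches on at distance \<open>1 / (n + 1)\<close> inside the interval, which makes the
  support compact. Since the arguments grow with \<open>n\<close>, the bumps converge to the indicator of
  the interval.
\<close>

definition bump :: "real \<Rightarrow> real \<Rightarrow> nat \<Rightarrow> real \<Rightarrow> real" where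
  "bump a b n t = flat (real (Suc n) * t + (- real (Suc n) * a - 1)) * flat ((- real (Suc n)) * t + (real (Suc n) * b - 1))"

lemma bump_bounds: "0 \<le> bump a b n t" "bump a b n t \<le> 1"
  using flat_bounds by (auto simp: bump_def intro!: mult_nonneg_nonneg mult_le_one)

lemma bump_support:
  assumes "bump a b n t \<noteq> 0" shows "t \<in> {a + 1 / Suc n .. b - 1 / Suc n}"
proof -
  have "0 < real (Suc n) * t + (- real (Suc n) * a - 1)" "0 < (- real (Suc n)) * t + (real (Suc n) * b - 1)"
    using assms by (auto simp: bump_def flat_def split: if_splits)
  then show ?thesis by (auto simp: field_simps)
qed

lemma bump_eq_0: assumes "t \<notin> {a<..<b}" shows "bump a b n t = 0"
proof (rule ccontr)
  assume "bump a b n t \<noteq> 0"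
  from bump_support[OF this] have "a + 1 / Suc n \<le> t" "t \<le> b - 1 / Suc n" by auto
  moreover have "0 < 1 / real (Suc n)" by simp
  ultimately show False using assms unfolding greaterThanLessThan_iff by linarith
qed

lemma bump_tendsto: "(\<lambda>n. bump a b n t) \<longlonglongrightarrow> indicator {a<..<b} t"
proof (cases "a < t \<and> t < b")
  case True
  have lim: "filterlim (\<lambda>n. real (Suc n) * c - 1) at_top sequentially" if "c > 0" for c :: real
  proof -
    have "filterlim (\<lambda>n. c * real (Suc n)) at_top sequentially"
      by (rule filterlim_tendsto_pos_mult_at_top[OF tendsto_const that])
         (rule filterlim_compose[OF filterlim_real_sequentially filterlim_Suc])
    then show ?thesis
      using filterlim_tendsto_add_at_top[OF tendsto_const[of "-1"]] by (simp add: mult.commute)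
  qed
  have "(\<lambda>n. flat (real (Suc n) * (t - a) - 1) * flat (real (Suc n) * (b - t) - 1)) \<longlonglongrightarrow> 1 * 1"
    by (intro tendsto_mult flat_tendsto lim) (use True in auto)
  moreover have "bump a b n t = flat (real (Suc n) * (t - a) - 1) * flat (real (Suc n) * (b - t) - 1)" for n
    by (simp add: bump_def algebra_simps)
  ultimately show ?thesis using True by simp
next
  case False
  have "bump a b n t = 0" for n using False by (intro bump_eq_0) auto
  then show ?thesis using False by (auto simp: indicator_def)
qed

lemma smooth_bump: "smooth (bump a b n)"
  unfolding bump_def[abs_def] by (intro smooth_mult smooth_affine smooth_flat)

text \<open>
  Replacing the compact support by a symmetric margin makes sums and products of test functions immediate.
\<close>

lemma test_function_iff:
  "test_function \<phi> \<longleftrightarrow> smooth \<phi> \<and> (\<exists>\<epsilon>>0. \<epsilon> < 1 / 2 \<and> (\<forall>t. t \<notin> {\<epsilon>..1 - \<epsilon>} \<longrightarrow> \<phi> t = 0))"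
proof
  assume "test_function \<phi>"
  then obtain K where K: "smooth \<phi>" "compact K" "K \<subseteq> \<Omega>" "\<forall>t. t \<notin> K \<longrightarrow> \<phi> t = 0"
    by (auto simp: test_function_def smooth_def)
  have "\<exists>\<epsilon>>0. \<epsilon> < 1 / 2 \<and> K \<subseteq> {\<epsilon>..1 - \<epsilon>}"
  proof (cases "K = {}")
    case True then show ?thesis by (intro exI[of _ "1/4"]) auto
  next
    case False
    obtain x y where "x \<in> K" "\<forall>t\<in>K. x \<le> t" "y \<in> K" "\<forall>t\<in>K. t \<le> y"
      using compact_attains_inf[OF K(2) False] compact_attains_sup[OF K(2) False] by blast
    moreover from this have "0 < x" "y < 1" using K(3) by auto
    ultimately show ?thesis
      by (intro exI[of _ "min (1/4) (min x (1 - y))"]) (fastforce simp: min_def)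
  qed
  with K show "smooth \<phi> \<and> (\<exists>\<epsilon>>0. \<epsilon> < 1 / 2 \<and> (\<forall>t. t \<notin> {\<epsilon>..1 - \<epsilon>} \<longrightarrow> \<phi> t = 0))" by blast
next
  assume "smooth \<phi> \<and> (\<exists>\<epsilon>>0. \<epsilon> < 1 / 2 \<and> (\<forall>t. t \<notin> {\<epsilon>..1 - \<epsilon>} \<longrightarrow> \<phi> t = 0))"
  then obtain \<epsilon> where "smooth \<phi>" "0 < \<epsilon>" "\<forall>t. t \<notin> {\<epsilon>..1 - \<epsilon>} \<longrightarrow> \<phi> t = 0" by auto
  then show "test_function \<phi>" unfolding test_function_def smooth_def[symmetric]
    by (intro conjI exI[of _ "{\<epsilon>..1 - \<epsilon>}"]) auto
qed

lemma test_function_bump: assumes "0 \<le> a" "b \<le> 1" shows "test_function (bump a b n)"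
proof -
  have "test_function (bump a b n)" if "0 < e" "e < 1/2" "e \<le> 1 / Suc n" for e
    unfolding test_function_iff
  proof (intro conjI exI[of _ e] allI impI)
    fix t assume "t \<notin> {e..1 - e}"
    then show "bump a b n t = 0" using bump_support[of a b n t] assms that by fastforce
  qed (use that smooth_bump in auto)
  from this[of "min (1/4) (1 / Suc n)"] show ?thesis by auto
qed

lemma test_function_smooth: "test_function \<phi> \<Longrightarrow> smooth \<phi>" by (simp add: test_function_iff)

lemma test_function_ess_bounded: "test_function \<phi> \<Longrightarrow> ess_bounded \<phi>"
  by (rule ess_bounded_cont) (rule smooth_continuous[OF test_function_smooth])

lemma test_function_deriv_ess_bounded: "test_function \<phi> \<Longrightarrow> ess_bounded (deriv \<phi>)"
  by (rule ess_bounded_cont) (rule smooth_continuous[OF smooth_deriv[OF test_function_smooth]])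

lemma test_function_prim_deriv:
  assumes \<phi>: "test_function \<phi>" and t: "t \<in> {0..1}" shows "prim (deriv \<phi>) t = \<phi> t"
proof -
  have "\<phi> 0 = 0" using \<phi> unfolding test_function_iff by auto
  moreover have "prim (deriv \<phi>) t = \<phi> t - \<phi> 0"
    by (rule prim_FTC[OF _ ess_bounded_integrable[OF test_function_deriv_ess_bounded[OF \<phi>]] t])
       (rule has_field_derivative_at_within[OF smooth_has_derivative[OF test_function_smooth[OF \<phi>]]])
  ultimately show ?thesis by simp
qed

lemma test_function_integral_deriv: "test_function \<phi> \<Longrightarrow> (LINT t|leb_\<Omega>. deriv \<phi> t) = 0"
  using test_function_prim_deriv[of \<phi> 1] prim_1[of "deriv \<phi>"]
  unfolding test_function_iff by auto

lemma test_function_add_scaled: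
  assumes "test_function \<phi>" "test_function \<psi>" shows "test_function (\<lambda>t. \<phi> t + c * \<psi> t)"
proof -
  obtain e e' where e: "e > 0" "e < 1/2" "e' > 0" "\<And>t. t \<notin> {e..1 - e} \<Longrightarrow> \<phi> t = 0"
    "\<And>t. t \<notin> {e'..1 - e'} \<Longrightarrow> \<psi> t = 0" using assms unfolding test_function_iff by blast
  have "\<phi> t + c * \<psi> t = 0" if "t \<notin> {min e e'..1 - min e e'}" for t
  proof -
    have "t \<notin> {e..1 - e}" "t \<notin> {e'..1 - e'}" using that by (auto simp: min_def split: if_splits)
    then show ?thesis using e(4)[of t] e(5)[of t] by simp
  qed
  then show ?thesis using assms e(1-3) unfolding test_function_iff
    by (intro conjI exI[of _ "min e e'"] smooth_add smooth_mult) auto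
qed

lemma test_function_mult:
  assumes "smooth p" "test_function \<psi>" shows "test_function (\<lambda>t. p t * \<psi> t)"
  using assms unfolding test_function_iff by (auto intro!: smooth_mult)

text \<open>
  The vanishing mean is what makes the primitive vanish near the right end point as well.
\<close>

lemma test_function_prim:
  assumes \<psi>: "test_function \<psi>" and mean: "(LINT t|leb_\<Omega>. \<psi> t) = 0"
  shows "test_function (prim \<psi>)" "deriv (prim \<psi>) = \<psi>"
proof -
  obtain e where e: "0 < e" "e < 1/2" "\<forall>t. t \<notin> {e..1 - e} \<longrightarrow> \<psi> t = 0"
    using \<psi> unfolding test_function_iff by auto
  have int: "integrable leb_\<Omega> \<psi>" using test_function_ess_bounded[OF \<psi>] by auto
  have left: "prim \<psi> t = 0" if "t \<le> e" for t
    unfolding prim_def by (rule integral_eq_zero_AE) (use that e in \<open>auto simp: indicator_def intro!: AE_leb_\<Omega>I\<close>)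
  have right: "prim \<psi> t = 0" if "1 - e \<le> t" for t
  proof -
    have "prim \<psi> t = (LINT t|leb_\<Omega>. \<psi> t)" unfolding prim_def
    proof (rule integral_cong_AE)
      have "AE s in leb_\<Omega>. s \<noteq> 1 - e" unfolding AE_leb_\<Omega>_iff
        using AE_completion[OF AE_lborel_singleton[of "1 - e"]] by eventually_elim auto
      then show "AE x in leb_\<Omega>. indicator {..<t} x * \<psi> x = \<psi> x"
        by eventually_elim (use that e in \<open>auto simp: indicator_def\<close>)
    qed (use int in \<open>auto intro!: borel_measurable_integrable\<close>)
    with mean show ?thesis by simp
  qed
  have der: "(prim \<psi> has_real_derivative \<psi> t) (at t)" for t
  proof (cases "0 < t \<and> t < 1")
    case True
    then show ?thesis using prim_has_derivative[OF smooth_continuous[OF test_function_smooth[OF \<psi>]], of t] by auto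
  next
    case False
    have "((\<lambda>_. 0) has_real_derivative \<psi> t) (at t)" using False e by auto
    then show ?thesis
    proof (rule DERIV_cong_ev[THEN iffD1, rotated -1])
      have "\<forall>\<^sub>F u in nhds t. u \<in> {..<e} \<union> {1 - e<..}" using False e by (intro eventually_nhds_in_open) auto
      then show "\<forall>\<^sub>F u in nhds t. 0 = prim \<psi> u" by eventually_elim (auto simp: left right)
    qed auto
  qed
  show "deriv (prim \<psi>) = \<psi>" by (rule ext) (rule DERIV_imp_deriv[OF der])
  show "test_function (prim \<psi>)" unfolding test_function_iff
    using e smooth_antiderivative[OF test_function_smooth[OF \<psi>] der] left right
    by (auto intro!: exI[of _ e])
qed

section \<open>The fundamental lemma of the calculus of variations\<close>

text \<open>
  Integration by parts makes \<open>g\<close> orthogonal to all smooth functions, hence by the Weierstrass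
  theorem to all continuous ones. The sign of \<open>g\<close> is an almost everywhere limit of continuous
  functions bounded by one, so dominated convergence gives \<open>L\<^sup>1\<close> norm zero.
\<close>

lemma prim_zero_imp_AE_zero:
  assumes g: "integrable leb_\<Omega> g" and z: "\<And>t. prim g t = 0"
  shows "AE t in leb_\<Omega>. g t = 0"
proof -
  have [measurable]: "g \<in> borel_measurable leb_\<Omega>" using g by auto
  have orth_poly: "(LINT t|leb_\<Omega>. g t * p t) = 0" if p: "smooth p" for p
  proof -
    have d: "integrable leb_\<Omega> (deriv p)" using smooth_continuous[OF smooth_deriv[OF p]] ess_bounded_cont by blast
    have "(LINT t|leb_\<Omega>. deriv p t * prim g t) = (LINT s|leb_\<Omega>. g s) * (LINT s|leb_\<Omega>. deriv p s) - (LINT s|leb_\<Omega>. g s * prim (deriv p) s)"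
      by (rule prim_by_parts[OF g d])
    then have "(LINT s|leb_\<Omega>. g s * prim (deriv p) s) = 0" using z[of 1] by (simp add: z prim_1)
    moreover have "(LINT s|leb_\<Omega>. g s * prim (deriv p) s) = (LINT s|leb_\<Omega>. g s * p s - p 0 * g s)"
    proof (rule Bochner_Integration.integral_cong)
      fix s assume "s \<in> space leb_\<Omega>"
      then have "prim (deriv p) s = p s - p 0"
        using prim_FTC[of p "deriv p" s, OF has_field_derivative_at_within[OF smooth_has_derivative[OF p]] d] by auto
      then show "g s * prim (deriv p) s = g s * p s - p 0 * g s" by (simp add: left_diff_distrib right_diff_distrib mult.commute)
    qed simp
    moreover have "\<dots> = (LINT s|leb_\<Omega>. g s * p s) - p 0 * (LINT s|leb_\<Omega>. g s)"
      using g ess_bounded_mult_integrable[OF ess_bounded_cont[OF smooth_continuous[OF p]] g]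
      by (subst Bochner_Integration.integral_diff) (auto simp: mult.commute)
    ultimately show ?thesis using z[of 1] by (simp add: prim_1)
  qed
  have orth_cont: "(LINT t|leb_\<Omega>. g t * f t) = 0" if f: "continuous_on {0..1} f" for f
  proof -
    define X where "X = (LINT t|leb_\<Omega>. \<bar>g t\<bar>)"
    have "\<bar>LINT t|leb_\<Omega>. g t * f t\<bar> \<le> X * e" if e0: "0 < e" for e
    proof -
      obtain p where p: "real_polynomial_function p" "\<And>x. x \<in> {0..1} \<Longrightarrow> \<bar>f x - p x\<bar> < e"
        by (rule Stone_Weierstrass_real_polynomial_function[of "{0..1::real}" f e]) (use f e0 in auto)
      note sp = smooth_polynomial[OF p(1)]
      have i: "integrable leb_\<Omega> (\<lambda>t. g t * f t)" "integrable leb_\<Omega> (\<lambda>t. g t * p t)"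
        using ess_bounded_mult_integrable[OF ess_bounded_cont[OF f] g]
          ess_bounded_mult_integrable[OF ess_bounded_cont[OF smooth_continuous[OF sp]] g] by (auto simp: mult.commute)
      have "\<bar>LINT t|leb_\<Omega>. g t * f t\<bar> = \<bar>LINT t|leb_\<Omega>. g t * f t - g t * p t\<bar>"
        using orth_poly[OF sp] i by simp
      also have "\<dots> \<le> (LINT t|leb_\<Omega>. \<bar>g t * f t - g t * p t\<bar>)" by (rule integral_abs_bound)
      also have "\<dots> \<le> (LINT t|leb_\<Omega>. \<bar>g t\<bar> * e)"
      proof (rule integral_mono_AE)
        show "AE t in leb_\<Omega>. \<bar>g t * f t - g t * p t\<bar> \<le> \<bar>g t\<bar> * e"
        proof (rule AE_leb_\<Omega>I)
          fix t :: real assume "0 < t" "t < 1"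
          then have "\<bar>g t\<bar> * \<bar>f t - p t\<bar> \<le> \<bar>g t\<bar> * e" using p(2)[of t] by (intro mult_left_mono) auto
          then show "\<bar>g t * f t - g t * p t\<bar> \<le> \<bar>g t\<bar> * e"
            by (simp add: abs_mult[symmetric] right_diff_distrib)
        qed
      qed (use i g in auto)
      also have "\<dots> = X * e" by (simp add: X_def)
      finally show ?thesis .
    qed
    note bound = this
    have X0: "0 \<le> X" by (simp add: X_def)
    have small: "\<bar>LINT t|leb_\<Omega>. g t * f t\<bar> \<le> e" if "e > 0" for e
    proof (cases "X = 0")
      case True with bound[of 1] that show ?thesis by simp
    next
      case False with X0 have "0 < X" by simp
      with bound[of "e / X"] that show ?thesis by simp
    qed
    have "\<bar>LINT t|leb_\<Omega>. g t * f t\<bar> \<le> 0" by (rule field_le_epsilon) (use small in auto)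
    then show ?thesis by simp
  qed
  define S where "S = (\<lambda>t. if t \<in> \<Omega> then sgn (g t) else 0)"
  have "(\<lambda>t. sgn (g t)) measurable_on \<Omega>"
    by (subst measurable_on_iff_borel_measurable) auto
  then obtain N f where N: "negligible N" and f: "\<And>n. continuous_on UNIV (f n)"
    and lim: "\<And>x. x \<notin> N \<Longrightarrow> (\<lambda>n. f n x) \<longlonglongrightarrow> (if x \<in> \<Omega> then sgn (g x) else 0)"
    unfolding measurable_on_def by blast
  \<comment> \<open>Truncation keeps the limit, as signs lie between -1 and 1, and provides the dominating function.\<close>
  define F where "F n t = max (-1) (min 1 (f n t))" for n t
  have F: "continuous_on {0..1} (F n)" for n
    unfolding F_def by (intro continuous_intros continuous_on_subset[OF f]) auto
  have F_meas[measurable]: "F n \<in> borel_measurable leb_\<Omega>" for n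
    using ess_bounded_cont[OF F] by auto
  have aeN: "AE t in leb_\<Omega>. t \<notin> N"
    unfolding AE_leb_\<Omega>_iff using N by (auto simp: negligible_iff_null_sets intro!: AE_I')
  have "(\<lambda>n. LINT t|leb_\<Omega>. g t * F n t) \<longlonglongrightarrow> (LINT t|leb_\<Omega>. \<bar>g t\<bar>)"
  proof (rule integral_dominated_convergence[where w="\<lambda>t. \<bar>g t\<bar>"])
    show "AE t in leb_\<Omega>. (\<lambda>n. g t * F n t) \<longlonglongrightarrow> \<bar>g t\<bar>"
      using aeN AE_space
    proof eventually_elim
      fix t assume t: "t \<notin> N" "t \<in> space leb_\<Omega>"
      have "(\<lambda>n. g t * F n t) \<longlonglongrightarrow> g t * max (-1) (min 1 (sgn (g t)))"
        unfolding F_def using lim[OF t(1)] t(2) by (intro tendsto_intros) auto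
      moreover have "g t * max (-1) (min 1 (sgn (g t))) = \<bar>g t\<bar>" by (auto simp: sgn_if)
      ultimately show "(\<lambda>n. g t * F n t) \<longlonglongrightarrow> \<bar>g t\<bar>" by simp
    qed
    show "AE t in leb_\<Omega>. norm (g t * F n t) \<le> \<bar>g t\<bar>" for n
      by (auto simp: abs_mult F_def intro!: mult_left_le AE_leb_\<Omega>I)
  qed (use g in auto)
  then have "(LINT t|leb_\<Omega>. \<bar>g t\<bar>) = 0"
    using orth_cont[OF F] LIMSEQ_unique[OF tendsto_const] by fastforce
  then show ?thesis using g by (subst (asm) integral_nonneg_eq_0_iff_AE) auto
qed

lemma integral_bump_tendsto:
  assumes g: "integrable leb_\<Omega> (\<lambda>t. indicator {a..b} t * g t)"
  shows "(\<lambda>n. LINT t|leb_\<Omega>. g t * bump a b n t) \<longlonglongrightarrow> (LINT t|leb_\<Omega>. indicator {a<..<b} t * g t)"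
proof -
  have [measurable]: "bump a b n \<in> borel_measurable leb_\<Omega>" for n
    using ess_bounded_cont[OF smooth_continuous[OF smooth_bump]] by auto
  have [measurable]: "indicator {a..b} \<in> borel_measurable leb_\<Omega>" "indicator {a<..<b} \<in> borel_measurable leb_\<Omega>"
    by (auto intro: borel_imp_leb_\<Omega>)
  define G where "G t = indicator {a..b} t * g t" for t
  have [measurable]: "G \<in> borel_measurable leb_\<Omega>" using g unfolding G_def by auto
  have "(\<lambda>n. LINT t|leb_\<Omega>. G t * bump a b n t) \<longlonglongrightarrow> (LINT t|leb_\<Omega>. G t * indicator {a<..<b} t)"
  proof (rule integral_dominated_convergence[where w="\<lambda>t. \<bar>G t\<bar>"])
    show "AE t in leb_\<Omega>. (\<lambda>n. G t * bump a b n t) \<longlonglongrightarrow> G t * indicator {a<..<b} t"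
      by (auto intro!: tendsto_mult bump_tendsto)
    show "AE t in leb_\<Omega>. norm (G t * bump a b n t) \<le> \<bar>G t\<bar>" for n
      using bump_bounds by (auto simp: abs_mult intro!: mult_left_le AE_leb_\<Omega>I)
  qed (use g G_def in auto)
  moreover have "(\<lambda>t. G t * bump a b n t) = (\<lambda>t. g t * bump a b n t)" for n
  proof
    fix t show "G t * bump a b n t = g t * bump a b n t"
      using bump_eq_0[of t a b n] by (cases "t \<in> {a<..<b}") (auto simp: G_def)
  qed
  moreover have "(\<lambda>t. G t * indicator {a<..<b} t) = (\<lambda>t. indicator {a<..<b} t * g t)"
    by (auto simp: G_def indicator_def fun_eq_iff)
  ultimately show ?thesis by simp
qed

lemma integrable_imp_locally_L1:
  assumes v: "integrable leb_\<Omega> v" shows "locally_L1 v"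
  unfolding locally_L1_def
proof (intro allI impI, elim conjE)
  fix K assume K: "compact K" "K \<subseteq> \<Omega>"
  have Kl: "K \<in> sets lebesgue" using K by (simp add: borel_compact)
  have "integrable lebesgue (\<lambda>t. indicator \<Omega> t *\<^sub>R v t)"
    using v by (subst (asm) integrable_restrict_space) auto
  then have "integrable lebesgue (\<lambda>t. indicator K t *\<^sub>R (indicator \<Omega> t *\<^sub>R v t))"
    by (rule integrable_mult_indicator[OF Kl])
  moreover have "(\<lambda>t. indicator K t *\<^sub>R (indicator \<Omega> t *\<^sub>R v t)) = (\<lambda>t. indicator K t *\<^sub>R v t)"
    using K by (auto simp: fun_eq_iff indicator_def)
  ultimately show "integrable (lebesgue_on K) v" using Kl by (subst integrable_restrict_space) auto
qed

lemma locally_L1_indicator_integrable: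
  assumes g: "locally_L1 g" and ab: "0 < a" "b < 1"
  shows "integrable leb_\<Omega> (\<lambda>t. indicator {a..b} t * g t)"
proof -
  have "integrable (lebesgue_on {a..b}) g"
    by (rule g[unfolded locally_L1_def, rule_format]) (use ab in auto)
  then have "integrable lebesgue (\<lambda>t. indicator {a..b} t *\<^sub>R g t)"
    by (subst (asm) integrable_restrict_space) auto
  then have "integrable lebesgue (\<lambda>t. indicator \<Omega> t *\<^sub>R (indicator {a..b} t *\<^sub>R g t))"
    by (rule integrable_mult_indicator[rotated]) auto
  then have "integrable leb_\<Omega> (\<lambda>t. indicator {a..b} t *\<^sub>R g t)"
    by (subst integrable_restrict_space) auto
  then show ?thesis by simp
qed

text \<open>
  Bumps turn the hypothesis into vanishing integrals over all compactly contained intervals; on each such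
  interval the localized function then has vanishing primitive.
\<close>

lemma AE_zero_if_orthogonal_to_test_functions:
  assumes g: "locally_L1 g" and orth: "\<And>\<phi>. test_function \<phi> \<Longrightarrow> L2_inner g \<phi> = 0"
  shows "AE t in leb_\<Omega>. g t = 0"
proof -
  note int = locally_L1_indicator_integrable[OF g]
  have zero: "(LINT t|leb_\<Omega>. indicator {a<..<b} t * g t) = 0" if "0 < a" "b < 1" for a b
  proof -
    have "(\<lambda>n. LINT t|leb_\<Omega>. g t * bump a b n t) \<longlonglongrightarrow> (LINT t|leb_\<Omega>. indicator {a<..<b} t * g t)"
      by (rule integral_bump_tendsto[OF int[OF that]])
    moreover have "(LINT t|leb_\<Omega>. g t * bump a b n t) = 0" for n
      using orth[OF test_function_bump[of a b n]] that by (simp add: L2_inner_def)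
    ultimately show ?thesis by (simp add: LIMSEQ_const_iff)
  qed
  have AE_int: "AE t in leb_\<Omega>. t \<in> {a<..<b} \<longrightarrow> g t = 0" if ab: "0 < a" "b < 1" for a b
  proof -
    define G where "G t = indicator {a<..<b} t * g t" for t
    have "(\<lambda>t. indicator {a<..<b} t * (indicator {a..b} t * g t)) = G"
      by (auto simp: G_def indicator_def fun_eq_iff)
    then have G: "integrable leb_\<Omega> G" using integrable_ind[OF _ int[OF ab], of "{a<..<b}"] by simp
    have "prim G t = 0" for t
    proof -
      have "prim G t = (LINT s|leb_\<Omega>. indicator {a<..<min b t} s * g s)"
        unfolding prim_def by (rule Bochner_Integration.integral_cong) (auto simp: G_def indicator_def)
      then show ?thesis using zero[of a "min b t"] ab by auto
    qed
    then have "AE t in leb_\<Omega>. G t = 0" using prim_zero_imp_AE_zero[OF G] by simp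
    then show ?thesis by eventually_elim (auto simp: G_def)
  qed
  have "AE t in leb_\<Omega>. \<forall>n::nat. t \<in> {1 / (n + 2)<..<1 - 1 / (n + 2)} \<longrightarrow> g t = 0"
    unfolding AE_all_countable by (intro allI AE_int) auto
  then show ?thesis using AE_space
  proof eventually_elim
    fix t assume t: "\<forall>n::nat. t \<in> {1 / (n + 2)<..<1 - 1 / (n + 2)} \<longrightarrow> g t = 0" "t \<in> space leb_\<Omega>"
    obtain n :: nat where "n > 0" "1 / n < min t (1 - t)"
      using t(2) nat_approx_posE[of "min t (1 - t)"] by (metis greaterThanLessThan_iff diff_gt_0_iff_gt min_less_iff_conj space_lebesgue_on zero_less_Suc)
    moreover have "1 / (real n + 2) \<le> 1 / n" using \<open>n > 0\<close> by (simp add: field_simps)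
    ultimately show "g t = 0" using t(1)[rule_format, of n] by auto
  qed
qed

lemma unit_mass_test_function:
  obtains \<rho> where "test_function \<rho>" "(LINT t|leb_\<Omega>. \<rho> t) = 1"
proof -
  have "(\<lambda>n. LINT t|leb_\<Omega>. 1 * bump 0 1 n t) \<longlonglongrightarrow> (LINT t|leb_\<Omega>. indicator \<Omega> t * 1)"
    by (rule integral_bump_tendsto) (auto intro!: ess_bounded_integrable)
  moreover have "(LINT t|leb_\<Omega>. indicator \<Omega> t * 1) = (1 :: real)"
    using leb.prob_space by simp
  ultimately have "\<forall>\<^sub>F n in sequentially. (LINT t|leb_\<Omega>. 1 * bump 0 1 n t) > 0"
    by (intro order_tendstoD(1)) auto
  then obtain n where n: "(LINT t|leb_\<Omega>. bump 0 1 n t) > 0"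
    using eventually_happens by fastforce
  define X where "X = (LINT t|leb_\<Omega>. bump 0 1 n t)"
  have "test_function (\<lambda>t. 1 / X * bump 0 1 n t)"
    by (rule test_function_mult) (auto intro: test_function_bump)
  moreover have "(LINT t|leb_\<Omega>. 1 / X * bump 0 1 n t) = 1" using n by (simp add: X_def)
  ultimately show ?thesis by (rule that)
qed

text \<open>
  The lemma of du Bois-Reymond. After subtraction of its mean times a fixed test function of unit mass, an
  arbitrary test function has mean zero and is thus itself the derivative of a test function.
\<close>

lemma AE_constant_if_weak_deriv_zero:
  assumes v: "integrable leb_\<Omega> v" and orth: "\<And>\<phi>. test_function \<phi> \<Longrightarrow> L2_inner v (deriv \<phi>) = 0"
  shows "\<exists>c. AE t in leb_\<Omega>. v t = c"
proof -
  obtain \<rho> where \<rho>: "test_function \<rho>" "(LINT t|leb_\<Omega>. \<rho> t) = 1" by (rule unit_mass_test_function)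
  define c where "c = (LINT t|leb_\<Omega>. v t * \<rho> t)"
  have "AE t in leb_\<Omega>. v t - c = 0"
  proof (rule AE_zero_if_orthogonal_to_test_functions)
    show "locally_L1 (\<lambda>t. v t - c)" using v by (intro integrable_imp_locally_L1) auto
    fix \<psi> assume \<psi>: "test_function \<psi>"
    define m where "m = (LINT t|leb_\<Omega>. \<psi> t)"
    define \<eta> where "\<eta> t = \<psi> t + (- m) * \<rho> t" for t
    note i = test_function_ess_bounded[OF \<psi>] test_function_ess_bounded[OF \<rho>(1)]
    have \<eta>: "test_function \<eta>" unfolding \<eta>_def by (rule test_function_add_scaled[OF \<psi> \<rho>(1)])
    have "(LINT t|leb_\<Omega>. \<eta> t) = 0"
      unfolding \<eta>_def using i \<rho>(2) by (simp add: ess_bounded_integrable m_def)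
    from orth[OF test_function_prim(1)[OF \<eta> this]] test_function_prim(2)[OF \<eta> this]
    have "(LINT t|leb_\<Omega>. v t * \<eta> t) = 0" by (simp add: L2_inner_def)
    moreover have vi: "integrable leb_\<Omega> (\<lambda>t. v t * \<psi> t)" "integrable leb_\<Omega> (\<lambda>t. v t * \<rho> t)"
      using ess_bounded_mult_integrable[OF i(1) v] ess_bounded_mult_integrable[OF i(2) v] by (simp_all add: mult.commute)
    moreover have "(LINT t|leb_\<Omega>. v t * \<eta> t) = (LINT t|leb_\<Omega>. v t * \<psi> t - m * (v t * \<rho> t))"
      by (simp add: \<eta>_def algebra_simps)
    ultimately have "(LINT t|leb_\<Omega>. v t * \<psi> t) = m * c" by (simp add: c_def)
    moreover have "(LINT t|leb_\<Omega>. (v t - c) * \<psi> t) = (LINT t|leb_\<Omega>. v t * \<psi> t - c * \<psi> t)"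
      by (simp add: algebra_simps)
    ultimately show "L2_inner (\<lambda>t. v t - c) \<psi> = 0"
      unfolding L2_inner_def using vi i by (simp add: ess_bounded_integrable m_def)
  qed
  then show ?thesis by auto
qed

section \<open>Weak derivatives and the space \<open>H\<^sub>0\<^sup>1\<close>\<close>

text \<open>
  A representative \<open>v\<close> of an element of \<^const>\<open>H10\<close> is recovered from its
  derivative \<open>g\<close>: the boundary value at 0 is built into the primitive, the one at 1 says that
  \<open>g\<close> has mean zero.
\<close>

definition hrep :: "(real \<Rightarrow> real) \<Rightarrow> (real \<Rightarrow> real) \<Rightarrow> bool" where
  "hrep v g \<longleftrightarrow> in_L2 g \<and> prim g 1 = 0 \<and> (AE t in leb_\<Omega>. v t = prim g t)"

lemma hrep_ess_bounded: "hrep v g \<Longrightarrow> ess_bounded v"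
  unfolding hrep_def using in_L2_integrable[of g] by (auto intro!: ess_bounded_AE_cong[OF ess_bounded_prim, of g v])

lemma hrep_has_weak_deriv:
  assumes vg: "hrep v g" shows "has_weak_deriv v g"
  unfolding has_weak_deriv_def
proof (intro conjI allI impI)
  have g: "integrable leb_\<Omega> g" using vg by (auto simp: hrep_def)
  show "locally_L1 v" using hrep_ess_bounded[OF vg] by (intro integrable_imp_locally_L1) auto
  show "locally_L1 g" by (rule integrable_imp_locally_L1[OF g])
  fix \<phi> assume \<phi>: "test_function \<phi>"
  have [measurable]: "v \<in> borel_measurable leb_\<Omega>" "deriv \<phi> \<in> borel_measurable leb_\<Omega>" "prim g \<in> borel_measurable leb_\<Omega>"
    using hrep_ess_bounded[OF vg] test_function_deriv_ess_bounded[OF \<phi>] ess_bounded_prim[OF g] by auto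
  have "L2_inner v (deriv \<phi>) = (LINT t|leb_\<Omega>. deriv \<phi> t * prim g t)"
    unfolding L2_inner_def by (rule integral_cong_AE) (use vg in \<open>auto simp: hrep_def\<close>)
  also have "\<dots> = - (LINT t|leb_\<Omega>. g t * prim (deriv \<phi>) t)"
    using prim_by_parts[OF g ess_bounded_integrable[OF test_function_deriv_ess_bounded[OF \<phi>]]]
      test_function_integral_deriv[OF \<phi>] by simp
  also have "(LINT t|leb_\<Omega>. g t * prim (deriv \<phi>) t) = L2_inner g \<phi>"
    unfolding L2_inner_def by (rule Bochner_Integration.integral_cong) (use test_function_prim_deriv[OF \<phi>] in auto)
  finally show "L2_inner v (deriv \<phi>) = - L2_inner g \<phi>" .
qed

lemma locally_L1_diff: "locally_L1 f \<Longrightarrow> locally_L1 g \<Longrightarrow> locally_L1 (\<lambda>t. f t - g t)"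
  by (auto simp: locally_L1_def)

lemma locally_L1_test_integrable:
  assumes g: "locally_L1 g" and \<phi>: "test_function \<phi>"
  shows "integrable leb_\<Omega> (\<lambda>t. g t * \<phi> t)"
proof -
  obtain e where e: "0 < e" "\<And>t. t \<notin> {e..1 - e} \<Longrightarrow> \<phi> t = 0"
    using \<phi> unfolding test_function_iff by blast
  have "integrable leb_\<Omega> (\<lambda>t. indicator {e..1 - e} t * g t)"
    using g e by (intro locally_L1_indicator_integrable) auto
  from ess_bounded_mult_integrable[OF test_function_ess_bounded[OF \<phi>] this]
  show ?thesis
  proof (rule Bochner_Integration.integrable_cong[THEN iffD1, rotated -1])
    show "\<phi> t * (indicator {e..1 - e} t * g t) = g t * \<phi> t" for t
      using e(2)[of t] by (cases "t \<in> {e..1 - e}") auto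
  qed simp
qed

lemma has_weak_deriv_unique:
  assumes "has_weak_deriv v g" "has_weak_deriv v k" shows "AE t in leb_\<Omega>. g t = k t"
proof -
  have l: "locally_L1 g" "locally_L1 k" using assms by (auto simp: has_weak_deriv_def)
  have "AE t in leb_\<Omega>. g t - k t = 0"
  proof (rule AE_zero_if_orthogonal_to_test_functions[OF locally_L1_diff[OF l]])
    fix \<phi> assume \<phi>: "test_function \<phi>"
    have "L2_inner g \<phi> = L2_inner k \<phi>" using assms \<phi> unfolding has_weak_deriv_def by (metis neg_equal_iff_equal)
    then show "L2_inner (\<lambda>t. g t - k t) \<phi> = 0"
      using locally_L1_test_integrable[OF l(1) \<phi>] locally_L1_test_integrable[OF l(2) \<phi>]
      by (simp add: L2_inner_def left_diff_distrib)
  qed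
  then show ?thesis by eventually_elim simp
qed

text \<open>
  Weak derivatives are unique up to null sets, so the one that is chosen in the definition of the bilinear
  form may be replaced by \<open>g\<close>.
\<close>

lemma hrep_weak_deriv: "hrep v g \<Longrightarrow> AE t in leb_\<Omega>. g t = weak_deriv v t"
  unfolding weak_deriv_def
  by (rule has_weak_deriv_unique[OF hrep_has_weak_deriv someI[where P="has_weak_deriv v", OF hrep_has_weak_deriv]])

lemma L1_le_L2_norm: "in_L2 f \<Longrightarrow> (LINT t|leb_\<Omega>. \<bar>f t\<bar>) \<le> L2_norm f"
  unfolding L2_norm_def L2_inner_def
  by (rule real_le_rsqrt) (use square_integral_abs_le[of f] in \<open>simp add: power2_eq_square\<close>)

lemma L1_tendsto_0_if_L2:
  assumes "\<And>n::nat. in_L2 (f n)" "(\<lambda>n. L2_norm (f n)) \<longlonglongrightarrow> 0"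
  shows "(\<lambda>n. LINT t|leb_\<Omega>. \<bar>f n t\<bar>) \<longlonglongrightarrow> 0"
  by (rule tendsto_sandwich[OF _ _ tendsto_const assms(2)]) (use L1_le_L2_norm[OF assms(1)] in auto)

text \<open>
  Primitive and boundary value survive the closure: convergence of the derivatives in
  \<open>L\<^sup>2\<close> gives uniform convergence of the test functions.
\<close>

lemma H10_imp_hrep:
  assumes v: "v \<in> H10" shows "\<exists>g. hrep v g"
proof -
  obtain g \<phi> where g: "in_L2 v" "in_L2 g" and \<phi>: "\<And>n::nat. test_function (\<phi> n)"
    and lim: "(\<lambda>n. L2_norm (\<lambda>t. \<phi> n t - v t)) \<longlonglongrightarrow> 0" "(\<lambda>n. L2_norm (\<lambda>t. deriv (\<phi> n) t - g t)) \<longlonglongrightarrow> 0"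
    using v unfolding H10_def by blast
  note b = test_function_ess_bounded[OF \<phi>] test_function_deriv_ess_bounded[OF \<phi>]
  have l1: "(\<lambda>n. LINT t|leb_\<Omega>. \<bar>\<phi> n t - v t\<bar>) \<longlonglongrightarrow> 0"
    by (rule L1_tendsto_0_if_L2[OF _ lim(1)]) (use g ess_bounded_in_L2[OF b(1)] in auto)
  have l2: "(\<lambda>n. LINT t|leb_\<Omega>. \<bar>deriv (\<phi> n) t - g t\<bar>) \<longlonglongrightarrow> 0"
    by (rule L1_tendsto_0_if_L2[OF _ lim(2)]) (use g ess_bounded_in_L2[OF b(2)] in auto)
  have gi: "integrable leb_\<Omega> g" "integrable leb_\<Omega> v" using g by auto
  have bi: "integrable leb_\<Omega> (deriv (\<phi> n))" "integrable leb_\<Omega> (\<phi> n)" for n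
    using b by auto
  have close: "\<bar>\<phi> n t - prim g t\<bar> \<le> (LINT t|leb_\<Omega>. \<bar>deriv (\<phi> n) t - g t\<bar>)" if "t \<in> {0..1}" for n t
    using prim_bound_integral[of "\<lambda>t. deriv (\<phi> n) t - g t" t] prim_diff[OF bi(1) gi(1), of n t] bi(1)[of n] gi
      test_function_prim_deriv[OF \<phi>, of t n] that by simp
  have "prim g 1 = 0"
  proof -
    have "\<phi> n 1 = 0" for n using \<phi>[of n] unfolding test_function_iff by auto
    then have "\<bar>prim g 1\<bar> \<le> (LINT t|leb_\<Omega>. \<bar>deriv (\<phi> n) t - g t\<bar>)" for n using close[of 1 n] by simp
    then have "\<bar>prim g 1\<bar> \<le> 0" using LIMSEQ_le_const[OF l2] by blast
    then show ?thesis by simp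
  qed
  moreover have "AE t in leb_\<Omega>. v t = prim g t"
  proof -
    have pi: "integrable leb_\<Omega> (prim g)" using ess_bounded_prim[OF gi(1)] by auto
    have "(LINT t|leb_\<Omega>. \<bar>v t - prim g t\<bar>) \<le> (LINT t|leb_\<Omega>. \<bar>\<phi> n t - v t\<bar>) + (LINT t|leb_\<Omega>. \<bar>deriv (\<phi> n) t - g t\<bar>)" for n
    proof -
      have "(LINT t|leb_\<Omega>. \<bar>v t - prim g t\<bar>) \<le> (LINT t|leb_\<Omega>. \<bar>\<phi> n t - v t\<bar> + (LINT t|leb_\<Omega>. \<bar>deriv (\<phi> n) t - g t\<bar>))"
      proof (rule integral_mono_AE)
        show "AE t in leb_\<Omega>. \<bar>v t - prim g t\<bar> \<le> \<bar>\<phi> n t - v t\<bar> + (LINT t|leb_\<Omega>. \<bar>deriv (\<phi> n) t - g t\<bar>)"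
        proof (rule AE_leb_\<Omega>I)
          fix t :: real assume "0 < t" "t < 1"
          then show "\<bar>v t - prim g t\<bar> \<le> \<bar>\<phi> n t - v t\<bar> + (LINT t|leb_\<Omega>. \<bar>deriv (\<phi> n) t - g t\<bar>)"
            using close[of t n] by auto
        qed
      qed (use pi gi bi in auto)
      also have "\<dots> = (LINT t|leb_\<Omega>. \<bar>\<phi> n t - v t\<bar>) + (LINT t|leb_\<Omega>. \<bar>deriv (\<phi> n) t - g t\<bar>)"
        using gi bi leb.prob_space by (subst Bochner_Integration.integral_add) auto
      finally show ?thesis .
    qed
    then have "(LINT t|leb_\<Omega>. \<bar>v t - prim g t\<bar>) \<le> 0 + 0"
      using LIMSEQ_le_const[OF tendsto_add[OF l1 l2]] by blast
    then have "(LINT t|leb_\<Omega>. \<bar>v t - prim g t\<bar>) = 0" by (intro antisym integral_nonneg_AE) auto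
    then have "AE t in leb_\<Omega>. \<bar>v t - prim g t\<bar> = 0"
      using pi gi by (subst (asm) integral_nonneg_eq_0_iff_AE) auto
    then show ?thesis by eventually_elim auto
  qed
  ultimately show ?thesis using g by (auto simp: hrep_def)
qed

lemma L2_norm_tendsto_0:
  assumes f: "\<And>n::nat. f n \<in> borel_measurable leb_\<Omega>" and bnd: "\<And>n t. 0 < t \<Longrightarrow> t < 1 \<Longrightarrow> \<bar>f n t\<bar> \<le> B"
    and lim: "\<And>t. 0 < t \<Longrightarrow> t < 1 \<Longrightarrow> (\<lambda>n. f n t) \<longlonglongrightarrow> 0"
  shows "(\<lambda>n. L2_norm (f n)) \<longlonglongrightarrow> 0"
proof -
  note f[measurable]
  have "(\<lambda>n. LINT t|leb_\<Omega>. f n t * f n t) \<longlonglongrightarrow> (LINT t|leb_\<Omega>. 0)"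
  proof (rule integral_dominated_convergence[where w="\<lambda>_. B * B"])
    show "AE t in leb_\<Omega>. (\<lambda>n. f n t * f n t) \<longlonglongrightarrow> 0"
      by (rule AE_leb_\<Omega>I) (use tendsto_mult[OF lim lim] in simp)
    show "AE t in leb_\<Omega>. norm (f n t * f n t) \<le> B * B" for n
      by (rule AE_leb_\<Omega>I) (use bnd in \<open>simp only: real_norm_def abs_mult, intro mult_mono', auto\<close>)
  qed auto
  then have "(\<lambda>n. sqrt (LINT t|leb_\<Omega>. f n t * f n t)) \<longlonglongrightarrow> sqrt 0" by (intro tendsto_real_sqrt) simp
  then show ?thesis by (simp add: L2_norm_def L2_inner_def)
qed

text \<open>
  The approximating test functions are primitives of polynomials that are cut off by bumps and then
  corrected to mean zero by a multiple of a fixed test function of unit mass.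
\<close>

lemma continuous_prim_in_H10:
  assumes g: "continuous_on {0..1} g" and g1: "prim g 1 = 0" shows "prim g \<in> H10"
proof -
  note gb = ess_bounded_cont[OF g]
  have gi: "integrable leb_\<Omega> g" using gb by auto
  have "\<exists>B. \<forall>t\<in>{0..1}. \<bar>g t\<bar> \<le> B"
    using compact_imp_bounded[OF compact_continuous_image[OF g]] by (auto simp: bounded_iff)
  then obtain B where B: "\<And>t. t \<in> {0..1} \<Longrightarrow> \<bar>g t\<bar> \<le> B" by blast
  have "\<exists>p. real_polynomial_function p \<and> (\<forall>t\<in>{0..1}. \<bar>g t - p t\<bar> < 1 / Suc n)" for n
    by (rule Stone_Weierstrass_real_polynomial_function[of "{0..1::real}" g "1 / Suc n"]) (use g in auto)
  then obtain p where p: "\<And>n. real_polynomial_function (p n)" "\<And>n t. t \<in> {0..1} \<Longrightarrow> \<bar>g t - p n t\<bar> < 1 / Suc n" by metis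
  obtain \<rho> where \<rho>: "test_function \<rho>" "(LINT t|leb_\<Omega>. \<rho> t) = 1" by (rule unit_mass_test_function)
  define \<eta> where "\<eta> n t = p n t * bump 0 1 n t" for n t
  have \<eta>: "test_function (\<eta> n)" for n
    unfolding \<eta>_def by (intro test_function_mult smooth_polynomial p test_function_bump) auto
  define m where "m n = (LINT t|leb_\<Omega>. \<eta> n t)" for n
  define \<psi> where "\<psi> n t = \<eta> n t + (- m n) * \<rho> t" for n t
  have \<psi>: "test_function (\<psi> n)" for n unfolding \<psi>_def by (rule test_function_add_scaled[OF \<eta> \<rho>(1)])
  have \<eta>i: "integrable leb_\<Omega> (\<eta> n)" for n using test_function_ess_bounded[OF \<eta>] by auto
  have \<psi>0: "(LINT t|leb_\<Omega>. \<psi> n t) = 0" for n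
    unfolding \<psi>_def using \<eta>i ess_bounded_integrable[OF test_function_ess_bounded[OF \<rho>(1)]] \<rho>(2)
    by (simp add: m_def)
  have \<eta>lim: "(\<lambda>n. \<eta> n t) \<longlonglongrightarrow> g t" if "0 < t" "t < 1" for t
  proof -
    have "(\<lambda>n. g t - p n t) \<longlonglongrightarrow> 0"
      by (rule tendsto_rabs_zero_cancel, rule tendsto_sandwich[OF _ _ tendsto_const LIMSEQ_inverse_real_of_nat])
         (use p(2)[of t] that in \<open>auto intro!: always_eventually less_imp_le simp: inverse_eq_divide\<close>)
    then have "(\<lambda>n. g t - (g t - p n t)) \<longlonglongrightarrow> g t - 0" by (intro tendsto_intros)
    then have "(\<lambda>n. p n t * bump 0 1 n t) \<longlonglongrightarrow> g t * indicator {0<..<1} t"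
      by (intro tendsto_mult bump_tendsto) simp
    then show ?thesis using that by (simp add: \<eta>_def)
  qed
  have \<eta>bnd: "\<bar>\<eta> n t\<bar> \<le> B + 1" if "0 < t" "t < 1" for n t
  proof -
    have "\<bar>\<eta> n t\<bar> \<le> \<bar>p n t\<bar>" unfolding \<eta>_def abs_mult using bump_bounds[of 0 1 n t] by (intro mult_left_le) auto
    also have "\<dots> \<le> B + 1"
    proof -
      have "\<bar>g t - p n t\<bar> < 1 / real (Suc n)" using p(2)[of t n] that by simp
      also have "\<dots> \<le> 1" by simp
      finally show ?thesis using B[of t] that by auto
    qed
    finally show ?thesis .
  qed
  have mlim: "m \<longlonglongrightarrow> 0"
  proof -
    have "(\<lambda>n. LINT t|leb_\<Omega>. \<eta> n t) \<longlonglongrightarrow> (LINT t|leb_\<Omega>. g t)"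
    proof (rule integral_dominated_convergence[where w="\<lambda>_. B + 1"])
      show "AE t in leb_\<Omega>. (\<lambda>n. \<eta> n t) \<longlonglongrightarrow> g t" by (rule AE_leb_\<Omega>I) (rule \<eta>lim)
      show "AE t in leb_\<Omega>. norm (\<eta> n t) \<le> B + 1" for n by (rule AE_leb_\<Omega>I) (use \<eta>bnd in auto)
    qed (use gi \<eta>i in auto)
    then show ?thesis using g1 by (simp add: m_def[abs_def] prim_1)
  qed
  obtain M where M: "\<And>n. \<bar>m n\<bar> \<le> M" using convergent_imp_Bseq[OF convergentI[OF mlim]] by (auto simp: Bseq_def)
  have "compact (\<rho> ` {0..1})"
    by (rule compact_continuous_image[OF smooth_continuous[OF test_function_smooth[OF \<rho>(1)]]]) auto
  then have "\<exists>R. \<forall>t\<in>{0..1}. \<bar>\<rho> t\<bar> \<le> R" by (auto dest!: compact_imp_bounded simp: bounded_iff)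
  then obtain R where R: "\<And>t. t \<in> {0..1} \<Longrightarrow> \<bar>\<rho> t\<bar> \<le> R" by blast
  have lim2: "(\<lambda>n. L2_norm (\<lambda>t. \<psi> n t - g t)) \<longlonglongrightarrow> 0"
  proof (rule L2_norm_tendsto_0[where B="(B + 1) + M * R + B"])
    show "(\<lambda>t. \<psi> n t - g t) \<in> borel_measurable leb_\<Omega>" for n
      using test_function_ess_bounded[OF \<psi>, of n] gb by auto
    fix t :: real assume t: "0 < t" "t < 1"
    have "(\<lambda>n. \<eta> n t + (- m n) * \<rho> t - g t) \<longlonglongrightarrow> g t + (- 0) * \<rho> t - g t"
      by (intro tendsto_intros \<eta>lim t mlim)
    then show "(\<lambda>n. \<psi> n t - g t) \<longlonglongrightarrow> 0" by (simp add: \<psi>_def)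
    fix n
    have "\<bar>m n * \<rho> t\<bar> \<le> M * R" unfolding abs_mult using M[of n] R[of t] t by (intro mult_mono') auto
    then show "\<bar>\<psi> n t - g t\<bar> \<le> (B + 1) + M * R + B"
      using \<eta>bnd[OF t, of n] B[of t] t by (simp add: \<psi>_def)
  qed
  have \<psi>i: "integrable leb_\<Omega> (\<psi> n)" for n using test_function_ess_bounded[OF \<psi>] by auto
  have sq: "in_L2 (\<lambda>t. \<psi> n t - g t)" for n
    using test_function_ess_bounded[OF \<psi>, of n] gb by (intro ess_bounded_in_L2) auto
  have lim1: "(\<lambda>n. L2_norm (\<lambda>t. prim (\<psi> n) t - prim g t)) \<longlonglongrightarrow> 0"
  proof (rule tendsto_sandwich[OF _ _ tendsto_const lim2]; intro always_eventually allI)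
    fix n
    define X where "X = (LINT t|leb_\<Omega>. \<bar>\<psi> n t - g t\<bar>)"
    have X: "\<bar>prim (\<psi> n) t - prim g t\<bar> \<le> X" for t
      unfolding X_def prim_diff[OF \<psi>i gi, symmetric] by (rule prim_bound_integral) (use \<psi>i gi in auto)
    have X0: "0 \<le> X" by (simp add: X_def)
    have pb: "ess_bounded (\<lambda>t. prim (\<psi> n) t - prim g t)" using \<psi>i gi by auto
    have "(LINT t|leb_\<Omega>. (prim (\<psi> n) t - prim g t) * (prim (\<psi> n) t - prim g t)) \<le> (LINT t|leb_\<Omega>. X * X)"
      using pb X by (intro integral_mono_AE AE_I2) (auto intro!: abs_le_square_iff[THEN iffD1, unfolded power2_eq_square] simp: X0)
    also have "\<dots> = X * X" using leb.prob_space by simp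
    finally have le: "(LINT t|leb_\<Omega>. (prim (\<psi> n) t - prim g t) * (prim (\<psi> n) t - prim g t)) \<le> X * X" .
    have "L2_norm (\<lambda>t. prim (\<psi> n) t - prim g t) \<le> X"
      unfolding L2_norm_def L2_inner_def using X0 le by (intro real_le_lsqrt) (auto simp: power2_eq_square)
    also have "X \<le> L2_norm (\<lambda>t. \<psi> n t - g t)" unfolding X_def by (rule L1_le_L2_norm[OF sq])
    finally show "L2_norm (\<lambda>t. prim (\<psi> n) t - prim g t) \<le> L2_norm (\<lambda>t. \<psi> n t - g t)" .
    show "0 \<le> L2_norm (\<lambda>t. prim (\<psi> n) t - prim g t)" by (simp add: L2_norm_def L2_inner_def)
  qed
  have "hrep (prim g) g" using g1 ess_bounded_in_L2[OF gb] by (simp add: hrep_def)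
  then show ?thesis unfolding H10_def
    using hrep_has_weak_deriv[of "prim g" g] ess_bounded_in_L2[OF gb] ess_bounded_in_L2[OF ess_bounded_prim[OF gi]]
      test_function_prim[OF \<psi> \<psi>0] lim1 lim2
    by (intro CollectI exI[of _ g] conjI exI[of _ "\<lambda>n. prim (\<psi> n)"]) auto
qed

section \<open>Functions of bounded variation\<close>

abbreviation "borel_\<Omega> \<equiv> restrict_space (borel :: real measure) \<Omega>"

lemma finite_borel_measure_\<Omega>D:
  assumes "finite_borel_measure_\<Omega> M"
  shows "finite_measure M" "sets M = sets borel_\<Omega>" "space M = \<Omega>"
  using assms sets_eq_imp_space_eq[of M borel_\<Omega>]
  by (auto simp: finite_borel_measure_\<Omega>_def space_restrict_space)

lemma borel_\<Omega>_sets_iff: "A \<in> sets borel_\<Omega> \<longleftrightarrow> A \<in> sets borel \<and> A \<subseteq> \<Omega>"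
  by (subst sets_restrict_space_iff) auto

lemma borel_\<Omega>_measurable:
  assumes "finite_borel_measure_\<Omega> M" "f \<in> borel_measurable borel"
  shows "f \<in> borel_measurable M"
proof -
  have "f \<in> borel_measurable borel_\<Omega>" using assms(2) by (rule measurable_restrict_space1)
  then show ?thesis using finite_borel_measure_\<Omega>D(2)[OF assms(1)] measurable_cong_sets by blast
qed

lemma finite_borel_integrable:
  assumes M: "finite_borel_measure_\<Omega> M" and f: "f \<in> borel_measurable borel"
    and B: "\<And>t. t \<in> \<Omega> \<Longrightarrow> \<bar>f t :: real\<bar> \<le> B"
  shows "integrable M f"
proof -
  interpret finite_measure M using finite_borel_measure_\<Omega>D[OF M] by simp
  show ?thesis
    by (rule integrable_const_bound[of _ B])
       (use B finite_borel_measure_\<Omega>D[OF M] borel_\<Omega>_measurable[OF M f] in auto)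
qed

text \<open>
  The distribution function, with the same strict inequality as in \<^const>\<open>prim\<close>; the two
  conventions have to agree for the Fubini argument.
\<close>

definition mcdf :: "real measure \<Rightarrow> real \<Rightarrow> real" where
  "mcdf M t = measure M ({..<t} \<inter> \<Omega>)"

lemma sets_lessThan_\<Omega>: "{..<t} \<inter> \<Omega> \<in> sets borel_\<Omega>" by (auto simp: borel_\<Omega>_sets_iff)

lemma mcdf_eq_integral:
  assumes M: "finite_borel_measure_\<Omega> M" shows "mcdf M t = (LINT s|M. indicator {..<t} s * 1)"
  unfolding mcdf_def using finite_borel_measure_\<Omega>D[OF M] by simp

lemma mcdf_mono:
  assumes M: "finite_borel_measure_\<Omega> M" shows "mono (mcdf M)"
proof (rule monoI)
  fix s t :: real assume "s \<le> t"
  interpret finite_measure M using finite_borel_measure_\<Omega>D[OF M] by simp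
  show "mcdf M s \<le> mcdf M t" unfolding mcdf_def
    by (rule finite_measure_mono) (use \<open>s \<le> t\<close> sets_lessThan_\<Omega> finite_borel_measure_\<Omega>D[OF M] in auto)
qed

lemma ess_bounded_mcdf:
  assumes M: "finite_borel_measure_\<Omega> M" shows "ess_bounded (mcdf M)"
proof (rule ess_boundedI)
  interpret finite_measure M using finite_borel_measure_\<Omega>D[OF M] by simp
  show "mcdf M \<in> borel_measurable leb_\<Omega>"
    by (rule borel_imp_leb_\<Omega>) (rule borel_measurable_mono[OF mcdf_mono[OF M]])
  show "\<bar>mcdf M t\<bar> \<le> measure M (space M)" for t
    unfolding mcdf_def by (simp add: bounded_measure)
qed

lemma ess_bounded_mcdf_diff:
  assumes "finite_borel_measure_\<Omega> M" "finite_borel_measure_\<Omega> N"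
  shows "ess_bounded (\<lambda>t. c + mcdf M t - mcdf N t)"
  by (intro ess_bounded_diff ess_bounded_add ess_bounded_const ess_bounded_mcdf assms)

text \<open>
  For \<open>k\<close> of mean zero no boundary term survives. With \<open>k\<close> the derivative of a
  test function this says that the distribution function has distributional derivative \<open>M\<close>;
  with \<open>k\<close> the adjoint state it turns the pairing with a control into an integral of the
  switching function.
\<close>

lemma mcdf_pairing:
  assumes M: "finite_borel_measure_\<Omega> M" and k: "integrable leb_\<Omega> k" "(LINT t|leb_\<Omega>. k t) = 0"
  shows "(LINT t|leb_\<Omega>. k t * mcdf M t) = - (LINT s|M. prim k s)"
proof -
  interpret finite_measure M using finite_borel_measure_\<Omega>D[OF M] by simp
  have "(LINT t|leb_\<Omega>. k t * (LINT s|M. indicator {..<t} s * 1)) = (LINT s|M. 1 * ((LINT t|leb_\<Omega>. k t) - prim k s))"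
    by (rule triangle_Fubini) (use finite_borel_measure_\<Omega>D[OF M] k borel_\<Omega>_measurable[OF M, of "\<lambda>s. s"] in auto)
  then show ?thesis unfolding mcdf_eq_integral[OF M] using k by simp
qed

text \<open>
  The function \<open>mcdf M - mcdf N\<close> has the prescribed derivative, so \<open>q\<close> differs
  from it by a function whose weak derivative vanishes, that is, by a constant.
\<close>

lemma has_deriv_measure_iff:
  assumes q: "integrable leb_\<Omega> q"
  shows "has_deriv_measure q (M, N) \<longleftrightarrow> finite_borel_measure_\<Omega> M \<and> finite_borel_measure_\<Omega> N \<and>
    (\<exists>c. AE t in leb_\<Omega>. q t = c + mcdf M t - mcdf N t)"
proof (cases "finite_borel_measure_\<Omega> M \<and> finite_borel_measure_\<Omega> N")
  case True
  then have M: "finite_borel_measure_\<Omega> M" and N: "finite_borel_measure_\<Omega> N" by auto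
  note mb = ess_bounded_mcdf[OF M] ess_bounded_mcdf[OF N]
  define F where "F t = mcdf M t - mcdf N t" for t
  have F: "ess_bounded F" unfolding F_def using mb by auto
  have key: "(LINT t|leb_\<Omega>. F t * deriv \<phi> t) = - ((LINT t|M. \<phi> t) - (LINT t|N. \<phi> t))" if \<phi>: "test_function \<phi>" for \<phi>
  proof -
    note db = test_function_deriv_ess_bounded[OF \<phi>]
    have "(LINT t|leb_\<Omega>. F t * deriv \<phi> t) = (LINT t|leb_\<Omega>. deriv \<phi> t * mcdf M t - deriv \<phi> t * mcdf N t)"
      by (simp add: F_def algebra_simps)
    also have "\<dots> = (LINT t|leb_\<Omega>. deriv \<phi> t * mcdf M t) - (LINT t|leb_\<Omega>. deriv \<phi> t * mcdf N t)"
      using mb db by (intro Bochner_Integration.integral_diff) auto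
    also have "\<dots> = - (LINT t|M. prim (deriv \<phi>) t) + (LINT t|N. prim (deriv \<phi>) t)"
      using mcdf_pairing[OF M ess_bounded_integrable[OF db]] mcdf_pairing[OF N ess_bounded_integrable[OF db]]
        test_function_integral_deriv[OF \<phi>] by simp
    also have "(LINT t|M. prim (deriv \<phi>) t) = (LINT t|M. \<phi> t)"
      using finite_borel_measure_\<Omega>D(3)[OF M] test_function_prim_deriv[OF \<phi>]
      by (intro Bochner_Integration.integral_cong) auto
    also have "(LINT t|N. prim (deriv \<phi>) t) = (LINT t|N. \<phi> t)"
      using finite_borel_measure_\<Omega>D(3)[OF N] test_function_prim_deriv[OF \<phi>]
      by (intro Bochner_Integration.integral_cong) auto
    finally show ?thesis by simp
  qed
  have qi: "integrable leb_\<Omega> (\<lambda>t. q t * deriv \<phi> t)" if "test_function \<phi>" for \<phi>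
    using ess_bounded_mult_integrable[OF test_function_deriv_ess_bounded[OF that] q] by (simp add: mult.commute)
  have "(\<forall>\<phi>. test_function \<phi> \<longrightarrow> L2_inner q (deriv \<phi>) = - ((LINT t|M. \<phi> t) - (LINT t|N. \<phi> t)))
     \<longleftrightarrow> (\<forall>\<phi>. test_function \<phi> \<longrightarrow> L2_inner (\<lambda>t. q t - F t) (deriv \<phi>) = 0)"
  proof (intro all_cong1 imp_cong refl)
    fix \<phi> assume \<phi>: "test_function \<phi>"
    have "L2_inner (\<lambda>t. q t - F t) (deriv \<phi>) = (LINT t|leb_\<Omega>. q t * deriv \<phi> t - F t * deriv \<phi> t)"
      by (simp add: L2_inner_def algebra_simps)
    also have "\<dots> = L2_inner q (deriv \<phi>) + ((LINT t|M. \<phi> t) - (LINT t|N. \<phi> t))"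
      using qi[OF \<phi>] F test_function_deriv_ess_bounded[OF \<phi>] key[OF \<phi>]
      by (subst Bochner_Integration.integral_diff) (auto simp: L2_inner_def)
    finally show "(L2_inner q (deriv \<phi>) = - ((LINT t|M. \<phi> t) - (LINT t|N. \<phi> t))) =
      (L2_inner (\<lambda>t. q t - F t) (deriv \<phi>) = 0)" by linarith
  qed
  also have "\<dots> \<longleftrightarrow> (\<exists>c. AE t in leb_\<Omega>. q t - F t = c)"
  proof
    assume "\<forall>\<phi>. test_function \<phi> \<longrightarrow> L2_inner (\<lambda>t. q t - F t) (deriv \<phi>) = 0"
    then show "\<exists>c. AE t in leb_\<Omega>. q t - F t = c"
      using q F by (intro AE_constant_if_weak_deriv_zero) auto
  next
    assume "\<exists>c. AE t in leb_\<Omega>. q t - F t = c"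
    then obtain c where c: "AE t in leb_\<Omega>. q t - F t = c" by blast
    show "\<forall>\<phi>. test_function \<phi> \<longrightarrow> L2_inner (\<lambda>t. q t - F t) (deriv \<phi>) = 0"
    proof (intro allI impI)
      fix \<phi> assume \<phi>: "test_function \<phi>"
      have [measurable]: "q \<in> borel_measurable leb_\<Omega>" "F \<in> borel_measurable leb_\<Omega>" "deriv \<phi> \<in> borel_measurable leb_\<Omega>"
        using q F test_function_deriv_ess_bounded[OF \<phi>] by auto
      have "L2_inner (\<lambda>t. q t - F t) (deriv \<phi>) = (LINT t|leb_\<Omega>. c * deriv \<phi> t)"
        unfolding L2_inner_def by (rule integral_cong_AE) (use c in auto)
      then show "L2_inner (\<lambda>t. q t - F t) (deriv \<phi>) = 0" using test_function_integral_deriv[OF \<phi>] by simp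
    qed
  qed
  also have "\<dots> \<longleftrightarrow> (\<exists>c. AE t in leb_\<Omega>. q t = c + mcdf M t - mcdf N t)"
    by (auto simp: F_def algebra_simps)
  finally show ?thesis using True by (simp add: has_deriv_measure_def)
next
  case False then show ?thesis by (auto simp: has_deriv_measure_def)
qed

lemma BV_ess_bounded: assumes "q \<in> BV" shows "ess_bounded q"
proof -
  obtain M N c where q: "integrable leb_\<Omega> q" "finite_borel_measure_\<Omega> M" "finite_borel_measure_\<Omega> N"
    "AE t in leb_\<Omega>. q t = c + mcdf M t - mcdf N t"
    using assms has_deriv_measure_iff[of q] by (auto simp: BV_def)
  show ?thesis
    by (rule ess_bounded_AE_cong[OF ess_bounded_mcdf_diff[OF q(2,3)]]) (use q(4) in \<open>simp add: eq_commute\<close>)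
qed

text \<open>
  Only nonnegative combinations of measures exist; combinations of signed measures are formed in the
  positive and in the negative parts separately.
\<close>

definition mcomb :: "real \<Rightarrow> real measure \<Rightarrow> real \<Rightarrow> real measure \<Rightarrow> real measure" where
  "mcomb r M s N = measure_of \<Omega> (sets borel_\<Omega>) (\<lambda>A. ennreal r * emeasure M A + ennreal s * emeasure N A)"

lemma mcomb:
  assumes M: "finite_borel_measure_\<Omega> M" and N: "finite_borel_measure_\<Omega> N" and rs: "0 \<le> r" "0 \<le> s"
  shows "finite_borel_measure_\<Omega> (mcomb r M s N)"
    and "A \<in> sets borel_\<Omega> \<Longrightarrow> emeasure (mcomb r M s N) A = ennreal r * emeasure M A + ennreal s * emeasure N A"
    and "A \<in> sets borel_\<Omega> \<Longrightarrow> measure (mcomb r M s N) A = r * measure M A + s * measure N A"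
proof -
  interpret M: finite_measure M using finite_borel_measure_\<Omega>D[OF M] by simp
  interpret N: finite_measure N using finite_borel_measure_\<Omega>D[OF N] by simp
  note sM = finite_borel_measure_\<Omega>D(2)[OF M] and sN = finite_borel_measure_\<Omega>D(2)[OF N]
  have sa: "sigma_algebra \<Omega> (sets borel_\<Omega>)"
    using sets.sigma_algebra_axioms[of borel_\<Omega>] by (simp add: space_restrict_space)
  have sets: "sets (mcomb r M s N) = sets borel_\<Omega>" unfolding mcomb_def
    by (rule sigma_algebra.sets_measure_of_eq[OF sa])
  have em: "emeasure (mcomb r M s N) A = ennreal r * emeasure M A + ennreal s * emeasure N A" if "A \<in> sets borel_\<Omega>" for A
    unfolding mcomb_def
  proof (rule emeasure_measure_of_sigma[OF sa _ _ that])
    show "positive (sets borel_\<Omega>) (\<lambda>A. ennreal r * emeasure M A + ennreal s * emeasure N A)"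
      by (simp add: positive_def)
    show "countably_additive (sets borel_\<Omega>) (\<lambda>A. ennreal r * emeasure M A + ennreal s * emeasure N A)"
      unfolding countably_additive_def
    proof (intro allI impI)
      fix F :: "nat \<Rightarrow> real set" assume F: "range F \<subseteq> sets borel_\<Omega>" "disjoint_family F" "\<Union> (range F) \<in> sets borel_\<Omega>"
      have "(\<Sum>i. emeasure M (F i)) = emeasure M (\<Union> (range F))" "(\<Sum>i. emeasure N (F i)) = emeasure N (\<Union> (range F))"
        using F sM sN by (auto intro!: suminf_emeasure)
      then show "(\<Sum>i. ennreal r * emeasure M (F i) + ennreal s * emeasure N (F i)) = ennreal r * emeasure M (\<Union> (range F)) + ennreal s * emeasure N (\<Union> (range F))"
        by (subst suminf_add[symmetric]) (auto simp: ennreal_suminf_cmult)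
    qed
  qed
  show "emeasure (mcomb r M s N) A = ennreal r * emeasure M A + ennreal s * emeasure N A" if "A \<in> sets borel_\<Omega>"
    using em[OF that] .
  have em': "emeasure (mcomb r M s N) A = ennreal (r * measure M A + s * measure N A)" if "A \<in> sets borel_\<Omega>" for A
    using rs by (simp add: em[OF that] M.emeasure_eq_measure N.emeasure_eq_measure ennreal_mult)
  show "measure (mcomb r M s N) A = r * measure M A + s * measure N A" if "A \<in> sets borel_\<Omega>"
    using rs by (intro measure_eq_emeasure_eq_ennreal em'[OF that]) auto
  have "space (mcomb r M s N) = \<Omega>" using sets_eq_imp_space_eq[OF sets] by (simp add: space_restrict_space)
  moreover have "\<Omega> \<in> sets borel_\<Omega>" by (simp add: borel_\<Omega>_sets_iff)
  ultimately have "finite_measure (mcomb r M s N)" by (intro finite_measureI) (simp add: em')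
  then show "finite_borel_measure_\<Omega> (mcomb r M s N)" using sets by (simp add: finite_borel_measure_\<Omega>_def)
qed

text \<open>
  The intervals that start at 0 form a generator that is closed under intersections.
\<close>

lemma finite_borel_measure_eqI:
  assumes M: "finite_borel_measure_\<Omega> M" and N: "finite_borel_measure_\<Omega> N"
    and eq: "\<And>t. t \<in> {0<..1} \<Longrightarrow> measure M {0<..<t} = measure N {0<..<t}"
  shows "M = N"
proof -
  interpret M: finite_measure M using finite_borel_measure_\<Omega>D[OF M] by simp
  interpret N: finite_measure N using finite_borel_measure_\<Omega>D[OF N] by simp
  note sM = finite_borel_measure_\<Omega>D(2)[OF M] and sN = finite_borel_measure_\<Omega>D(2)[OF N]
  have mM: "(\<lambda>x. x) \<in> borel_measurable M" "(\<lambda>x. x) \<in> borel_measurable N"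
    by (rule borel_\<Omega>_measurable[OF M] borel_\<Omega>_measurable[OF N], simp)+
  have d: "emeasure (distr M borel (\<lambda>x. x)) A = emeasure M (A \<inter> \<Omega>)"
    "emeasure (distr N borel (\<lambda>x. x)) A = emeasure N (A \<inter> \<Omega>)" if "A \<in> sets borel" for A
    using that mM finite_borel_measure_\<Omega>D(3)[OF M] finite_borel_measure_\<Omega>D(3)[OF N]
    by (auto simp: emeasure_distr)
  have I: "emeasure M ({..<t} \<inter> \<Omega>) = emeasure N ({..<t} \<inter> \<Omega>)" for t
  proof (cases "t \<le> 0")
    case True
    then have "{..<t} \<inter> \<Omega> = {}" by auto
    then show ?thesis by simp
  next
    case False
    have "{..<t} \<inter> \<Omega> = {0<..<min t 1}" by auto
    then show ?thesis using eq[of "min t 1"] False by (simp add: M.emeasure_eq_measure N.emeasure_eq_measure)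
  qed
  have sb: "sets borel = sigma_sets UNIV (range (lessThan :: real \<Rightarrow> _))" by (subst borel_Iio) simp
  have "distr M borel (\<lambda>x. x) = distr N borel (\<lambda>x. x)"
  proof (rule measure_eqI_generator_eq[where E="range lessThan" and \<Omega>=UNIV and A="\<lambda>i. {..<real i}"])
    have "{..<s} \<inter> {..<t} = {..<min s t}" for s t :: real by auto
    then show "Int_stable (range (lessThan :: real \<Rightarrow> _))" by (auto simp: Int_stable_def)
    show "(\<Union>i. {..<real i}) = UNIV" using reals_Archimedean2 by auto
    show "sets (distr M borel (\<lambda>x. x)) = sigma_sets UNIV (range lessThan)"
      "sets (distr N borel (\<lambda>x. x)) = sigma_sets UNIV (range lessThan)"
      by (simp_all add: sb)
    show "emeasure (distr M borel (\<lambda>x. x)) {..<real i} \<noteq> \<infinity>" for i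
      using d M.emeasure_finite by simp
  qed (use d I in auto)
  then have eqd: "emeasure M (A \<inter> \<Omega>) = emeasure N (A \<inter> \<Omega>)" if "A \<in> sets borel" for A
    using d[OF that] by simp
  show ?thesis
  proof (rule measure_eqI)
    fix A assume "A \<in> sets M"
    then have "A \<in> sets borel" "A \<inter> \<Omega> = A" using sM borel_\<Omega>_sets_iff by auto
    then show "emeasure M A = emeasure N A" using eqd[of A] by simp
  qed (use sM sN in simp)
qed

lemma integral_bump_measure_tendsto:
  assumes M: "finite_borel_measure_\<Omega> M" and t: "t \<in> {0<..1}"
  shows "(\<lambda>n. LINT s|M. bump 0 t n s) \<longlonglongrightarrow> measure M {0<..<t}"
proof -
  interpret M: finite_measure M using finite_borel_measure_\<Omega>D[OF M] by simp
  have "(\<lambda>n. LINT s|M. bump 0 t n s) \<longlonglongrightarrow> (LINT s|M. indicator {0<..<t} s)"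
  proof (rule integral_dominated_convergence[where w="\<lambda>_. 1"])
    show "AE s in M. (\<lambda>n. bump 0 t n s) \<longlonglongrightarrow> indicator {0<..<t} s" using bump_tendsto by auto
    show "AE s in M. norm (bump 0 t n s) \<le> 1" for n using bump_bounds by auto
    show "indicator {0<..<t} \<in> borel_measurable M" by (rule borel_\<Omega>_measurable[OF M]) simp
  qed (auto intro!: borel_\<Omega>_measurable[OF M] borel_measurable_continuous_onI smooth_continuous smooth_bump)
  moreover have "{0<..<t} \<inter> \<Omega> = {0<..<t}" using t by auto
  ultimately show ?thesis using finite_borel_measure_\<Omega>D(3)[OF M] by simp
qed

text \<open>
  Bumps recover the measures of intervals from the distribution. Moving the negative parts to the other side
  turns equality of two differences into equality of two measures, which can be tested on intervals.
\<close>

lemma has_deriv_measure_unique: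
  assumes 1: "has_deriv_measure q (M, N)" and 2: "has_deriv_measure q (M', N')" and A: "A \<in> sets borel_\<Omega>"
  shows "measure M A - measure N A = measure M' A - measure N' A"
proof -
  have fin: "finite_borel_measure_\<Omega> M" "finite_borel_measure_\<Omega> N" "finite_borel_measure_\<Omega> M'" "finite_borel_measure_\<Omega> N'"
    using 1 2 by (auto simp: has_deriv_measure_def)
  have diff: "measure M {0<..<t} - measure N {0<..<t} = measure M' {0<..<t} - measure N' {0<..<t}" if t: "t \<in> {0<..1}" for t
  proof (rule LIMSEQ_unique)
    show "(\<lambda>n. (LINT s|M. bump 0 t n s) - (LINT s|N. bump 0 t n s)) \<longlonglongrightarrow> measure M {0<..<t} - measure N {0<..<t}"
      by (intro tendsto_diff integral_bump_measure_tendsto fin t)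
    have "(\<lambda>n. (LINT s|M'. bump 0 t n s) - (LINT s|N'. bump 0 t n s)) \<longlonglongrightarrow> measure M' {0<..<t} - measure N' {0<..<t}"
      by (intro tendsto_diff integral_bump_measure_tendsto fin t)
    moreover have "(LINT s|M'. bump 0 t n s) - (LINT s|N'. bump 0 t n s) = (LINT s|M. bump 0 t n s) - (LINT s|N. bump 0 t n s)" for n
    proof -
      have "test_function (bump 0 t n)" using t by (intro test_function_bump) auto
      then show ?thesis using 1 2 unfolding has_deriv_measure_def by fastforce
    qed
    ultimately show "(\<lambda>n. (LINT s|M. bump 0 t n s) - (LINT s|N. bump 0 t n s)) \<longlonglongrightarrow> measure M' {0<..<t} - measure N' {0<..<t}" by simp
  qed
  have "mcomb 1 M 1 N' = mcomb 1 M' 1 N"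
  proof (rule finite_borel_measure_eqI)
    fix t :: real assume t: "t \<in> {0<..1}"
    then have "{0<..<t} \<in> sets borel_\<Omega>" by (auto simp: borel_\<Omega>_sets_iff)
    then show "measure (mcomb 1 M 1 N') {0<..<t} = measure (mcomb 1 M' 1 N) {0<..<t}"
      using diff[OF t] by (simp add: mcomb(3) fin)
  qed (auto intro: mcomb(1) fin)
  then have "measure (mcomb 1 M 1 N') A = measure (mcomb 1 M' 1 N) A" by simp
  then show ?thesis using A by (simp add: mcomb(3) fin)
qed

section \<open>Total variation\<close>

abbreviation borel_partition :: "real set set \<Rightarrow> bool" where
  "borel_partition P \<equiv> finite P \<and> partition_on \<Omega> P \<and> P \<subseteq> sets borel"

lemma borel_partition_sets: "borel_partition P \<Longrightarrow> A \<in> P \<Longrightarrow> A \<in> sets borel_\<Omega>"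
  by (auto simp: borel_\<Omega>_sets_iff partition_on_def)

lemma sum_partition:
  assumes M: "finite_borel_measure_\<Omega> M" and P: "borel_partition P"
  shows "(\<Sum>A\<in>P. measure M A) = measure M \<Omega>"
proof -
  interpret M: finite_measure M using finite_borel_measure_\<Omega>D[OF M] by simp
  have "measure M (\<Union>A\<in>P. A) = (\<Sum>A\<in>P. measure M A)"
    by (rule M.finite_measure_finite_Union)
       (use P borel_partition_sets[OF P] finite_borel_measure_\<Omega>D[OF M] in
         \<open>auto simp: partition_on_def disjoint_def disjoint_family_on_def\<close>)
  moreover have "(\<Union>A\<in>P. A) = \<Omega>" using P by (auto simp: partition_on_def)
  ultimately show ?thesis by simp
qed

lemma tv_norm_bdd:
  assumes M: "finite_borel_measure_\<Omega> M" and N: "finite_borel_measure_\<Omega> N"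
  shows "bdd_above ((\<lambda>P. \<Sum>A\<in>P. \<bar>measure M A - measure N A\<bar>) ` {P. borel_partition P})"
proof (rule bdd_aboveI2[where M="measure M \<Omega> + measure N \<Omega>"])
  fix P assume "P \<in> {P. borel_partition P}"
  then have P: "borel_partition P" by simp
  have "(\<Sum>A\<in>P. \<bar>measure M A - measure N A\<bar>) \<le> (\<Sum>A\<in>P. measure M A + measure N A)"
    by (rule sum_mono) (auto simp: abs_le_iff)
  then show "(\<Sum>A\<in>P. \<bar>measure M A - measure N A\<bar>) \<le> measure M \<Omega> + measure N \<Omega>"
    using sum_partition[OF M P] sum_partition[OF N P] by (simp add: sum.distrib)
qed

lemma tv_norm_upper:
  assumes "finite_borel_measure_\<Omega> M" "finite_borel_measure_\<Omega> N" "borel_partition P"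
  shows "(\<Sum>A\<in>P. \<bar>measure M A - measure N A\<bar>) \<le> tv_norm (M, N)"
  unfolding tv_norm_def using cSUP_upper[OF _ tv_norm_bdd[OF assms(1,2)], of P] assms(3) by simp

lemma tv_norm_least:
  assumes "\<And>P. borel_partition P \<Longrightarrow> (\<Sum>A\<in>P. \<bar>measure M A - measure N A\<bar>) \<le> c"
  shows "tv_norm (M, N) \<le> c"
proof -
  have "borel_partition {\<Omega>}" by (auto simp: partition_on_def)
  then show ?thesis unfolding tv_norm_def prod.case by (intro cSUP_least) (use assms in auto)
qed

text \<open>
  Because of the Hahn decomposition, partitions into a set and its complement suffice for all lower bounds
  on the total variation.
\<close>

lemma tv_norm_two_sets:
  assumes M: "finite_borel_measure_\<Omega> M" and N: "finite_borel_measure_\<Omega> N" and Y: "Y \<in> sets borel_\<Omega>"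
  shows "\<bar>measure M Y - measure N Y\<bar> + \<bar>measure M (\<Omega> - Y) - measure N (\<Omega> - Y)\<bar> \<le> tv_norm (M, N)"
proof -
  have Y': "Y \<in> sets borel" "Y \<subseteq> \<Omega>" using Y by (auto simp: borel_\<Omega>_sets_iff)
  consider "Y = {}" | "Y = \<Omega>" | "Y \<noteq> {}" "Y \<noteq> \<Omega>" by auto
  then show ?thesis
  proof cases
    case 3
    have "borel_partition {Y, \<Omega> - Y}" using 3 Y' by (auto simp: partition_on_def disjoint_def)
    from tv_norm_upper[OF M N this] show ?thesis using 3 Y' by (subst (asm) sum.insert) auto
  qed (use tv_norm_upper[OF M N, of "{\<Omega>}"] in \<open>auto simp: partition_on_def\<close>)
qed

lemma tv_norm_measure_diff:
  assumes "finite_borel_measure_\<Omega> M" "finite_borel_measure_\<Omega> N" "A \<in> sets borel_\<Omega>"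
  shows "\<bar>measure M A - measure N A\<bar> \<le> tv_norm (M, N)"
  using tv_norm_two_sets[OF assms] by linarith

text \<open>
  The choice in \<^const>\<open>deriv_tv\<close> is harmless, as the set function is determined by
  \<open>q\<close>.
\<close>

lemma deriv_tv_eq:
  assumes "has_deriv_measure q (M, N)" shows "deriv_tv q = tv_norm (M, N)"
proof -
  define \<mu> where "\<mu> = (SOME \<mu>. has_deriv_measure q \<mu>)"
  have "has_deriv_measure q \<mu>" unfolding \<mu>_def by (rule someI[of "has_deriv_measure q", OF assms])
  then obtain M' N' where \<mu>: "\<mu> = (M', N')" "has_deriv_measure q (M', N')" by (cases \<mu>) auto
  have "tv_norm (M', N') = tv_norm (M, N)" unfolding tv_norm_def prod.case
  proof (intro SUP_cong refl sum.cong)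
    fix P A assume "P \<in> {P. borel_partition P}" "A \<in> P"
    then have "A \<in> sets borel_\<Omega>" using borel_partition_sets by auto
    then show "\<bar>measure M' A - measure N' A\<bar> = \<bar>measure M A - measure N A\<bar>"
      using has_deriv_measure_unique[OF \<mu>(2) assms] by simp
  qed
  then show ?thesis by (simp add: deriv_tv_def \<mu>_def[symmetric] \<mu>(1))
qed

lemma BV_obtain_measures:
  assumes "q \<in> BV"
  obtains M N c where "finite_borel_measure_\<Omega> M" "finite_borel_measure_\<Omega> N"
    "AE t in leb_\<Omega>. q t = c + mcdf M t - mcdf N t" "deriv_tv q = tv_norm (M, N)"
proof -
  obtain M N where q: "integrable leb_\<Omega> q" "has_deriv_measure q (M, N)"
    using assms unfolding BV_def by auto
  from q(2) obtain c where "finite_borel_measure_\<Omega> M" "finite_borel_measure_\<Omega> N"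
    "AE t in leb_\<Omega>. q t = c + mcdf M t - mcdf N t" unfolding has_deriv_measure_iff[OF q(1)] by blast
  then show thesis using deriv_tv_eq[OF q(2)] by (rule that)
qed

lemma BV_from_measures:
  assumes "finite_borel_measure_\<Omega> M" "finite_borel_measure_\<Omega> N"
    "AE t in leb_\<Omega>. q t = c + mcdf M t - mcdf N t"
  shows "q \<in> BV" "deriv_tv q = tv_norm (M, N)"
proof -
  have "ess_bounded q"
    by (rule ess_bounded_AE_cong[OF ess_bounded_mcdf_diff[OF assms(1,2)]]) (use assms(3) in \<open>simp add: eq_commute\<close>)
  then have q: "integrable leb_\<Omega> q" by auto
  have "has_deriv_measure q (M, N)" using has_deriv_measure_iff[OF q] assms by blast
  then show "q \<in> BV" "deriv_tv q = tv_norm (M, N)" using q deriv_tv_eq by (auto simp: BV_def)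
qed

lemma tv_norm_nonneg:
  assumes "finite_borel_measure_\<Omega> M" "finite_borel_measure_\<Omega> N" shows "0 \<le> tv_norm (M, N)"
  using tv_norm_measure_diff[OF assms, of "{}"] by (simp add: borel_\<Omega>_sets_iff)

lemma deriv_tv_nonneg: "q \<in> BV \<Longrightarrow> 0 \<le> deriv_tv q"
  by (erule BV_obtain_measures) (simp add: tv_norm_nonneg)

lemma tv_norm_comb:
  assumes fin: "finite_borel_measure_\<Omega> M" "finite_borel_measure_\<Omega> N" "finite_borel_measure_\<Omega> M'" "finite_borel_measure_\<Omega> N'"
    and rs: "0 \<le> r" "0 \<le> s"
  shows "tv_norm (mcomb r M s M', mcomb r N s N') \<le> r * tv_norm (M, N) + s * tv_norm (M', N')"
proof (rule tv_norm_least)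
  fix P assume P: "borel_partition P"
  have "(\<Sum>A\<in>P. \<bar>measure (mcomb r M s M') A - measure (mcomb r N s N') A\<bar>)
    \<le> (\<Sum>A\<in>P. r * \<bar>measure M A - measure N A\<bar> + s * \<bar>measure M' A - measure N' A\<bar>)"
  proof (rule sum_mono)
    fix A assume "A \<in> P"
    then have A: "A \<in> sets borel_\<Omega>" using borel_partition_sets[OF P] by simp
    have "measure (mcomb r M s M') A - measure (mcomb r N s N') A = r * (measure M A - measure N A) + s * (measure M' A - measure N' A)"
      using A by (simp add: mcomb(3) fin rs algebra_simps)
    also have "\<bar>\<dots>\<bar> \<le> \<bar>r * (measure M A - measure N A)\<bar> + \<bar>s * (measure M' A - measure N' A)\<bar>" by (rule abs_triangle_ineq)
    finally show "\<bar>measure (mcomb r M s M') A - measure (mcomb r N s N') A\<bar>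
      \<le> r * \<bar>measure M A - measure N A\<bar> + s * \<bar>measure M' A - measure N' A\<bar>" using rs by (simp add: abs_mult)
  qed
  also have "\<dots> = r * (\<Sum>A\<in>P. \<bar>measure M A - measure N A\<bar>) + s * (\<Sum>A\<in>P. \<bar>measure M' A - measure N' A\<bar>)"
    by (simp add: sum.distrib sum_distrib_left)
  also have "\<dots> \<le> r * tv_norm (M, N) + s * tv_norm (M', N')"
    by (intro add_mono mult_left_mono tv_norm_upper fin P rs)
  finally show "(\<Sum>A\<in>P. \<bar>measure (mcomb r M s M') A - measure (mcomb r N s N') A\<bar>) \<le> r * tv_norm (M, N) + s * tv_norm (M', N')" .
qed

lemma mcdf_mcomb:
  assumes "finite_borel_measure_\<Omega> M" "finite_borel_measure_\<Omega> N" "0 \<le> r" "0 \<le> s"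
  shows "mcdf (mcomb r M s N) t = r * mcdf M t + s * mcdf N t"
  unfolding mcdf_def by (rule mcomb(3)[OF assms sets_lessThan_\<Omega>])

lemma tv_norm_swap: "tv_norm (M, N) = tv_norm (N, M)"
  unfolding tv_norm_def prod.case by (intro SUP_cong refl sum.cong) (auto simp: abs_minus_commute)

text \<open>
  For negative \<open>s\<close> the two measures that represent the derivative of \<open>p\<close> change
  roles.
\<close>

lemma BV_comb:
  assumes q: "q \<in> BV" and p: "p \<in> BV" and r: "0 \<le> r"
  shows "(\<lambda>t. r * q t + s * p t) \<in> BV"
    and "deriv_tv (\<lambda>t. r * q t + s * p t) \<le> r * deriv_tv q + \<bar>s\<bar> * deriv_tv p"
proof -
  obtain M N c where 1: "finite_borel_measure_\<Omega> M" "finite_borel_measure_\<Omega> N"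
    "AE t in leb_\<Omega>. q t = c + mcdf M t - mcdf N t" "deriv_tv q = tv_norm (M, N)"
    by (rule BV_obtain_measures[OF q])
  obtain M' N' c' where 2: "finite_borel_measure_\<Omega> M'" "finite_borel_measure_\<Omega> N'"
    "AE t in leb_\<Omega>. p t = c' + mcdf M' t - mcdf N' t" "deriv_tv p = tv_norm (M', N')"
    by (rule BV_obtain_measures[OF p])
  have "(\<lambda>t. r * q t + s * p t) \<in> BV \<and> deriv_tv (\<lambda>t. r * q t + s * p t) \<le> r * deriv_tv q + \<bar>s\<bar> * deriv_tv p"
  proof (cases "0 \<le> s")
    case True
    have "AE t in leb_\<Omega>. r * q t + s * p t = (r * c + s * c') + mcdf (mcomb r M s M') t - mcdf (mcomb r N s N') t"
      using 1(3) 2(3) by eventually_elim (simp only: mcdf_mcomb 1(1,2) 2(1,2) r True, simp (no_asm) add: algebra_simps)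
    from BV_from_measures[OF _ _ this] tv_norm_comb[OF 1(1,2) 2(1,2) r True] show ?thesis
      using True 1 2 r by (simp add: mcomb(1))
  next
    case False
    then have s: "0 \<le> - s" by simp
    have "AE t in leb_\<Omega>. r * q t + s * p t = (r * c + s * c') + mcdf (mcomb r M (- s) N') t - mcdf (mcomb r N (- s) M') t"
      using 1(3) 2(3) by eventually_elim (simp only: mcdf_mcomb 1(1,2) 2(1,2) r s, simp (no_asm) add: algebra_simps)
    from BV_from_measures[OF _ _ this] tv_norm_comb[OF 1(1,2) 2(2,1) r s] show ?thesis
      using False 1 2 r s by (simp add: mcomb(1) tv_norm_swap[of N' M'])
  qed
  then show "(\<lambda>t. r * q t + s * p t) \<in> BV" "deriv_tv (\<lambda>t. r * q t + s * p t) \<le> r * deriv_tv q + \<bar>s\<bar> * deriv_tv p" by auto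
qed

lemma finite_borel_null: "finite_borel_measure_\<Omega> (null_measure borel_\<Omega>)"
  by (auto simp: finite_borel_measure_\<Omega>_def intro!: finite_measureI)

lemma BV_const: "(\<lambda>_. c) \<in> BV" and deriv_tv_const: "deriv_tv (\<lambda>_. c) = 0"
proof -
  have 1: "AE t in leb_\<Omega>. c = c + mcdf (null_measure borel_\<Omega>) t - mcdf (null_measure borel_\<Omega>) t" by simp
  note r = BV_from_measures[OF finite_borel_null finite_borel_null 1]
  show "(\<lambda>_. c) \<in> BV" by (rule r(1))
  have "tv_norm (null_measure borel_\<Omega>, null_measure borel_\<Omega>) \<le> 0" by (rule tv_norm_least) (simp add: measure_def)
  then show "deriv_tv (\<lambda>_. c) = 0" using r(2) tv_norm_nonneg[OF finite_borel_null finite_borel_null] by simp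
qed

text \<open>
  The derivative is the Dirac measure at the jump.
\<close>

lemma BV_jump: "x \<in> \<Omega> \<Longrightarrow> indicator {x<..<1} \<in> BV"
  and deriv_tv_jump: "x \<in> \<Omega> \<Longrightarrow> deriv_tv (indicator {x<..<1}) \<le> 1"
proof -
  assume x: "x \<in> \<Omega>"
  define \<delta> where "\<delta> = return borel_\<Omega> x"
  interpret J: prob_space \<delta> unfolding \<delta>_def by (rule prob_space_return) (use x in \<open>simp add: space_restrict_space\<close>)
  have fin: "finite_borel_measure_\<Omega> \<delta>"
    using J.finite_measure_axioms by (simp add: finite_borel_measure_\<Omega>_def \<delta>_def)
  have m: "measure \<delta> A = indicator A x" if "A \<in> sets borel_\<Omega>" for A
    using that unfolding \<delta>_def by (simp add: measure_return)
  have "AE t in leb_\<Omega>. indicator {x<..<1} t = 0 + mcdf \<delta> t - mcdf (null_measure borel_\<Omega>) t"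
  proof (rule AE_leb_\<Omega>I)
    fix t :: real assume "0 < t" "t < 1"
    then show "indicator {x<..<1} t = 0 + mcdf \<delta> t - mcdf (null_measure borel_\<Omega>) t"
      using x unfolding mcdf_def m[OF sets_lessThan_\<Omega>] by (auto simp: indicator_def measure_def)
  qed
  note r = BV_from_measures[OF fin finite_borel_null this]
  show "indicator {x<..<1} \<in> BV" by (rule r(1))
  have "tv_norm (\<delta>, null_measure borel_\<Omega>) \<le> 1"
  proof (rule tv_norm_least)
    fix P assume P: "borel_partition P"
    have "(\<Sum>A\<in>P. \<bar>measure \<delta> A - measure (null_measure borel_\<Omega>) A\<bar>) = (\<Sum>A\<in>P. measure \<delta> A)"
      by (simp add: measure_def[of "null_measure _"])
    also have "\<dots> = measure \<delta> \<Omega>" by (rule sum_partition[OF fin P])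
    also have "\<dots> \<le> 1" by simp
    finally show "(\<Sum>A\<in>P. \<bar>measure \<delta> A - measure (null_measure borel_\<Omega>) A\<bar>) \<le> 1" .
  qed
  then show "deriv_tv (indicator {x<..<1}) \<le> 1" using r(2) by simp
qed

text \<open>
  Radon-Nikodym with respect to \<open>M + N\<close>. The set where the density is nonnegative is a Hahn
  set, and the partition into this set and its complement bounds the \<open>L\<^sup>1\<close> norm of the
  density by the total variation.
\<close>

lemma signed_density:
  assumes M: "finite_borel_measure_\<Omega> M" and N: "finite_borel_measure_\<Omega> N"
  obtains S h where "finite_borel_measure_\<Omega> S" "integrable S h"
    "\<And>f B. f \<in> borel_measurable borel \<Longrightarrow> (\<And>t. t \<in> \<Omega> \<Longrightarrow> \<bar>f t\<bar> \<le> B) \<Longrightarrow>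
      (LINT t|M. f t) - (LINT t|N. f t) = (LINT t|S. h t * f t)"
    "(LINT t|S. \<bar>h t\<bar>) \<le> tv_norm (M, N)"
proof -
  define S where "S = mcomb 1 M 1 N"
  have S: "finite_borel_measure_\<Omega> S" unfolding S_def by (rule mcomb(1)) (use M N in auto)
  interpret S: finite_measure S using finite_borel_measure_\<Omega>D[OF S] by simp
  have em: "emeasure S A = emeasure M A + emeasure N A" if "A \<in> sets borel_\<Omega>" for A
    unfolding S_def by (subst mcomb(2)) (use M N that in auto)
  note ss = finite_borel_measure_\<Omega>D(2)[OF S] finite_borel_measure_\<Omega>D(2)[OF M] finite_borel_measure_\<Omega>D(2)[OF N]
  have dens: "\<exists>f. f \<in> borel_measurable S \<and> (\<forall>x. 0 \<le> f x) \<and> density S (\<lambda>x. ennreal (f x)) = K"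
    if K: "finite_borel_measure_\<Omega> K" and le: "\<And>A. A \<in> sets borel_\<Omega> \<Longrightarrow> emeasure K A \<le> emeasure S A" for K
  proof -
    have sK: "sets K = sets S" using ss finite_borel_measure_\<Omega>D(2)[OF K] by simp
    have ac: "absolutely_continuous S K" unfolding absolutely_continuous_def
    proof
      fix A assume "A \<in> null_sets S"
      then show "A \<in> null_sets K" using le[of A] ss sK by (auto simp: null_sets_def)
    qed
    obtain D where D: "D \<in> borel_measurable S" "AE x in S. RN_deriv S K x = ennreal (D x)" "\<And>x. 0 \<le> D x"
      by (rule S.real_RN_deriv[OF finite_borel_measure_\<Omega>D(1)[OF K] ac sK]) (blast intro: that)
    have "density S (\<lambda>x. ennreal (D x)) = density S (RN_deriv S K)"
      by (rule density_cong) (use D in auto)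
    also have "\<dots> = K" by (rule S.density_RN_deriv[OF ac sK])
    finally show ?thesis using D by auto
  qed
  obtain f where f: "f \<in> borel_measurable S" "\<And>x. 0 \<le> f x" "density S (\<lambda>x. ennreal (f x)) = M"
    using dens[OF M] em by auto
  obtain g where g: "g \<in> borel_measurable S" "\<And>x. 0 \<le> g x" "density S (\<lambda>x. ennreal (g x)) = N"
    using dens[OF N] em by auto
  have rep: "integrable S (\<lambda>x. f x * k x)" "integrable S (\<lambda>x. g x * k x)"
    "(LINT t|M. k t) = (LINT t|S. f t * k t)" "(LINT t|N. k t) = (LINT t|S. g t * k t)"
    if k: "k \<in> borel_measurable borel" "\<And>t. t \<in> \<Omega> \<Longrightarrow> \<bar>k t\<bar> \<le> B" for k B
  proof -
    have kS: "k \<in> borel_measurable S" by (rule borel_\<Omega>_measurable[OF S k(1)])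
    have "integrable M k" "integrable N k" using finite_borel_integrable[OF M k] finite_borel_integrable[OF N k] by auto
    then show "integrable S (\<lambda>x. f x * k x)" "integrable S (\<lambda>x. g x * k x)"
      using f g kS integrable_real_density[of f S k] integrable_real_density[of g S k] by auto
    show "(LINT t|M. k t) = (LINT t|S. f t * k t)" "(LINT t|N. k t) = (LINT t|S. g t * k t)"
      using f g kS integral_real_density[of f S k] integral_real_density[of g S k] by auto
  qed
  define h where "h x = f x - g x" for x
  have hi: "integrable S h" using rep(1,2)[of "\<lambda>_. 1" 1] by (auto simp: h_def[abs_def])
  have pair: "(LINT t|M. k t) - (LINT t|N. k t) = (LINT t|S. h t * k t)"
    if k: "k \<in> borel_measurable borel" "\<And>t. t \<in> \<Omega> \<Longrightarrow> \<bar>k t\<bar> \<le> B" for k B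
    using rep[OF k] by (simp add: h_def left_diff_distrib)
  define Y where "Y = {x \<in> space S. 0 \<le> h x}"
  have Y: "Y \<in> sets borel_\<Omega>" using hi unfolding Y_def ss(1)[symmetric] by measurable
  have Yb: "Y \<in> sets borel" "Y \<subseteq> \<Omega>" using Y by (auto simp: borel_\<Omega>_sets_iff)
  have meas: "measure M A - measure N A = (LINT t|S. h t * indicator A t)" if A: "A \<in> sets borel_\<Omega>" for A
  proof -
    have "A \<in> sets borel" "A \<inter> \<Omega> = A" using A by (auto simp: borel_\<Omega>_sets_iff)
    then show ?thesis using pair[of "indicator A" 1] finite_borel_measure_\<Omega>D(3)[OF M] finite_borel_measure_\<Omega>D(3)[OF N]
      by (simp add: indicator_def[of A, abs_def] if_distrib[of abs] cong: if_cong) (simp add: indicator_def[of A, abs_def, symmetric])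
  qed
  have Y2: "\<Omega> - Y \<in> sets borel_\<Omega>" using Yb by (auto simp: borel_\<Omega>_sets_iff)
  have indi: "integrable S (\<lambda>t. h t * indicator A t)" if "A \<in> sets borel_\<Omega>" for A
    using integrable_mult_indicator[of A S h] hi that ss by (simp add: mult.commute)
  have "(LINT t|S. \<bar>h t\<bar>) = (LINT t|S. h t * indicator Y t - h t * indicator (\<Omega> - Y) t)"
    by (rule Bochner_Integration.integral_cong)
       (use finite_borel_measure_\<Omega>D(3)[OF S] in \<open>auto simp: Y_def indicator_def\<close>)
  also have "\<dots> = (measure M Y - measure N Y) - (measure M (\<Omega> - Y) - measure N (\<Omega> - Y))"
    using indi[OF Y] indi[OF Y2] by (simp add: meas[OF Y] meas[OF Y2])
  also have "\<dots> \<le> tv_norm (M, N)" using tv_norm_two_sets[OF M N Y] by linarith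
  finally show ?thesis using that[OF S hi] pair by blast
qed

text \<open>
  The equality case of \<open>\<integral> \<Phi> d\<mu> \<le> \<alpha> |\<mu>|\<close>. In terms of the
  density \<open>h\<close> the function \<open>\<alpha> * |h| - h * \<Phi>\<close> is nonnegative with
  integral at most zero, so it vanishes almost everywhere, and this forces \<open>h = 0\<close> wherever
  \<open>|\<Phi>| < \<alpha>\<close>.
\<close>

lemma concentration:
  assumes M: "finite_borel_measure_\<Omega> M" and N: "finite_borel_measure_\<Omega> N"
    and \<Phi>: "\<Phi> \<in> borel_measurable borel" "\<And>t. t \<in> \<Omega> \<Longrightarrow> \<bar>\<Phi> t\<bar> \<le> \<alpha>" and \<alpha>: "0 \<le> \<alpha>"
    and ext: "\<alpha> * tv_norm (M, N) \<le> (LINT t|M. \<Phi> t) - (LINT t|N. \<Phi> t)"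
    and A: "A \<in> sets borel_\<Omega>" "\<And>t. t \<in> A \<Longrightarrow> \<bar>\<Phi> t\<bar> \<noteq> \<alpha>"
  shows "measure M A = measure N A"
proof -
  obtain S h where S: "finite_borel_measure_\<Omega> S" and h: "integrable S h"
    and pair: "\<And>f B. f \<in> borel_measurable borel \<Longrightarrow> (\<And>t. t \<in> \<Omega> \<Longrightarrow> \<bar>f t\<bar> \<le> B) \<Longrightarrow>
      (LINT t|M. f t) - (LINT t|N. f t) = (LINT t|S. h t * f t)"
    and tv: "(LINT t|S. \<bar>h t\<bar>) \<le> tv_norm (M, N)" using signed_density[OF M N] by blast
  have sp: "space S = \<Omega>" "space M = \<Omega>" "space N = \<Omega>" using finite_borel_measure_\<Omega>D(3) S M N by auto
  have [measurable]: "\<Phi> \<in> borel_measurable S" "h \<in> borel_measurable S" using borel_\<Omega>_measurable[OF S \<Phi>(1)] h by auto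
  have hP: "integrable S (\<lambda>t. h t * \<Phi> t)"
  proof (rule Bochner_Integration.integrable_bound)
    show "integrable S (\<lambda>t. \<alpha> * h t)" using h by simp
    show "AE t in S. norm (h t * \<Phi> t) \<le> norm (\<alpha> * h t)"
      using \<Phi>(2) sp \<alpha> by (intro AE_I2) (auto simp: abs_mult mult.commute intro!: mult_right_mono)
  qed measurable
  have nn: "0 \<le> \<alpha> * \<bar>h t\<bar> - h t * \<Phi> t" if "t \<in> \<Omega>" for t
  proof -
    have "h t * \<Phi> t \<le> \<bar>h t\<bar> * \<bar>\<Phi> t\<bar>" by (metis abs_ge_self abs_mult)
    also have "\<dots> \<le> \<bar>h t\<bar> * \<alpha>" using \<Phi>(2)[OF that] by (intro mult_left_mono) auto
    finally show ?thesis by (simp add: mult.commute)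
  qed
  have "(LINT t|S. \<alpha> * \<bar>h t\<bar> - h t * \<Phi> t) = \<alpha> * (LINT t|S. \<bar>h t\<bar>) - (LINT t|S. h t * \<Phi> t)"
    using h hP by simp
  also have "\<dots> \<le> 0" using ext pair[OF \<Phi>] mult_left_mono[OF tv \<alpha>] by linarith
  finally have "(LINT t|S. \<alpha> * \<bar>h t\<bar> - h t * \<Phi> t) = 0"
    using nn sp by (intro antisym integral_nonneg_AE AE_I2) auto
  then have ae: "AE t in S. \<alpha> * \<bar>h t\<bar> - h t * \<Phi> t = 0"
    using h hP nn sp by (subst (asm) integral_nonneg_eq_0_iff_AE) auto
  have "AE t in S. h t * indicator A t = 0"
    using ae AE_space
  proof eventually_elim
    fix t assume t: "\<alpha> * \<bar>h t\<bar> - h t * \<Phi> t = 0" "t \<in> space S"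
    show "h t * indicator A t = 0"
    proof (rule ccontr)
      assume "h t * indicator A t \<noteq> 0"
      then have "h t \<noteq> 0" "t \<in> A" by (auto simp: indicator_def split: if_splits)
      then have "\<bar>\<Phi> t\<bar> < \<alpha>" using A(2) \<Phi>(2)[of t] t(2) sp by force
      then have "\<bar>h t\<bar> * \<bar>\<Phi> t\<bar> < \<bar>h t\<bar> * \<alpha>" using \<open>h t \<noteq> 0\<close> by simp
      moreover have "h t * \<Phi> t \<le> \<bar>h t\<bar> * \<bar>\<Phi> t\<bar>" by (metis abs_ge_self abs_mult)
      ultimately show False using t(1) by (simp add: mult.commute)
    qed
  qed
  then have "(LINT t|S. h t * indicator A t) = 0" by (rule integral_eq_zero_AE)
  moreover have "A \<in> sets borel" "A \<inter> \<Omega> = A" using A by (auto simp: borel_\<Omega>_sets_iff)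
  ultimately show ?thesis using pair[of "indicator A" 1] sp by (simp add: indicator_le_1)
qed

lemma concentrated_imp_step:
  assumes M: "finite_borel_measure_\<Omega> M" and N: "finite_borel_measure_\<Omega> N"
    and \<xi>: "inj_on \<xi> {1..m}" "\<xi> ` {1..m} \<subseteq> \<Omega>"
    and conc: "\<And>A. A \<in> sets borel_\<Omega> \<Longrightarrow> A \<inter> \<xi> ` {1..m} = {} \<Longrightarrow> measure M A = measure N A"
    and t: "t \<in> \<Omega>"
  shows "c + mcdf M t - mcdf N t = step_fun m c (\<lambda>i. measure M {\<xi> i} - measure N {\<xi> i}) \<xi> t"
proof -
  have split: "mcdf K t = measure K ({..<t} \<inter> \<Omega> - \<xi> ` {1..m}) + (\<Sum>i=1..m. measure K {\<xi> i} * indicator {\<xi> i<..<1} t)"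
    if K: "finite_borel_measure_\<Omega> K" for K
  proof -
    interpret K: finite_measure K using finite_borel_measure_\<Omega>D[OF K] by simp
    note sK = finite_borel_measure_\<Omega>D(2)[OF K]
    define I where "I = {i \<in> {1..m}. \<xi> i < t}"
    have fb: "finite (\<xi> ` {1..m})" by simp
    have "measure K ({..<t} \<inter> \<Omega>) = measure K (({..<t} \<inter> \<Omega> - \<xi> ` {1..m}) \<union> \<xi> ` I)"
      using \<xi>(2) by (intro arg_cong[where f="measure K"]) (auto simp: I_def)
    also have "\<dots> = measure K ({..<t} \<inter> \<Omega> - \<xi> ` {1..m}) + measure K (\<xi> ` I)"
    proof (rule K.finite_measure_Union)
      have "\<xi> ` {1..m} \<in> sets borel" "\<xi> ` I \<in> sets borel"
        by (intro borel_closed finite_imp_closed; simp add: I_def)+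
      then show "{..<t} \<inter> \<Omega> - \<xi> ` {1..m} \<in> sets K" "\<xi> ` I \<in> sets K" unfolding sK borel_\<Omega>_sets_iff
        using \<xi>(2) by (auto simp: I_def image_subset_iff)
    qed (auto simp: I_def)
    also have "measure K (\<xi> ` I) = (\<Sum>x\<in>\<xi> ` I. measure K {x})"
    proof (rule K.finite_measure_eq_sum_singleton)
      show "finite (\<xi> ` I)" by (simp add: I_def)
      fix x assume "x \<in> \<xi> ` I"
      then have "x \<in> \<Omega>" using \<xi>(2) unfolding I_def by blast
      then show "{x} \<in> sets K" unfolding sK borel_\<Omega>_sets_iff by simp
    qed
    also have "\<dots> = (\<Sum>i\<in>I. measure K {\<xi> i})"
    proof -
      have "inj_on \<xi> I" by (rule inj_on_subset[OF \<xi>(1)]) (auto simp: I_def)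
      then show ?thesis by (simp add: sum.reindex)
    qed
    also have "\<dots> = (\<Sum>i=1..m. measure K {\<xi> i} * indicator {\<xi> i<..<1} t)"
    proof -
      have "(\<Sum>i\<in>I. measure K {\<xi> i}) = (\<Sum>i=1..m. if \<xi> i < t then measure K {\<xi> i} else 0)"
        unfolding I_def by (rule sum.inter_filter) simp
      also have "\<dots> = (\<Sum>i=1..m. measure K {\<xi> i} * indicator {\<xi> i<..<1} t)"
        by (rule sum.cong) (use t in auto)
      finally show ?thesis .
    qed
    finally show ?thesis by (simp add: mcdf_def)
  qed
  have "measure M ({..<t} \<inter> \<Omega> - \<xi> ` {1..m}) = measure N ({..<t} \<inter> \<Omega> - \<xi> ` {1..m})"
  proof (rule conc)
    have "\<xi> ` {1..m} \<in> sets borel" by (intro borel_closed finite_imp_closed) simp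
    then show "{..<t} \<inter> \<Omega> - \<xi> ` {1..m} \<in> sets borel_\<Omega>" unfolding borel_\<Omega>_sets_iff by auto
  qed auto
  then show ?thesis unfolding split[OF M] split[OF N] step_fun_def
    by (simp add: sum_subtractf left_diff_distrib)
qed

section \<open>The elliptic equation\<close>

lemma prim_mono_bound:
  assumes f: "integrable leb_\<Omega> f" and g: "integrable leb_\<Omega> g" and fg: "AE s in leb_\<Omega>. \<bar>f s\<bar> \<le> g s"
  shows "\<bar>prim f t\<bar> \<le> prim g t"
proof -
  have "\<bar>prim f t\<bar> \<le> (LINT s|leb_\<Omega>. \<bar>indicator {..<t} s * f s\<bar>)"
    unfolding prim_def by (rule integral_abs_bound)
  also have "\<dots> \<le> prim g t" unfolding prim_def
  proof (rule integral_mono_AE)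
    show "AE s in leb_\<Omega>. \<bar>indicator {..<t} s * f s\<bar> \<le> indicator {..<t} s * g s"
      using fg by eventually_elim (auto simp: indicator_def)
    show "integrable leb_\<Omega> (\<lambda>s. \<bar>indicator {..<t} s * f s\<bar>)" by (rule integrable_abs) (use f in auto)
  qed (use g in auto)
  finally show ?thesis .
qed

lemma integral_zero_imp_AE_zero:
  assumes "in_L2 g" "(LINT t|leb_\<Omega>. (g t)\<^sup>2) = 0" shows "AE t in leb_\<Omega>. g t = 0"
  using assms by (subst (asm) integral_nonneg_eq_0_iff_AE) (auto simp: in_L2_def)

lemma prim_AE_zero: "AE t in leb_\<Omega>. g t = 0 \<Longrightarrow> prim g t = 0"
  unfolding prim_def by (rule integral_eq_zero_AE) (auto elim: eventually_mono)

text \<open>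
  The derivatives of the elements of \<^const>\<open>H10\<close>.
\<close>

definition H :: "(real \<Rightarrow> real) set" where
  "H = {g. in_L2 g \<and> prim g 1 = 0}"

lemma H_D: "g \<in> H \<Longrightarrow> in_L2 g" "g \<in> H \<Longrightarrow> prim g 1 = 0" "g \<in> H \<Longrightarrow> integrable leb_\<Omega> g"
  "g \<in> H \<Longrightarrow> (LINT t|leb_\<Omega>. g t) = 0" "g \<in> H \<Longrightarrow> g \<in> borel_measurable leb_\<Omega>"
  by (auto simp: H_def prim_1[symmetric])

lemma H_comb: "g \<in> H \<Longrightarrow> k \<in> H \<Longrightarrow> (\<lambda>t. r * g t + s * k t) \<in> H"
  unfolding H_def mem_Collect_eq
  by (subst prim_add) (auto simp: prim_cmult)

lemma H_diff: "g \<in> H \<Longrightarrow> k \<in> H \<Longrightarrow> (\<lambda>t. g t - k t) \<in> H"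
  using H_comb[of g k 1 "-1"] by simp

text \<open>
  The constants are kept as parameters because every estimate has to be uniform in the mesh and in the
  right-hand side.
\<close>

locale elliptic =
  fixes a d :: "real \<Rightarrow> real" and L A \<nu> D :: real
  assumes a_lipschitz: "L-lipschitz_on {0..1} a"
    and \<nu>: "0 < \<nu>"
    and a_lower: "\<And>t. t \<in> {0..1} \<Longrightarrow> \<nu> \<le> a t"
    and a_upper: "\<And>t. t \<in> {0..1} \<Longrightarrow> a t \<le> A"
    and d_measurable: "d \<in> borel_measurable leb_\<Omega>"
    and d_nonneg: "AE t in leb_\<Omega>. 0 \<le> d t"
    and d_upper: "AE t in leb_\<Omega>. d t \<le> D"
begin

lemma a_cont: "continuous_on {0..1} a"
  using a_lipschitz by (rule lipschitz_on_continuous_on)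

lemma a_diff: "s \<in> {0..1} \<Longrightarrow> t \<in> {0..1} \<Longrightarrow> \<bar>a s - a t\<bar> \<le> L * \<bar>s - t\<bar>"
  using lipschitz_onD[OF a_lipschitz] by (simp add: dist_real_def)

lemma L0: "0 \<le> L" using lipschitz_on_nonneg[OF a_lipschitz] .

lemma a_pos: "t \<in> {0..1} \<Longrightarrow> 0 < a t" using a_lower[of t] \<nu> by linarith

lemma A_pos: "0 < A" using a_pos[of 0] a_upper[of 0] by simp

lemma D0: "0 \<le> D"
proof -
  have "AE t in leb_\<Omega>. 0 \<le> D" using d_nonneg d_upper by eventually_elim auto
  then show ?thesis by (simp add: leb.AE_const)
qed

lemma d_abs: "AE t in leb_\<Omega>. \<bar>d t\<bar> \<le> D" using d_nonneg d_upper by eventually_elim auto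

lemma a_bounded: "ess_bounded a" by (rule ess_bounded_cont[OF a_cont])

lemma d_bounded: "ess_bounded d" using d_measurable d_abs by (rule ess_bounded_AE_I)

lemma inv_a_cont: "continuous_on {0..1} (\<lambda>t. 1 / a t)"
  using a_cont a_pos by (intro continuous_intros) (auto simp: less_le)

text \<open>
  The bilinear form of the problem in terms of the derivatives of its arguments.
\<close>

definition form :: "(real \<Rightarrow> real) \<Rightarrow> (real \<Rightarrow> real) \<Rightarrow> real" where
  "form g k = (LINT t|leb_\<Omega>. a t * (g t * k t)) + (LINT t|leb_\<Omega>. d t * (prim g t * prim k t))"

lemma form_int:
  assumes "in_L2 g" "in_L2 k"
  shows "integrable leb_\<Omega> (\<lambda>t. a t * (g t * k t))" "integrable leb_\<Omega> (\<lambda>t. d t * (prim g t * prim k t))"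
proof -
  show "integrable leb_\<Omega> (\<lambda>t. a t * (g t * k t))"
    by (rule ess_bounded_mult_integrable[OF a_bounded in_L2_mult_integrable[OF assms]])
  show "integrable leb_\<Omega> (\<lambda>t. d t * (prim g t * prim k t))"
    by (intro ess_bounded_integrable ess_bounded_mult d_bounded ess_bounded_prim in_L2_integrable assms)
qed

lemma form_commute: "form g k = form k g" by (simp add: form_def ac_simps)

lemma form_comb:
  assumes "g \<in> H" "g' \<in> H" "k \<in> H"
  shows "form (\<lambda>t. r * g t + s * g' t) k = r * form g k + s * form g' k"
proof -
  note l = H_D(1)[OF assms(1)] H_D(1)[OF assms(2)] H_D(1)[OF assms(3)]
  have "prim (\<lambda>t. r * g t + s * g' t) t = r * prim g t + s * prim g' t" for t
    using l by (simp add: prim_add prim_cmult in_L2_integrable)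
  then have "form (\<lambda>t. r * g t + s * g' t) k =
      (LINT t|leb_\<Omega>. r * (a t * (g t * k t)) + s * (a t * (g' t * k t)))
    + (LINT t|leb_\<Omega>. r * (d t * (prim g t * prim k t)) + s * (d t * (prim g' t * prim k t)))"
    by (simp add: form_def algebra_simps)
  then show ?thesis
    using form_int[OF l(1,3)] form_int[OF l(2,3)] by (simp add: form_def algebra_simps)
qed

lemma form_diff:
  "g \<in> H \<Longrightarrow> g' \<in> H \<Longrightarrow> k \<in> H \<Longrightarrow> form (\<lambda>t. g t - g' t) k = form g k - form g' k"
  using form_comb[of g g' k 1 "-1"] by simp

lemma coercive:
  assumes g: "g \<in> H" shows "\<nu> * (LINT t|leb_\<Omega>. (g t)\<^sup>2) \<le> form g g"
proof -
  note l = H_D(1)[OF g]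
  have "\<nu> * (LINT t|leb_\<Omega>. (g t)\<^sup>2) = (LINT t|leb_\<Omega>. \<nu> * (g t)\<^sup>2)" by simp
  also have "\<dots> \<le> (LINT t|leb_\<Omega>. a t * (g t * g t))"
    using l form_int(1)[OF l l]
    by (intro integral_mono_AE AE_leb_\<Omega>I) (auto simp: in_L2_def power2_eq_square intro!: mult_right_mono a_lower)
  also have "\<dots> \<le> form g g"
  proof -
    have "0 \<le> (LINT t|leb_\<Omega>. d t * (prim g t * prim g t))"
      by (rule integral_nonneg_AE) (use d_nonneg in eventually_elim, auto)
    then show ?thesis by (simp add: form_def)
  qed
  finally show ?thesis .
qed

text \<open>
  Definiteness only holds up to null sets, as the elements of \<^const>\<open>H\<close> are functions and
  not equivalence classes.
\<close>

lemma form_zero: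
  assumes g: "g \<in> H" and "form g g \<le> 0" shows "AE t in leb_\<Omega>. g t = 0"
proof -
  have "\<nu> * (LINT t|leb_\<Omega>. (g t)\<^sup>2) \<le> 0" using coercive[OF g] assms(2) by linarith
  then have "(LINT t|leb_\<Omega>. (g t)\<^sup>2) = 0"
    using \<nu> by (intro antisym integral_nonneg_AE) (auto simp: mult_le_0_iff)
  then show ?thesis by (rule integral_zero_imp_AE_zero[OF H_D(1)[OF g]])
qed

text \<open>
  The Galerkin equation for right-hand side \<open>f\<close> in the space of primitives of \<open>G\<close>,
  formulated for the derivative \<open>g\<close> of the solution. Both the weak solution and the finite
  element solution are of this form.
\<close>

definition sol :: "(real \<Rightarrow> real) set \<Rightarrow> (real \<Rightarrow> real) \<Rightarrow> (real \<Rightarrow> real) \<Rightarrow> bool" where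
  "sol G f g \<longleftrightarrow> g \<in> G \<and> (\<forall>k\<in>G. form g k = (LINT t|leb_\<Omega>. f t * prim k t))"

text \<open>
  Testing with the solution itself, and bounding the solution uniformly by the \<open>L\<^sup>1\<close> norm
  of its derivative, gives an estimate that only needs the \<open>L\<^sup>1\<close> norm of the right-hand
  side. It holds for all trial spaces alike.
\<close>

lemma energy:
  assumes G: "G \<subseteq> H" and g: "sol G f g" and f: "integrable leb_\<Omega> f"
  shows "(LINT t|leb_\<Omega>. \<bar>g t\<bar>) \<le> (LINT t|leb_\<Omega>. \<bar>f t\<bar>) / \<nu>"
proof -
  have gH: "g \<in> H" using g G by (auto simp: sol_def)
  define X where "X = (LINT t|leb_\<Omega>. \<bar>g t\<bar>)"
  define F where "F = (LINT t|leb_\<Omega>. \<bar>f t\<bar>)"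
  have X0: "0 \<le> X" by (simp add: X_def)
  have F0: "0 \<le> F" by (simp add: F_def)
  have fi: "integrable leb_\<Omega> (\<lambda>t. f t * prim g t)"
    using ess_bounded_mult_integrable[OF ess_bounded_prim[OF H_D(3)[OF gH]] f] by (simp add: mult.commute)
  have "\<nu> * X\<^sup>2 \<le> \<nu> * (LINT t|leb_\<Omega>. (g t)\<^sup>2)"
    unfolding X_def using square_integral_abs_le[OF H_D(1)[OF gH]] \<nu> by simp
  also have "\<dots> \<le> form g g" by (rule coercive[OF gH])
  also have "\<dots> = (LINT t|leb_\<Omega>. f t * prim g t)" using g by (auto simp: sol_def)
  also have "\<dots> \<le> (LINT t|leb_\<Omega>. \<bar>f t\<bar> * X)"
  proof (rule integral_mono_AE[OF fi _ AE_I2])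
    fix t
    have "f t * prim g t \<le> \<bar>f t\<bar> * \<bar>prim g t\<bar>" by (metis abs_ge_self abs_mult)
    also have "\<dots> \<le> \<bar>f t\<bar> * X" unfolding X_def by (intro mult_left_mono prim_bound_integral H_D(3)[OF gH]) auto
    finally show "f t * prim g t \<le> \<bar>f t\<bar> * X" .
  qed (use f in auto)
  also have "\<dots> = F * X" by (simp add: F_def)
  finally have "\<nu> * X * X \<le> F * X" by (simp add: power2_eq_square mult.assoc)
  then have "\<nu> * X \<le> F" using X0 F0 by (cases "X = 0") auto
  then show ?thesis using \<nu> by (simp add: X_def F_def field_simps)
qed

lemma energy_sup:
  assumes G: "G \<subseteq> H" and g: "sol G f g" and f: "integrable leb_\<Omega> f"
  shows "\<bar>prim g t\<bar> \<le> (LINT t|leb_\<Omega>. \<bar>f t\<bar>) / \<nu>"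
proof -
  have "g \<in> H" using g G by (auto simp: sol_def)
  from prim_bound_integral[OF H_D(3)[OF this], of t] energy[OF assms] show ?thesis by linarith
qed

lemma sol_comb:
  assumes GH: "G \<subseteq> H" and G: "\<And>g k r s. g \<in> G \<Longrightarrow> k \<in> G \<Longrightarrow> (\<lambda>t. r * g t + s * k t) \<in> G"
    and 1: "sol G f g" and 2: "sol G f' g'" and f: "integrable leb_\<Omega> f" "integrable leb_\<Omega> f'"
  shows "sol G (\<lambda>t. r * f t + s * f' t) (\<lambda>t. r * g t + s * g' t)"
  unfolding sol_def
proof (intro conjI ballI)
  show "(\<lambda>t. r * g t + s * g' t) \<in> G" using G 1 2 by (auto simp: sol_def)
  fix k assume k: "k \<in> G"
  then have kH: "k \<in> H" "g \<in> H" "g' \<in> H" using GH 1 2 by (auto simp: sol_def)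
  have i: "integrable leb_\<Omega> (\<lambda>t. f t * prim k t)" "integrable leb_\<Omega> (\<lambda>t. f' t * prim k t)"
    using ess_bounded_mult_integrable[OF ess_bounded_prim[OF H_D(3)[OF kH(1)]]] f by (simp_all add: mult.commute)
  have "form (\<lambda>t. r * g t + s * g' t) k = r * (LINT t|leb_\<Omega>. f t * prim k t) + s * (LINT t|leb_\<Omega>. f' t * prim k t)"
    using form_comb[OF kH(2,3,1)] 1 2 k by (auto simp: sol_def)
  also have "\<dots> = (LINT t|leb_\<Omega>. r * (f t * prim k t) + s * (f' t * prim k t))" using i by simp
  finally show "form (\<lambda>t. r * g t + s * g' t) k = (LINT t|leb_\<Omega>. (r * f t + s * f' t) * prim k t)"
    by (simp add: algebra_simps)
qed

lemma sol_unique: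
  assumes GH: "G \<subseteq> H" and G: "\<And>g k r s. g \<in> G \<Longrightarrow> k \<in> G \<Longrightarrow> (\<lambda>t. r * g t + s * k t) \<in> G"
    and 1: "sol G f g" and 2: "sol G f g'" and f: "integrable leb_\<Omega> f"
  shows "AE t in leb_\<Omega>. g t = g' t" "prim g = prim g'"
proof -
  have s: "sol G (\<lambda>t. 1 * f t + (- 1) * f t) (\<lambda>t. 1 * g t + (- 1) * g' t)"
    by (rule sol_comb[OF GH G 1 2 f f])
  then have kH: "(\<lambda>t. 1 * g t + (- 1) * g' t) \<in> H" using GH by (auto simp: sol_def)
  have "form (\<lambda>t. 1 * g t + (- 1) * g' t) (\<lambda>t. 1 * g t + (- 1) * g' t) = 0"
    using s by (auto simp: sol_def)
  then have "AE t in leb_\<Omega>. 1 * g t + (- 1) * g' t = 0" by (intro form_zero[OF kH]) simp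
  then show "AE t in leb_\<Omega>. g t = g' t" by eventually_elim simp
  then show "prim g = prim g'" using 1 GH by (intro prim_cong_AE) (auto simp: sol_def dest: H_D(5))
qed

text \<open>
  The once integrated equation. It avoids second derivatives, and the constant \<open>c\<close> drops out
  against test functions with mean-free derivative.
\<close>

lemma flux_imp_weak:
  assumes g: "in_L2 g" and flux: "AE t in leb_\<Omega>. a t * g t = c + prim (\<lambda>s. d s * prim g s - f s) t"
    and f: "integrable leb_\<Omega> f" and k: "k \<in> H"
  shows "form g k = (LINT t|leb_\<Omega>. f t * prim k t)"
proof -
  define R where "R s = d s * prim g s - f s" for s
  have dg: "ess_bounded (\<lambda>s. d s * prim g s)"
    by (intro ess_bounded_mult d_bounded ess_bounded_prim in_L2_integrable g)
  have R: "integrable leb_\<Omega> R" unfolding R_def[abs_def] using dg f by auto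
  note ki = H_D(3)[OF k]
  have kR: "integrable leb_\<Omega> (\<lambda>t. k t * prim R t)"
    using ess_bounded_mult_integrable[OF ess_bounded_prim[OF R] ki] by (simp add: mult.commute)
  have [measurable]: "a \<in> borel_measurable leb_\<Omega>" "g \<in> borel_measurable leb_\<Omega>" "k \<in> borel_measurable leb_\<Omega>"
    "prim R \<in> borel_measurable leb_\<Omega>"
    using a_bounded g H_D(5)[OF k] ess_bounded_prim[OF R] by (auto intro: ess_bounded_measurable in_L2_measurable)
  have "(LINT t|leb_\<Omega>. a t * (g t * k t)) = (LINT t|leb_\<Omega>. c * k t + k t * prim R t)"
  proof (rule integral_cong_AE)
    show "AE t in leb_\<Omega>. a t * (g t * k t) = c * k t + k t * prim R t"
      using flux unfolding R_def[abs_def, symmetric]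
      by eventually_elim (simp add: mult.assoc[symmetric] distrib_left distrib_right mult.commute)
  qed measurable
  also have "\<dots> = (LINT t|leb_\<Omega>. k t * prim R t)" using H_D(4)[OF k] ki kR by simp
  also have "\<dots> = - (LINT t|leb_\<Omega>. R t * prim k t)"
    using prim_by_parts[OF R ki] H_D(4)[OF k] by simp
  also have "(LINT t|leb_\<Omega>. R t * prim k t) = (LINT t|leb_\<Omega>. d t * (prim g t * prim k t) - f t * prim k t)"
    by (simp add: R_def algebra_simps)
  also have "\<dots> = (LINT t|leb_\<Omega>. d t * (prim g t * prim k t)) - (LINT t|leb_\<Omega>. f t * prim k t)"
    using form_int(2)[OF g H_D(1)[OF k]] ess_bounded_mult_integrable[OF ess_bounded_prim[OF ki] f]
    by (intro Bochner_Integration.integral_diff) (auto simp: mult.commute)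
  finally show ?thesis by (simp add: form_def)
qed

section \<open>Existence for the initial value problem\<close>

text \<open>
  Solving the once integrated equation for the derivative and integrating again leads to \<open>u = y +
  volterra u\<close>.
\<close>

definition volterra :: "(real \<Rightarrow> real) \<Rightarrow> real \<Rightarrow> real" where
  "volterra u = prim (\<lambda>s. prim (\<lambda>r. d r * u r) s / a s)"

lemma volterra_inner:
  assumes "continuous_on {0..1} u"
  shows "continuous_on {0..1} (\<lambda>s. prim (\<lambda>r. d r * u r) s / a s)"
proof -
  have "integrable leb_\<Omega> (\<lambda>r. d r * u r)"
    by (intro ess_bounded_integrable ess_bounded_mult d_bounded ess_bounded_cont assms)
  then show ?thesis using continuous_prim a_cont a_pos by (intro continuous_intros) (auto simp: less_le)
qed

lemma volterra_cont: "continuous_on {0..1} u \<Longrightarrow> continuous_on {0..1} (volterra u)"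
  unfolding volterra_def
  by (intro continuous_prim ess_bounded_integrable ess_bounded_cont volterra_inner)

text \<open>
  Each application gains a factor \<open>t / (n + 1)\<close>, whence the Neumann series converges without
  any smallness of the coefficients.
\<close>

lemma volterra_bound:
  assumes u: "continuous_on {0..1} u" and bnd: "\<And>t. t \<in> {0..1} \<Longrightarrow> \<bar>u t\<bar> \<le> B * (t ^ n / fact n)"
    and t: "t \<in> {0..1}" and B: "0 \<le> B"
  shows "\<bar>volterra u t\<bar> \<le> D / \<nu> * B * (t ^ Suc n / fact (Suc n))"
proof -
  have du: "integrable leb_\<Omega> (\<lambda>r. d r * u r)"
    by (intro ess_bounded_integrable ess_bounded_mult d_bounded ess_bounded_cont u)
  have inner: "\<bar>prim (\<lambda>r. d r * u r) s\<bar> \<le> D * (B * (s ^ n / fact n))" if s: "s \<in> {0..1}" for s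
  proof -
    have "\<bar>prim (\<lambda>r. d r * u r) s\<bar> = \<bar>prim (\<lambda>r. indicator {..<s} r * (d r * u r)) s - prim (\<lambda>r. indicator {..<s} r * (d r * u r)) 0\<bar>"
      by (simp add: prim_0) (simp add: prim_def mult.assoc[symmetric] indicator_inter_arith[symmetric])
    also have "\<dots> \<le> D * (B * (s ^ n / fact n)) * \<bar>s - 0\<bar>"
    proof (rule prim_lipschitz)
      show "integrable leb_\<Omega> (\<lambda>r. indicator {..<s} r * (d r * u r))" using du by auto
      show "AE r in leb_\<Omega>. \<bar>indicator {..<s} r * (d r * u r)\<bar> \<le> D * (B * (s ^ n / fact n))"
        using d_abs AE_space
      proof eventually_elim
        fix r assume r: "\<bar>d r\<bar> \<le> D" "r \<in> space leb_\<Omega>"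
        show "\<bar>indicator {..<s} r * (d r * u r)\<bar> \<le> D * (B * (s ^ n / fact n))"
        proof (cases "r < s")
          case True
          have "\<bar>u r\<bar> \<le> B * (r ^ n / fact n)" using bnd[of r] r(2) by auto
          also have "\<dots> \<le> B * (s ^ n / fact n)"
            using True r(2) B by (intro mult_left_mono divide_right_mono power_mono) auto
          finally have "\<bar>d r\<bar> * \<bar>u r\<bar> \<le> D * (B * (s ^ n / fact n))" using r(1) by (intro mult_mono') auto
          then show ?thesis using True by (simp add: abs_mult)
        qed (use B D0 s in auto)
      qed
    qed (use s in auto)
    also have "\<dots> \<le> D * (B * (s ^ n / fact n)) * 1"
      using s B D0 by (intro mult_left_mono) auto
    finally show ?thesis by simp
  qed
  define F where "F s = D / \<nu> * B * (s ^ n / fact n)" for s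
  have Fc: "continuous_on {0..1} F" unfolding F_def by (intro continuous_intros) auto
  have "\<bar>volterra u t\<bar> \<le> prim F t" unfolding volterra_def
  proof (rule prim_mono_bound)
    show "integrable leb_\<Omega> (\<lambda>s. prim (\<lambda>r. d r * u r) s / a s)"
      by (intro ess_bounded_integrable ess_bounded_cont volterra_inner u)
    show "integrable leb_\<Omega> F" by (intro ess_bounded_integrable ess_bounded_cont Fc)
    show "AE s in leb_\<Omega>. \<bar>prim (\<lambda>r. d r * u r) s / a s\<bar> \<le> F s"
    proof (rule AE_leb_\<Omega>I)
      fix s :: real assume s: "0 < s" "s < 1"
      then have "\<bar>prim (\<lambda>r. d r * u r) s\<bar> \<le> D * (B * (s ^ n / fact n))" "\<nu> \<le> \<bar>a s\<bar>"
        using inner[of s] a_lower[of s] by auto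
      then have "\<bar>prim (\<lambda>r. d r * u r) s\<bar> / \<bar>a s\<bar> \<le> D * (B * (s ^ n / fact n)) / \<nu>"
        using \<nu> by (intro frac_le) auto
      then show "\<bar>prim (\<lambda>r. d r * u r) s / a s\<bar> \<le> F s" by (simp add: F_def ac_simps)
    qed
  qed
  also have "prim F t = D / \<nu> * B * (t ^ Suc n / fact (Suc n)) - D / \<nu> * B * (0 ^ Suc n / fact (Suc n))"
  proof (rule prim_FTC[OF _ _ t])
    show "integrable leb_\<Omega> F" by (intro ess_bounded_integrable ess_bounded_cont Fc)
    fix s :: real
    have "((\<lambda>t. D / \<nu> * B * (t ^ Suc n / fact (Suc n))) has_real_derivative D / \<nu> * B * (real (Suc n) * s ^ n / fact (Suc n))) (at s within {0..1})"
      using \<nu> by (auto intro!: derivative_eq_intros simp del: fact_Suc of_nat_Suc power_Suc)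
    moreover have "real (Suc n) * s ^ n / fact (Suc n) = s ^ n / fact n" by (simp add: fact_Suc del: of_nat_Suc)
    ultimately show "((\<lambda>t. D / \<nu> * B * (t ^ Suc n / fact (Suc n))) has_real_derivative F s) (at s within {0..1})"
      unfolding F_def using \<nu> by simp
  qed
  finally show ?thesis by simp
qed

lemma volterra_diff:
  assumes u: "continuous_on {0..1} u" and v: "continuous_on {0..1} v"
  shows "volterra (\<lambda>t. u t - v t) t = volterra u t - volterra v t"
proof -
  have i: "integrable leb_\<Omega> (\<lambda>r. d r * u r)" "integrable leb_\<Omega> (\<lambda>r. d r * v r)"
    by (intro ess_bounded_integrable ess_bounded_mult d_bounded ess_bounded_cont u v)+
  have "volterra (\<lambda>t. u t - v t) t = prim (\<lambda>s. prim (\<lambda>r. d r * u r) s / a s - prim (\<lambda>r. d r * v r) s / a s) t"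
    unfolding volterra_def right_diff_distrib prim_diff[OF i] diff_divide_distrib ..
  also have "\<dots> = volterra u t - volterra v t" unfolding volterra_def
    by (intro prim_diff ess_bounded_integrable ess_bounded_cont volterra_inner u v)
  finally show ?thesis .
qed

text \<open>
  The Neumann series, summed uniformly by the Weierstrass test.
\<close>

lemma volterra_equation:
  assumes y: "continuous_on {0..1} y"
  obtains u where "continuous_on {0..1} u" "\<And>t. t \<in> {0..1} \<Longrightarrow> u t = y t + volterra u t"
proof -
  define K where "K = D / \<nu>"
  have K0: "0 \<le> K" using D0 \<nu> by (simp add: K_def)
  obtain B where B: "\<And>t. t \<in> {0..1} \<Longrightarrow> \<bar>y t\<bar> \<le> B"
  proof -
    have "\<exists>B. \<forall>t\<in>{0..1}. \<bar>y t\<bar> \<le> B"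
      using compact_imp_bounded[OF compact_continuous_image[OF y]] by (auto simp: bounded_iff)
    then show ?thesis using that by blast
  qed
  have B0: "0 \<le> B" using B[of 0] by auto
  define w where "w n = (volterra ^^ n) y" for n
  have wc: "continuous_on {0..1} (w n)" for n
    by (induction n) (auto simp: w_def y volterra_cont)
  have wb: "\<bar>w n t\<bar> \<le> (K ^ n * B) * (t ^ n / fact n)" if "t \<in> {0..1}" for n t
    using that
  proof (induction n arbitrary: t)
    case 0 then show ?case using B by (simp add: w_def)
  next
    case (Suc n)
    have "\<bar>volterra (w n) t\<bar> \<le> D / \<nu> * (K ^ n * B) * (t ^ Suc n / fact (Suc n))"
      by (rule volterra_bound[OF wc Suc.IH Suc.prems]) (use B0 K0 in auto)
    then show ?case by (simp add: w_def K_def mult.assoc)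
  qed
  define b where "b n = B * (inverse (fact n) * K ^ n)" for n
  have wb': "\<bar>w n t\<bar> \<le> b n" if t: "t \<in> {0..1}" for n t
  proof -
    have "\<bar>w n t\<bar> \<le> (K ^ n * B) * (t ^ n / fact n)" by (rule wb[OF t])
    also have "\<dots> \<le> (K ^ n * B) * (1 / fact n)"
      using t B0 K0 by (intro mult_left_mono divide_right_mono power_le_one) auto
    finally show ?thesis by (simp add: b_def field_simps)
  qed
  have sb: "summable b" unfolding b_def by (intro summable_mult summable_exp)
  define s where "s N t = (\<Sum>i<N. w i t)" for N t
  define u where "u t = (\<Sum>i. w i t)" for t
  have ul: "uniform_limit {0..1} s u sequentially"
    unfolding s_def[abs_def] u_def[abs_def] by (rule Weierstrass_m_test[OF _ sb]) (use wb' in auto)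
  have sc: "continuous_on {0..1} (s N)" for N unfolding s_def by (intro continuous_intros wc)
  have uc: "continuous_on {0..1} u"
    by (rule uniform_limit_theorem[OF _ ul]) (auto intro: always_eventually sc)
  have srec: "s (Suc N) t = y t + volterra (s N) t" if "t \<in> {0..1}" for N t
  proof (induction N)
    case 0 show ?case by (simp add: s_def w_def volterra_def prim_zero prim_def)
  next
    case (Suc N)
    have "volterra (s (Suc N)) t - volterra (s N) t = volterra (\<lambda>t. s (Suc N) t - s N t) t"
      by (rule volterra_diff[symmetric]) (rule sc)+
    also have "(\<lambda>t. s (Suc N) t - s N t) = w N" by (simp add: s_def fun_eq_iff)
    also have "volterra (w N) t = w (Suc N) t" by (simp add: w_def)
    finally show ?case using Suc by (simp add: s_def)
  qed
  show ?thesis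
  proof (rule that[OF uc])
    fix t :: real assume t: "t \<in> {0..1}"
    have l1: "(\<lambda>N. s N t) \<longlonglongrightarrow> u t" by (rule tendsto_uniform_limitI[OF ul t])
    have "(\<lambda>N. volterra (s N) t) \<longlonglongrightarrow> volterra u t"
    proof (rule LIMSEQ_I)
      fix e :: real assume e: "0 < e"
      define e' where "e' = e / (K + 1)"
      have "0 < e'" using e K0 by (simp add: e'_def)
      from uniform_limitD[OF ul this] obtain N0 where N0: "\<And>N x. N \<ge> N0 \<Longrightarrow> x \<in> {0..1} \<Longrightarrow> dist (s N x) (u x) < e'"
        unfolding eventually_sequentially by blast
      have "norm (volterra (s N) t - volterra u t) < e" if "N \<ge> N0" for N
      proof -
        have "\<bar>volterra (\<lambda>t. s N t - u t) t\<bar> \<le> D / \<nu> * e' * (t ^ Suc 0 / fact (Suc 0))"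
          by (rule volterra_bound)
             (use N0[OF that] sc uc t \<open>0 < e'\<close> in \<open>auto intro!: continuous_on_diff less_imp_le simp: dist_real_def\<close>)
        also have "\<dots> \<le> K * e'" using t \<open>0 < e'\<close> K0 by (simp add: K_def[symmetric] mult_left_le)
        also have "\<dots> < e" using e K0 by (simp add: e'_def field_simps)
        finally show ?thesis using volterra_diff[OF sc uc] by simp
      qed
      then show "\<exists>N0. \<forall>N\<ge>N0. norm (volterra (s N) t - volterra u t) < e" by blast
    qed
    then have "(\<lambda>N. s (Suc N) t) \<longlonglongrightarrow> y t + volterra u t" unfolding srec[OF t] by (intro tendsto_intros)
    then show "u t = y t + volterra u t" using LIMSEQ_unique[OF LIMSEQ_Suc[OF l1]] by blast
  qed
qed

lemma initial_value_problem:
  assumes f: "integrable leb_\<Omega> f"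
  obtains g where "continuous_on {0..1} g"
    "\<And>t. t \<in> {0..1} \<Longrightarrow> a t * g t = c + prim (\<lambda>s. d s * prim g s - f s) t"
proof -
  define y' where "y' t = (c - prim f t) / a t" for t
  have y': "continuous_on {0..1} y'" unfolding y'_def
    using continuous_prim[OF f] a_cont a_pos by (intro continuous_intros) (auto simp: less_le)
  have "continuous_on {0..1} (prim y')"
    by (intro continuous_prim ess_bounded_integrable ess_bounded_cont y')
  from volterra_equation[OF this] obtain u where u: "continuous_on {0..1} u"
    "\<And>t. t \<in> {0..1} \<Longrightarrow> u t = prim y' t + volterra u t" by blast
  define g where "g t = y' t + prim (\<lambda>r. d r * u r) t / a t" for t
  have gc: "continuous_on {0..1} g" unfolding g_def by (intro continuous_intros y' volterra_inner u)
  have gu: "prim g t = u t" if "t \<in> {0..1}" for t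
    unfolding g_def u(2)[OF that] volterra_def
    by (intro prim_add ess_bounded_integrable ess_bounded_cont y' volterra_inner u)
  have du: "integrable leb_\<Omega> (\<lambda>r. d r * u r)"
    by (intro ess_bounded_integrable ess_bounded_mult d_bounded ess_bounded_cont u)
  have "prim (\<lambda>s. d s * prim g s - f s) = prim (\<lambda>s. d s * u s - f s)"
    by (rule prim_cong) (simp add: gu)
  then have "prim (\<lambda>s. d s * prim g s - f s) t = prim (\<lambda>r. d r * u r) t - prim f t" for t
    using prim_diff[OF du f] by simp
  moreover have "a t * g t = (c - prim f t) + prim (\<lambda>r. d r * u r) t" if "t \<in> {0..1}" for t
    using a_pos[OF that] by (simp add: g_def y'_def distrib_left)
  ultimately have "a t * g t = c + prim (\<lambda>s. d s * prim g s - f s) t" if "t \<in> {0..1}" for t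
    using that by simp
  then show thesis using that gc by blast
qed

section \<open>The boundary value problem\<close>

lemma inverse_a_integral_pos: "0 < (LINT t|leb_\<Omega>. 1 / a t)"
proof -
  have "(LINT t|leb_\<Omega>. 1 / A) \<le> (LINT t|leb_\<Omega>. 1 / a t)"
    using a_pos a_upper A_pos
    by (intro integral_mono_AE ess_bounded_integrable ess_bounded_cont inv_a_cont ess_bounded_const AE_leb_\<Omega>I divide_left_mono) auto
  then show ?thesis using A_pos leb.prob_space by (simp add: less_le_trans[rotated])
qed

text \<open>
  The shooting method. The solution of the homogeneous equation with unit initial flux cannot vanish at the
  right end point: it would solve the homogeneous boundary value problem and hence be zero, against the unit
  flux.
\<close>

lemma boundary_value_problem:
  assumes f: "integrable leb_\<Omega> f"
  obtains g c where "continuous_on {0..1} g" "prim g 1 = 0"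
    "\<And>t. t \<in> {0..1} \<Longrightarrow> a t * g t = c + prim (\<lambda>s. d s * prim g s - f s) t"
proof -
  obtain g0 where g0: "continuous_on {0..1} g0"
    "\<And>t. t \<in> {0..1} \<Longrightarrow> a t * g0 t = 0 + prim (\<lambda>s. d s * prim g0 s - f s) t"
    using initial_value_problem[OF f, of 0] by blast
  have zi: "integrable leb_\<Omega> (\<lambda>_. 0 :: real)" by simp
  obtain g1 where g1: "continuous_on {0..1} g1"
    "\<And>t. t \<in> {0..1} \<Longrightarrow> a t * g1 t = 1 + prim (\<lambda>s. d s * prim g1 s - 0) t"
    using initial_value_problem[OF zi, of 1] by blast
  note b0 = ess_bounded_cont[OF g0(1)] and b1 = ess_bounded_cont[OF g1(1)]
  have ne: "prim g1 1 \<noteq> 0"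
  proof
    assume z: "prim g1 1 = 0"
    then have H1: "g1 \<in> H" using ess_bounded_in_L2[OF b1] by (simp add: H_def)
    have "form g1 g1 = (LINT t|leb_\<Omega>. 0 * prim g1 t)"
      by (rule flux_imp_weak[OF H_D(1)[OF H1] _ zi H1, of 1]) (rule AE_leb_\<Omega>I, use g1(2) in auto)
    then have ae: "AE t in leb_\<Omega>. g1 t = 0" by (intro form_zero[OF H1]) simp
    then have "prim g1 = (\<lambda>_. 0)" by (intro ext prim_AE_zero)
    then have ne0: "g1 t \<noteq> 0" if "t \<in> {0..1}" for t using g1(2)[OF that] by (auto simp: prim_zero)
    have "AE t in leb_\<Omega>. False" using ae AE_space
    proof eventually_elim
      fix t assume "g1 t = 0" "t \<in> space leb_\<Omega>"
      then show False using ne0[of t] by auto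
    qed
    then show False by simp
  qed
  define c where "c = - prim g0 1 / prim g1 1"
  define g where "g t = g0 t + c * g1 t" for t
  have gc: "continuous_on {0..1} g" unfolding g_def by (intro continuous_intros g0 g1)
  have pg: "prim g t = prim g0 t + c * prim g1 t" for t
    unfolding g_def using b0 b1 by (subst prim_add) (auto simp: prim_cmult)
  have i: "integrable leb_\<Omega> (\<lambda>s. d s * prim g0 s - f s)" "integrable leb_\<Omega> (\<lambda>s. d s * prim g1 s)"
    by (intro Bochner_Integration.integrable_diff f ess_bounded_integrable ess_bounded_mult d_bounded ess_bounded_prim b0 b1)+
  have "a t * g t = c + prim (\<lambda>s. d s * prim g s - f s) t" if "t \<in> {0..1}" for t
  proof -
    have "(\<lambda>s. d s * prim g s - f s) = (\<lambda>s. (d s * prim g0 s - f s) + c * (d s * prim g1 s))"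
      by (simp add: pg algebra_simps)
    then have "prim (\<lambda>s. d s * prim g s - f s) t = prim (\<lambda>s. d s * prim g0 s - f s) t + c * prim (\<lambda>s. d s * prim g1 s) t"
      using i by (simp add: prim_add prim_cmult)
    moreover have "a t * g t = a t * g0 t + c * (a t * g1 t)" by (simp add: g_def algebra_simps)
    ultimately show ?thesis using g0(2)[OF that] g1(2)[OF that] by (simp add: algebra_simps)
  qed
  moreover have "prim g 1 = 0" using ne by (simp add: pg c_def)
  ultimately show thesis using that gc by blast
qed

text \<open>
  Explicit constants in the regularity estimates for the derivative of the solution: \<open>C1\<close>
  bounds it uniformly in terms of the \<open>L\<^sup>1\<close> norm of the data, \<open>C2\<close> is its
  Lipschitz constant for data bounded by one.
\<close>

definition C1 :: real where "C1 = 2 / \<nu> * (D / \<nu> + 1)"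
definition C2 :: real where "C2 = ((D / \<nu> + 1) + L * C1) / \<nu>"

lemma C1_pos: "0 < C1" and C2_pos: "0 < C2"
proof -
  have 1: "0 < D / \<nu> + 1" using \<nu> D0 by (simp add: add_nonneg_pos)
  then show C1: "0 < C1" unfolding C1_def using \<nu> by (intro mult_pos_pos divide_pos_pos) auto
  have "0 \<le> L * C1" using L0 C1 by simp
  then have "0 < (D / \<nu> + 1) + L * C1" using 1 by linarith
  then show "0 < C2" unfolding C2_def using \<nu> by (rule divide_pos_pos)
qed

text \<open>
  The flux \<open>a * g\<close> is a constant \<open>c\<close> plus the primitive of a bounded function
  \<open>R\<close>. The constant is controlled through the condition that \<open>g\<close> has mean zero,
  and the Lipschitz bound passes from the flux to \<open>g\<close> because \<open>a\<close> is Lipschitz and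
  bounded below.
\<close>

lemma sol_H_regular:
  assumes f: "ess_bounded f"
  obtains g where "sol H f g" "continuous_on {0..1} g"
    "\<And>t. t \<in> {0..1} \<Longrightarrow> \<bar>g t\<bar> \<le> C1 * (LINT t|leb_\<Omega>. \<bar>f t\<bar>)"
    "\<And>s t F. AE t in leb_\<Omega>. \<bar>f t\<bar> \<le> F \<Longrightarrow> s \<in> {0..1} \<Longrightarrow> t \<in> {0..1} \<Longrightarrow> \<bar>g s - g t\<bar> \<le> C2 * F * \<bar>s - t\<bar>"
proof -
  note fi = ess_bounded_integrable[OF f]
  obtain g c where g: "continuous_on {0..1} g" "prim g 1 = 0"
    "\<And>t. t \<in> {0..1} \<Longrightarrow> a t * g t = c + prim (\<lambda>s. d s * prim g s - f s) t"
    using boundary_value_problem[OF fi] by blast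
  have gH: "g \<in> H" using g ess_bounded_in_L2[OF ess_bounded_cont[OF g(1)]] by (simp add: H_def)
  have s: "sol H f g" unfolding sol_def
    using gH flux_imp_weak[OF H_D(1)[OF gH] AE_leb_\<Omega>I fi, of c] g(3) by auto
  define F1 where "F1 = (LINT t|leb_\<Omega>. \<bar>f t\<bar>)"
  have F10: "0 \<le> F1" by (simp add: F1_def)
  have sup: "\<bar>prim g t\<bar> \<le> F1 / \<nu>" for t unfolding F1_def by (rule energy_sup[OF subset_refl s fi])
  define R where "R t = d t * prim g t - f t" for t
  have Rb: "ess_bounded R" unfolding R_def
    by (intro ess_bounded_diff ess_bounded_mult d_bounded ess_bounded_prim H_D(3)[OF gH] f)
  note Ri = ess_bounded_integrable[OF Rb]
  have Rae: "AE t in leb_\<Omega>. \<bar>R t\<bar> \<le> D * (F1 / \<nu>) + \<bar>f t\<bar>"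
    using d_abs
  proof eventually_elim
    fix t assume "\<bar>d t\<bar> \<le> D"
    then have "\<bar>d t * prim g t\<bar> \<le> D * (F1 / \<nu>)" unfolding abs_mult using sup D0 by (intro mult_mono) auto
    then show "\<bar>R t\<bar> \<le> D * (F1 / \<nu>) + \<bar>f t\<bar>" unfolding R_def by linarith
  qed
  define \<rho> where "\<rho> = (D / \<nu> + 1) * F1"
  have \<rho>: "\<bar>prim R t\<bar> \<le> \<rho>" for t
  proof -
    have "\<bar>prim R t\<bar> \<le> (LINT t|leb_\<Omega>. \<bar>R t\<bar>)" by (rule prim_bound_integral[OF Ri])
    also have "\<dots> \<le> (LINT t|leb_\<Omega>. D * (F1 / \<nu>) + \<bar>f t\<bar>)"
      by (rule integral_mono_AE) (use Ri fi Rae in auto)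
    also have "\<dots> = \<rho>" using fi leb.prob_space by (simp add: F1_def \<rho>_def algebra_simps)
    finally show ?thesis .
  qed
  have flux: "a t * g t = c + prim R t" if "t \<in> {0..1}" for t using g(3)[OF that] by (simp add: R_def[abs_def])
  have cb: "\<bar>c\<bar> \<le> \<rho>"
  proof -
    define J where "J = (LINT t|leb_\<Omega>. 1 / a t)"
    note ia = ess_bounded_cont[OF inv_a_cont]
    have "(LINT t|leb_\<Omega>. g t) = (LINT t|leb_\<Omega>. c * (1 / a t) + prim R t * (1 / a t))"
    proof (rule Bochner_Integration.integral_cong)
      fix t assume "t \<in> space leb_\<Omega>"
      then have "t \<in> {0..1}" by auto
      then show "g t = c * (1 / a t) + prim R t * (1 / a t)" using flux[of t] a_pos[of t] by (simp add: field_simps)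
    qed simp
    also have "\<dots> = c * J + (LINT t|leb_\<Omega>. prim R t * (1 / a t))"
    proof -
      have "ess_bounded (\<lambda>t. c * (1 / a t))" "ess_bounded (\<lambda>t. prim R t * (1 / a t))"
        using ia ess_bounded_prim[OF Ri] by (intro ess_bounded_mult ess_bounded_const; simp)+
      then have "(LINT t|leb_\<Omega>. c * (1 / a t) + prim R t * (1 / a t)) =
          (LINT t|leb_\<Omega>. c * (1 / a t)) + (LINT t|leb_\<Omega>. prim R t * (1 / a t))"
        by (intro Bochner_Integration.integral_add ess_bounded_integrable)
      then show ?thesis unfolding J_def integral_mult_right_zero .
    qed
    finally have "c * J = - (LINT t|leb_\<Omega>. prim R t * (1 / a t))" using H_D(4)[OF gH] by simp
    then have "\<bar>c * J\<bar> = \<bar>LINT t|leb_\<Omega>. prim R t * (1 / a t)\<bar>" by simp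
    also have "\<dots> \<le> (LINT t|leb_\<Omega>. \<bar>prim R t * (1 / a t)\<bar>)" by (rule integral_abs_bound)
    also have "\<dots> \<le> (LINT t|leb_\<Omega>. \<rho> * (1 / a t))"
    proof (rule integral_mono_AE)
      show "integrable leb_\<Omega> (\<lambda>t. \<bar>prim R t * (1 / a t)\<bar>)"
        by (intro ess_bounded_integrable ess_bounded_abs ess_bounded_mult ia ess_bounded_prim Ri)
      show "integrable leb_\<Omega> (\<lambda>t. \<rho> * (1 / a t))"
        by (intro ess_bounded_integrable ess_bounded_mult ia ess_bounded_const)
      show "AE t in leb_\<Omega>. \<bar>prim R t * (1 / a t)\<bar> \<le> \<rho> * (1 / a t)"
      proof (rule AE_leb_\<Omega>I)
        fix t :: real assume "0 < t" "t < 1"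
        then have "0 < a t" using a_pos[of t] by simp
        then show "\<bar>prim R t * (1 / a t)\<bar> \<le> \<rho> * (1 / a t)" using \<rho>[of t] by (simp add: abs_mult divide_right_mono)
      qed
    qed
    also have "\<dots> = \<rho> * J" unfolding J_def by (rule integral_mult_right_zero)
    finally show ?thesis using inverse_a_integral_pos by (simp add: abs_mult J_def)
  qed
  have gb: "\<bar>g t\<bar> \<le> C1 * F1" if t: "t \<in> {0..1}" for t
  proof -
    have "\<nu> * \<bar>g t\<bar> \<le> \<bar>a t * g t\<bar>" unfolding abs_mult using a_lower[OF t] by (intro mult_right_mono) auto
    also have "\<dots> \<le> 2 * \<rho>" using flux[OF t] cb \<rho>[of t] by linarith
    finally show ?thesis using \<nu> by (simp add: C1_def \<rho>_def field_simps)
  qed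
  have gl: "\<bar>g s - g t\<bar> \<le> C2 * F * \<bar>s - t\<bar>" if F: "AE t in leb_\<Omega>. \<bar>f t\<bar> \<le> F" and st: "s \<in> {0..1}" "t \<in> {0..1}" for s t F
  proof -
    have F1F: "F1 \<le> F"
    proof -
      have "F1 \<le> (LINT t|leb_\<Omega>. F)" unfolding F1_def by (rule integral_mono_AE) (use fi F in auto)
      then show ?thesis using leb.prob_space by simp
    qed
    have "AE t in leb_\<Omega>. \<bar>R t\<bar> \<le> D * (F1 / \<nu>) + F" using Rae F by eventually_elim auto
    from prim_lipschitz[OF Ri this st(2,1)]
    have "\<bar>prim R s - prim R t\<bar> \<le> (D * (F1 / \<nu>) + F) * \<bar>s - t\<bar>" .
    also have "\<dots> \<le> (D / \<nu> + 1) * F * \<bar>s - t\<bar>"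
      using F1F D0 \<nu> by (intro mult_right_mono) (auto simp: algebra_simps intro!: divide_right_mono mult_left_mono)
    finally have 1: "\<bar>a s * g s - a t * g t\<bar> \<le> (D / \<nu> + 1) * F * \<bar>s - t\<bar>" using flux st by simp
    have 2: "\<bar>(a s - a t) * g t\<bar> \<le> (L * \<bar>s - t\<bar>) * (C1 * F)"
    proof -
      have "\<bar>g t\<bar> \<le> C1 * F" using gb[OF st(2)] mult_left_mono[OF F1F, of C1] C1_pos by linarith
      then show ?thesis unfolding abs_mult using a_diff[OF st] by (intro mult_mono') auto
    qed
    have "\<nu> * \<bar>g s - g t\<bar> \<le> \<bar>a s * (g s - g t)\<bar>" unfolding abs_mult using a_lower[OF st(1)] by (intro mult_right_mono) auto
    also have "a s * (g s - g t) = (a s * g s - a t * g t) - (a s - a t) * g t" by (simp add: algebra_simps)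
    also have "\<bar>\<dots>\<bar> \<le> (D / \<nu> + 1) * F * \<bar>s - t\<bar> + (L * \<bar>s - t\<bar>) * (C1 * F)" using 1 2 by linarith
    also have "\<dots> = \<nu> * (C2 * F * \<bar>s - t\<bar>)" using \<nu> by (simp add: C2_def field_simps)
    finally show ?thesis using \<nu> by simp
  qed
  show thesis by (rule that[OF s g(1)]) (use gb gl in \<open>auto simp: F1_def\<close>)
qed

end

section \<open>Trial spaces\<close>

context elliptic
begin

text \<open>
  The only place where the weak derivatives in the definition of the bilinear form are unfolded; from here
  on the problem is phrased in terms of \<^const>\<open>prim\<close>.
\<close>

lemma bform_eq_form:
  assumes v: "hrep v g" and w: "hrep w k"
  shows "bform a d v w = form g k"
proof -
  have l: "in_L2 g" "in_L2 k" using v w by (auto simp: hrep_def)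
  note wd = hrep_weak_deriv[OF v] hrep_weak_deriv[OF w]
  have [measurable]: "g \<in> borel_measurable leb_\<Omega>" "k \<in> borel_measurable leb_\<Omega>"
    using l by (auto intro: in_L2_measurable)
  have [measurable]: "weak_deriv v \<in> borel_measurable leb_\<Omega>" "weak_deriv w \<in> borel_measurable leb_\<Omega>"
    using leb_\<Omega>_AE_eq_measurable[OF _ wd(1)] leb_\<Omega>_AE_eq_measurable[OF _ wd(2)] l[THEN in_L2_measurable] by blast+
  have [measurable]: "a \<in> borel_measurable leb_\<Omega>" "d \<in> borel_measurable leb_\<Omega>"
    "v \<in> borel_measurable leb_\<Omega>" "w \<in> borel_measurable leb_\<Omega>"
    "prim g \<in> borel_measurable leb_\<Omega>" "prim k \<in> borel_measurable leb_\<Omega>"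
    using a_bounded d_bounded hrep_ess_bounded[OF v] hrep_ess_bounded[OF w] l
    by (auto intro: ess_bounded_measurable ess_bounded_prim)
  have "L2_inner (\<lambda>t. a t * weak_deriv v t) (weak_deriv w) = (LINT t|leb_\<Omega>. a t * (g t * k t))"
    unfolding L2_inner_def
  proof (rule integral_cong_AE)
    show "AE t in leb_\<Omega>. a t * weak_deriv v t * weak_deriv w t = a t * (g t * k t)"
      using wd by eventually_elim simp
  qed measurable
  moreover have "L2_inner (\<lambda>t. d t * v t) w = (LINT t|leb_\<Omega>. d t * (prim g t * prim k t))"
    unfolding L2_inner_def
  proof (rule integral_cong_AE)
    have "AE t in leb_\<Omega>. v t = prim g t" "AE t in leb_\<Omega>. w t = prim k t" using v w by (auto simp: hrep_def)
    then show "AE t in leb_\<Omega>. d t * v t * w t = d t * (prim g t * prim k t)"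
      by eventually_elim simp
  qed measurable
  ultimately show ?thesis by (simp add: bform_def form_def)
qed

lemma L2_inner_hrep:
  assumes f: "f \<in> borel_measurable leb_\<Omega>" and w: "hrep w k"
  shows "L2_inner f w = (LINT t|leb_\<Omega>. f t * prim k t)"
  unfolding L2_inner_def
proof (rule integral_cong_AE)
  have [measurable]: "w \<in> borel_measurable leb_\<Omega>" "prim k \<in> borel_measurable leb_\<Omega>" "f \<in> borel_measurable leb_\<Omega>"
    using hrep_ess_bounded[OF w] w f by (auto simp: hrep_def intro: ess_bounded_measurable ess_bounded_prim)
  show "(\<lambda>t. f t * w t) \<in> borel_measurable leb_\<Omega>" "(\<lambda>t. f t * prim k t) \<in> borel_measurable leb_\<Omega>" by measurable
  show "AE t in leb_\<Omega>. f t * w t = f t * prim k t" using w unfolding hrep_def by (auto elim: eventually_mono)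
qed

end

text \<open>
  What the optimality conditions need to know about the trial space \<open>W\<close>, with \<open>G\<close>
  the derivatives of its elements. The continuous and the discretized problem are two instances.
\<close>

locale trial_space = elliptic +
  fixes W G :: "(real \<Rightarrow> real) set"
  assumes W_rep: "\<And>w. w \<in> W \<Longrightarrow> \<exists>k\<in>G. hrep w k"
    and G_H: "G \<subseteq> H"
    and G_comb: "\<And>g k r s. g \<in> G \<Longrightarrow> k \<in> G \<Longrightarrow> (\<lambda>t. r * g t + s * k t) \<in> G"
    and solvable: "\<And>f. ess_bounded f \<Longrightarrow> \<exists>u\<in>W. \<exists>g. hrep u g \<and> sol G f g"
begin

lemma sol_H: "sol G f g \<Longrightarrow> g \<in> H" using G_H by (auto simp: sol_def)

lemma hrep_is_state:
  assumes f: "ess_bounded f" and u: "u \<in> W" "hrep u g" "sol G f g"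
  shows "is_state a d W f u"
  unfolding is_state_def
proof (intro conjI ballI u(1))
  fix w assume "w \<in> W"
  then obtain k where k: "k \<in> G" "hrep w k" using W_rep by blast
  then show "bform a d u w = L2_inner f w"
    using bform_eq_form[OF u(2) k(2)] L2_inner_hrep[OF ess_bounded_measurable[OF f] k(2)] u(3) by (simp add: sol_def)
qed

text \<open>
  Any state agrees almost everywhere with the one that \<open>solvable\<close> provides, because the form is
  definite.
\<close>

lemma is_state_sol:
  assumes f: "ess_bounded f" and u: "is_state a d W f u"
  shows "\<exists>g. hrep u g \<and> sol G f g"
proof -
  obtain v g where v: "v \<in> W" "hrep v g" "sol G f g" using solvable[OF f] by blast
  have uW: "u \<in> W" using u by (simp add: is_state_def)
  then obtain g' where g': "g' \<in> G" "hrep u g'" using W_rep by blast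
  obtain k where k: "k \<in> G" "hrep v k" using W_rep v(1) by blast
  have gG: "g \<in> G" using v(3) by (simp add: sol_def)
  have H: "g \<in> H" "g' \<in> H" using G_H gG g' by auto
  have eq: "form g' g'' = form g g''" if "hrep w g''" "w \<in> W" "g'' \<in> G" for w g''
  proof -
    have "form g' g'' = L2_inner f w"
      using u that bform_eq_form[OF g'(2) that(1)] by (simp add: is_state_def)
    also have "\<dots> = form g g''"
      using L2_inner_hrep[OF ess_bounded_measurable[OF f] that(1)] v(3) that(3) by (simp add: sol_def)
    finally show ?thesis .
  qed
  have gH: "(\<lambda>t. g' t - g t) \<in> H" by (rule H_diff[OF H(2,1)])
  have "form (\<lambda>t. g' t - g t) (\<lambda>t. g' t - g t) = form g' (\<lambda>t. g' t - g t) - form g (\<lambda>t. g' t - g t)"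
    by (rule form_diff[OF H(2,1) gH])
  also have "\<dots> = form (\<lambda>t. g' t - g t) g' - form (\<lambda>t. g' t - g t) g"
    using H by (simp add: form_commute[of g' "\<lambda>t. g' t - g t"] form_commute[of g "\<lambda>t. g' t - g t"])
  also have "\<dots> = (form g' g' - form g g') - (form g' g - form g g)"
    using H by (simp add: form_diff)
  also have "\<dots> = 0" using eq[OF g'(2) uW g'(1)] eq[OF v(2,1) gG] by simp
  finally have "AE t in leb_\<Omega>. g' t - g t = 0" by (intro form_zero[OF gH]) simp
  then have "AE t in leb_\<Omega>. g' t = g t" by eventually_elim simp
  then have "prim g' = prim g" by (rule prim_cong_AE[OF H_D(5)[OF H(2)]])
  then have "hrep u g" using g'(2) H_D(1,2)[OF H(1)] by (simp add: hrep_def)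
  then show ?thesis using v(3) by blast
qed

lemma state_sol:
  assumes f: "ess_bounded f" shows "\<exists>g. hrep (state a d W f) g \<and> sol G f g"
proof -
  have "\<exists>u. is_state a d W f u" using solvable[OF f] hrep_is_state[OF f] by blast
  then have "is_state a d W f (state a d W f)" unfolding state_def by (rule someI_ex)
  then show ?thesis by (rule is_state_sol[OF f])
qed

lemma sol_exists: "ess_bounded f \<Longrightarrow> \<exists>g. sol G f g" using solvable by blast

lemma sols_comb:
  "sol G f g \<Longrightarrow> sol G f' g' \<Longrightarrow> ess_bounded f \<Longrightarrow> ess_bounded f' \<Longrightarrow>
    sol G (\<lambda>t. r * f t + s * f' t) (\<lambda>t. r * g t + s * g' t)"
  by (rule sol_comb[OF G_H G_comb]) auto

lemma sols_unique: "sol G f g \<Longrightarrow> sol G f g' \<Longrightarrow> ess_bounded f \<Longrightarrow> prim g = prim g'"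
  by (rule sol_unique(2)[OF G_H G_comb]) auto

lemma state_AE:
  assumes f: "ess_bounded f" and g: "sol G f g" shows "AE t in leb_\<Omega>. state a d W f t = prim g t"
proof -
  obtain g' where g': "hrep (state a d W f) g'" "sol G f g'" using state_sol[OF f] by blast
  then show ?thesis using sols_unique[OF g g'(2) f] by (simp add: hrep_def)
qed

lemma sol_prim_bounded: "sol G f g \<Longrightarrow> ess_bounded (prim g)"
  by (rule ess_bounded_prim[OF H_D(3)[OF sol_H]])

text \<open>
  The form is symmetric, so the adjoint equation is a state equation.
\<close>

lemma adjoint_sol:
  assumes q: "ess_bounded q" and ud: "ess_bounded ud" and z: "adjoint_state a d W ud q z" and g: "sol G q g"
  shows "\<exists>k. hrep z k \<and> sol G (\<lambda>t. prim g t - ud t) k"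
proof (rule is_state_sol)
  have gb: "ess_bounded (prim g)" by (rule sol_prim_bounded[OF g])
  show f: "ess_bounded (\<lambda>t. prim g t - ud t)" using gb ud by auto
  show "is_state a d W (\<lambda>t. prim g t - ud t) z" unfolding is_state_def
  proof (intro conjI ballI)
    show zW: "z \<in> W" using z by (simp add: adjoint_state_def)
    fix w assume w: "w \<in> W"
    obtain k where k: "hrep w k" using W_rep[OF w] by blast
    obtain m where m: "hrep z m" using W_rep[OF zW] by blast
    have "bform a d z w = bform a d w z" by (simp add: bform_eq_form[OF m k] bform_eq_form[OF k m] form_commute)
    also have "\<dots> = L2_inner w (\<lambda>t. state a d W q t - ud t)" using z w by (simp add: adjoint_state_def)
    also have "\<dots> = L2_inner (\<lambda>t. prim g t - ud t) w"
      unfolding L2_inner_def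
    proof (rule integral_cong_AE)
      have s: "ess_bounded (state a d W q)"
        by (rule ess_bounded_AE_cong[OF gb]) (use state_AE[OF q g] in \<open>simp add: eq_commute\<close>)
      have [measurable]: "w \<in> borel_measurable leb_\<Omega>" "state a d W q \<in> borel_measurable leb_\<Omega>"
        "prim g \<in> borel_measurable leb_\<Omega>" "ud \<in> borel_measurable leb_\<Omega>"
        using hrep_ess_bounded[OF k] s gb ud by auto
      show "(\<lambda>t. w t * (state a d W q t - ud t)) \<in> borel_measurable leb_\<Omega>"
        "(\<lambda>t. (prim g t - ud t) * w t) \<in> borel_measurable leb_\<Omega>" by measurable
      show "AE t in leb_\<Omega>. w t * (state a d W q t - ud t) = (prim g t - ud t) * w t"
        using state_AE[OF q g] by eventually_elim simp
    qed
    finally show "bform a d z w = L2_inner (\<lambda>t. prim g t - ud t) w" .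
  qed
qed

end

section \<open>Solvability in \<open>H\<^sub>0\<^sup>1\<close>\<close>

context elliptic
begin

lemma trial_space_H10: "trial_space a d L A \<nu> D H10 H"
proof
  show "\<exists>k\<in>H. hrep w k" if "w \<in> H10" for w
    using H10_imp_hrep[OF that] by (auto simp: hrep_def H_def)
  show "(\<lambda>t. r * g t + s * k t) \<in> H" if "g \<in> H" "k \<in> H" for g k r s by (rule H_comb[OF that])
  fix f :: "real \<Rightarrow> real" assume f: "ess_bounded f"
  obtain g where g: "sol H f g" "continuous_on {0..1} g"
    by (rule sol_H_regular[OF f]) (rule that)
  then have gH: "g \<in> H" by (simp add: sol_def)
  have "prim g \<in> H10" using g(2) H_D(2)[OF gH] by (rule continuous_prim_in_H10)
  moreover have "hrep (prim g) g" using H_D(1,2)[OF gH] by (simp add: hrep_def)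
  ultimately show "\<exists>u\<in>H10. \<exists>g. hrep u g \<and> sol H f g" using g(1) by blast
qed auto

section \<open>Representation of functionals on finite-dimensional spaces\<close>

text \<open>
  Linear functionals on \<^const>\<open>H\<close>. The second clause makes them well defined on classes of
  almost everywhere equal functions, which linearity on functions does not give.
\<close>

definition functional :: "((real \<Rightarrow> real) \<Rightarrow> real) \<Rightarrow> bool" where
  "functional \<theta> \<longleftrightarrow> (\<forall>g\<in>H. \<forall>k\<in>H. \<forall>r s. \<theta> (\<lambda>t. r * g t + s * k t) = r * \<theta> g + s * \<theta> k) \<and>
     (\<forall>g\<in>H. (AE t in leb_\<Omega>. g t = 0) \<longrightarrow> \<theta> g = 0)"

text \<open>
  The Riesz representation property with respect to the energy inner product. On the piecewise constant
  functions it is obtained by induction on the dimension.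
\<close>

definition representable :: "(real \<Rightarrow> real) set \<Rightarrow> bool" where
  "representable U \<longleftrightarrow> (\<forall>\<theta>. functional \<theta> \<longrightarrow> (\<exists>u\<in>U. \<forall>w\<in>U. form u w = \<theta> w))"

lemma functionalD:
  assumes "functional \<theta>" "g \<in> H" "k \<in> H"
  shows "\<theta> (\<lambda>t. r * g t + s * k t) = r * \<theta> g + s * \<theta> k"
  using assms unfolding functional_def by blast

lemma form_AE_zero:
  assumes "AE t in leb_\<Omega>. k t = 0" shows "form g k = 0"
proof -
  have p: "prim k = (\<lambda>_. 0)" by (intro ext prim_AE_zero assms)
  have "(LINT t|leb_\<Omega>. a t * (g t * k t)) = 0"
    by (rule integral_eq_zero_AE) (use assms in eventually_elim, simp)
  then show ?thesis by (simp add: form_def p)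
qed

lemma functional_form: "\<phi> \<in> H \<Longrightarrow> functional (form \<phi>)"
  unfolding functional_def by (simp add: form_commute[of \<phi>] form_comb) (simp add: form_commute[of _ \<phi>] form_AE_zero)

lemma functional_load:
  assumes f: "ess_bounded f" shows "functional (\<lambda>k. LINT t|leb_\<Omega>. f t * prim k t)"
  unfolding functional_def
proof (intro conjI ballI allI impI)
  fix g k r s assume gk: "g \<in> H" "k \<in> H"
  have i: "integrable leb_\<Omega> (\<lambda>t. f t * prim g t)" "integrable leb_\<Omega> (\<lambda>t. f t * prim k t)"
    by (intro ess_bounded_integrable ess_bounded_mult f ess_bounded_prim H_D(3) gk)+
  have "(LINT t|leb_\<Omega>. f t * prim (\<lambda>t. r * g t + s * k t) t) = (LINT t|leb_\<Omega>. r * (f t * prim g t) + s * (f t * prim k t))"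
    using H_D(3)[OF gk(1)] H_D(3)[OF gk(2)] by (simp add: prim_add prim_cmult algebra_simps)
  then show "(LINT t|leb_\<Omega>. f t * prim (\<lambda>t. r * g t + s * k t) t) =
    r * (LINT t|leb_\<Omega>. f t * prim g t) + s * (LINT t|leb_\<Omega>. f t * prim k t)" using i by simp
next
  fix g assume "AE t in leb_\<Omega>. g t = (0::real)"
  then have "prim g = (\<lambda>_. 0)" by (intro ext prim_AE_zero)
  then show "(LINT t|leb_\<Omega>. f t * prim g t) = 0" by simp
qed

text \<open>
  One Gram-Schmidt step: the part \<open>r\<close> of \<open>\<phi>\<close> that is orthogonal to
  \<open>U\<close> spans \<open>U'\<close> together with \<open>U\<close>, and the representatives on the
  two orthogonal parts add up.
\<close>

lemma representable_extend:
  assumes U: "representable U" and sub: "U \<subseteq> U'" "U' \<subseteq> H"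
    and comb: "\<And>g k r s. g \<in> U' \<Longrightarrow> k \<in> U' \<Longrightarrow> (\<lambda>t. r * g t + s * k t) \<in> U'"
    and combU: "\<And>g k r s. g \<in> U \<Longrightarrow> k \<in> U \<Longrightarrow> (\<lambda>t. r * g t + s * k t) \<in> U"
    and \<phi>: "\<phi> \<in> U'" and dec: "\<And>g. g \<in> U' \<Longrightarrow> \<exists>c. (\<lambda>t. g t - c * \<phi> t) \<in> U"
  shows "representable U'"
  unfolding representable_def
proof (intro allI impI)
  fix \<theta> assume l: "functional \<theta>"
  have \<phi>H: "\<phi> \<in> H" using \<phi> sub by auto
  obtain u where u: "u \<in> U" "\<And>w. w \<in> U \<Longrightarrow> form u w = \<theta> w" using U l unfolding representable_def by blast
  obtain p where p: "p \<in> U" "\<And>w. w \<in> U \<Longrightarrow> form p w = form \<phi> w"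
    using U functional_form[OF \<phi>H] unfolding representable_def by blast
  define r where "r t = 1 * \<phi> t + (- 1) * p t" for t
  have pU': "p \<in> U'" "u \<in> U'" using p u sub by auto
  have rU': "r \<in> U'" unfolding r_def using comb[OF \<phi> pU'(1), of 1 "-1"] .
  have H: "r \<in> H" "p \<in> H" "u \<in> H" using rU' pU' sub by auto
  have orth: "form r w = 0" if "w \<in> U" for w
    using p(2)[OF that] form_comb[OF \<phi>H H(2), of w 1 "-1"] that sub unfolding r_def by auto
  have split: "\<exists>c w. w \<in> U \<and> g = (\<lambda>t. c * r t + 1 * w t)" if g: "g \<in> U'" for g
  proof -
    obtain c where c: "(\<lambda>t. g t - c * \<phi> t) \<in> U" using dec[OF g] by blast
    have "(\<lambda>t. 1 * (g t - c * \<phi> t) + c * p t) \<in> U" by (rule combU[OF c p(1)])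
    moreover have "g = (\<lambda>t. c * r t + 1 * (1 * (g t - c * \<phi> t) + c * p t))" by (auto simp: r_def algebra_simps)
    ultimately show ?thesis by (intro exI[of _ c] exI[of _ "\<lambda>t. 1 * (g t - c * \<phi> t) + c * p t"] conjI)
  qed
  \<comment> \<open>A vanishing energy occurs if \<open>\<phi>\<close> lies in \<open>U\<close> up to null sets; then
    \<open>\<theta> r = 0\<close> as well.\<close>
  define b where "b = (if form r r = 0 then 0 else \<theta> r / form r r)"
  have lr: "b * form r r = \<theta> r"
  proof (cases "form r r = 0")
    case True
    then have "AE t in leb_\<Omega>. r t = 0" by (intro form_zero[OF H(1)]) simp
    then show ?thesis using l H(1) True by (simp add: functional_def)
  qed (simp add: b_def)
  define v where "v t = 1 * u t + b * r t" for t
  have vU': "v \<in> U'" unfolding v_def by (rule comb[OF pU'(2) rU'])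
  have ur: "form u r = 0" using orth[OF u(1)] by (simp add: form_commute)
  show "\<exists>u\<in>U'. \<forall>w\<in>U'. form u w = \<theta> w"
  proof (rule bexI[OF _ vU'], rule ballI)
    fix g assume "g \<in> U'"
    then obtain c w where w: "w \<in> U" and g: "g = (\<lambda>t. c * r t + 1 * w t)" using split by blast
    have wH: "w \<in> H" using w sub by auto
    have vr: "form v r = \<theta> r" unfolding v_def using form_comb[OF H(3,1,1), of 1 b] ur lr by simp
    have vw: "form v w = \<theta> w" unfolding v_def using form_comb[OF H(3,1) wH, of 1 b] orth[OF w] u(2)[OF w] by simp
    have "v \<in> H" using vU' sub by auto
    then have "form v g = c * form v r + 1 * form v w"
      unfolding g form_commute[of v] by (rule form_comb[OF H(1) wH])
    also have "\<dots> = \<theta> g" unfolding g functionalD[OF l H(1) wH] vr vw ..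
    finally show "form v g = \<theta> g" .
  qed
qed

end

section \<open>Finite elements\<close>

locale mesh =
  fixes l :: nat and x :: "nat \<Rightarrow> real"
  assumes grid: "grid l x"
begin

lemma x_step: "i < l \<Longrightarrow> x i < x (Suc i)" and x0: "x 0 = 0" and xl: "x l = 1" and l1: "1 < l"
  using grid by (auto simp: grid_def)

lemma x_less: "i < j \<Longrightarrow> j \<le> l \<Longrightarrow> x i < x j"
proof (induction j)
  case (Suc j)
  then show ?case using x_step[of j] by (cases "i = j") auto
qed simp

lemma x_mono: "i \<le> j \<Longrightarrow> j \<le> l \<Longrightarrow> x i \<le> x j"
  using x_less[of i j] by (cases "i = j") auto

lemma x_range: "i \<le> l \<Longrightarrow> 0 \<le> x i" "i \<le> l \<Longrightarrow> x i \<le> 1"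
  using x_mono[of 0 i] x_mono[of i l] x0 xl by auto

lemma element_exists:
  assumes "0 \<le> t" "t < 1" shows "\<exists>i<l. x i \<le> t \<and> t < x (Suc i)"
proof -
  have "\<exists>j. t < x j" by (rule exI[of _ l]) (use assms xl in simp)
  define j where "j = (LEAST j. t < x j)"
  have j: "t < x j" unfolding j_def using \<open>\<exists>j. t < x j\<close> by (rule LeastI_ex)
  have "j \<noteq> 0" using j x0 assms by (cases j) auto
  then obtain i where i: "j = Suc i" using not0_implies_Suc by blast
  have "\<not> t < x i" using not_less_Least[of i "\<lambda>j. t < x j"] i unfolding j_def by simp
  moreover have "i < l"
  proof -
    have "j \<le> l" unfolding j_def using xl assms by (intro Least_le) simp
    then show ?thesis using i by simp
  qed
  ultimately show ?thesis using j i by auto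
qed

lemma element_unique:
  assumes "i < l" "j < l" "x i \<le> t" "t < x (Suc i)" "x j \<le> t" "t < x (Suc j)"
  shows "i = j"
proof (rule ccontr)
  assume "i \<noteq> j"
  then consider "Suc i \<le> j" | "Suc j \<le> i" by linarith
  then show False using assms x_mono[of "Suc i" j] x_mono[of "Suc j" i] by cases auto
qed

lemma element_iff:
  assumes "i < l" "t \<in> {x i<..<x (Suc i)}" "j < l"
  shows "t \<in> {x j..<x (Suc j)} \<longleftrightarrow> j = i"
proof
  assume "t \<in> {x j..<x (Suc j)}"
  with assms show "j = i" by (intro element_unique[of j i t]) simp_all
qed (use assms in simp)

text \<open>
  Only finitely many points are nodes.
\<close>

lemma AE_element: "AE t in leb_\<Omega>. \<exists>i<l. t \<in> {x i<..<x (Suc i)}"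
proof -
  have "AE t in lebesgue. \<forall>i\<in>{..l}. t \<noteq> x i"
    by (subst AE_finite_all) (auto intro!: AE_completion AE_lborel_singleton)
  then have "AE t in leb_\<Omega>. \<forall>i\<in>{..l}. t \<noteq> x i" unfolding AE_leb_\<Omega>_iff by eventually_elim auto
  then show ?thesis using AE_space
  proof eventually_elim
    fix t assume t: "\<forall>i\<in>{..l}. t \<noteq> x i" "t \<in> space leb_\<Omega>"
    then obtain i where i: "i < l" "x i \<le> t" "t < x (Suc i)" using element_exists[of t] by auto
    then have "x i < t" using t(1) by (auto simp: less_le)
    then show "\<exists>i<l. t \<in> {x i<..<x (Suc i)}" using i by auto
  qed
qed

lemma x_diff_le: "i < l \<Longrightarrow> x (Suc i) - x i \<le> mesh_width l x"
  unfolding mesh_width_def by (intro Max_ge) auto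

lemma mesh_width_pos: "0 < mesh_width l x"
  using x_diff_le[of 0] x_step[of 0] l1 by linarith

lemma mesh_width_le_1: "mesh_width l x \<le> 1"
  unfolding mesh_width_def
proof (rule Max.boundedI)
  fix b assume "b \<in> (\<lambda>i. x (Suc i) - x i) ` {..<l}"
  then obtain i where "i < l" "b = x (Suc i) - x i" by auto
  then show "b \<le> 1" using x_range[of i] x_range[of "Suc i"] by auto
qed (use l1 in auto)

text \<open>
  The derivatives of the elements of \<^term>\<open>Vh l x\<close>. The values at the nodes are immaterial.
\<close>

definition pwc :: "(real \<Rightarrow> real) set" where
  "pwc = {g \<in> H. \<forall>i<l. \<exists>c. \<forall>t\<in>{x i<..<x (Suc i)}. g t = c}"

lemma pwc_H: "pwc \<subseteq> H" by (auto simp: pwc_def)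

lemma pwc_const: "g \<in> pwc \<Longrightarrow> i < l \<Longrightarrow> \<exists>c. \<forall>t\<in>{x i<..<x (Suc i)}. g t = c"
  by (simp add: pwc_def)

lemma pwc_comb: "g \<in> pwc \<Longrightarrow> k \<in> pwc \<Longrightarrow> (\<lambda>t. r * g t + s * k t) \<in> pwc"
  unfolding pwc_def mem_Collect_eq by (intro conjI H_comb allI impI) (auto, metis)

lemma prim_on_element:
  assumes g: "integrable leb_\<Omega> g" and i: "i < l" and c: "\<And>t. t \<in> {x i<..<x (Suc i)} \<Longrightarrow> g t = c"
    and st: "x i \<le> s" "s \<le> t" "t \<le> x (Suc i)"
  shows "prim g t - prim g s = c * (t - s)"
proof -
  have r: "0 \<le> s" "t \<le> 1" using st x_range[of i] x_range[of "Suc i"] i by auto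
  have "prim g t - prim g s = (LINT r|leb_\<Omega>. indicator {s..<t} r * g r)" by (rule prim_diff_ind[OF g st(2)])
  also have "\<dots> = (LINT r|leb_\<Omega>. c * indicator {s..<t} r)"
  proof (rule integral_cong_AE)
    have "AE r in leb_\<Omega>. r \<noteq> s" unfolding AE_leb_\<Omega>_iff
      using AE_completion[OF AE_lborel_singleton[of s]] by eventually_elim auto
    then show "AE r in leb_\<Omega>. indicator {s..<t} r * g r = c * indicator {s..<t} r"
      by eventually_elim (use c st in \<open>auto simp: indicator_def\<close>)
    show "(\<lambda>r. indicator {s..<t} r * g r) \<in> borel_measurable leb_\<Omega>"
      using g by (intro borel_measurable_integrable integrable_ind) auto
    show "(\<lambda>r. c * indicator {s..<t} r) \<in> borel_measurable leb_\<Omega>"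
      by (intro ess_bounded_measurable ess_bounded_mult ess_bounded_indicator ess_bounded_const) auto
  qed
  also have "\<dots> = c * (t - s)" using integral_indicator_interval[OF r(1) st(2) r(2)] by (simp del: integral_indicator)
  finally show ?thesis .
qed

text \<open>
  A continuous function that is affine on every element is recovered from its slopes; by continuity the
  affine formula extends to the closed elements.
\<close>

lemma Vh_hrep:
  assumes v: "v \<in> Vh l x"
  obtains k where "k \<in> pwc" "\<And>t. t \<in> {0..1} \<Longrightarrow> v t = prim k t"
proof -
  have vc: "continuous_on {0..1} v" "v 0 = 0" "v 1 = 0" using v by (auto simp: Vh_def)
  have "\<forall>i. \<exists>b c. i < l \<longrightarrow> (\<forall>t\<in>{x i<..<x (Suc i)}. v t = b + c * t)" using v by (auto simp: Vh_def)
  then obtain b c where bc: "\<And>i t. i < l \<Longrightarrow> t \<in> {x i<..<x (Suc i)} \<Longrightarrow> v t = b i + c i * t" by metis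
  have cl: "v t = b i + c i * t" if i: "i < l" and t: "t \<in> {x i..x (Suc i)}" for i t
  proof -
    have cle: "closure {x i<..<x (Suc i)} = {x i..x (Suc i)}" using x_step[OF i] by simp
    have "v t - (b i + c i * t) = 0"
    proof (rule continuous_constant_on_closure[where S="{x i<..<x (Suc i)}" and f="\<lambda>t. v t - (b i + c i * t)" and x=t and a=0])
      show "continuous_on (closure {x i<..<x (Suc i)}) (\<lambda>t. v t - (b i + c i * t))"
        unfolding cle using x_range[of i] x_range[of "Suc i"] i
        by (intro continuous_intros continuous_on_subset[OF vc(1)]) auto
      show "t \<in> closure {x i<..<x (Suc i)}" unfolding cle by (rule t)
      show "v s - (b i + c i * s) = 0" if "s \<in> {x i<..<x (Suc i)}" for s using bc[OF i that] by simp
    qed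
    then show ?thesis by simp
  qed
  define k where "k t = (\<Sum>i<l. c i * indicator {x i..<x (Suc i)} t)" for t
  have kb: "ess_bounded k" unfolding k_def
    by (intro ess_bounded_sum ess_bounded_mult ess_bounded_const ess_bounded_indicator) auto
  have kv: "k t = c i" if i: "i < l" and t: "t \<in> {x i<..<x (Suc i)}" for i t
  proof -
    have "k t = (\<Sum>j<l. if j = i then c i else 0)" unfolding k_def
    proof (rule sum.cong)
      fix j assume "j \<in> {..<l}"
      then have "t \<in> {x j..<x (Suc j)} \<longleftrightarrow> j = i" using element_iff[OF i t] by simp
      then show "c j * indicator {x j..<x (Suc j)} t = (if j = i then c i else 0)" using t by (cases "j = i") simp_all
    qed simp
    then show ?thesis using i by simp
  qed
  have node: "prim k (x i) = v (x i)" if "i \<le> l" for i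
    using that
  proof (induction i)
    case 0 then show ?case by (simp add: x0 prim_0 vc)
  next
    case (Suc i)
    have "prim k (x (Suc i)) - prim k (x i) = c i * (x (Suc i) - x i)"
      by (rule prim_on_element[OF ess_bounded_integrable[OF kb] _ kv]) (use Suc x_step[of i] in auto)
    moreover have "v (x (Suc i)) - v (x i) = c i * (x (Suc i) - x i)"
      using cl[of i "x i"] cl[of i "x (Suc i)"] x_step[of i] Suc.prems by (simp add: algebra_simps)
    ultimately show ?case using Suc by simp
  qed
  have eq: "v t = prim k t" if t: "t \<in> {0..1}" for t
  proof (cases "t = 1")
    case True then show ?thesis using node[of l] xl by simp
  next
    case False
    then obtain i where i: "i < l" "x i \<le> t" "t < x (Suc i)" using element_exists[of t] t by auto
    have "prim k t - prim k (x i) = c i * (t - x i)"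
      by (rule prim_on_element[OF ess_bounded_integrable[OF kb] i(1) kv[OF i(1)]]) (use i in auto)
    moreover have "v t - v (x i) = c i * (t - x i)"
      using cl[of i "x i"] cl[of i t] i x_step[of i] by (simp add: algebra_simps)
    ultimately show ?thesis using node[of i] i by simp
  qed
  have "k \<in> pwc" unfolding pwc_def H_def using ess_bounded_in_L2[OF kb] eq[of 1] vc(3) kv by auto
  then show thesis using that eq by blast
qed

lemma pwc_prim_Vh:
  assumes g: "g \<in> pwc" shows "prim g \<in> Vh l x"
proof -
  have gH: "g \<in> H" using g by (simp add: pwc_def)
  note gi = H_D(3)[OF gH]
  have "\<exists>b c. \<forall>t\<in>{x i<..<x (Suc i)}. prim g t = b + c * t" if i: "i < l" for i
  proof -
    obtain c where c: "\<And>t. t \<in> {x i<..<x (Suc i)} \<Longrightarrow> g t = c" using pwc_const[OF g i] by blast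
    have "prim g t = (prim g (x i) - c * x i) + c * t" if "t \<in> {x i<..<x (Suc i)}" for t
      using prim_on_element[OF gi i c, of "x i" t] that by (simp add: algebra_simps)
    then show ?thesis by blast
  qed
  then show ?thesis using continuous_prim[OF gi] H_D(2)[OF gH] prim_0[of 0 g] by (auto simp: Vh_def)
qed

text \<open>
  The derivative of the nodal basis function at the node \<open>x n\<close>.
\<close>

definition hat :: "nat \<Rightarrow> real \<Rightarrow> real" where
  "hat n t = indicator {x (n - 1)..<x n} t * (1 / (x n - x (n - 1)))
     + indicator {x n..<x (Suc n)} t * (- 1 / (x (Suc n) - x n))"

text \<open>
  Testing with a hat function compares the mean values over two adjacent elements.
\<close>

lemma hat_integral:
  assumes n: "1 \<le> n" "n < l" and f: "integrable leb_\<Omega> f"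
  shows "(LINT t|leb_\<Omega>. f t * hat n t) =
    (prim f (x n) - prim f (x (n - 1))) / (x n - x (n - 1)) - (prim f (x (Suc n)) - prim f (x n)) / (x (Suc n) - x n)"
proof -
  have le: "x (n - 1) \<le> x n" "x n \<le> x (Suc n)" using n by (auto intro: x_mono)
  have "(LINT t|leb_\<Omega>. f t * hat n t) =
    (LINT t|leb_\<Omega>. (1 / (x n - x (n - 1))) * (indicator {x (n - 1)..<x n} t * f t)
       + (- 1 / (x (Suc n) - x n)) * (indicator {x n..<x (Suc n)} t * f t))"
    by (rule Bochner_Integration.integral_cong) (auto simp: hat_def algebra_simps)
  also have "\<dots> = (1 / (x n - x (n - 1))) * (LINT t|leb_\<Omega>. indicator {x (n - 1)..<x n} t * f t)
       + (- 1 / (x (Suc n) - x n)) * (LINT t|leb_\<Omega>. indicator {x n..<x (Suc n)} t * f t)"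
    using integrable_ind[OF _ f] by (subst Bochner_Integration.integral_add) auto
  finally show ?thesis using prim_diff_ind[OF f le(1)] prim_diff_ind[OF f le(2)] by simp
qed

lemma hat_ess_bounded: "ess_bounded (hat n)"
  unfolding hat_def[abs_def]
  by (intro ess_bounded_add ess_bounded_mult ess_bounded_indicator ess_bounded_const) auto

lemma prim_one: "t \<in> {0..1} \<Longrightarrow> prim (\<lambda>_. 1) t = t"
  using prim_FTC[of "\<lambda>t. t" "\<lambda>_. 1" t] by auto

lemma hat_pwc:
  assumes n: "1 \<le> n" "n < l" shows "hat n \<in> pwc"
proof -
  have ne: "x n - x (n - 1) \<noteq> 0" "x (Suc n) - x n \<noteq> 0" using x_less[of "n - 1" n] x_less[of n "Suc n"] n by auto
  have one: "integrable leb_\<Omega> (\<lambda>_. 1 :: real)" by simp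
  have r: "x n \<in> {0..1}" "x (n - 1) \<in> {0..1}" "x (Suc n) \<in> {0..1}"
    using x_range[of n] x_range[of "n - 1"] x_range[of "Suc n"] n by auto
  have "(LINT t|leb_\<Omega>. 1 * hat n t) = 0"
    unfolding hat_integral[OF n one] prim_one[OF r(1)] prim_one[OF r(2)] prim_one[OF r(3)] using ne by simp
  then have "hat n \<in> H" using hat_ess_bounded by (simp add: H_def prim_1 ess_bounded_in_L2)
  moreover have "\<exists>c. \<forall>t\<in>{x i<..<x (Suc i)}. hat n t = c" if i: "i < l" for i
  proof -
    have e1: "t \<in> {x (n - 1)..<x n} \<longleftrightarrow> i = n - 1" if "t \<in> {x i<..<x (Suc i)}" for t
      using element_iff[OF i that, of "n - 1"] n by auto
    have e2: "t \<in> {x n..<x (Suc n)} \<longleftrightarrow> i = n" if "t \<in> {x i<..<x (Suc i)}" for t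
      using element_iff[OF i that, of n] n by auto
    show ?thesis unfolding hat_def indicator_def using e1 e2 by (intro exI ballI) (simp only: e1 e2)
  qed
  ultimately show ?thesis by (simp add: pwc_def)
qed

text \<open>
  Derivatives of the finite element functions that vanish to the right of the node \<open>x n\<close>. These
  spaces increase from zero to all of \<^const>\<open>pwc\<close>, and each step adds one hat function.
\<close>

definition pwc_upto :: "nat \<Rightarrow> (real \<Rightarrow> real) set" where
  "pwc_upto n = {g \<in> pwc. \<forall>i. n \<le> i \<longrightarrow> i < l \<longrightarrow> (\<forall>t\<in>{x i<..<x (Suc i)}. g t = 0)}"

text \<open>
  The mean is a positive multiple of the constant value on the first element.
\<close>

lemma pwc_upto_1:
  assumes g: "g \<in> pwc_upto 1" shows "AE t in leb_\<Omega>. g t = 0"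
proof -
  have gH: "g \<in> H" and gp: "g \<in> pwc" using g pwc_H by (auto simp: pwc_upto_def)
  note gi = H_D(3)[OF gH]
  have z: "g t = 0" if "1 \<le> i" "i < l" "t \<in> {x i<..<x (Suc i)}" for i t
    using g that by (auto simp: pwc_upto_def)
  obtain c where c: "\<And>t. t \<in> {x 0<..<x (Suc 0)} \<Longrightarrow> g t = c" using pwc_const[OF gp, of 0] l1 by fastforce
  have "prim g (x i) = c * x 1" if "1 \<le> i" "i \<le> l" for i
    using that
  proof (induction i rule: nat_induct_at_least)
    case base
    have "prim g (x (Suc 0)) - prim g (x 0) = c * (x (Suc 0) - x 0)"
      by (rule prim_on_element[OF gi _ c]) (use l1 x_step[of 0] in auto)
    then show ?case by (simp add: x0 prim_0)
  next
    case (Suc i)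
    have "prim g (x (Suc i)) - prim g (x i) = 0 * (x (Suc i) - x i)"
      by (rule prim_on_element[OF gi _ z[of i]]) (use Suc x_step[of i] in auto)
    then show ?case using Suc by simp
  qed
  from this[of l] have "c * x 1 = 0" using l1 xl H_D(2)[OF gH] by simp
  then have "c = 0" using x_step[of 0] x0 l1 by simp
  then have "g t = 0" if "i < l" "t \<in> {x i<..<x (Suc i)}" for i t
    using z[of i t] c[of t] that by (cases i) auto
  then show ?thesis using AE_element by (auto elim: eventually_mono)
qed

end

context elliptic
begin

lemma representable_pwc:
  assumes "grid l x" shows "representable (mesh.pwc l x)"
proof -
  interpret mesh l x by standard fact
  have comb: "(\<lambda>t. r * g t + s * k t) \<in> pwc_upto n" if "g \<in> pwc_upto n" "k \<in> pwc_upto n" for g k r s n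
    using that pwc_comb by (auto simp: pwc_upto_def)
  have H: "pwc_upto n \<subseteq> H" for n using pwc_H by (auto simp: pwc_upto_def)
  have "representable (pwc_upto n)" if "1 \<le> n" "n \<le> l" for n
    using that
  proof (induction n rule: nat_induct_at_least)
    case base
    have z: "(\<lambda>_. 0) \<in> pwc_upto 1"
      using ess_bounded_in_L2[OF ess_bounded_const[of 0]] by (simp add: pwc_upto_def pwc_def H_def prim_zero)
    show ?case unfolding representable_def
    proof (intro allI impI bexI[OF _ z] ballI)
      fix \<theta> w assume l: "functional \<theta>" and w: "w \<in> pwc_upto 1"
      have "AE t in leb_\<Omega>. w t = 0" by (rule pwc_upto_1[OF w])
      moreover have "w \<in> H" using w H by blast
      ultimately have "\<theta> w = 0" using l by (simp add: functional_def)
      then show "form (\<lambda>_. 0) w = \<theta> w" using form_AE_zero[OF \<open>AE t in leb_\<Omega>. w t = 0\<close>] by simp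
    qed
  next
    case (Suc n)
    show ?case
    proof (rule representable_extend[where U="pwc_upto n" and \<phi>="hat n"])
      show "representable (pwc_upto n)" using Suc by simp
      show "pwc_upto n \<subseteq> pwc_upto (Suc n)" unfolding pwc_upto_def by (auto dest!: Suc_leD)
      show "hat n \<in> pwc_upto (Suc n)" unfolding pwc_upto_def mem_Collect_eq
      proof (intro conjI allI impI ballI)
        show "hat n \<in> pwc" by (rule hat_pwc) (use Suc in auto)
        fix i t assume i: "Suc n \<le> i" "i < l" and t: "t \<in> {x i<..<x (Suc i)}"
        have "x n \<le> x i" "x (Suc n) \<le> x i" using x_mono i by auto
        then show "hat n t = 0" using t by (auto simp: hat_def)
      qed
      fix g assume g: "g \<in> pwc_upto (Suc n)"
      then have gp: "g \<in> pwc" by (simp add: pwc_upto_def)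
      obtain c where c: "\<And>t. t \<in> {x n<..<x (Suc n)} \<Longrightarrow> g t = c"
        using pwc_const[OF gp, of n] Suc by fastforce
      \<comment> \<open>This multiple of the hat function has slope \<open>c\<close> on the last active element.\<close>
      define b where "b = - c * (x (Suc n) - x n)"
      have hn: "hat n t = - 1 / (x (Suc n) - x n)" if "t \<in> {x n<..<x (Suc n)}" for t
        using that by (auto simp: hat_def)
      have "(\<lambda>t. 1 * g t + (- b) * hat n t) \<in> pwc" by (rule pwc_comb[OF gp hat_pwc]) (use Suc in auto)
      then have "(\<lambda>t. g t - b * hat n t) \<in> pwc" by simp
      moreover have "g t - b * hat n t = 0" if "n \<le> i" "i < l" "t \<in> {x i<..<x (Suc i)}" for i t
      proof (cases "i = n")
        case True
        then show ?thesis using that c[of t] hn[of t] x_step[of n] by (simp add: b_def)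
      next
        case False
        then have i: "Suc n \<le> i" using that by simp
        then have "x n \<le> x i" "x (Suc n) \<le> x i" using x_mono that by auto
        then have "hat n t = 0" using that by (auto simp: hat_def)
        then show ?thesis using g i that by (auto simp: pwc_upto_def)
      qed
      ultimately show "\<exists>c. (\<lambda>t. g t - c * hat n t) \<in> pwc_upto n" unfolding pwc_upto_def by blast
    qed (use comb H in auto)
  qed
  from this[of l] have "representable (pwc_upto l)" using l1 by simp
  moreover have "pwc_upto l = pwc" by (auto simp: pwc_upto_def)
  ultimately show ?thesis by simp
qed

lemma trial_space_Vh:
  assumes "grid l x" shows "trial_space a d L A \<nu> D (Vh l x) (mesh.pwc l x)"
proof -
  interpret mesh l x by standard fact
  show ?thesis
  proof
    show "\<exists>k\<in>pwc. hrep w k" if wV: "w \<in> Vh l x" for w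
    proof -
      obtain k where k: "k \<in> pwc" "\<And>t. t \<in> {0..1} \<Longrightarrow> w t = prim k t" by (rule Vh_hrep[OF wV]) (rule that)
      then have "hrep w k" using pwc_H H_D(1,2)[of k] by (auto simp: hrep_def intro!: AE_leb_\<Omega>I)
      then show ?thesis using k by blast
    qed
    show "pwc \<subseteq> H" by (rule pwc_H)
    show "(\<lambda>t. r * g t + s * k t) \<in> pwc" if "g \<in> pwc" "k \<in> pwc" for g k r s by (rule pwc_comb[OF that])
    fix f :: "real \<Rightarrow> real" assume f: "ess_bounded f"
    obtain g where g: "g \<in> pwc" "\<And>w. w \<in> pwc \<Longrightarrow> form g w = (LINT t|leb_\<Omega>. f t * prim w t)"
      using representable_pwc[OF assms] functional_load[OF f] unfolding representable_def by blast
    have "hrep (prim g) g" using g(1) pwc_H H_D(1,2)[of g] by (auto simp: hrep_def)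
    then show "\<exists>u\<in>Vh l x. \<exists>g. hrep u g \<and> sol pwc f g"
      using pwc_prim_Vh[OF g(1)] g by (auto simp: sol_def)
  qed
qed

end

section \<open>The finite element error\<close>

lemma integral_open_interval_bound:
  assumes g: "g \<in> borel_measurable leb_\<Omega>" and B: "\<And>r. s < r \<Longrightarrow> r < t \<Longrightarrow> \<bar>g r\<bar> \<le> B" "0 \<le> B"
    and st: "0 \<le> s" "s \<le> t" "t \<le> 1"
  shows "\<bar>LINT r|leb_\<Omega>. indicator {s..<t} r * g r\<bar> \<le> B * (t - s)"
proof -
  note g[measurable]
  have [measurable]: "indicator {s..<t} \<in> borel_measurable leb_\<Omega>" "indicator {s<..<t} \<in> borel_measurable leb_\<Omega>"
    by (rule borel_imp_leb_\<Omega>, simp)+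
  have "AE r in leb_\<Omega>. r \<noteq> s" unfolding AE_leb_\<Omega>_iff
    using AE_completion[OF AE_lborel_singleton[of s]] by eventually_elim auto
  then have "AE r in leb_\<Omega>. indicator {s..<t} r * g r = indicator {s..<t} r * (indicator {s<..<t} r * g r)"
    by eventually_elim (auto simp: indicator_def)
  then have "(LINT r|leb_\<Omega>. indicator {s..<t} r * g r) = (LINT r|leb_\<Omega>. indicator {s..<t} r * (indicator {s<..<t} r * g r))"
    by (intro integral_cong_AE) measurable
  also have "\<bar>\<dots>\<bar> \<le> B * (t - s)"
    by (rule integral_indicator_bound) (use B st in \<open>auto simp: indicator_def intro!: AE_leb_\<Omega>I\<close>)
  finally show ?thesis .
qed

context mesh
begin

text \<open>
  Averaging \<open>f s - f t\<close> over \<open>s\<close> in the element leaves \<open>- f t\<close>.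
\<close>

lemma element_bound_from_oscillation:
  assumes f: "integrable leb_\<Omega> f" and i: "i < l" and mean: "prim f (x (Suc i)) = prim f (x i)"
    and osc: "\<And>s t. s \<in> {x i<..<x (Suc i)} \<Longrightarrow> t \<in> {x i<..<x (Suc i)} \<Longrightarrow> \<bar>f s - f t\<bar> \<le> \<omega>"
    and t: "t \<in> {x i<..<x (Suc i)}"
  shows "\<bar>f t\<bar> \<le> \<omega>"
proof -
  have le: "x i < x (Suc i)" "0 \<le> x i" "x (Suc i) \<le> 1" using x_step[OF i] x_range[of i] x_range[of "Suc i"] i by auto
  have \<omega>: "0 \<le> \<omega>" using osc[OF t t] by simp
  define k where "k s = f s - f t" for s
  have ki: "integrable leb_\<Omega> k" unfolding k_def[abs_def] using f by auto
  have pk: "prim k s = prim f s - f t * prim (\<lambda>_. 1) s" for s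
    unfolding k_def using f prim_diff[of f "\<lambda>_. f t * 1" s] prim_cmult[of "f t" "\<lambda>_. 1" s] by simp
  have "prim k (x (Suc i)) - prim k (x i) = - (f t * (x (Suc i) - x i))"
    unfolding pk using mean le by (simp add: prim_one algebra_simps)
  moreover have "\<bar>prim k (x (Suc i)) - prim k (x i)\<bar> \<le> \<omega> * (x (Suc i) - x i)"
    unfolding prim_diff_ind[OF ki less_imp_le[OF le(1)]]
  proof (rule integral_open_interval_bound)
    show "k \<in> borel_measurable leb_\<Omega>" using ki by auto
    show "\<bar>k s\<bar> \<le> \<omega>" if "x i < s" "s < x (Suc i)" for s using osc[of s t] that t by (simp add: k_def)
  qed (use le \<omega> in auto)
  ultimately have "\<bar>f t\<bar> * (x (Suc i) - x i) \<le> \<omega> * (x (Suc i) - x i)" using le by (simp add: abs_mult)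
  then show ?thesis using le by simp
qed

text \<open>
  Against a factor whose element means vanish, only the oscillation of the other factor on each element
  counts. This gains the second power of the mesh width at the nodes.
\<close>

lemma weighted_mean_bound:
  assumes r: "integrable leb_\<Omega> r" and k: "ess_bounded k"
    and mean: "\<And>i. i \<le> l \<Longrightarrow> prim r (x i) = 0"
    and bnd: "\<And>i t. i < l \<Longrightarrow> t \<in> {x i<..<x (Suc i)} \<Longrightarrow> \<bar>r t\<bar> \<le> \<sigma>"
    and osc: "\<And>i s t. i < l \<Longrightarrow> s \<in> {x i<..<x (Suc i)} \<Longrightarrow> t \<in> {x i<..<x (Suc i)} \<Longrightarrow> \<bar>k s - k t\<bar> \<le> \<omega>"
    and j: "j \<le> l"
  shows "\<bar>prim (\<lambda>t. r t * k t) (x j)\<bar> \<le> \<sigma> * \<omega> * x j"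
  using j
proof (induction j)
  case 0 then show ?case by (simp add: x0 prim_0)
next
  case (Suc i)
  then have i: "i < l" by simp
  have le: "x i < x (Suc i)" "0 \<le> x i" "x (Suc i) \<le> 1" using x_step[OF i] x_range[of i] x_range[of "Suc i"] i by auto
  define s where "s = (x i + x (Suc i)) / 2"
  have s: "s \<in> {x i<..<x (Suc i)}" using le by (auto simp: s_def)
  have nn: "0 \<le> \<sigma>" "0 \<le> \<omega>" using bnd[OF i s] osc[OF i s s] by auto
  have rk: "integrable leb_\<Omega> (\<lambda>t. r t * k t)" using ess_bounded_mult_integrable[OF k r] by (simp add: mult.commute)
  define w where "w t = r t * k t - k s * r t" for t
  have wi: "integrable leb_\<Omega> w" unfolding w_def[abs_def] using rk r by auto
  have pw: "prim w t = prim (\<lambda>t. r t * k t) t - k s * prim r t" for t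
    unfolding w_def using prim_diff[OF rk, of "\<lambda>t. k s * r t"] r by (simp add: prim_cmult)
  have "prim (\<lambda>t. r t * k t) (x (Suc i)) - prim (\<lambda>t. r t * k t) (x i) = prim w (x (Suc i)) - prim w (x i)"
    unfolding pw using mean[of i] mean[of "Suc i"] Suc.prems by simp
  also have "\<bar>\<dots>\<bar> \<le> \<sigma> * \<omega> * (x (Suc i) - x i)"
    unfolding prim_diff_ind[OF wi less_imp_le[OF le(1)]]
  proof (rule integral_open_interval_bound)
    fix t assume t: "x i < t" "t < x (Suc i)"
    have "w t = r t * (k t - k s)" by (simp add: w_def algebra_simps)
    then show "\<bar>w t\<bar> \<le> \<sigma> * \<omega>" using bnd[OF i, of t] osc[OF i, of t s] s t by (simp add: abs_mult mult_mono')
  qed (use wi le nn in auto)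
  finally have "\<bar>prim (\<lambda>t. r t * k t) (x (Suc i)) - prim (\<lambda>t. r t * k t) (x i)\<bar> \<le> \<sigma> * \<omega> * (x (Suc i) - x i)" .
  moreover have "\<bar>prim (\<lambda>t. r t * k t) (x i)\<bar> \<le> \<sigma> * \<omega> * x i" using Suc by simp
  ultimately have "\<bar>prim (\<lambda>t. r t * k t) (x (Suc i))\<bar> \<le> \<sigma> * \<omega> * (x (Suc i) - x i) + \<sigma> * \<omega> * x i" by linarith
  then show ?case by (simp add: algebra_simps)
qed

lemma pwc_bounded:
  assumes "g \<in> pwc" obtains B where "\<And>i t. i < l \<Longrightarrow> t \<in> {x i<..<x (Suc i)} \<Longrightarrow> \<bar>g t\<bar> \<le> B"
proof -
  obtain c where c: "\<And>i t. i < l \<Longrightarrow> t \<in> {x i<..<x (Suc i)} \<Longrightarrow> g t = c i"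
    using pwc_const[OF assms] by metis
  have "\<bar>g t\<bar> \<le> (\<Sum>i<l. \<bar>c i\<bar>)" if "i < l" "t \<in> {x i<..<x (Suc i)}" for i t
    unfolding c[OF that] using that by (intro member_le_sum) auto
  then show thesis by (rule that)
qed

end

context elliptic
begin

lemma sol_H_lipschitz:
  assumes f: "ess_bounded f" and F: "AE t in leb_\<Omega>. \<bar>f t\<bar> \<le> F"
  shows "\<exists>g. sol H f g \<and> continuous_on {0..1} g \<and>
    (\<forall>s\<in>{0..1}. \<forall>t\<in>{0..1}. \<bar>g s - g t\<bar> \<le> C2 * F * \<bar>s - t\<bar>)"
proof (rule sol_H_regular[OF f], goal_cases)
  case (1 g)
  have "\<bar>g s - g t\<bar> \<le> C2 * F * \<bar>s - t\<bar>" if "s \<in> {0..1}" "t \<in> {0..1}" for s t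
    by (rule 1(4)[OF F that])
  with 1(1,2) show ?case by blast
qed

text \<open>
  Bounds the error of the derivative by the oscillation of the residual in \<open>galerkin_error\<close>
  below.
\<close>

definition K1 :: real where "K1 = 2 / \<nu> * (1 + D * C2)"

lemma K1_pos: "0 < K1"
proof -
  have "0 \<le> D * C2" using D0 C2_pos by simp
  then show ?thesis unfolding K1_def using \<nu> by (intro mult_pos_pos divide_pos_pos) linarith+
qed

lemma inv_a_diff:
  assumes "s \<in> {0..1}" "t \<in> {0..1}" shows "\<bar>1 / a s - 1 / a t\<bar> \<le> L / \<nu>\<^sup>2 * \<bar>s - t\<bar>"
proof -
  have p: "0 < a s" "0 < a t" "\<nu> \<le> a s" "\<nu> \<le> a t" using assms a_pos a_lower by auto
  have "1 / a s - 1 / a t = (a t - a s) / (a s * a t)" using p by (simp add: field_simps)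
  also have "\<bar>\<dots>\<bar> = \<bar>a t - a s\<bar> / (a s * a t)" using p by (simp add: abs_mult)
  also have "\<dots> \<le> (L * \<bar>s - t\<bar>) / (\<nu> * \<nu>)"
    using p a_diff[OF assms] \<nu> by (intro frac_le mult_mono) (auto simp: abs_minus_commute)
  finally show ?thesis by (simp add: power2_eq_square)
qed

lemma prim_inv_a: "t \<in> {0..1} \<Longrightarrow> 0 \<le> prim (\<lambda>t. 1 / a t) t" "prim (\<lambda>t. 1 / a t) t \<le> prim (\<lambda>t. 1 / a t) 1"
proof -
  have i: "integrable leb_\<Omega> (\<lambda>t. 1 / a t)" by (intro ess_bounded_integrable ess_bounded_cont inv_a_cont)
  have p: "0 < 1 / a t" if "0 < t" "t < 1" for t using a_pos[of t] that by simp
  show "0 \<le> prim (\<lambda>t. 1 / a t) t" unfolding prim_def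
    by (rule integral_nonneg_AE, rule AE_leb_\<Omega>I) (use p in \<open>auto simp: indicator_def less_imp_le\<close>)
  show "prim (\<lambda>t. 1 / a t) t \<le> prim (\<lambda>t. 1 / a t) 1" unfolding prim_def
  proof (rule integral_mono_AE)
    show "AE s in leb_\<Omega>. indicator {..<t} s * (1 / a s) \<le> indicator {..<1} s * (1 / a s)"
      by (rule AE_leb_\<Omega>I) (use p in \<open>auto simp: indicator_def less_imp_le\<close>)
  qed (rule integrable_ind[OF _ i], simp)+
qed

text \<open>
  The factor of \<open>G * h\<^sup>2\<close> in the error bound for the function. The first summand comes
  from the nodal errors, the second one from the growth of the error between the nodes.
\<close>

definition K2 :: real where "K2 = 2 * (2 * A * (L / \<nu>\<^sup>2) + D * (2 * A * C2) / \<nu>) + 2 * K1 * A"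

text \<open>
  A sup-norm error estimate without interpolation. Write \<open>e\<close> for the error in the derivative.
  After integration by parts the Galerkin orthogonality concerns \<open>r = a * e - prim (d * prim
  e)\<close>, and testing with hat functions says that \<open>r\<close> has the same mean \<open>c\<close>
  over every element. Hence \<open>r - c\<close> is bounded by the oscillation of \<open>r\<close> on
  elements, which is \<open>O(h)\<close>, as the discrete part of \<open>e\<close> is constant there.
  Duality with a Lipschitz continuous dual derivative gives \<open>O(h\<^sup>2)\<close> for the
  \<open>L\<^sup>1\<close> norm of the error, which controls the lower order term. The vanishing mean of
  \<open>e\<close> bounds \<open>c\<close>, so \<open>e\<close> is \<open>O(h)\<close>. At the nodes all
  remaining terms are of second order, and between the nodes the error changes by at most
  \<open>O(h)\<close> times \<open>h\<close>.
\<close>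

lemma galerkin_error:
  assumes grid: "grid l x" and h: "mesh_width l x = h" "K1 * (L + D) * h \<le> 1 / 2"
    and gH: "g \<in> H" and gh: "gh \<in> mesh.pwc l x"
    and orth: "\<And>k. k \<in> mesh.pwc l x \<Longrightarrow> form (\<lambda>t. g t - gh t) k = 0"
    and gc: "continuous_on {0..1} g"
    and G: "\<And>s t. s \<in> {0..1} \<Longrightarrow> t \<in> {0..1} \<Longrightarrow> \<bar>g s - g t\<bar> \<le> G * \<bar>s - t\<bar>"
  shows "AE t in leb_\<Omega>. \<bar>g t - gh t\<bar> \<le> 2 * K1 * A * G * h"
    and "t \<in> {0..1} \<Longrightarrow> \<bar>prim g t - prim gh t\<bar> \<le> K2 * G * h\<^sup>2"
proof -
  interpret mesh l x by standard fact
  have h0: "0 < h" "h \<le> 1" using mesh_width_pos mesh_width_le_1 h by auto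
  have hstep: "x (Suc i) - x i \<le> h" if "i < l" for i using x_diff_le[OF that] h by simp
  have elem: "t \<in> {0..1}" if "i < l" "t \<in> {x i<..<x (Suc i)}" for i t
    using that x_range[of i] x_range[of "Suc i"] by auto
  have G0: "0 \<le> G" using G[of 0 1] by auto
  define e where "e t = g t - gh t" for t
  have ghH: "gh \<in> H" using gh pwc_H by auto
  have eH: "e \<in> H" unfolding e_def[abs_def] by (rule H_diff[OF gH ghH])
  note ei = H_D(3)[OF eH]
  obtain Bh where Bh: "\<And>i t. i < l \<Longrightarrow> t \<in> {x i<..<x (Suc i)} \<Longrightarrow> \<bar>gh t\<bar> \<le> Bh" using pwc_bounded[OF gh] by blast
  have "\<exists>B. \<forall>t\<in>{0..1}. \<bar>g t\<bar> \<le> B"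
    using compact_imp_bounded[OF compact_continuous_image[OF gc]] by (auto simp: bounded_iff)
  then obtain Bg where Bg: "\<And>t. t \<in> {0..1} \<Longrightarrow> \<bar>g t\<bar> \<le> Bg" by blast
  define S where "S = (\<Union>i<l. {x i<..<x (Suc i)})"
  \<comment> \<open>The supremum over the open elements: at the nodes the discrete derivative has no meaning.\<close>
  define E where "E = (SUP t\<in>S. \<bar>e t\<bar>)"
  have bdd: "bdd_above ((\<lambda>t. \<bar>e t\<bar>) ` S)"
  proof (rule bdd_aboveI2[where M="Bg + Bh"])
    fix t assume "t \<in> S"
    then obtain i where i: "i < l" "t \<in> {x i<..<x (Suc i)}" by (auto simp: S_def)
    show "\<bar>e t\<bar> \<le> Bg + Bh" using Bh[OF i] Bg[OF elem[OF i]] by (simp add: e_def)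
  qed
  have Ebound: "\<bar>e t\<bar> \<le> E" if "i < l" "t \<in> {x i<..<x (Suc i)}" for i t
    unfolding E_def by (rule cSUP_upper[OF _ bdd]) (use that in \<open>auto simp: S_def\<close>)
  have Sne: "S \<noteq> {}"
  proof -
    have "(x 0 + x (Suc 0)) / 2 \<in> {x 0<..<x (Suc 0)}" using x_step[of 0] l1 by auto
    then have "(x 0 + x (Suc 0)) / 2 \<in> S" unfolding S_def by (rule UN_I[rotated]) (use l1 in simp)
    then show ?thesis by blast
  qed
  have E0: "0 \<le> E"
  proof -
    obtain t where "t \<in> S" using Sne by blast
    then obtain i where "i < l" "t \<in> {x i<..<x (Suc i)}" by (auto simp: S_def)
    from Ebound[OF this] show ?thesis by linarith
  qed
  have EAE: "AE t in leb_\<Omega>. \<bar>e t\<bar> \<le> E" using AE_element by eventually_elim (use Ebound in blast)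
  have pe: "\<bar>prim e t\<bar> \<le> E" for t
  proof -
    have "\<bar>prim e t\<bar> \<le> (LINT t|leb_\<Omega>. \<bar>e t\<bar>)" by (rule prim_bound_integral[OF ei])
    also have "\<dots> \<le> (LINT t|leb_\<Omega>. E)" by (rule integral_mono_AE) (use ei EAE in auto)
    finally show ?thesis using leb.prob_space by simp
  qed
  have eb: "ess_bounded e" by (rule ess_bounded_AE_I[OF H_D(5)[OF eH] EAE])
  define de where "de t = d t * prim e t" for t
  have deb: "ess_bounded de" unfolding de_def[abs_def] by (intro ess_bounded_mult d_bounded ess_bounded_prim ei)
  note dei = ess_bounded_integrable[OF deb]
  define r where "r t = a t * e t - prim de t" for t
  have rb: "ess_bounded r" unfolding r_def[abs_def]
    by (intro ess_bounded_diff ess_bounded_mult a_bounded eb ess_bounded_prim dei)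
  note ri = ess_bounded_integrable[OF rb]
  \<comment> \<open>Integration by parts turns the error equation into orthogonality of \<open>r\<close> to mean-free step functions.\<close>
  have form_r: "form e k = (LINT t|leb_\<Omega>. r t * k t)" if k: "k \<in> H" for k
  proof -
    have i1: "integrable leb_\<Omega> (\<lambda>t. k t * prim de t)"
      using ess_bounded_mult_integrable[OF ess_bounded_prim[OF dei] H_D(3)[OF k]] by (simp add: mult.commute)
    have "(LINT t|leb_\<Omega>. d t * (prim e t * prim k t)) = (LINT t|leb_\<Omega>. de t * prim k t)"
      by (simp add: de_def mult.assoc)
    also have "\<dots> = - (LINT t|leb_\<Omega>. k t * prim de t)"
      using prim_by_parts[OF dei H_D(3)[OF k]] H_D(4)[OF k] by simp
    finally have "form e k = (LINT t|leb_\<Omega>. a t * (e t * k t)) - (LINT t|leb_\<Omega>. k t * prim de t)"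
      by (simp add: form_def)
    also have "\<dots> = (LINT t|leb_\<Omega>. a t * (e t * k t) - k t * prim de t)"
      using form_int(1)[OF H_D(1)[OF eH] H_D(1)[OF k]] i1 by simp
    finally show ?thesis by (simp add: r_def algebra_simps)
  qed
  \<comment> \<open>The mean over the first element, and by the hat functions over all elements.\<close>
  define c where "c = prim r (x 1) / x 1"
  have x1: "0 < x 1" using x_step[of 0] l1 x0 by simp
  have means: "(prim r (x (Suc i)) - prim r (x i)) / (x (Suc i) - x i) = c" if "i < l" for i
    using that
  proof (induction i)
    case 0 then show ?case by (simp add: c_def x0 prim_0)
  next
    case (Suc i)
    have n: "1 \<le> Suc i" "Suc i < l" using Suc by auto
    have "form e (hat (Suc i)) = 0" using orth[OF hat_pwc[OF n]] by (simp add: e_def[abs_def])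
    then have "(LINT t|leb_\<Omega>. r t * hat (Suc i) t) = 0" using form_r[of "hat (Suc i)"] hat_pwc[OF n] pwc_H by auto
    then show ?case using hat_integral[OF n ri] Suc by simp
  qed
  define r0 where "r0 t = r t - c" for t
  have r0b: "ess_bounded r0" unfolding r0_def[abs_def] by (intro ess_bounded_diff rb ess_bounded_const)
  note r0i = ess_bounded_integrable[OF r0b]
  have pr0: "prim r0 t = prim r t - c * prim (\<lambda>_. 1) t" for t
    unfolding r0_def using prim_diff[OF ri, of "\<lambda>_. c * 1" t] prim_cmult[of c "\<lambda>_. 1" t] by simp
  have mean0: "prim r0 (x i) = 0" if "i \<le> l" for i
    using that
  proof (induction i)
    case 0 then show ?case by (simp add: x0 prim_0)
  next
    case (Suc i)
    then have i: "i < l" by simp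
    have "prim r (x (Suc i)) - prim r (x i) = c * (x (Suc i) - x i)" using means[OF i] x_step[OF i] by (simp add: field_simps)
    then have "prim r0 (x (Suc i)) = prim r0 (x i)"
      unfolding pr0 using x_range[of i] x_range[of "Suc i"] i by (simp add: prim_one algebra_simps)
    then show ?case using Suc by simp
  qed
  \<comment> \<open>The oscillation of \<open>r0\<close> on an element is at most \<open>h * \<rho>\<close>. The unknown
    \<open>E\<close> in it is absorbed for small \<open>h\<close>.\<close>
  define \<rho> where "\<rho> = A * G + (L + D) * E"
  have \<rho>0: "0 \<le> \<rho>" using A_pos G0 L0 D0 E0 by (simp add: \<rho>_def)
  have osc: "\<bar>r0 s - r0 t\<bar> \<le> h * \<rho>" if i: "i < l" and s: "s \<in> {x i<..<x (Suc i)}" and t: "t \<in> {x i<..<x (Suc i)}" for i s t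
  proof -
    note si = elem[OF i s] and ti = elem[OF i t]
    have st: "\<bar>s - t\<bar> \<le> h" using s t hstep[OF i] by auto
    have ees: "e s - e t = g s - g t" using pwc_const[OF gh i] s t by (auto simp: e_def)
    have 1: "\<bar>a s * (e s - e t)\<bar> \<le> A * (G * h)"
    proof -
      have "\<bar>g s - g t\<bar> \<le> G * h" using G[OF si ti] mult_left_mono[OF st G0] by linarith
      then show ?thesis unfolding abs_mult ees using a_pos[OF si] a_upper[OF si] by (intro mult_mono') auto
    qed
    have 2: "\<bar>(a s - a t) * e t\<bar> \<le> (L * h) * E"
    proof -
      have "\<bar>a s - a t\<bar> \<le> L * h" using a_diff[OF si ti] mult_left_mono[OF st L0] by linarith
      then show ?thesis unfolding abs_mult using Ebound[OF i t] by (intro mult_mono') auto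
    qed
    have 3: "\<bar>prim de s - prim de t\<bar> \<le> D * E * h"
    proof -
      have "AE t in leb_\<Omega>. \<bar>de t\<bar> \<le> D * E"
        using d_abs by eventually_elim (use pe D0 in \<open>auto simp: de_def abs_mult intro!: mult_mono\<close>)
      from prim_lipschitz[OF dei this ti si] mult_left_mono[OF st, of "D * E"] D0 E0 show ?thesis by auto
    qed
    have "r0 s - r0 t = a s * (e s - e t) + (a s - a t) * e t - (prim de s - prim de t)"
      by (simp add: r0_def r_def algebra_simps)
    then have "\<bar>r0 s - r0 t\<bar> \<le> A * (G * h) + L * h * E + D * E * h" using 1 2 3 by linarith
    then show ?thesis by (simp add: \<rho>_def algebra_simps)
  qed
  have r0_bound: "\<bar>r0 t\<bar> \<le> h * \<rho>" if i: "i < l" and t: "t \<in> {x i<..<x (Suc i)}" for i t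
    by (rule element_bound_from_oscillation[OF r0i i _ osc[OF i] t]) (use mean0[of i] mean0[of "Suc i"] i in auto)
  have r0_AE: "AE t in leb_\<Omega>. \<bar>r0 t\<bar> \<le> h * \<rho>" using AE_element by eventually_elim (use r0_bound in blast)
  \<comment> \<open>Duality: the \<open>L\<^sup>1\<close> norm of the error is its pairing with its own sign.\<close>
  define \<eta> where "\<eta> = (LINT t|leb_\<Omega>. \<bar>prim e t\<bar>)"
  have \<eta>0: "0 \<le> \<eta>" by (simp add: \<eta>_def)
  have \<eta>: "\<eta> \<le> C2 * (h * (h * \<rho>))"
  proof -
    define f where "f t = sgn (prim e t)" for t
    have fb: "ess_bounded f" unfolding f_def[abs_def]
    proof (rule ess_boundedI[of _ 1])
      have [measurable]: "prim e \<in> borel_measurable leb_\<Omega>" using ess_bounded_prim[OF ei] by auto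
      show "(\<lambda>t. sgn (prim e t)) \<in> borel_measurable leb_\<Omega>" by measurable
    qed (simp add: sgn_if)
    have f1: "AE t in leb_\<Omega>. \<bar>f t\<bar> \<le> 1" by (auto simp: f_def sgn_if)
    obtain k where k: "sol H f k" "continuous_on {0..1} k"
      "\<And>s t. s \<in> {0..1} \<Longrightarrow> t \<in> {0..1} \<Longrightarrow> \<bar>k s - k t\<bar> \<le> C2 * 1 * \<bar>s - t\<bar>"
      using sol_H_lipschitz[OF fb f1] by blast
    have kH: "k \<in> H" using k(1) by (simp add: sol_def)
    have kb: "ess_bounded k" by (rule ess_bounded_cont[OF k(2)])
    have "\<eta> = (LINT t|leb_\<Omega>. f t * prim e t)"
      unfolding \<eta>_def f_def by (rule Bochner_Integration.integral_cong) (auto simp: sgn_if)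
    also have "\<dots> = form k e" using k(1) eH by (simp add: sol_def)
    also have "\<dots> = (LINT t|leb_\<Omega>. r t * k t)" using form_r[OF kH] by (simp add: form_commute)
    also have "\<dots> = (LINT t|leb_\<Omega>. r0 t * k t + c * k t)" by (simp add: r0_def algebra_simps)
    also have "\<dots> = prim (\<lambda>t. r0 t * k t) (x l)"
      using H_D(4)[OF kH] H_D(3)[OF kH] ess_bounded_integrable[OF ess_bounded_mult[OF r0b kb]] by (simp add: xl prim_1)
    also have "\<dots> \<le> \<bar>prim (\<lambda>t. r0 t * k t) (x l)\<bar>" by simp
    also have "\<dots> \<le> (h * \<rho>) * (C2 * h) * x l"
    proof (rule weighted_mean_bound[OF r0i kb mean0 r0_bound])
      fix i s t assume i: "i < l" and s: "s \<in> {x i<..<x (Suc i)}" and t: "t \<in> {x i<..<x (Suc i)}"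
      have "\<bar>k s - k t\<bar> \<le> C2 * 1 * \<bar>s - t\<bar>" by (rule k(3)[OF elem[OF i s] elem[OF i t]])
      also have "\<dots> \<le> C2 * h" using s t hstep[OF i] C2_pos by auto
      finally show "\<bar>k s - k t\<bar> \<le> C2 * h" .
    qed auto
    finally show ?thesis by (simp add: xl ac_simps)
  qed
  have pde: "\<bar>prim de t\<bar> \<le> D * \<eta>" for t
  proof -
    have "\<bar>prim de t\<bar> \<le> (LINT t|leb_\<Omega>. \<bar>de t\<bar>)" by (rule prim_bound_integral[OF dei])
    also have "\<dots> \<le> (LINT t|leb_\<Omega>. D * \<bar>prim e t\<bar>)"
    proof (rule integral_mono_AE)
      show "AE t in leb_\<Omega>. \<bar>de t\<bar> \<le> D * \<bar>prim e t\<bar>"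
        using d_abs by eventually_elim (auto simp: de_def abs_mult intro!: mult_right_mono)
      show "integrable leb_\<Omega> (\<lambda>t. D * \<bar>prim e t\<bar>)"
        by (intro ess_bounded_integrable ess_bounded_mult ess_bounded_const ess_bounded_abs ess_bounded_prim ei)
    qed (use dei in auto)
    finally show ?thesis by (simp add: \<eta>_def)
  qed
  define J where "J t = prim (\<lambda>t. 1 / a t) t" for t
  have J1: "0 < J 1" using inverse_a_integral_pos by (simp add: J_def prim_1)
  note iab = ess_bounded_cont[OF inv_a_cont]
  have Jle: "J 1 \<le> 1 / \<nu>"
  proof -
    have "J 1 \<le> (LINT t|leb_\<Omega>. 1 / \<nu>)" unfolding J_def prim_1
    proof (rule integral_mono_AE[OF ess_bounded_integrable[OF iab]])
      show "AE t in leb_\<Omega>. 1 / a t \<le> 1 / \<nu>"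
        by (rule AE_leb_\<Omega>I) (use a_lower a_pos \<nu> in \<open>auto intro!: divide_left_mono\<close>)
    qed simp
    then show ?thesis using leb.prob_space by simp
  qed
  define q where "q t = r0 t + prim de t" for t
  have qb: "ess_bounded q" unfolding q_def[abs_def] by (intro ess_bounded_add r0b ess_bounded_prim dei)
  have e_rep: "e t = c * (1 / a t) + q t * (1 / a t)" if "t \<in> {0..1}" for t
    using a_pos[OF that] by (simp add: q_def r0_def r_def field_simps)
  have prim_e: "prim e t = c * J t + prim (\<lambda>t. q t * (1 / a t)) t" for t
  proof -
    have "prim e = prim (\<lambda>t. c * (1 / a t) + q t * (1 / a t))" by (rule prim_cong) (simp add: e_rep)
    then show ?thesis using prim_add[of "\<lambda>t. c * (1 / a t)" "\<lambda>t. q t * (1 / a t)" t] prim_cmult[of c "\<lambda>t. 1 / a t" t]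
      ess_bounded_integrable[OF ess_bounded_mult[OF ess_bounded_const[of c] iab]] ess_bounded_integrable[OF ess_bounded_mult[OF qb iab]]
      by (simp add: J_def)
  qed
  have e1: "prim e 1 = 0" by (rule H_D(2)[OF eH])
  define \<tau> where "\<tau> = h * \<rho> + D * \<eta>"
  have \<tau>0: "0 \<le> \<tau>" using h0 \<rho>0 D0 \<eta>0 by (simp add: \<tau>_def)
  have q_AE: "AE t in leb_\<Omega>. \<bar>q t\<bar> \<le> \<tau>"
    using r0_AE
  proof eventually_elim
    fix t assume "\<bar>r0 t\<bar> \<le> h * \<rho>"
    then show "\<bar>q t\<bar> \<le> \<tau>" unfolding q_def \<tau>_def using pde[of t] by linarith
  qed
  have c_bound: "\<bar>c\<bar> \<le> \<tau>"
  proof -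
    have "\<bar>prim (\<lambda>t. q t * (1 / a t)) 1\<bar> \<le> prim (\<lambda>t. \<tau> * (1 / a t)) 1"
    proof (rule prim_mono_bound)
      show "AE t in leb_\<Omega>. \<bar>q t * (1 / a t)\<bar> \<le> \<tau> * (1 / a t)"
        using q_AE AE_space
      proof eventually_elim
        fix t assume "\<bar>q t\<bar> \<le> \<tau>" "t \<in> space leb_\<Omega>"
        then show "\<bar>q t * (1 / a t)\<bar> \<le> \<tau> * (1 / a t)" using a_pos[of t] by (simp add: abs_mult divide_right_mono)
      qed
    qed (intro ess_bounded_integrable ess_bounded_mult ess_bounded_const iab qb)+
    also have "\<dots> = \<tau> * J 1" unfolding J_def by (rule prim_cmult)
    finally have "\<bar>c * J 1\<bar> \<le> \<tau> * J 1" using prim_e[of 1] e1 by linarith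
    then show ?thesis using J1 by (simp add: abs_mult)
  qed
  have e_bound: "\<bar>e t\<bar> \<le> 2 * \<tau> / \<nu>" if i: "i < l" and t: "t \<in> {x i<..<x (Suc i)}" for i t
  proof -
    note ti = elem[OF i t]
    have "a t * e t = c + q t" by (simp add: q_def r0_def r_def)
    moreover have "\<bar>q t\<bar> \<le> \<tau>" unfolding q_def \<tau>_def using pde[of t] r0_bound[OF i t] by linarith
    ultimately have "\<bar>a t * e t\<bar> \<le> 2 * \<tau>" using c_bound by linarith
    moreover have "\<nu> * \<bar>e t\<bar> \<le> \<bar>a t * e t\<bar>" unfolding abs_mult using a_lower[OF ti] by (intro mult_right_mono) auto
    ultimately have "\<nu> * \<bar>e t\<bar> \<le> 2 * \<tau>" by linarith
    then show ?thesis using \<nu> by (simp add: field_simps)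
  qed
  have \<eta>2: "\<eta> \<le> C2 * (h * \<rho>)"
  proof -
    have "h * (h * \<rho>) \<le> 1 * (h * \<rho>)" using h0 \<rho>0 by (intro mult_right_mono) auto
    then have "C2 * (h * (h * \<rho>)) \<le> C2 * (h * \<rho>)" using C2_pos by simp
    then show ?thesis using \<eta> by linarith
  qed
  have \<tau>le: "2 * \<tau> / \<nu> \<le> K1 * (h * \<rho>)"
  proof -
    have "\<tau> \<le> (1 + D * C2) * (h * \<rho>)" unfolding \<tau>_def using mult_left_mono[OF \<eta>2 D0] by (simp add: algebra_simps)
    then have "\<tau> * (2 / \<nu>) \<le> (1 + D * C2) * (h * \<rho>) * (2 / \<nu>)" using \<nu> by (intro mult_right_mono) auto
    then show ?thesis by (simp add: K1_def ac_simps)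
  qed
  have E1: "E \<le> K1 * (h * \<rho>)" unfolding E_def
  proof (rule cSUP_least[OF Sne])
    fix t assume "t \<in> S"
    then obtain i where "i < l" "t \<in> {x i<..<x (Suc i)}" by (auto simp: S_def)
    from e_bound[OF this] \<tau>le show "\<bar>e t\<bar> \<le> K1 * (h * \<rho>)" by linarith
  qed
  \<comment> \<open>This is where the mesh has to be fine.\<close>
  have absorb: "K1 * (L + D) * h * E \<le> 1 / 2 * E" using mult_right_mono[OF h(2) E0] .
  have E2: "E \<le> 2 * K1 * A * G * h"
  proof -
    have "E \<le> K1 * h * (A * G) + K1 * (L + D) * h * E" using E1 by (simp add: \<rho>_def algebra_simps)
    then have "E \<le> 2 * (K1 * h * (A * G))" using absorb by linarith
    then show ?thesis by (simp add: ac_simps)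
  qed
  have \<rho>2: "\<rho> \<le> 2 * A * G"
  proof -
    have "(L + D) * E \<le> (L + D) * (2 * K1 * A * G * h)" using E2 L0 D0 by (intro mult_left_mono) auto
    also have "\<dots> = (K1 * (L + D) * h) * (2 * A * G)" by (simp add: ac_simps)
    also have "\<dots> \<le> 1 / 2 * (2 * A * G)" using h(2) A_pos G0 by (intro mult_right_mono) auto
    finally show ?thesis by (simp add: \<rho>_def)
  qed
  show "AE t in leb_\<Omega>. \<bar>g t - gh t\<bar> \<le> 2 * K1 * A * G * h"
    using EAE by eventually_elim (use E2 in \<open>simp add: e_def\<close>)
  \<comment> \<open>Up to a node, \<open>r0\<close> is integrated over whole elements, where its mean vanishes.\<close>
  define \<delta> where "\<delta> = (h * \<rho>) * (L / \<nu>\<^sup>2 * h) + D * \<eta> / \<nu>"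
  have node: "\<bar>prim e (x j)\<bar> \<le> 2 * \<delta>" if j: "j \<le> l" for j
  proof -
    have xj: "x j \<in> {0..1}" using x_range[OF j] by auto
    have qbound: "\<bar>prim (\<lambda>t. q t * (1 / a t)) (x i)\<bar> \<le> \<delta>" if i: "i \<le> l" for i
    proof -
      have xi: "x i \<in> {0..1}" using x_range[OF i] by auto
      have ib: "ess_bounded (\<lambda>t. r0 t * (1 / a t))" "ess_bounded (\<lambda>t. prim de t * (1 / a t))"
        by (intro ess_bounded_mult r0b iab ess_bounded_prim dei)+
      have "prim (\<lambda>t. q t * (1 / a t)) (x i) = prim (\<lambda>t. r0 t * (1 / a t)) (x i) + prim (\<lambda>t. prim de t * (1 / a t)) (x i)"
        unfolding q_def distrib_right by (rule prim_add) (use ib in auto)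
      moreover have "\<bar>prim (\<lambda>t. r0 t * (1 / a t)) (x i)\<bar> \<le> (h * \<rho>) * (L / \<nu>\<^sup>2 * h)"
      proof -
        have "\<bar>prim (\<lambda>t. r0 t * (1 / a t)) (x i)\<bar> \<le> (h * \<rho>) * (L / \<nu>\<^sup>2 * h) * x i"
        proof (rule weighted_mean_bound[OF r0i iab mean0 r0_bound])
          fix j s t assume i: "j < l" and s: "s \<in> {x j<..<x (Suc j)}" and t: "t \<in> {x j<..<x (Suc j)}"
          have "\<bar>1 / a s - 1 / a t\<bar> \<le> L / \<nu>\<^sup>2 * \<bar>s - t\<bar>" by (rule inv_a_diff[OF elem[OF i s] elem[OF i t]])
          also have "\<dots> \<le> L / \<nu>\<^sup>2 * h" using s t hstep[OF i] L0 by (intro mult_left_mono) auto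
          finally show "\<bar>1 / a s - 1 / a t\<bar> \<le> L / \<nu>\<^sup>2 * h" .
        qed (use i in auto)
        also have "\<dots> \<le> (h * \<rho>) * (L / \<nu>\<^sup>2 * h) * 1"
          using xi h0 \<rho>0 L0 by (intro mult_left_mono mult_nonneg_nonneg) auto
        finally show ?thesis by simp
      qed
      moreover have "\<bar>prim (\<lambda>t. prim de t * (1 / a t)) (x i)\<bar> \<le> D * \<eta> / \<nu>"
      proof -
        have "\<bar>prim (\<lambda>t. prim de t * (1 / a t)) (x i)\<bar> \<le> prim (\<lambda>t. D * \<eta> * (1 / a t)) (x i)"
        proof (rule prim_mono_bound)
          show "AE t in leb_\<Omega>. \<bar>prim de t * (1 / a t)\<bar> \<le> D * \<eta> * (1 / a t)"
          proof (rule AE_leb_\<Omega>I)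
            fix t :: real assume "0 < t" "t < 1"
            then have "0 < a t" using a_pos[of t] by simp
            then show "\<bar>prim de t * (1 / a t)\<bar> \<le> D * \<eta> * (1 / a t)" using pde[of t] by (simp add: abs_mult divide_right_mono)
          qed
        qed (intro ess_bounded_integrable ess_bounded_mult ess_bounded_const iab ess_bounded_prim dei)+
        also have "\<dots> = D * \<eta> * J (x i)" unfolding J_def by (rule prim_cmult)
        also have "\<dots> \<le> D * \<eta> * (1 / \<nu>)"
          using prim_inv_a(2)[of "x i"] Jle D0 \<eta>0 by (intro mult_left_mono) (auto simp: J_def)
        finally show ?thesis by simp
      qed
      ultimately show ?thesis unfolding \<delta>_def by linarith
    qed
    have "\<bar>c * J 1\<bar> \<le> \<delta>" using prim_e[of 1] e1 qbound[of l] xl by simp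
    moreover have "\<bar>c * J (x j)\<bar> \<le> \<bar>c * J 1\<bar>"
      unfolding abs_mult J_def using prim_inv_a[of "x j"] xj by (intro mult_left_mono) auto
    ultimately have "\<bar>c * J (x j)\<bar> \<le> \<delta>" by linarith
    then show ?thesis using prim_e[of "x j"] qbound[OF j] by linarith
  qed
  have \<delta>le: "\<delta> \<le> (2 * A * (L / \<nu>\<^sup>2) + D * (2 * A * C2) / \<nu>) * G * h\<^sup>2"
  proof -
    have 1: "(h * \<rho>) * (L / \<nu>\<^sup>2 * h) \<le> (h * (2 * A * G)) * (L / \<nu>\<^sup>2 * h)"
      using \<rho>2 h0 L0 by (intro mult_right_mono mult_left_mono mult_nonneg_nonneg) auto
    have "\<eta> \<le> C2 * (h * (h * (2 * A * G)))"
    proof -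
      have "C2 * (h * (h * \<rho>)) \<le> C2 * (h * (h * (2 * A * G)))"
        using \<rho>2 h0 C2_pos by (intro mult_left_mono) auto
      then show ?thesis using \<eta> by linarith
    qed
    then have 2: "D * \<eta> / \<nu> \<le> D * (C2 * (h * (h * (2 * A * G)))) / \<nu>"
      using D0 \<nu> by (intro divide_right_mono mult_left_mono) auto
    have "\<delta> \<le> (h * (2 * A * G)) * (L / \<nu>\<^sup>2 * h) + D * (C2 * (h * (h * (2 * A * G)))) / \<nu>"
      unfolding \<delta>_def using 1 2 by linarith
    also have "\<dots> = (2 * A * (L / \<nu>\<^sup>2) + D * (2 * A * C2) / \<nu>) * G * h\<^sup>2"
      by (simp add: power2_eq_square distrib_right distrib_left ac_simps)
    finally show ?thesis .
  qed
  show "\<bar>prim g t - prim gh t\<bar> \<le> K2 * G * h\<^sup>2" if t: "t \<in> {0..1}"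
  proof -
    have "\<exists>i\<le>l. \<bar>t - x i\<bar> \<le> h"
    proof (cases "t = 1")
      case True then show ?thesis using xl h0 by (intro exI[of _ l]) auto
    next
      case False
      then obtain i where "i < l" "x i \<le> t" "t < x (Suc i)" using element_exists[of t] t by auto
      then show ?thesis using hstep[of i] by (intro exI[of _ i]) auto
    qed
    then obtain i where i: "i \<le> l" "\<bar>t - x i\<bar> \<le> h" by blast
    have "\<bar>prim e t - prim e (x i)\<bar> \<le> E * \<bar>t - x i\<bar>"
      by (rule prim_lipschitz[OF ei EAE]) (use t x_range[OF i(1)] in auto)
    also have "\<dots> \<le> (2 * K1 * A * G * h) * h" using E2 E0 i(2) by (intro mult_mono') auto
    finally have "\<bar>prim e t\<bar> \<le> 2 * \<delta> + 2 * K1 * A * G * h * h" using node[OF i(1)] by linarith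
    also have "\<dots> \<le> 2 * ((2 * A * (L / \<nu>\<^sup>2) + D * (2 * A * C2) / \<nu>) * G * h\<^sup>2) + 2 * K1 * A * G * h * h"
      using \<delta>le by linarith
    also have "\<dots> = K2 * G * h\<^sup>2"
    proof -
      have "2 * (M * G * h\<^sup>2) + 2 * K1 * A * G * h * h = (2 * M + 2 * K1 * A) * G * h\<^sup>2" for M
        by (simp add: power2_eq_square algebra_simps)
      then show ?thesis unfolding K2_def .
    qed
    finally show ?thesis unfolding e_def using H_D(3)[OF gH] H_D(3)[OF ghH] by (simp add: prim_diff)
  qed
qed

text \<open>
  Regularity makes the derivative of the exact solution Lipschitz continuous, with a constant proportional
  to the bound \<open>F\<close> of the data. The estimate is uniform in the data because it is later applied
  to the unknown discrete controls.
\<close>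

theorem finite_element_error:
  obtains C h0 where "0 < C" "0 < h0" "h0 \<le> 1"
    "\<And>l x f F g gh. grid l x \<Longrightarrow> mesh_width l x \<le> h0 \<Longrightarrow> ess_bounded f \<Longrightarrow> AE t in leb_\<Omega>. \<bar>f t\<bar> \<le> F \<Longrightarrow>
      sol H f g \<Longrightarrow> sol (mesh.pwc l x) f gh \<Longrightarrow>
      (AE t in leb_\<Omega>. \<bar>g t - gh t\<bar> \<le> C * F * mesh_width l x) \<and>
      (\<forall>t\<in>{0..1}. \<bar>prim g t - prim gh t\<bar> \<le> C * F * (mesh_width l x)\<^sup>2)"
proof -
  define C where "C = max (2 * K1 * A * C2) (K2 * C2) + 1"
  define h0 where "h0 = min 1 (1 / (2 * K1 * (L + D + 1)))"
  have LD: "0 < K1 * (L + D + 1)" using L0 D0 K1_pos by (intro mult_pos_pos) auto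
  have K1A: "0 \<le> 2 * K1 * A * C2" using K1_pos A_pos C2_pos by simp
  have C: "0 < C" "2 * K1 * A * C2 \<le> C" "K2 * C2 \<le> C" using K1A unfolding C_def by linarith+
  have h0: "0 < h0" "h0 \<le> 1" using LD by (auto simp: h0_def)
  show thesis
  proof (rule that[OF C(1) h0])
    fix l x f F g gh
    assume grid: "grid l x" and h: "mesh_width l x \<le> h0" and f: "ess_bounded f" and F: "AE t in leb_\<Omega>. \<bar>f t\<bar> \<le> F"
      and g: "sol H f g" and gh: "sol (mesh.pwc l x) f gh"
    interpret mesh l x by standard fact
    define h where "h = mesh_width l x"
    have hpos: "0 < h" using mesh_width_pos by (simp add: h_def)
    have F0: "0 \<le> F"
    proof -
      have "AE t in leb_\<Omega>. 0 \<le> F" using F by eventually_elim auto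
      then show ?thesis by (simp add: leb.AE_const)
    qed
    have small: "K1 * (L + D) * h \<le> 1 / 2"
    proof -
      have "K1 * (L + D) * h \<le> K1 * (L + D + 1) * h" using K1_pos hpos by (intro mult_right_mono mult_left_mono) auto
      also have "\<dots> \<le> K1 * (L + D + 1) * (1 / (2 * K1 * (L + D + 1)))"
        using h LD by (intro mult_left_mono) (auto simp: h_def h0_def)
      also have "\<dots> = 1 / 2" using LD by (simp add: field_simps)
      finally show ?thesis .
    qed
    obtain g' where g': "sol H f g'" "continuous_on {0..1} g'"
      and lip: "\<forall>s\<in>{0..1}. \<forall>t\<in>{0..1}. \<bar>g' s - g' t\<bar> \<le> C2 * F * \<bar>s - t\<bar>"
      using sol_H_lipschitz[OF f F] by (elim exE conjE) (rule that)
    have eq: "AE t in leb_\<Omega>. g t = g' t" "prim g = prim g'"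
      by (rule sol_unique[OF subset_refl H_comb g g'(1) ess_bounded_integrable[OF f]]; assumption)+
    have H: "g' \<in> H" "gh \<in> H" "gh \<in> pwc" using g' gh pwc_H by (auto simp: sol_def)
    have orth: "form (\<lambda>t. g' t - gh t) k = 0" if k: "k \<in> pwc" for k
      using form_diff[OF H(1,2), of k] g'(1) gh k pwc_H by (auto simp: sol_def)
    have err1: "AE t in leb_\<Omega>. \<bar>g' t - gh t\<bar> \<le> 2 * K1 * A * (C2 * F) * h"
      by (rule galerkin_error(1)[OF grid h_def[symmetric] small H(1,3) orth g'(2)]) (use lip in auto)
    have err2: "\<bar>prim g' t - prim gh t\<bar> \<le> K2 * (C2 * F) * h\<^sup>2" if t: "t \<in> {0..1}" for t
      by (rule galerkin_error(2)[OF grid h_def[symmetric] small H(1,3) orth g'(2) _ t]) (use lip in auto)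
    have b1: "2 * K1 * A * (C2 * F) * h \<le> C * F * h"
      using mult_right_mono[OF mult_right_mono[OF C(2) F0], of h] hpos by (simp add: ac_simps)
    have b2: "K2 * (C2 * F) * h\<^sup>2 \<le> C * F * h\<^sup>2"
      using mult_right_mono[OF mult_right_mono[OF C(3) F0], of "h\<^sup>2"] by (simp add: ac_simps)
    have "AE t in leb_\<Omega>. \<bar>g t - gh t\<bar> \<le> C * F * h" using eq(1) err1 by eventually_elim (use b1 in auto)
    moreover have "\<forall>t\<in>{0..1}. \<bar>prim g t - prim gh t\<bar> \<le> C * F * h\<^sup>2"
      unfolding eq(2) using err2 b2 by force
    ultimately show "(AE t in leb_\<Omega>. \<bar>g t - gh t\<bar> \<le> C * F * mesh_width l x) \<and>
      (\<forall>t\<in>{0..1}. \<bar>prim g t - prim gh t\<bar> \<le> C * F * (mesh_width l x)\<^sup>2)" by (simp add: h_def)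
  qed
qed

end

section \<open>Optimality conditions\<close>

lemma nonpos_of_quadratic:
  fixes X Y :: real
  assumes "\<And>\<tau>. 0 < \<tau> \<Longrightarrow> \<tau> \<le> 1 \<Longrightarrow> \<tau> * X \<le> \<tau>\<^sup>2 * Y" shows "X \<le> 0"
proof (rule ccontr)
  assume "\<not> X \<le> 0"
  then have X: "0 < X" by simp
  define \<tau> where "\<tau> = min 1 (X / (2 * (\<bar>Y\<bar> + 1)))"
  have \<tau>: "0 < \<tau>" "\<tau> \<le> 1" using X by (auto simp: \<tau>_def)
  have "\<tau> * X \<le> \<tau> * (\<tau> * Y)" using assms[OF \<tau>] by (simp add: power2_eq_square mult.assoc)
  then have "X \<le> \<tau> * Y" using \<tau> by simp
  also have "\<dots> \<le> \<tau> * (\<bar>Y\<bar> + 1)" using \<tau> by (intro mult_left_mono) auto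
  also have "\<dots> \<le> X / (2 * (\<bar>Y\<bar> + 1)) * (\<bar>Y\<bar> + 1)"
    by (intro mult_right_mono) (auto simp: \<tau>_def)
  also have "\<dots> = X / 2" by (simp add: field_simps)
  finally show False using X by simp
qed

context trial_space
begin

text \<open>
  The cost in terms of the derivative of the state, free of choice operators.
\<close>

lemma cost_eq:
  assumes q: "ess_bounded q" and ud: "ess_bounded ud" and g: "sol G q g"
  shows "cost a d W ud \<alpha> q = 1 / 2 * (LINT t|leb_\<Omega>. (prim g t - ud t)\<^sup>2) + \<alpha> * deriv_tv q"
proof -
  have s: "ess_bounded (state a d W q)"
    by (rule ess_bounded_AE_cong[OF sol_prim_bounded[OF g]]) (use state_AE[OF q g] in \<open>simp add: eq_commute\<close>)
  have [measurable]: "state a d W q \<in> borel_measurable leb_\<Omega>" "prim g \<in> borel_measurable leb_\<Omega>" "ud \<in> borel_measurable leb_\<Omega>"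
    using s sol_prim_bounded[OF g] ud by auto
  have "(L2_norm (\<lambda>t. state a d W q t - ud t))\<^sup>2 = (LINT t|leb_\<Omega>. (state a d W q t - ud t) * (state a d W q t - ud t))"
    unfolding L2_norm_def L2_inner_def by (rule real_sqrt_pow2) (rule integral_nonneg_AE, simp)
  also have "\<dots> = (LINT t|leb_\<Omega>. (prim g t - ud t)\<^sup>2)"
  proof (rule integral_cong_AE)
    show "AE t in leb_\<Omega>. (state a d W q t - ud t) * (state a d W q t - ud t) = (prim g t - ud t)\<^sup>2"
      using state_AE[OF q g] by eventually_elim (simp add: power2_eq_square)
  qed measurable
  finally show ?thesis by (simp add: cost_def)
qed

text \<open>
  Symmetry of the form moves the solution operator from one factor to the other.
\<close>

lemma adjoint_pairing:
  assumes k: "sol G f k" and g: "sol G p g"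
  shows "(LINT t|leb_\<Omega>. f t * prim g t) = (LINT t|leb_\<Omega>. p t * prim k t)"
  using k g form_commute[of k g] by (simp add: sol_def)

text \<open>
  Comparison of \<open>q\<close> with \<open>(1 + \<rho>) q + s p\<close>. Scaling by a nonnegative factor
  scales the total variation exactly, while the variation of \<open>s p\<close> is estimated by the triangle
  inequality; the tracking term is expanded and its linear part is rewritten with the adjoint state.
\<close>

lemma variation_inequality:
  assumes opt: "optimal_control a d W ud \<alpha> q" and ud: "ess_bounded ud" and \<alpha>: "0 < \<alpha>"
    and g: "sol G q g" and k: "sol G (\<lambda>t. prim g t - ud t) k" and p: "p \<in> BV" and gp: "sol G p gp"
    and \<rho>: "- 1 \<le> \<rho>"
  shows "0 \<le> \<rho> * ((LINT t|leb_\<Omega>. q t * prim k t) + \<alpha> * deriv_tv q) + s * (LINT t|leb_\<Omega>. p t * prim k t) + \<alpha> * \<bar>s\<bar> * deriv_tv p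
    + 1 / 2 * (LINT t|leb_\<Omega>. (\<rho> * prim g t + s * prim gp t)\<^sup>2)"
proof -
  have q: "q \<in> BV" using opt by (simp add: optimal_control_def)
  note qb = BV_ess_bounded[OF q] and pb = BV_ess_bounded[OF p]
  define q' where "q' t = (1 + \<rho>) * q t + s * p t" for t
  define g' where "g' t = (1 + \<rho>) * g t + s * gp t" for t
  have r: "0 \<le> 1 + \<rho>" using \<rho> by simp
  have q': "q' \<in> BV" and tv: "deriv_tv q' \<le> (1 + \<rho>) * deriv_tv q + \<bar>s\<bar> * deriv_tv p"
    unfolding q'_def[abs_def] by (rule BV_comb[OF q p r])+
  have g': "sol G q' g'" unfolding q'_def[abs_def] g'_def[abs_def] by (rule sols_comb[OF g gp qb pb])
  have gi: "integrable leb_\<Omega> g" "integrable leb_\<Omega> gp" using sol_H[OF g] sol_H[OF gp] by (auto dest: H_D(3))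
  have pg': "prim g' t = (1 + \<rho>) * prim g t + s * prim gp t" for t
    unfolding g'_def using gi by (subst prim_add) (auto simp: prim_cmult)
  note yb = sol_prim_bounded[OF g] sol_prim_bounded[OF gp]
  define w where "w t = \<rho> * prim g t + s * prim gp t" for t
  have wb: "ess_bounded w" unfolding w_def[abs_def] by (intro ess_bounded_add ess_bounded_mult ess_bounded_const yb)
  have rb: "ess_bounded (\<lambda>t. prim g t - ud t)" by (intro ess_bounded_diff yb ud)
  have "cost a d W ud \<alpha> q \<le> cost a d W ud \<alpha> q'" using opt q' by (simp add: optimal_control_def)
  then have "1 / 2 * (LINT t|leb_\<Omega>. (prim g t - ud t)\<^sup>2) + \<alpha> * deriv_tv q \<le>
     1 / 2 * (LINT t|leb_\<Omega>. (prim g' t - ud t)\<^sup>2) + \<alpha> * deriv_tv q'"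
    unfolding cost_eq[OF qb ud g] cost_eq[OF BV_ess_bounded[OF q'] ud g'] .
  moreover have "\<alpha> * deriv_tv q' \<le> \<alpha> * ((1 + \<rho>) * deriv_tv q + \<bar>s\<bar> * deriv_tv p)" using tv \<alpha> by simp
  moreover have "(LINT t|leb_\<Omega>. (prim g' t - ud t)\<^sup>2) =
     (LINT t|leb_\<Omega>. (prim g t - ud t)\<^sup>2) + 2 * (LINT t|leb_\<Omega>. (prim g t - ud t) * w t) + (LINT t|leb_\<Omega>. (w t)\<^sup>2)"
  proof -
    have "(LINT t|leb_\<Omega>. (prim g' t - ud t)\<^sup>2) =
      (LINT t|leb_\<Omega>. ((prim g t - ud t)\<^sup>2 + 2 * ((prim g t - ud t) * w t)) + (w t)\<^sup>2)"
      by (rule Bochner_Integration.integral_cong) (auto simp: pg' w_def power2_eq_square algebra_simps)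
    moreover have b: "ess_bounded (\<lambda>t. (prim g t - ud t)\<^sup>2)" "ess_bounded (\<lambda>t. 2 * ((prim g t - ud t) * w t))" "ess_bounded (\<lambda>t. (w t)\<^sup>2)"
      unfolding power2_eq_square by (intro ess_bounded_mult ess_bounded_const rb wb)+
    ultimately show ?thesis
      using Bochner_Integration.integral_add[OF ess_bounded_integrable[OF ess_bounded_add[OF b(1,2)]] ess_bounded_integrable[OF b(3)]]
        Bochner_Integration.integral_add[OF ess_bounded_integrable[OF b(1)] ess_bounded_integrable[OF b(2)]]
      by simp
  qed
  moreover have "(LINT t|leb_\<Omega>. (prim g t - ud t) * w t) = \<rho> * (LINT t|leb_\<Omega>. q t * prim k t) + s * (LINT t|leb_\<Omega>. p t * prim k t)"
  proof -
    have "(LINT t|leb_\<Omega>. (prim g t - ud t) * w t) =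
       (LINT t|leb_\<Omega>. \<rho> * ((prim g t - ud t) * prim g t) + s * ((prim g t - ud t) * prim gp t))"
      by (simp add: w_def algebra_simps)
    also have "\<dots> = \<rho> * (LINT t|leb_\<Omega>. (prim g t - ud t) * prim g t) + s * (LINT t|leb_\<Omega>. (prim g t - ud t) * prim gp t)"
    proof -
      have "ess_bounded (\<lambda>t. (prim g t - ud t) * prim g t)" "ess_bounded (\<lambda>t. (prim g t - ud t) * prim gp t)"
        by (intro ess_bounded_mult rb yb)+
      then show ?thesis by (simp add: ess_bounded_integrable)
    qed
    finally show ?thesis unfolding adjoint_pairing[OF k g] adjoint_pairing[OF k gp] .
  qed
  moreover have "(LINT t|leb_\<Omega>. (\<rho> * prim g t + s * prim gp t)\<^sup>2) = (LINT t|leb_\<Omega>. (w t)\<^sup>2)" by (simp add: w_def)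
  ultimately show ?thesis by (simp add: algebra_simps)
qed

text \<open>
  Shrinking \<open>q\<close> gives the first inequality, adding small multiples of \<open>p\<close> and of
  \<open>- p\<close> the second. Together they say that minus the adjoint state is a subgradient of the
  regularizer at \<open>q\<close>.
\<close>

lemma optimality:
  assumes opt: "optimal_control a d W ud \<alpha> q" and ud: "ess_bounded ud" and \<alpha>: "0 < \<alpha>"
    and g: "sol G q g" and k: "sol G (\<lambda>t. prim g t - ud t) k"
  shows "(LINT t|leb_\<Omega>. q t * prim k t) + \<alpha> * deriv_tv q \<le> 0"
    and "p \<in> BV \<Longrightarrow> \<bar>LINT t|leb_\<Omega>. p t * prim k t\<bar> \<le> \<alpha> * deriv_tv p"
proof -
  have q: "q \<in> BV" using opt by (simp add: optimal_control_def)
  note var = variation_inequality[OF opt ud \<alpha> g k]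
  show "(LINT t|leb_\<Omega>. q t * prim k t) + \<alpha> * deriv_tv q \<le> 0"
  proof (rule nonpos_of_quadratic)
    fix \<tau> :: real assume \<tau>: "0 < \<tau>" "\<tau> \<le> 1"
    have "(LINT t|leb_\<Omega>. (- \<tau> * prim g t + 0 * prim g t)\<^sup>2) = \<tau>\<^sup>2 * (LINT t|leb_\<Omega>. (prim g t)\<^sup>2)"
      by (simp add: power_mult_distrib)
    then show "\<tau> * ((LINT t|leb_\<Omega>. q t * prim k t) + \<alpha> * deriv_tv q) \<le> \<tau>\<^sup>2 * (1 / 2 * (LINT t|leb_\<Omega>. (prim g t)\<^sup>2))"
      using var[OF q g, of "- \<tau>" 0] \<tau> by simp
  qed
  show "\<bar>LINT t|leb_\<Omega>. p t * prim k t\<bar> \<le> \<alpha> * deriv_tv p" if p: "p \<in> BV"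
  proof -
    obtain gp where gp: "sol G p gp" using sol_exists[OF BV_ess_bounded[OF p]] by blast
    define I where "I = (LINT t|leb_\<Omega>. p t * prim k t)"
    define Y where "Y = (LINT t|leb_\<Omega>. (prim gp t)\<^sup>2)"
    have *: "\<sigma> * I - \<alpha> * deriv_tv p \<le> 0" if \<sigma>: "\<bar>\<sigma>\<bar> = 1" for \<sigma>
    proof (rule nonpos_of_quadratic)
      fix \<tau> :: real assume \<tau>: "0 < \<tau>" "\<tau> \<le> 1"
      have "\<sigma>\<^sup>2 = 1" using \<sigma> by (metis power2_abs one_power2)
      then have e1: "(LINT t|leb_\<Omega>. (0 * prim g t + (- \<tau> * \<sigma>) * prim gp t)\<^sup>2) = \<tau>\<^sup>2 * Y"
        by (simp add: power_mult_distrib Y_def)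
      have e2: "\<bar>- \<tau> * \<sigma>\<bar> = \<tau>" using \<tau> \<sigma> by (simp add: abs_mult)
      have "(- 1 :: real) \<le> 0" by simp
      from var[OF p gp this, of "- \<tau> * \<sigma>", unfolded I_def[symmetric] e1 e2]
      show "\<tau> * (\<sigma> * I - \<alpha> * deriv_tv p) \<le> \<tau>\<^sup>2 * (1 / 2 * Y)" by (simp add: algebra_simps)
    qed
    show ?thesis using *[of 1] *[of "-1"] by (simp add: I_def abs_le_iff)
  qed
qed

text \<open>
  Constant controls have no variation.
\<close>

lemma adjoint_mean_zero:
  assumes "optimal_control a d W ud \<alpha> q" "ess_bounded ud" "0 < \<alpha>" "sol G q g" "sol G (\<lambda>t. prim g t - ud t) k"
  shows "(LINT t|leb_\<Omega>. prim k t) = 0"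
  using optimality(2)[OF assms BV_const[of 1]] by (simp add: deriv_tv_const)

text \<open>
  Jump functions have variation at most one, and the pairing of a jump with the adjoint state is minus the
  switching function, because the adjoint state has mean zero.
\<close>

lemma switching_function_bound:
  assumes opt: "optimal_control a d W ud \<alpha> q" "ess_bounded ud" "0 < \<alpha>" "sol G q g" "sol G (\<lambda>t. prim g t - ud t) k"
    and x: "x \<in> \<Omega>"
  shows "\<bar>prim (prim k) x\<bar> \<le> \<alpha>"
proof -
  have kb: "ess_bounded (prim k)" by (rule sol_prim_bounded[OF opt(5)])
  note ki = ess_bounded_integrable[OF kb]
  have "(LINT t|leb_\<Omega>. indicator {x<..<1} t * prim k t) = (LINT t|leb_\<Omega>. prim k t - indicator {..<x} t * prim k t)"
  proof (rule integral_cong_AE)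
    have "AE t in leb_\<Omega>. t \<noteq> x" unfolding AE_leb_\<Omega>_iff
      using AE_completion[OF AE_lborel_singleton[of x]] by eventually_elim auto
    then show "AE t in leb_\<Omega>. indicator {x<..<1} t * prim k t = prim k t - indicator {..<x} t * prim k t"
      using AE_space by eventually_elim (auto simp: indicator_def)
  qed (use ki in \<open>auto intro!: borel_measurable_integrable Bochner_Integration.integrable_diff integrable_ind\<close>)
  also have "\<dots> = - prim (prim k) x"
    unfolding prim_def[of "prim k"] using ki integrable_ind[OF _ ki] adjoint_mean_zero[OF opt]
    by (subst Bochner_Integration.integral_diff) auto
  finally have "\<bar>prim (prim k) x\<bar> \<le> \<alpha> * deriv_tv (indicator {x<..<1})"
    using optimality(2)[OF opt BV_jump[OF x]] by simp
  also have "\<dots> \<le> \<alpha>" using deriv_tv_jump[OF x] opt(3) by simp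
  finally show ?thesis .
qed

text \<open>
  The first optimality condition says that the derivative measure of \<open>q\<close> attains equality in
  the bound of its pairing with the switching function, so it is concentrated where the switching function
  has modulus \<open>\<alpha>\<close>. The constant \<open>c\<close> is the value of \<open>q\<close> to the
  left of all jumps.
\<close>

lemma optimal_control_structure:
  assumes opt: "optimal_control a d W ud \<alpha> q" "ess_bounded ud" "0 < \<alpha>" "sol G q g" "sol G (\<lambda>t. prim g t - ud t) k"
  shows "\<exists>c. (AE t in leb_\<Omega>. \<bar>q t - c\<bar> \<le> deriv_tv q) \<and>
    (\<forall>\<xi> m. inj_on \<xi> {1..m} \<longrightarrow> \<xi> ` {1..m} \<subseteq> \<Omega> \<longrightarrow> {t \<in> \<Omega>. \<bar>prim (prim k) t\<bar> = \<alpha>} \<subseteq> \<xi> ` {1..m} \<longrightarrow>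
      (\<exists>b. (AE t in leb_\<Omega>. q t = step_fun m c b \<xi> t) \<and> (\<forall>i\<in>{1..m}. \<bar>b i\<bar> \<le> deriv_tv q)))"
proof -
  have "q \<in> BV" using opt(1) by (simp add: optimal_control_def)
  then obtain M N c where MN: "finite_borel_measure_\<Omega> M" "finite_borel_measure_\<Omega> N"
    "AE t in leb_\<Omega>. q t = c + mcdf M t - mcdf N t" "deriv_tv q = tv_norm (M, N)"
    by (rule BV_obtain_measures)
  define \<Phi> where "\<Phi> = prim (prim k)"
  have kb: "ess_bounded (prim k)" by (rule sol_prim_bounded[OF opt(5)])
  note ki = ess_bounded_integrable[OF kb]
  have \<Phi>m: "\<Phi> \<in> borel_measurable borel" unfolding \<Phi>_def
    by (rule borel_measurable_continuous_onI) (rule continuous_prim[OF ki])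
  have \<Phi>b: "\<bar>\<Phi> t\<bar> \<le> \<alpha>" if "t \<in> \<Omega>" for t unfolding \<Phi>_def by (rule switching_function_bound[OF opt that])
  note mean = adjoint_mean_zero[OF opt]
  have "(LINT t|leb_\<Omega>. q t * prim k t) = (LINT t|leb_\<Omega>. c * prim k t + (prim k t * mcdf M t - prim k t * mcdf N t))"
  proof (rule integral_cong_AE)
    have mb: "ess_bounded (mcdf M)" "ess_bounded (mcdf N)" using MN ess_bounded_mcdf by auto
    show "(\<lambda>t. q t * prim k t) \<in> borel_measurable leb_\<Omega>"
      using BV_ess_bounded[OF \<open>q \<in> BV\<close>] kb by (intro ess_bounded_measurable ess_bounded_mult)
    show "(\<lambda>t. c * prim k t + (prim k t * mcdf M t - prim k t * mcdf N t)) \<in> borel_measurable leb_\<Omega>"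
      by (intro ess_bounded_measurable ess_bounded_add ess_bounded_diff ess_bounded_mult ess_bounded_const kb mb)
    show "AE t in leb_\<Omega>. q t * prim k t = c * prim k t + (prim k t * mcdf M t - prim k t * mcdf N t)"
      using MN(3) by eventually_elim (erule ssubst, simp (no_asm) add: algebra_simps)
  qed
  also have "\<dots> = (LINT t|leb_\<Omega>. prim k t * mcdf M t) - (LINT t|leb_\<Omega>. prim k t * mcdf N t)"
  proof -
    have "ess_bounded (\<lambda>t. prim k t * mcdf M t)" "ess_bounded (\<lambda>t. prim k t * mcdf N t)"
      by (intro ess_bounded_mult kb ess_bounded_mcdf MN)+
    then show ?thesis using ki mean by (simp add: ess_bounded_integrable)
  qed
  also have "\<dots> = - ((LINT s|M. \<Phi> s) - (LINT s|N. \<Phi> s))"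
    using mcdf_pairing[OF MN(1) ki mean] mcdf_pairing[OF MN(2) ki mean] by (simp add: \<Phi>_def)
  finally have ext: "\<alpha> * tv_norm (M, N) \<le> (LINT s|M. \<Phi> s) - (LINT s|N. \<Phi> s)"
    using optimality(1)[OF opt, unfolded MN(4)] by linarith
  show ?thesis
  proof (intro exI[of _ c] conjI allI impI)
    show "AE t in leb_\<Omega>. \<bar>q t - c\<bar> \<le> deriv_tv q"
      using MN(3)
    proof eventually_elim
      fix t assume "q t = c + mcdf M t - mcdf N t"
      then show "\<bar>q t - c\<bar> \<le> deriv_tv q"
        using tv_norm_measure_diff[OF MN(1,2) sets_lessThan_\<Omega>, of t] MN(4) by (simp add: mcdf_def)
    qed
    fix \<xi> :: "nat \<Rightarrow> real" and m
    assume \<xi>: "inj_on \<xi> {1..m}" "\<xi> ` {1..m} \<subseteq> \<Omega>" and sub: "{t \<in> \<Omega>. \<bar>prim (prim k) t\<bar> = \<alpha>} \<subseteq> \<xi> ` {1..m}"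
    have conc: "measure M A = measure N A" if A: "A \<in> sets borel_\<Omega>" "A \<inter> \<xi> ` {1..m} = {}" for A
    proof (rule concentration[OF MN(1,2) \<Phi>m \<Phi>b _ ext A(1)])
      fix t assume t: "t \<in> A"
      have "A \<subseteq> \<Omega>" using A(1) borel_\<Omega>_sets_iff by blast
      then show "\<bar>\<Phi> t\<bar> \<noteq> \<alpha>" using t sub A(2) unfolding \<Phi>_def by blast
    qed (use opt(3) in auto)
    define b where "b i = measure M {\<xi> i} - measure N {\<xi> i}" for i
    show "\<exists>b. (AE t in leb_\<Omega>. q t = step_fun m c b \<xi> t) \<and> (\<forall>i\<in>{1..m}. \<bar>b i\<bar> \<le> deriv_tv q)"
    proof (intro exI[of _ b] conjI ballI)
      show "AE t in leb_\<Omega>. q t = step_fun m c b \<xi> t"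
        using MN(3) AE_space
      proof eventually_elim
        fix t assume t: "q t = c + mcdf M t - mcdf N t" "t \<in> space leb_\<Omega>"
        then have "t \<in> \<Omega>" by simp
        from concentrated_imp_step[OF MN(1,2) \<xi> conc this, of c] t(1) show "q t = step_fun m c b \<xi> t"
          by (simp add: b_def[abs_def])
      qed
      fix i assume "i \<in> {1..m}"
      then have "\<xi> i \<in> \<Omega>" using \<xi>(2) by blast
      then have "{\<xi> i} \<in> sets borel_\<Omega>" by (simp add: borel_\<Omega>_sets_iff)
      from tv_norm_measure_diff[OF MN(1,2) this] MN(4) show "\<bar>b i\<bar> \<le> deriv_tv q" by (simp add: b_def)
    qed
  qed
qed

end

section \<open>A priori bounds and convergence of the controls\<close>

text \<open>
  The continuous problem and all its discretizations share these data.
\<close>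

locale control_problem = elliptic +
  fixes ud :: "real \<Rightarrow> real" and \<alpha> U :: real
  assumes \<alpha>: "0 < \<alpha>" and ud_measurable: "ud \<in> borel_measurable leb_\<Omega>" and ud_bound: "AE t in leb_\<Omega>. \<bar>ud t\<bar> \<le> U"
begin

lemma ud: "ess_bounded ud" using ud_measurable ud_bound by (rule ess_bounded_AE_I)

lemma U0: "0 \<le> U"
proof -
  have "AE t in leb_\<Omega>. 0 \<le> U" using ud_bound by eventually_elim auto
  then show ?thesis by (simp add: leb.AE_const)
qed

lemma integral_abs_le_const:
  fixes f :: "real \<Rightarrow> real"
  assumes "integrable leb_\<Omega> f" "AE t in leb_\<Omega>. \<bar>f t\<bar> \<le> B" shows "(LINT t|leb_\<Omega>. \<bar>f t\<bar>) \<le> B"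
proof -
  have "(LINT t|leb_\<Omega>. \<bar>f t\<bar>) \<le> (LINT t|leb_\<Omega>. B)" by (rule integral_mono_AE) (use assms in auto)
  then show ?thesis using leb.prob_space by simp
qed

text \<open>
  A vanishing state makes the control orthogonal to all test functions.
\<close>

lemma sol_injective:
  assumes p: "ess_bounded p" and g: "sol H p g" and z: "AE t in leb_\<Omega>. prim g t = 0"
  shows "AE t in leb_\<Omega>. p t = 0"
proof (rule AE_zero_if_orthogonal_to_test_functions)
  show "locally_L1 p" using p by (intro integrable_imp_locally_L1) auto
  have gH: "g \<in> H" using g by (simp add: sol_def)
  have "(LINT t|leb_\<Omega>. p t * prim g t) = 0" by (rule integral_eq_zero_AE) (use z in eventually_elim, simp)
  then have "form g g = 0" using g gH by (simp add: sol_def)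
  then have g0: "AE t in leb_\<Omega>. g t = 0" by (intro form_zero[OF gH]) simp
  fix \<phi> assume \<phi>: "test_function \<phi>"
  have H: "deriv \<phi> \<in> H"
    using ess_bounded_in_L2[OF test_function_deriv_ess_bounded[OF \<phi>]] test_function_integral_deriv[OF \<phi>]
    by (simp add: H_def prim_1)
  have "L2_inner p \<phi> = (LINT t|leb_\<Omega>. p t * prim (deriv \<phi>) t)"
    unfolding L2_inner_def by (rule Bochner_Integration.integral_cong) (use test_function_prim_deriv[OF \<phi>] in auto)
  also have "\<dots> = form g (deriv \<phi>)" using g H by (simp add: sol_def)
  also have "\<dots> = 0" using form_AE_zero[OF g0] by (simp add: form_commute[of g])
  finally show "L2_inner p \<phi> = 0" .
qed

text \<open>
  The mean of the state of the constant control one is the energy of that state.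
\<close>

lemma sol_one_mean_pos:
  assumes g: "sol H (\<lambda>_. 1) g" shows "0 < (LINT t|leb_\<Omega>. prim g t)"
proof -
  have gH: "g \<in> H" using g by (simp add: sol_def)
  have eq: "(LINT t|leb_\<Omega>. prim g t) = form g g" using g gH by (simp add: sol_def)
  have "\<not> form g g \<le> 0"
  proof
    assume "form g g \<le> 0"
    then have "AE t in leb_\<Omega>. g t = 0" by (rule form_zero[OF gH])
    then have "AE t in leb_\<Omega>. prim g t = 0" by (simp add: prim_AE_zero)
    then have "AE t in leb_\<Omega>. (1::real) = 0" by (rule sol_injective[OF ess_bounded_const g])
    then show False by simp
  qed
  then show ?thesis using eq by simp
qed

text \<open>
  Comparison with the zero control bounds the variation of \<open>qh\<close> and the distance of its state
  to the desired state. The variation only bounds \<open>qh\<close> up to an additive constant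
  \<open>c\<close>. As the state of \<open>qh\<close> is bounded, so is the state of \<open>c\<close>, and
  on fine meshes the state of the constant one has mean bounded away from zero, which bounds
  \<open>c\<close>.
\<close>

lemma uniform_bounds:
  obtains Q V h1 where "0 < Q" "0 < V" "0 < h1" "h1 \<le> 1"
    "\<And>l x qh. grid l x \<Longrightarrow> mesh_width l x \<le> h1 \<Longrightarrow> optimal_control a d (Vh l x) ud \<alpha> qh \<Longrightarrow>
      deriv_tv qh \<le> V \<and> (AE t in leb_\<Omega>. \<bar>qh t\<bar> \<le> Q)"
proof -
  obtain C h0 where C: "0 < C" "0 < h0" "h0 \<le> 1"
    and fe: "\<And>l x f F g gh. grid l x \<Longrightarrow> mesh_width l x \<le> h0 \<Longrightarrow> ess_bounded f \<Longrightarrow> AE t in leb_\<Omega>. \<bar>f t\<bar> \<le> F \<Longrightarrow>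
      sol H f g \<Longrightarrow> sol (mesh.pwc l x) f gh \<Longrightarrow>
      (AE t in leb_\<Omega>. \<bar>g t - gh t\<bar> \<le> C * F * mesh_width l x) \<and>
      (\<forall>t\<in>{0..1}. \<bar>prim g t - prim gh t\<bar> \<le> C * F * (mesh_width l x)\<^sup>2)"
    by (rule finite_element_error) blast
  interpret c: trial_space a d L A \<nu> D H10 H by (rule trial_space_H10)
  obtain g1 where g1: "sol H (\<lambda>_. 1) g1" using c.sol_exists[OF ess_bounded_const] by blast
  define m1 where "m1 = (LINT t|leb_\<Omega>. prim g1 t)"
  have m1: "0 < m1" unfolding m1_def by (rule sol_one_mean_pos[OF g1])
  define h1 where "h1 = min h0 (m1 / (2 * C))"
  have h1: "0 < h1" "h1 \<le> 1" "h1 \<le> h0" "C * h1 \<le> m1 / 2"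
  proof -
    show "0 < h1" "h1 \<le> 1" "h1 \<le> h0" using C m1 by (auto simp: h1_def)
    have "C * h1 \<le> C * (m1 / (2 * C))" using C by (intro mult_left_mono) (auto simp: h1_def)
    then show "C * h1 \<le> m1 / 2" using C by simp
  qed
  \<comment> \<open>The cost of the zero control is at most \<open>U\<^sup>2 / 2\<close>.\<close>
  define V where "V = U\<^sup>2 / (2 * \<alpha>) + 1"
  have V: "0 < V" using \<alpha> by (simp add: V_def add_nonneg_pos)
  define B where "B = (2 * U + V / \<nu>) / (m1 / 2)"
  define Q where "Q = B + V"
  have B0: "0 \<le> B" using U0 V \<nu> m1 by (simp add: B_def)
  show thesis
  proof (rule that[of Q V h1])
    show "0 < Q" using B0 V by (simp add: Q_def)
    fix l x qh
    assume grid: "grid l x" and h: "mesh_width l x \<le> h1" and opt: "optimal_control a d (Vh l x) ud \<alpha> qh"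
    interpret mesh l x by standard fact
    interpret t: trial_space a d L A \<nu> D "Vh l x" pwc by (rule trial_space_Vh[OF grid])
    have qBV: "qh \<in> BV" using opt by (simp add: optimal_control_def)
    note qb = BV_ess_bounded[OF qBV]
    obtain gh where gh: "sol pwc qh gh" using t.sol_exists[OF qb] by blast
    have yb: "ess_bounded (prim gh)" by (rule t.sol_prim_bounded[OF gh])
    have rb: "ess_bounded (\<lambda>t. prim gh t - ud t)" using yb ud by auto
    obtain kh where kh: "sol pwc (\<lambda>t. prim gh t - ud t) kh" using t.sol_exists[OF rb] by blast
    obtain gz where gz: "sol pwc (\<lambda>_. 0) gz" using t.sol_exists[OF ess_bounded_const] by blast
    have pz: "prim gz t = 0" for t using energy_sup[OF pwc_H gz, of t] by simp
    have "cost a d (Vh l x) ud \<alpha> qh \<le> cost a d (Vh l x) ud \<alpha> (\<lambda>_. 0)"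
      using opt BV_const by (simp add: optimal_control_def)
    also have "\<dots> = 1 / 2 * (LINT t|leb_\<Omega>. (ud t)\<^sup>2)"
      using t.cost_eq[OF ess_bounded_const ud gz] by (simp add: pz deriv_tv_const)
    also have "(LINT t|leb_\<Omega>. (ud t)\<^sup>2) \<le> (LINT t|leb_\<Omega>. U\<^sup>2)"
    proof (rule integral_mono_AE)
      show "AE t in leb_\<Omega>. (ud t)\<^sup>2 \<le> U\<^sup>2" using ud_bound by eventually_elim (use U0 in \<open>auto simp: abs_le_square_iff[symmetric]\<close>)
    qed (use ess_bounded_in_L2[OF ud] in \<open>auto simp: in_L2_def\<close>)
    finally have c1: "1 / 2 * (LINT t|leb_\<Omega>. (prim gh t - ud t)\<^sup>2) + \<alpha> * deriv_tv qh \<le> 1 / 2 * U\<^sup>2"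
      unfolding t.cost_eq[OF qb ud gh] using leb.prob_space by simp
    have nn: "0 \<le> (LINT t|leb_\<Omega>. (prim gh t - ud t)\<^sup>2)" by (rule integral_nonneg_AE) simp
    have tv: "deriv_tv qh \<le> V"
    proof -
      have "\<alpha> * deriv_tv qh \<le> U\<^sup>2 / 2" using c1 nn by linarith
      then have "deriv_tv qh \<le> U\<^sup>2 / (2 * \<alpha>)" using \<alpha> by (simp add: field_simps)
      then show ?thesis by (simp add: V_def)
    qed
    have "(LINT t|leb_\<Omega>. \<bar>prim gh t - ud t\<bar>)\<^sup>2 \<le> U\<^sup>2"
      using square_integral_abs_le[OF ess_bounded_in_L2[OF rb]] c1 mult_nonneg_nonneg[OF less_imp_le[OF \<alpha>] deriv_tv_nonneg[OF qBV]] by linarith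
    then have d1: "(LINT t|leb_\<Omega>. \<bar>prim gh t - ud t\<bar>) \<le> U" by (rule power2_le_imp_le[OF _ U0])
    obtain c where c: "AE t in leb_\<Omega>. \<bar>qh t - c\<bar> \<le> deriv_tv qh"
      using t.optimal_control_structure[OF opt ud \<alpha> gh kh] by blast
    have cV: "AE t in leb_\<Omega>. \<bar>qh t - c * 1\<bar> \<le> V" using c by eventually_elim (use tv in auto)
    obtain g1h where g1h: "sol pwc (\<lambda>_. 1) g1h" using t.sol_exists[OF ess_bounded_const] by blast
    define gF where "gF t = 1 * gh t + (- c) * g1h t" for t
    have gF: "sol pwc (\<lambda>t. 1 * qh t + (- c) * 1) gF" unfolding gF_def[abs_def]
      by (rule t.sols_comb[OF gh g1h qb ess_bounded_const])
    have pF: "prim gF t = prim gh t - c * prim g1h t" for t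
      unfolding gF_def
      using prim_add[of "\<lambda>t. 1 * gh t" "\<lambda>t. (- c) * g1h t" t] prim_cmult[of "- c" g1h t]
        H_D(3)[OF t.sol_H[OF gh]] H_D(3)[OF t.sol_H[OF g1h]] by simp
    have Fb: "ess_bounded (\<lambda>t. 1 * qh t + (- c) * 1)" using qb by auto
    have F1: "\<bar>prim gF t\<bar> \<le> V / \<nu>" for t
    proof -
      have "(LINT t|leb_\<Omega>. \<bar>1 * qh t + (- c) * 1\<bar>) \<le> V"
        by (rule integral_abs_le_const[OF ess_bounded_integrable[OF Fb]]) (use cV in \<open>simp\<close>)
      then have "(LINT t|leb_\<Omega>. \<bar>1 * qh t + (- c) * 1\<bar>) / \<nu> \<le> V / \<nu>" using \<nu> by (intro divide_right_mono) auto
      then show ?thesis using energy_sup[OF pwc_H gF ess_bounded_integrable[OF Fb], of t] by linarith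
    qed
    define h where "h = mesh_width l x"
    have hh: "0 < h" "h \<le> h1" "h \<le> 1" "h \<le> h0" using mesh_width_pos h h1 by (auto simp: h_def)
    have m1h: "m1 / 2 \<le> (LINT t|leb_\<Omega>. prim g1h t)"
    proof -
      have y: "integrable leb_\<Omega> (prim g1)" "integrable leb_\<Omega> (prim g1h)"
        using c.sol_prim_bounded[OF g1] t.sol_prim_bounded[OF g1h] by auto
      have "AE t in leb_\<Omega>. \<bar>1 :: real\<bar> \<le> 1" by simp
      from fe[OF grid _ ess_bounded_const this g1 g1h] hh
      have err: "\<forall>t\<in>{0..1}. \<bar>prim g1 t - prim g1h t\<bar> \<le> C * 1 * h\<^sup>2" unfolding h_def by blast
      have "h\<^sup>2 \<le> h1" using hh mult_mono'[of h 1 h h1] by (simp add: power2_eq_square)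
      then have "C * 1 * h\<^sup>2 \<le> C * h1" using C by simp
      then have err2: "\<bar>prim g1 t - prim g1h t\<bar> \<le> m1 / 2" if "t \<in> {0..1}" for t using err that h1(4) by force
      have "m1 = (LINT t|leb_\<Omega>. (prim g1 t - prim g1h t) + prim g1h t)" by (simp add: m1_def)
      also have "\<dots> \<le> (LINT t|leb_\<Omega>. m1 / 2 + prim g1h t)"
      proof (rule integral_mono_AE)
        show "AE t in leb_\<Omega>. (prim g1 t - prim g1h t) + prim g1h t \<le> m1 / 2 + prim g1h t"
        proof (rule AE_leb_\<Omega>I)
          fix t :: real assume "0 < t" "t < 1"
          then have "t \<in> {0..1}" by simp
          from err2[OF this] show "(prim g1 t - prim g1h t) + prim g1h t \<le> m1 / 2 + prim g1h t" by linarith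
        qed
      qed (use y in auto)
      also have "\<dots> = m1 / 2 + (LINT t|leb_\<Omega>. prim g1h t)" using y leb.prob_space by simp
      finally show ?thesis by simp
    qed
    have cB: "\<bar>c\<bar> \<le> B"
    proof -
      have y: "integrable leb_\<Omega> (prim gh)" "integrable leb_\<Omega> (prim g1h)" "integrable leb_\<Omega> ud"
        using yb t.sol_prim_bounded[OF g1h] ud by auto
      have "\<bar>c\<bar> * (m1 / 2) \<le> \<bar>c\<bar> * (LINT t|leb_\<Omega>. prim g1h t)" using m1h by (intro mult_left_mono) auto
      also have "\<dots> \<le> \<bar>c * (LINT t|leb_\<Omega>. prim g1h t)\<bar>" by (simp add: abs_mult mult_left_mono)
      also have "c * (LINT t|leb_\<Omega>. prim g1h t) = (LINT t|leb_\<Omega>. c * prim g1h t)" by simp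
      also have "\<bar>\<dots>\<bar> \<le> (LINT t|leb_\<Omega>. \<bar>c * prim g1h t\<bar>)" by (rule integral_abs_bound)
      also have "\<dots> \<le> (LINT t|leb_\<Omega>. \<bar>prim gh t - ud t\<bar> + (U + V / \<nu>))"
      proof (rule integral_mono_AE)
        show "AE t in leb_\<Omega>. \<bar>c * prim g1h t\<bar> \<le> \<bar>prim gh t - ud t\<bar> + (U + V / \<nu>)"
          using ud_bound
        proof eventually_elim
          fix t assume "\<bar>ud t\<bar> \<le> U"
          then show "\<bar>c * prim g1h t\<bar> \<le> \<bar>prim gh t - ud t\<bar> + (U + V / \<nu>)" using F1[of t] pF[of t] by linarith
        qed
      qed (use y in auto)
      also have "\<dots> = (LINT t|leb_\<Omega>. \<bar>prim gh t - ud t\<bar>) + (U + V / \<nu>)" using y leb.prob_space by simp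
      also have "\<dots> \<le> 2 * U + V / \<nu>" using d1 by simp
      finally show ?thesis unfolding B_def using m1 by (simp only: pos_le_divide_eq half_gt_zero)
    qed
    have "AE t in leb_\<Omega>. \<bar>qh t\<bar> \<le> Q" using cV by eventually_elim (use cB in \<open>simp add: Q_def\<close>)
    then show "deriv_tv qh \<le> V \<and> (AE t in leb_\<Omega>. \<bar>qh t\<bar> \<le> Q)" using tv by simp
  qed (use V h1 in auto)
qed

end

lemma integral_product_bound:
  fixes f g :: "real \<Rightarrow> real"
  assumes f: "ess_bounded f" and g: "ess_bounded g" and B: "AE t in leb_\<Omega>. \<bar>f t\<bar> \<le> B"
  shows "(LINT t|leb_\<Omega>. f t * g t) \<le> B * (LINT t|leb_\<Omega>. \<bar>g t\<bar>)"
proof -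
  have "(LINT t|leb_\<Omega>. f t * g t) \<le> (LINT t|leb_\<Omega>. B * \<bar>g t\<bar>)"
  proof (rule integral_mono_AE)
    show "AE t in leb_\<Omega>. f t * g t \<le> B * \<bar>g t\<bar>"
      using B
    proof eventually_elim
      fix t assume "\<bar>f t\<bar> \<le> B"
      then have "\<bar>f t\<bar> * \<bar>g t\<bar> \<le> B * \<bar>g t\<bar>" by (intro mult_right_mono) auto
      moreover have "f t * g t \<le> \<bar>f t\<bar> * \<bar>g t\<bar>" by (metis abs_ge_self abs_mult)
      ultimately show "f t * g t \<le> B * \<bar>g t\<bar>" by linarith
    qed
  qed (use f g in \<open>auto intro!: ess_bounded_integrable\<close>)
  then show ?thesis by simp
qed

context control_problem
begin

text \<open>
  The regularity estimate for the solution constructed above holds for every solution, by uniqueness.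
\<close>

lemma sol_H_deriv_bound:
  assumes f: "ess_bounded f" and g: "sol H f g"
  shows "AE t in leb_\<Omega>. \<bar>g t\<bar> \<le> C1 * (LINT t|leb_\<Omega>. \<bar>f t\<bar>)"
proof (rule sol_H_regular[OF f], goal_cases)
  case (1 g')
  have "AE t in leb_\<Omega>. g t = g' t"
    by (rule sol_unique(1)[OF subset_refl H_comb g 1(1) ess_bounded_integrable[OF f]]; assumption)
  then show ?case using AE_space by eventually_elim (use 1(3) in auto)
qed

text \<open>
  With \<open>\<delta> = qb - qh\<close>, the optimality conditions of both problems, each tested with the
  other control, add up to \<open>(zh - z, \<delta>) \<ge> 0\<close>. Let \<open>\<kappa>\<close> and
  \<open>\<gamma>\<close> be the continuous solutions for the data of the discrete adjoint state and of the
  discrete state. Passing to them costs finite element errors of order \<open>h\<^sup>2\<close>, and the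
  remaining pairing is, up to such an error, minus the squared \<open>L\<^sup>2\<close> norm of the state of
  \<open>\<delta>\<close>. This gives the quadratic inequality for the \<open>L\<^sup>1\<close> norm
  \<open>s\<close> of that state. All other quantities are controlled by \<open>s\<close> and the finite
  element error, and the a priori bound on \<open>\<delta>\<close> already yields \<open>s = O(h)\<close>.
\<close>

theorem convergence:
  assumes opt: "optimal_control a d H10 ud \<alpha> qb" and g0: "sol H qb g0" and k0: "sol H (\<lambda>t. prim g0 t - ud t) k0"
  obtains C h1 where "0 < C" "0 < h1" "h1 \<le> 1"
    "\<And>l x qh gh kh g\<delta> h s D1. grid l x \<Longrightarrow> mesh_width l x \<le> h1 \<Longrightarrow> optimal_control a d (Vh l x) ud \<alpha> qh \<Longrightarrow>
      sol (mesh.pwc l x) qh gh \<Longrightarrow> sol (mesh.pwc l x) (\<lambda>t. prim gh t - ud t) kh \<Longrightarrow>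
      sol H (\<lambda>t. qb t - qh t) g\<delta> \<Longrightarrow> h = mesh_width l x \<Longrightarrow> s = (LINT t|leb_\<Omega>. \<bar>prim g\<delta> t\<bar>) \<Longrightarrow>
      D1 = (LINT t|leb_\<Omega>. \<bar>qb t - qh t\<bar>) \<Longrightarrow>
      s\<^sup>2 \<le> C * h\<^sup>2 * (D1 + s) \<and> (\<forall>t\<in>{0..1}. \<bar>prim k0 t - prim kh t\<bar> \<le> C * (h\<^sup>2 + s)) \<and>
      (AE t in leb_\<Omega>. \<bar>k0 t - kh t\<bar> \<le> C * (h + s)) \<and> s \<le> C * h \<and> deriv_tv qh \<le> C"
proof -
  obtain C0 h0 where C0: "0 < C0" "0 < h0" "h0 \<le> 1"
    and fe: "\<And>l x f F g gh. grid l x \<Longrightarrow> mesh_width l x \<le> h0 \<Longrightarrow> ess_bounded f \<Longrightarrow> AE t in leb_\<Omega>. \<bar>f t\<bar> \<le> F \<Longrightarrow>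
      sol H f g \<Longrightarrow> sol (mesh.pwc l x) f gh \<Longrightarrow>
      (AE t in leb_\<Omega>. \<bar>g t - gh t\<bar> \<le> C0 * F * mesh_width l x) \<and>
      (\<forall>t\<in>{0..1}. \<bar>prim g t - prim gh t\<bar> \<le> C0 * F * (mesh_width l x)\<^sup>2)"
    by (rule finite_element_error) blast
  obtain Q V h2 where Q: "0 < Q" "0 < V" "0 < h2" "h2 \<le> 1"
    and ub: "\<And>l x qh. grid l x \<Longrightarrow> mesh_width l x \<le> h2 \<Longrightarrow> optimal_control a d (Vh l x) ud \<alpha> qh \<Longrightarrow>
      deriv_tv qh \<le> V \<and> (AE t in leb_\<Omega>. \<bar>qh t\<bar> \<le> Q)"
    by (rule uniform_bounds) blast
  interpret c: trial_space a d L A \<nu> D H10 H by (rule trial_space_H10)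
  have qbBV: "qb \<in> BV" using opt by (simp add: optimal_control_def)
  note qbb = BV_ess_bounded[OF qbBV]
  obtain Qb where Qb: "AE t in leb_\<Omega>. \<bar>qb t\<bar> \<le> Qb" using qbb by (auto simp: ess_bounded_def)
  have Qb0: "0 \<le> Qb"
  proof -
    have "AE t in leb_\<Omega>. 0 \<le> Qb" using Qb by eventually_elim auto
    then show ?thesis by (simp add: leb.AE_const)
  qed
  define F where "F = Q / \<nu> + U"
  have F0: "0 \<le> F" using Q \<nu> U0 by (simp add: F_def)
  define E where "E = C0 * F + C0 * Q"
  have E0: "0 \<le> C0 * F" "0 \<le> C0 * Q" "0 \<le> E" using C0 F0 Q by (auto simp: E_def)
  define X where "X = E * ((Qb + Q) + (Qb + Q) / \<nu>)"
  have X0: "0 \<le> X" using E0 Qb0 Q \<nu> by (auto simp: X_def intro!: mult_nonneg_nonneg add_nonneg_nonneg)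
  define C where "C = E + E / \<nu> + 1 / \<nu> + C1 * E + C1 + (X + 1) + V"
  have nn: "0 \<le> E / \<nu>" "0 < 1 / \<nu>" "0 \<le> C1 * E" "0 < C1" using E0 \<nu> C1_pos by auto
  have C: "0 < C" "E \<le> C" "E + E / \<nu> \<le> C" "1 / \<nu> \<le> C" "E + C1 * E \<le> C" "C1 \<le> C" "X + 1 \<le> C" "V \<le> C"
    unfolding C_def using nn E0 X0 Q by linarith+
  show thesis
  proof (rule that[of C "min h0 h2"])
    fix l x qh gh kh g\<delta> h s D1
    assume grid: "grid l x" and hm: "mesh_width l x \<le> min h0 h2" and opth: "optimal_control a d (Vh l x) ud \<alpha> qh"
      and gh: "sol (mesh.pwc l x) qh gh" and kh: "sol (mesh.pwc l x) (\<lambda>t. prim gh t - ud t) kh"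
      and g\<delta>: "sol H (\<lambda>t. qb t - qh t) g\<delta>" and h: "h = mesh_width l x"
      and s: "s = (LINT t|leb_\<Omega>. \<bar>prim g\<delta> t\<bar>)" and D1: "D1 = (LINT t|leb_\<Omega>. \<bar>qb t - qh t\<bar>)"
    interpret mesh l x by standard fact
    interpret t: trial_space a d L A \<nu> D "Vh l x" pwc by (rule trial_space_Vh[OF grid])
    have hm': "mesh_width l x \<le> h0" "mesh_width l x \<le> h2" using hm by auto
    have h01: "0 < h" "h \<le> 1" using mesh_width_pos mesh_width_le_1 h by auto
    have h2h: "h\<^sup>2 \<le> h" using h01 by (simp add: power2_eq_square)
    have qhBV: "qh \<in> BV" using opth by (simp add: optimal_control_def)
    note qhb = BV_ess_bounded[OF qhBV]
    have qhQ: "AE t in leb_\<Omega>. \<bar>qh t\<bar> \<le> Q" and tv: "deriv_tv qh \<le> V" using ub[OF grid hm'(2) opth] by auto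
    have \<delta>b: "ess_bounded (\<lambda>t. qb t - qh t)" by (intro ess_bounded_diff qbb qhb)
    have s0: "0 \<le> s" by (simp add: s)
    have D10: "0 \<le> D1" by (simp add: D1)
    \<comment> \<open>The continuous state of the discrete control.\<close>
    define \<gamma> where "\<gamma> t = 1 * g0 t + (- 1) * g\<delta> t" for t
    have "sol H (\<lambda>t. 1 * qb t + (- 1) * (qb t - qh t)) \<gamma>" unfolding \<gamma>_def[abs_def]
      by (rule c.sols_comb[OF g0 g\<delta> qbb \<delta>b])
    then have \<gamma>: "sol H qh \<gamma>" by simp
    note Hs = c.sol_H[OF g0] c.sol_H[OF g\<delta>]
    have p\<gamma>: "prim g0 t = prim \<gamma> t + prim g\<delta> t" for t
      unfolding \<gamma>_def using prim_diff[OF H_D(3)[OF Hs(1)] H_D(3)[OF Hs(2)], of t] by simp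
    note yb = c.sol_prim_bounded[OF g0] t.sol_prim_bounded[OF gh] c.sol_prim_bounded[OF g\<delta>] c.sol_prim_bounded[OF \<gamma>]
    have e2: "\<bar>prim \<gamma> t - prim gh t\<bar> \<le> C0 * Q * h\<^sup>2" if "t \<in> {0..1}" for t
      using fe[OF grid hm'(1) qhb qhQ \<gamma> gh] that h by blast
    have fb: "ess_bounded (\<lambda>t. prim gh t - ud t)" by (intro ess_bounded_diff yb ud)
    have f0b: "ess_bounded (\<lambda>t. prim g0 t - ud t)" by (intro ess_bounded_diff yb ud)
    have qh1: "(LINT t|leb_\<Omega>. \<bar>qh t\<bar>) \<le> Q" by (rule integral_abs_le_const[OF ess_bounded_integrable[OF qhb] qhQ])
    have fF: "AE t in leb_\<Omega>. \<bar>prim gh t - ud t\<bar> \<le> F"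
      using ud_bound
    proof eventually_elim
      fix t assume "\<bar>ud t\<bar> \<le> U"
      moreover have "\<bar>prim gh t\<bar> \<le> Q / \<nu>"
        using energy_sup[OF pwc_H gh ess_bounded_integrable[OF qhb], of t] divide_right_mono[OF qh1, of \<nu>] \<nu> by linarith
      ultimately show "\<bar>prim gh t - ud t\<bar> \<le> F" unfolding F_def by linarith
    qed
    \<comment> \<open>The continuous adjoint state for the discrete state.\<close>
    obtain \<kappa> where \<kappa>: "sol H (\<lambda>t. prim gh t - ud t) \<kappa>" using c.sol_exists[OF fb] by blast
    from fe[OF grid hm'(1) fb fF \<kappa> kh] h
    have k1: "AE t in leb_\<Omega>. \<bar>\<kappa> t - kh t\<bar> \<le> C0 * F * h" and e1: "\<And>t. t \<in> {0..1} \<Longrightarrow> \<bar>prim \<kappa> t - prim kh t\<bar> \<le> C0 * F * h\<^sup>2"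
      by blast+
    \<comment> \<open>The data of \<open>\<mu>\<close> are the difference of the two states.\<close>
    define \<mu> where "\<mu> t = 1 * \<kappa> t + (- 1) * k0 t" for t
    have "sol H (\<lambda>t. 1 * (prim gh t - ud t) + (- 1) * (prim g0 t - ud t)) \<mu>" unfolding \<mu>_def[abs_def]
      by (rule c.sols_comb[OF \<kappa> k0 fb f0b])
    then have \<mu>: "sol H (\<lambda>t. prim gh t - prim g0 t) \<mu>" by simp
    note Hk = c.sol_H[OF \<kappa>] c.sol_H[OF k0]
    have p\<mu>: "prim \<mu> t = prim \<kappa> t - prim k0 t" for t
      unfolding \<mu>_def using prim_diff[OF H_D(3)[OF Hk(1)] H_D(3)[OF Hk(2)], of t] by simp
    note zb = c.sol_prim_bounded[OF k0] t.sol_prim_bounded[OF kh] c.sol_prim_bounded[OF \<kappa>] c.sol_prim_bounded[OF \<mu>]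
    have db: "ess_bounded (\<lambda>t. prim gh t - prim g0 t)" by (intro ess_bounded_diff yb)
    have y1: "(LINT t|leb_\<Omega>. \<bar>prim gh t - prim g0 t\<bar>) \<le> C0 * Q * h\<^sup>2 + s"
    proof -
      have "(LINT t|leb_\<Omega>. \<bar>prim gh t - prim g0 t\<bar>) \<le> (LINT t|leb_\<Omega>. C0 * Q * h\<^sup>2 + \<bar>prim g\<delta> t\<bar>)"
      proof (rule integral_mono_AE)
        show "AE t in leb_\<Omega>. \<bar>prim gh t - prim g0 t\<bar> \<le> C0 * Q * h\<^sup>2 + \<bar>prim g\<delta> t\<bar>"
        proof (rule AE_leb_\<Omega>I)
          fix t :: real assume "0 < t" "t < 1"
          then have "t \<in> {0..1}" by simp
          from e2[OF this] p\<gamma>[of t] show "\<bar>prim gh t - prim g0 t\<bar> \<le> C0 * Q * h\<^sup>2 + \<bar>prim g\<delta> t\<bar>" by linarith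
        qed
      qed (use db yb in \<open>auto intro!: ess_bounded_integrable\<close>)
      then show ?thesis using yb leb.prob_space by (simp add: s ess_bounded_integrable)
    qed
    \<comment> \<open>Each optimality system is tested with the control of the other problem.\<close>
    define I where "I q k = (LINT t|leb_\<Omega>. q t * prim k t)" for q k
    have o1: "I qb k0 + \<alpha> * deriv_tv qb \<le> 0" "\<bar>I qh k0\<bar> \<le> \<alpha> * deriv_tv qh"
      unfolding I_def using c.optimality[OF opt ud \<alpha> g0 k0] qhBV by auto
    have o2: "I qh kh + \<alpha> * deriv_tv qh \<le> 0" "\<bar>I qb kh\<bar> \<le> \<alpha> * deriv_tv qb"
      unfolding I_def using t.optimality[OF opth ud \<alpha> gh kh] qbBV by auto
    have "0 \<le> (I qb kh - I qh kh) - (I qb k0 - I qh k0)" using o1 o2 by linarith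
    also have "\<dots> = (LINT t|leb_\<Omega>. (prim kh t - prim \<kappa> t) * (qb t - qh t)) + (LINT t|leb_\<Omega>. (qb t - qh t) * prim \<mu> t)"
    proof -
      have i: "integrable leb_\<Omega> (\<lambda>t. qb t * prim kh t)" "integrable leb_\<Omega> (\<lambda>t. qh t * prim kh t)"
        "integrable leb_\<Omega> (\<lambda>t. qb t * prim k0 t)" "integrable leb_\<Omega> (\<lambda>t. qh t * prim k0 t)"
        "integrable leb_\<Omega> (\<lambda>t. (prim kh t - prim \<kappa> t) * (qb t - qh t))" "integrable leb_\<Omega> (\<lambda>t. (qb t - qh t) * prim \<mu> t)"
        by (intro ess_bounded_integrable ess_bounded_mult ess_bounded_diff qbb qhb zb)+
      have "(I qb kh - I qh kh) - (I qb k0 - I qh k0) =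
        (LINT t|leb_\<Omega>. (qb t * prim kh t - qh t * prim kh t) - (qb t * prim k0 t - qh t * prim k0 t))"
        unfolding I_def using i by simp
      also have "\<dots> = (LINT t|leb_\<Omega>. (prim kh t - prim \<kappa> t) * (qb t - qh t) + (qb t - qh t) * prim \<mu> t)"
        by (rule Bochner_Integration.integral_cong) (auto simp: p\<mu> algebra_simps)
      also have "\<dots> = (LINT t|leb_\<Omega>. (prim kh t - prim \<kappa> t) * (qb t - qh t)) + (LINT t|leb_\<Omega>. (qb t - qh t) * prim \<mu> t)"
        by (rule Bochner_Integration.integral_add[OF i(5,6)])
      finally show ?thesis .
    qed
    also have "(LINT t|leb_\<Omega>. (qb t - qh t) * prim \<mu> t) = (LINT t|leb_\<Omega>. (prim gh t - prim g0 t) * prim g\<delta> t)"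
      by (rule c.adjoint_pairing[OF \<mu> g\<delta>, symmetric])
    also have "\<dots> = (LINT t|leb_\<Omega>. (prim gh t - prim \<gamma> t) * prim g\<delta> t - (prim g\<delta> t)\<^sup>2)"
      by (rule Bochner_Integration.integral_cong) (auto simp: p\<gamma> power2_eq_square algebra_simps)
    also have "\<dots> = (LINT t|leb_\<Omega>. (prim gh t - prim \<gamma> t) * prim g\<delta> t) - (LINT t|leb_\<Omega>. (prim g\<delta> t)\<^sup>2)"
      unfolding power2_eq_square
      by (intro Bochner_Integration.integral_diff ess_bounded_integrable ess_bounded_mult ess_bounded_diff yb)
    finally have "(LINT t|leb_\<Omega>. (prim g\<delta> t)\<^sup>2) \<le>
        (LINT t|leb_\<Omega>. (prim kh t - prim \<kappa> t) * (qb t - qh t)) + (LINT t|leb_\<Omega>. (prim gh t - prim \<gamma> t) * prim g\<delta> t)" by linarith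
    also have "(LINT t|leb_\<Omega>. (prim kh t - prim \<kappa> t) * (qb t - qh t)) \<le> C0 * F * h\<^sup>2 * D1"
      unfolding D1
    proof (rule integral_product_bound[OF ess_bounded_diff[OF zb(2,3)] \<delta>b AE_leb_\<Omega>I])
      fix t :: real assume "0 < t" "t < 1"
      then show "\<bar>prim kh t - prim \<kappa> t\<bar> \<le> C0 * F * h\<^sup>2" using e1[of t] by (simp add: abs_minus_commute)
    qed
    also have "(LINT t|leb_\<Omega>. (prim gh t - prim \<gamma> t) * prim g\<delta> t) \<le> C0 * Q * h\<^sup>2 * s"
      unfolding s
    proof (rule integral_product_bound[OF ess_bounded_diff[OF yb(2,4)] yb(3) AE_leb_\<Omega>I])
      fix t :: real assume "0 < t" "t < 1"
      then show "\<bar>prim gh t - prim \<gamma> t\<bar> \<le> C0 * Q * h\<^sup>2" using e2[of t] by (simp add: abs_minus_commute)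
    qed
    finally have sq: "(LINT t|leb_\<Omega>. (prim g\<delta> t)\<^sup>2) \<le> C0 * F * h\<^sup>2 * D1 + C0 * Q * h\<^sup>2 * s" by simp
    have "s\<^sup>2 \<le> E * h\<^sup>2 * (D1 + s)"
    proof -
      have "s\<^sup>2 \<le> (LINT t|leb_\<Omega>. (prim g\<delta> t)\<^sup>2)"
        unfolding s by (rule square_integral_abs_le[OF ess_bounded_in_L2[OF yb(3)]])
      also have "\<dots> \<le> C0 * F * h\<^sup>2 * D1 + C0 * Q * h\<^sup>2 * s" by (rule sq)
      also have "\<dots> \<le> E * h\<^sup>2 * D1 + E * h\<^sup>2 * s"
        using E0 D10 s0 by (intro add_mono mult_right_mono) (auto simp: E_def)
      finally show ?thesis by (simp add: algebra_simps)
    qed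
    moreover have "E * h\<^sup>2 * (D1 + s) \<le> C * h\<^sup>2 * (D1 + s)"
      using C(2) D10 s0 by (intro mult_right_mono) auto
    ultimately have r1: "s\<^sup>2 \<le> E * h\<^sup>2 * (D1 + s)" "s\<^sup>2 \<le> C * h\<^sup>2 * (D1 + s)" by linarith+
    have zsup: "\<bar>prim k0 t - prim kh t\<bar> \<le> C * (h\<^sup>2 + s)" if t: "t \<in> {0..1}" for t
    proof -
      have "\<bar>prim \<mu> t\<bar> \<le> (C0 * Q * h\<^sup>2 + s) / \<nu>"
        using energy_sup[OF subset_refl \<mu> ess_bounded_integrable[OF db], of t] divide_right_mono[OF y1, of \<nu>] \<nu> by linarith
      then have "\<bar>prim k0 t - prim kh t\<bar> \<le> C0 * F * h\<^sup>2 + (C0 * Q * h\<^sup>2 + s) / \<nu>"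
        using e1[OF t] p\<mu>[of t] by linarith
      also have "\<dots> \<le> E * h\<^sup>2 + (E * h\<^sup>2 + s) / \<nu>"
        using E0 \<nu> by (intro add_mono divide_right_mono mult_right_mono) (auto simp: E_def)
      also have "\<dots> = (E + E / \<nu>) * h\<^sup>2 + (1 / \<nu>) * s" by (simp add: add_divide_distrib algebra_simps)
      also have "\<dots> \<le> C * h\<^sup>2 + C * s" using C s0 by (intro add_mono mult_right_mono) auto
      finally show ?thesis by (simp add: algebra_simps)
    qed
    have kAE: "AE t in leb_\<Omega>. \<bar>k0 t - kh t\<bar> \<le> C * (h + s)"
      using k1 sol_H_deriv_bound[OF db \<mu>]
    proof eventually_elim
      fix t assume 1: "\<bar>\<kappa> t - kh t\<bar> \<le> C0 * F * h" and 2: "\<bar>\<mu> t\<bar> \<le> C1 * (LINT t|leb_\<Omega>. \<bar>prim gh t - prim g0 t\<bar>)"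
      have "C1 * (LINT t|leb_\<Omega>. \<bar>prim gh t - prim g0 t\<bar>) \<le> C1 * (C0 * Q * h\<^sup>2 + s)" using y1 nn(4) by simp
      also have "\<dots> \<le> C1 * (E * h + s)"
      proof -
        have "C0 * Q * h\<^sup>2 \<le> E * h" using E0 h2h h01 by (intro mult_mono) (auto simp: E_def)
        then show ?thesis using nn(4) by simp
      qed
      finally have "\<bar>\<mu> t\<bar> \<le> C1 * (E * h + s)" using 2 by linarith
      moreover have "C0 * F * h \<le> E * h" using E0 h01 by (intro mult_right_mono) (auto simp: E_def)
      moreover have "k0 t - kh t = (\<kappa> t - kh t) - \<mu> t" by (simp add: \<mu>_def)
      ultimately have "\<bar>k0 t - kh t\<bar> \<le> E * h + C1 * (E * h + s)" using 1 by linarith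
      also have "\<dots> = (E + C1 * E) * h + C1 * s" by (simp add: algebra_simps)
      also have "\<dots> \<le> C * h + C * s" using C s0 h01 by (intro add_mono mult_right_mono) auto
      finally show "\<bar>k0 t - kh t\<bar> \<le> C * (h + s)" by (simp add: algebra_simps)
    qed
    have sh: "s \<le> C * h"
    proof -
      have D1le: "D1 \<le> Qb + Q" unfolding D1
      proof (rule integral_abs_le_const[OF ess_bounded_integrable[OF \<delta>b]])
        show "AE t in leb_\<Omega>. \<bar>qb t - qh t\<bar> \<le> Qb + Q" using Qb qhQ by eventually_elim linarith
      qed
      have "s \<le> D1 / \<nu>" unfolding s
      proof (rule integral_abs_le_const[OF ess_bounded_integrable[OF yb(3)]])
        show "AE t in leb_\<Omega>. \<bar>prim g\<delta> t\<bar> \<le> D1 / \<nu>"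
          unfolding D1 using energy_sup[OF subset_refl g\<delta> ess_bounded_integrable[OF \<delta>b]] by simp
      qed
      also have "\<dots> \<le> (Qb + Q) / \<nu>" using D1le \<nu> by (intro divide_right_mono) auto
      finally have "D1 + s \<le> (Qb + Q) + (Qb + Q) / \<nu>" using D1le by linarith
      then have "E * h\<^sup>2 * (D1 + s) \<le> E * h\<^sup>2 * ((Qb + Q) + (Qb + Q) / \<nu>)" using E0 by (intro mult_left_mono) auto
      then have "s\<^sup>2 \<le> X * h\<^sup>2" using r1(1) by (simp add: X_def ac_simps)
      also have "\<dots> \<le> ((X + 1) * h)\<^sup>2"
      proof -
        have "X \<le> (X + 1)\<^sup>2" using X0 by (simp add: power2_eq_square algebra_simps)
        then show ?thesis unfolding power_mult_distrib by (intro mult_right_mono) auto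
      qed
      finally have "s \<le> (X + 1) * h" using X0 h01 by (intro power2_le_imp_le[of s]) auto
      also have "\<dots> \<le> C * h" using C h01 by (intro mult_right_mono) auto
      finally show ?thesis .
    qed
    show "s\<^sup>2 \<le> C * h\<^sup>2 * (D1 + s) \<and> (\<forall>t\<in>{0..1}. \<bar>prim k0 t - prim kh t\<bar> \<le> C * (h\<^sup>2 + s)) \<and>
      (AE t in leb_\<Omega>. \<bar>k0 t - kh t\<bar> \<le> C * (h + s)) \<and> s \<le> C * h \<and> deriv_tv qh \<le> C"
      using r1(2) zsup kAE sh tv C(8) by auto
  qed (use C(1) C0 Q in auto)
qed

end

section \<open>Step functions\<close>

lemma AE_interval_exists:
  assumes P: "AE t in leb_\<Omega>. P t" and uv: "0 \<le> u" "u < v" "v \<le> 1"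
  shows "\<exists>t. u < t \<and> t < v \<and> P t"
proof (rule ccontr)
  assume "\<nexists>t. u < t \<and> t < v \<and> P t"
  then have *: "\<not> P t" if "u < t" "t < v" for t using that by blast
  have "AE t in leb_\<Omega>. t \<noteq> u" unfolding AE_leb_\<Omega>_iff
    using AE_completion[OF AE_lborel_singleton[of u]] by eventually_elim auto
  with P have "AE t in leb_\<Omega>. indicator {u..<v} t = (0 :: real)"
    by eventually_elim (use * in \<open>force simp: indicator_def less_le\<close>)
  then have "(LINT t|leb_\<Omega>. indicator {u..<v} t) = (0 :: real)" by (rule integral_eq_zero_AE)
  then show False using integral_indicator_interval[of u v] uv by simp
qed

text \<open>
  Below the smallest active jump the function equals \<open>b\<close>; crossing a jump \<open>\<xi>
  i\<close> changes it by \<open>c i\<close>.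
\<close>

lemma step_fun_injective:
  assumes \<xi>: "inj_on \<xi> {1..m}" "\<xi> ` {1..m} \<subseteq> \<Omega>" and z: "AE t in leb_\<Omega>. step_fun m b c \<xi> t = 0"
  shows "b = 0" "i \<in> {1..m} \<Longrightarrow> c i = 0"
proof -
  have ci: "c i = 0" if i: "i \<in> {1..m}" for i
  proof -
    obtain e where e: "0 < e" "\<forall>y\<in>\<xi> ` {1..m}. y \<noteq> \<xi> i \<longrightarrow> e \<le> dist (\<xi> i) y"
      using finite_set_avoid[of "\<xi> ` {1..m}" "\<xi> i"] by auto
    have "\<xi> i \<in> \<Omega>" using \<xi>(2) i by blast
    then have \<xi>i: "0 < \<xi> i" "\<xi> i < 1" by auto
    define r where "r = min e (min (\<xi> i) (1 - \<xi> i))"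
    have r: "0 < r" "r \<le> e" "r \<le> \<xi> i" "r \<le> 1 - \<xi> i" using e \<xi>i by (auto simp: r_def)
    obtain s where s: "\<xi> i - r < s" "s < \<xi> i" "step_fun m b c \<xi> s = 0"
      using AE_interval_exists[OF z, of "\<xi> i - r" "\<xi> i"] r \<xi>i by auto
    obtain t where t: "\<xi> i < t" "t < \<xi> i + r" "step_fun m b c \<xi> t = 0"
      using AE_interval_exists[OF z, of "\<xi> i" "\<xi> i + r"] r \<xi>i by auto
    have "step_fun m b c \<xi> t - step_fun m b c \<xi> s
      = (\<Sum>j=1..m. c j * indicator {\<xi> j<..<1} t - c j * indicator {\<xi> j<..<1} s)"
      by (simp add: step_fun_def sum_subtractf)
    also have "\<dots> = (\<Sum>j=1..m. if j = i then c i else 0)"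
    proof (rule sum.cong)
      fix j assume j: "j \<in> {1..m}"
      show "c j * indicator {\<xi> j<..<1} t - c j * indicator {\<xi> j<..<1} s = (if j = i then c i else 0)"
      proof (cases "j = i")
        case True then show ?thesis using s t r by (auto simp: indicator_def)
      next
        case False
        then have "\<xi> j \<noteq> \<xi> i" using \<xi>(1) i j by (auto dest: inj_onD)
        then have "e \<le> dist (\<xi> i) (\<xi> j)" using e(2) j by blast
        then have "r \<le> \<bar>\<xi> i - \<xi> j\<bar>" using r(2) unfolding dist_real_def by linarith
        then have "\<xi> j < t \<longleftrightarrow> \<xi> j < s" using s t by (auto simp: abs_if split: if_splits)
        then show ?thesis using False s t r by (auto simp: indicator_def)
      qed
    qed simp
    also have "\<dots> = c i" using i by simp
    finally show ?thesis using s t by simp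
  qed
  then show "i \<in> {1..m} \<Longrightarrow> c i = 0" .
  have "step_fun m b c \<xi> t = b" for t using ci by (simp add: step_fun_def)
  then have "AE t in leb_\<Omega>. b = 0" using z by simp
  then show "b = 0" by (simp add: leb.AE_const)
qed

lemma ess_bounded_step_fun: "ess_bounded (step_fun m b c \<xi>)"
  unfolding step_fun_def[abs_def]
  by (intro ess_bounded_add ess_bounded_sum ess_bounded_mult ess_bounded_const ess_bounded_indicator) auto

lemma integral_jump_diff:
  assumes "x \<in> \<Omega>" "y \<in> \<Omega>"
  shows "(LINT t|leb_\<Omega>. \<bar>indicator {x<..<1} t - indicator {y<..<1} t\<bar>) = \<bar>x - y\<bar>"
proof -
  have le: "(LINT t|leb_\<Omega>. \<bar>indicator {x<..<1} t - indicator {y<..<1} t\<bar>) = y - x" if xy: "x \<le> y" "x \<in> \<Omega>" "y \<in> \<Omega>" for x y :: real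
  proof -
    have "(LINT t|leb_\<Omega>. \<bar>indicator {x<..<1} t - indicator {y<..<1} t\<bar>) = (LINT t|leb_\<Omega>. (indicator {x..<y} t :: real))"
    proof (rule integral_cong_AE)
      have "AE t in leb_\<Omega>. t \<noteq> x" "AE t in leb_\<Omega>. t \<noteq> y" unfolding AE_leb_\<Omega>_iff
        using AE_completion[OF AE_lborel_singleton[of x]] AE_completion[OF AE_lborel_singleton[of y]]
        by (eventually_elim, auto)+
      then show "AE t in leb_\<Omega>. \<bar>indicator {x<..<1} t - indicator {y<..<1} t\<bar> = (indicator {x..<y} t :: real)"
        using AE_space by eventually_elim (use xy in \<open>auto simp: indicator_def\<close>)
      show "(\<lambda>t. \<bar>indicator {x<..<1} t - indicator {y<..<1} t\<bar> :: real) \<in> borel_measurable leb_\<Omega>"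
        by (intro ess_bounded_measurable ess_bounded_abs ess_bounded_diff ess_bounded_indicator) auto
      show "(indicator {x..<y} :: real \<Rightarrow> real) \<in> borel_measurable leb_\<Omega>"
        by (intro ess_bounded_measurable ess_bounded_indicator) auto
    qed
    then show ?thesis using integral_indicator_interval[of x y] xy by (simp del: integral_indicator)
  qed
  show ?thesis
  proof (cases "x \<le> y")
    case True then show ?thesis using le[OF True assms] by simp
  next
    case False
    then show ?thesis using le[of y x] assms by (simp add: abs_minus_commute)
  qed
qed

text \<open>
  Tychonoff; only finitely many coordinates matter, but all of them have to be bounded.
\<close>

lemma compact_cube: "compact {c :: nat \<Rightarrow> real. \<forall>i. c i \<in> {-1..1}}"
proof -
  have "compactin (product_topology (\<lambda>i :: nat. euclidean) UNIV) (PiE UNIV (\<lambda>i. {-1..1 :: real}))"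
    by (subst compactin_PiE) auto
  moreover have "PiE UNIV (\<lambda>i :: nat. {-1..1 :: real}) = {c. \<forall>i. c i \<in> {-1..1}}" by (auto simp: PiE_def Pi_def)
  ultimately show ?thesis by (simp add: euclidean_product_topology)
qed

context control_problem
begin

text \<open>
  For fixed jump points the \<open>L\<^sup>1\<close> norm of the state is a norm on the coefficients, since
  states determine controls and step functions determine their coefficients. It is continuous and hence
  attains a positive minimum on the compact unit sphere.
\<close>

lemma step_fun_norm_equivalence:
  assumes \<xi>: "inj_on \<xi> {1..m}" "\<xi> ` {1..m} \<subseteq> \<Omega>"
  obtains N where "0 < N"
    "\<And>b c g. sol H (step_fun m b c \<xi>) g \<Longrightarrow> \<bar>b\<bar> + (\<Sum>i=1..m. \<bar>c i\<bar>) \<le> N * (LINT t|leb_\<Omega>. \<bar>prim g t\<bar>)"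
proof -
  interpret c: trial_space a d L A \<nu> D H10 H by (rule trial_space_H10)
  \<comment> \<open>A common basis: index 0 stands for the constant, the others for the jumps.\<close>
  define v where "v i = (if i = 0 then (\<lambda>_. 1) else indicator {\<xi> i<..<1} :: real \<Rightarrow> real)" for i
  have vb: "ess_bounded (v i)" for i by (auto simp: v_def intro: ess_bounded_indicator)
  have "\<forall>i. \<exists>g. sol H (v i) g" using c.sol_exists[OF vb] by blast
  then obtain e where e: "\<And>i. sol H (v i) (e i)" by metis
  note eH = c.sol_H[OF e]
  have Y: "ess_bounded (prim (e i))" for i by (rule c.sol_prim_bounded[OF e])
  have comb: "sol H (\<lambda>t. \<Sum>i\<le>n. c i * v i t) (\<lambda>t. \<Sum>i\<le>n. c i * e i t) \<and>
      (\<forall>t. prim (\<lambda>t. \<Sum>i\<le>n. c i * e i t) t = (\<Sum>i\<le>n. c i * prim (e i) t))" for c n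
  proof (induction n)
    case 0
    have "sol H (\<lambda>t. c 0 * v 0 t + 0 * v 0 t) (\<lambda>t. c 0 * e 0 t + 0 * e 0 t)" by (rule c.sols_comb[OF e e vb vb])
    then show ?case by (simp add: prim_cmult)
  next
    case (Suc n)
    define f where "f t = (\<Sum>i\<le>n. c i * v i t)" for t
    define g where "g t = (\<Sum>i\<le>n. c i * e i t)" for t
    have fg: "sol H f g" "\<And>t. prim g t = (\<Sum>i\<le>n. c i * prim (e i) t)" using Suc unfolding f_def[abs_def] g_def[abs_def] by auto
    have fb: "ess_bounded f" unfolding f_def[abs_def] by (intro ess_bounded_sum ess_bounded_mult ess_bounded_const vb)
    have "sol H (\<lambda>t. 1 * f t + c (Suc n) * v (Suc n) t) (\<lambda>t. 1 * g t + c (Suc n) * e (Suc n) t)"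
      by (rule c.sols_comb[OF fg(1) e fb vb])
    moreover have "prim (\<lambda>t. g t + c (Suc n) * e (Suc n) t) t = prim g t + c (Suc n) * prim (e (Suc n)) t" for t
      using H_D(3)[OF c.sol_H[OF fg(1)]] H_D(3)[OF eH[of "Suc n"]] by (simp add: prim_add prim_cmult)
    ultimately show ?case using fg(2) by (simp add: f_def g_def)
  qed
  define \<psi> where "\<psi> c = (LINT t|leb_\<Omega>. \<bar>\<Sum>i\<le>m. c i * prim (e i) t\<bar>)" for c
  have Yc: "ess_bounded (\<lambda>t. \<Sum>i\<le>m. c i * prim (e i) t)" for c
    by (intro ess_bounded_sum ess_bounded_mult ess_bounded_const Y)
  \<comment> \<open>The unit sphere. The bound on all coordinates, also on those that do not enter, makes it compact.\<close>
  define S where "S = {c :: nat \<Rightarrow> real. (\<forall>i. c i \<in> {-1..1}) \<and> (\<Sum>i\<le>m. \<bar>c i\<bar>) = 1}"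
  have coord: "continuous_on UNIV (\<lambda>c :: nat \<Rightarrow> real. c i)" for i by (rule continuous_on_product_coordinates)
  have "closed {c :: nat \<Rightarrow> real. (\<Sum>i\<le>m. \<bar>c i\<bar>) = 1}"
    by (intro closed_Collect_eq continuous_intros coord)
  then have "compact ({c :: nat \<Rightarrow> real. \<forall>i. c i \<in> {-1..1}} \<inter> {c. (\<Sum>i\<le>m. \<bar>c i\<bar>) = 1})"
    by (rule compact_Int_closed[OF compact_cube])
  moreover have "{c :: nat \<Rightarrow> real. \<forall>i. c i \<in> {-1..1}} \<inter> {c. (\<Sum>i\<le>m. \<bar>c i\<bar>) = 1} = S" by (auto simp: S_def)
  ultimately have Sc: "compact S" by simp
  have "(\<lambda>i. if i = 0 then 1 else 0) \<in> S" by (auto simp: S_def if_distrib[of abs] cong: if_cong)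
  then have Sne: "S \<noteq> {}" by blast
  define B where "B i = (LINT t|leb_\<Omega>. \<bar>prim (e i) t\<bar>)" for i
  have diff: "\<bar>\<psi> c' - \<psi> c\<bar> \<le> (\<Sum>i\<le>m. \<bar>c' i - c i\<bar> * B i)" for c c'
  proof -
    have "\<bar>\<psi> c' - \<psi> c\<bar> = \<bar>LINT t|leb_\<Omega>. \<bar>\<Sum>i\<le>m. c' i * prim (e i) t\<bar> - \<bar>\<Sum>i\<le>m. c i * prim (e i) t\<bar>\<bar>"
      unfolding \<psi>_def using Yc by (subst Bochner_Integration.integral_diff) (auto intro!: ess_bounded_integrable)
    also have "\<dots> \<le> (LINT t|leb_\<Omega>. \<bar>\<bar>\<Sum>i\<le>m. c' i * prim (e i) t\<bar> - \<bar>\<Sum>i\<le>m. c i * prim (e i) t\<bar>\<bar>)" by (rule integral_abs_bound)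
    also have "\<dots> \<le> (LINT t|leb_\<Omega>. (\<Sum>i\<le>m. \<bar>c' i - c i\<bar> * \<bar>prim (e i) t\<bar>))"
    proof (rule integral_mono_AE)
      show "AE t in leb_\<Omega>. \<bar>\<bar>\<Sum>i\<le>m. c' i * prim (e i) t\<bar> - \<bar>\<Sum>i\<le>m. c i * prim (e i) t\<bar>\<bar> \<le> (\<Sum>i\<le>m. \<bar>c' i - c i\<bar> * \<bar>prim (e i) t\<bar>)"
      proof (rule AE_I2)
        fix t
        have "\<bar>\<bar>\<Sum>i\<le>m. c' i * prim (e i) t\<bar> - \<bar>\<Sum>i\<le>m. c i * prim (e i) t\<bar>\<bar> \<le> \<bar>(\<Sum>i\<le>m. c' i * prim (e i) t) - (\<Sum>i\<le>m. c i * prim (e i) t)\<bar>"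
          by (rule abs_triangle_ineq3)
        also have "(\<Sum>i\<le>m. c' i * prim (e i) t) - (\<Sum>i\<le>m. c i * prim (e i) t) = (\<Sum>i\<le>m. (c' i - c i) * prim (e i) t)"
          by (simp add: sum_subtractf left_diff_distrib)
        also have "\<bar>\<dots>\<bar> \<le> (\<Sum>i\<le>m. \<bar>(c' i - c i) * prim (e i) t\<bar>)" by (rule sum_abs)
        finally show "\<bar>\<bar>\<Sum>i\<le>m. c' i * prim (e i) t\<bar> - \<bar>\<Sum>i\<le>m. c i * prim (e i) t\<bar>\<bar> \<le> (\<Sum>i\<le>m. \<bar>c' i - c i\<bar> * \<bar>prim (e i) t\<bar>)"
          by (simp add: abs_mult)
      qed
      show "integrable leb_\<Omega> (\<lambda>t. \<bar>\<bar>\<Sum>i\<le>m. c' i * prim (e i) t\<bar> - \<bar>\<Sum>i\<le>m. c i * prim (e i) t\<bar>\<bar>)"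
        by (intro ess_bounded_integrable ess_bounded_abs ess_bounded_diff Yc)
      show "integrable leb_\<Omega> (\<lambda>t. \<Sum>i\<le>m. \<bar>c' i - c i\<bar> * \<bar>prim (e i) t\<bar>)"
        by (intro ess_bounded_integrable ess_bounded_sum ess_bounded_mult ess_bounded_const ess_bounded_abs Y)
    qed
    also have "\<dots> = (\<Sum>i\<le>m. \<bar>c' i - c i\<bar> * B i)"
      using Y by (subst Bochner_Integration.integral_sum) (auto simp: B_def intro!: ess_bounded_integrable ess_bounded_mult)
    finally show ?thesis .
  qed
  have "continuous_on S \<psi>" unfolding continuous_on_def
  proof
    fix c assume "c \<in> S"
    have "((\<lambda>c'. c' i) \<longlongrightarrow> c i) (at c within S)" for i
      using continuous_on_subset[OF coord[of i], of S] \<open>c \<in> S\<close> by (auto simp: continuous_on_def)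
    then have "((\<lambda>c'. \<Sum>i\<le>m. \<bar>c' i - c i\<bar> * B i) \<longlongrightarrow> (\<Sum>i\<le>m. \<bar>c i - c i\<bar> * B i)) (at c within S)"
      by (intro tendsto_intros)
    then have "((\<lambda>c'. \<Sum>i\<le>m. \<bar>c' i - c i\<bar> * B i) \<longlongrightarrow> 0) (at c within S)" by simp
    then have "((\<lambda>c'. \<psi> c' - \<psi> c) \<longlongrightarrow> 0) (at c within S)"
      by (rule Lim_null_comparison[rotated]) (use diff in \<open>auto intro!: always_eventually\<close>)
    then show "(\<psi> \<longlongrightarrow> \<psi> c) (at c within S)" by (simp add: LIM_zero_iff)
  qed
  then obtain c0 where c0: "c0 \<in> S" "\<And>c. c \<in> S \<Longrightarrow> \<psi> c0 \<le> \<psi> c"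
    using continuous_attains_inf[OF Sc Sne] by blast
  have step: "(\<Sum>i\<le>m. c i * v i t) = step_fun m (c 0) c \<xi> t" for c t
  proof -
    have "{..m} = insert 0 {1..m}" by auto
    then show ?thesis by (simp add: step_fun_def v_def)
  qed
  have pos: "0 < \<psi> c0"
  proof (rule ccontr)
    assume "\<not> 0 < \<psi> c0"
    moreover have "0 \<le> \<psi> c0" unfolding \<psi>_def by (rule integral_nonneg_AE) simp
    ultimately have "\<psi> c0 = 0" by linarith
    then have "(LINT t|leb_\<Omega>. \<bar>\<Sum>i\<le>m. c0 i * prim (e i) t\<bar>) = 0" unfolding \<psi>_def .
    then have "AE t in leb_\<Omega>. \<bar>\<Sum>i\<le>m. c0 i * prim (e i) t\<bar> = 0"
      using ess_bounded_integrable[OF ess_bounded_abs[OF Yc[of c0]]] by (subst (asm) integral_nonneg_eq_0_iff_AE) auto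
    then have "AE t in leb_\<Omega>. prim (\<lambda>t. \<Sum>i\<le>m. c0 i * e i t) t = 0"
      by eventually_elim (use comb[of c0 m] in simp)
    then have "AE t in leb_\<Omega>. (\<Sum>i\<le>m. c0 i * v i t) = 0"
      by (intro sol_injective[OF _ conjunct1[OF comb[of c0 m]]]) (intro ess_bounded_sum ess_bounded_mult ess_bounded_const vb)
    then have "AE t in leb_\<Omega>. step_fun m (c0 0) c0 \<xi> t = 0" by (simp add: step)
    from step_fun_injective[OF \<xi> this] have "c0 i = 0" if "i \<le> m" for i
      using that by (cases "i = 0") auto
    then have "(\<Sum>i\<le>m. \<bar>c0 i\<bar>) = 0" by simp
    then show False using c0(1) by (simp add: S_def)
  qed
  show thesis
  proof (rule that[of "1 / \<psi> c0"])
    show "0 < 1 / \<psi> c0" using pos by simp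
    fix b c g assume g: "sol H (step_fun m b c \<xi>) g"
    define c' where "c' i = (if i = 0 then b else if i \<le> m then c i else 0)" for i
    define T where "T = (\<Sum>i\<le>m. \<bar>c' i\<bar>)"
    have sf: "step_fun m b c \<xi> = (\<lambda>t. \<Sum>i\<le>m. c' i * v i t)"
      unfolding step by (auto simp: step_fun_def c'_def fun_eq_iff intro!: sum.cong)
    have "sol H (step_fun m b c \<xi>) (\<lambda>t. \<Sum>i\<le>m. c' i * e i t)" unfolding sf using comb[of c' m] by simp
    then have pg: "prim g t = (\<Sum>i\<le>m. c' i * prim (e i) t)" for t
      using c.sols_unique[OF g _ ess_bounded_step_fun] comb[of c' m] by metis
    have psi: "(LINT t|leb_\<Omega>. \<bar>prim g t\<bar>) = \<psi> c'" by (simp add: pg \<psi>_def)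
    have Teq: "T = \<bar>b\<bar> + (\<Sum>i=1..m. \<bar>c i\<bar>)"
    proof -
      have "{..m} = insert 0 {1..m}" by auto
      then show ?thesis unfolding T_def by (simp add: c'_def)
    qed
    have "T * \<psi> c0 \<le> \<psi> c'"
    proof (cases "T = 0")
      case True
      have "0 \<le> \<psi> c'" unfolding \<psi>_def by (rule integral_nonneg_AE) simp
      then show ?thesis using True by simp
    next
      case False
      have T0: "0 \<le> T" unfolding T_def by (intro sum_nonneg) auto
      with False have Tp: "0 < T" by simp
      have "(\<lambda>i. c' i / T) \<in> S" unfolding S_def mem_Collect_eq
      proof (intro conjI allI)
        fix i
        have "\<bar>c' i\<bar> \<le> T"
        proof (cases "i \<le> m")
          case True then show ?thesis unfolding T_def by (intro member_le_sum) auto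
        next
          case False then show ?thesis using T0 by (simp add: c'_def)
        qed
        then show "c' i / T \<in> {-1..1}" using Tp by (auto simp: abs_le_iff field_simps)
      next
        have "(\<Sum>i\<le>m. \<bar>c' i / T\<bar>) = T / T" using Tp by (simp add: T_def[symmetric] sum_divide_distrib[symmetric])
        then show "(\<Sum>i\<le>m. \<bar>c' i / T\<bar>) = 1" using Tp by simp
      qed
      then have "\<psi> c0 \<le> \<psi> (\<lambda>i. c' i / T)" by (rule c0(2))
      also have "\<dots> = \<psi> c' / T"
      proof -
        have "(\<Sum>i\<le>m. c' i / T * prim (e i) t) = (\<Sum>i\<le>m. c' i * prim (e i) t) / T" for t
          by (simp add: sum_divide_distrib)
        then show ?thesis using Tp by (simp add: \<psi>_def)
      qed
      finally show ?thesis using Tp by (simp add: field_simps)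
    qed
    then show "\<bar>b\<bar> + (\<Sum>i=1..m. \<bar>c i\<bar>) \<le> 1 / \<psi> c0 * (LINT t|leb_\<Omega>. \<bar>prim g t\<bar>)"
      using pos by (simp add: Teq psi field_simps)
  qed
qed

end

section \<open>Roots of the adjoint states\<close>

lemma prim_growth:
  assumes k: "integrable leb_\<Omega> k" and st: "0 \<le> s" "s \<le> t" "t \<le> 1"
    and lower: "AE r in leb_\<Omega>. s \<le> r \<longrightarrow> r < t \<longrightarrow> \<kappa> \<le> \<sigma> * k r"
  shows "\<kappa> * (t - s) \<le> \<sigma> * (prim k t - prim k s)"
proof -
  have i1: "integrable leb_\<Omega> (\<lambda>r. indicator {s..<t} r * k r)" by (rule integrable_ind[OF _ k]) simp
  have i2: "integrable leb_\<Omega> (indicator {s..<t} :: real \<Rightarrow> real)"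
    by (intro ess_bounded_integrable ess_bounded_indicator) simp
  have "\<kappa> * (t - s) = (LINT r|leb_\<Omega>. \<kappa> * indicator {s..<t} r)"
    using integral_indicator_interval[OF st] by (simp del: integral_indicator)
  also have "\<dots> \<le> (LINT r|leb_\<Omega>. \<sigma> * (indicator {s..<t} r * k r))"
  proof (rule integral_mono_AE)
    show "AE r in leb_\<Omega>. \<kappa> * indicator {s..<t} r \<le> \<sigma> * (indicator {s..<t} r * k r)"
      using lower by eventually_elim (auto simp: indicator_def)
  qed (use i1 i2 in auto)
  also have "\<dots> = \<sigma> * (prim k t - prim k s)" unfolding prim_diff_ind[OF k st(2)] by simp
  finally show ?thesis .
qed

text \<open>
  The exact derivative has a fixed sign on the ball, so the perturbed one has the same sign and at most one
  root is possible; uniform closeness gives a change of sign at distance \<open>R / 2\<close> on both sides.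
  Evaluating the exact function at the perturbed root measures the distance of the two roots.
\<close>

lemma perturbed_root:
  assumes k: "integrable leb_\<Omega> k" and kh: "integrable leb_\<Omega> kh"
    and R: "0 < R" "ball \<xi> R \<subseteq> \<Omega>" and \<kappa>: "0 < \<kappa>" and \<sigma>: "\<bar>\<sigma>\<bar> = (1::real)"
    and lower: "\<And>t. t \<in> ball \<xi> R \<Longrightarrow> \<kappa> \<le> \<sigma> * k t"
    and close': "AE t in leb_\<Omega>. \<bar>k t - kh t\<bar> \<le> \<kappa> / 2"
    and close: "\<And>t. t \<in> {0..1} \<Longrightarrow> \<bar>prim k t - prim kh t\<bar> \<le> \<kappa> * R / 4"
    and root: "prim k \<xi> = 0"
  shows "\<exists>r. {t \<in> ball \<xi> R. prim kh t = 0} = {r} \<and> \<kappa> * \<bar>\<xi> - r\<bar> \<le> \<bar>prim k r - prim kh r\<bar>"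
proof -
  have ballD: "0 < t \<and> t < 1" if "t \<in> ball \<xi> R" for t using R(2) that by auto
  have between: "r \<in> ball \<xi> R" if "s \<in> ball \<xi> R" "t \<in> ball \<xi> R" "s \<le> r" "r \<le> t" for r s t
    using that by (auto simp: dist_real_def abs_if split: if_splits)
  have up: "\<kappa> * (t - s) \<le> \<sigma> * (prim k t - prim k s)" if "s \<in> ball \<xi> R" "t \<in> ball \<xi> R" "s \<le> t" for s t
  proof (rule prim_growth[OF k])
    show "AE r in leb_\<Omega>. s \<le> r \<longrightarrow> r < t \<longrightarrow> \<kappa> \<le> \<sigma> * k r"
      using lower between[OF that(1,2)] by (intro AE_I2) auto
  qed (use that ballD[of s] ballD[of t] in auto)
  have uph: "\<kappa> / 2 * (t - s) \<le> \<sigma> * (prim kh t - prim kh s)" if "s \<in> ball \<xi> R" "t \<in> ball \<xi> R" "s \<le> t" for s t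
  proof (rule prim_growth[OF kh])
    show "AE r in leb_\<Omega>. s \<le> r \<longrightarrow> r < t \<longrightarrow> \<kappa> / 2 \<le> \<sigma> * kh r"
      using close'
    proof eventually_elim
      fix r assume c: "\<bar>k r - kh r\<bar> \<le> \<kappa> / 2"
      show "s \<le> r \<longrightarrow> r < t \<longrightarrow> \<kappa> / 2 \<le> \<sigma> * kh r"
      proof (intro impI)
        assume "s \<le> r" "r < t"
        then have "\<kappa> \<le> \<sigma> * k r" using lower between[OF that(1,2), of r] by auto
        moreover have "\<bar>\<sigma> * (k r - kh r)\<bar> \<le> \<kappa> / 2" using c \<sigma> by (simp add: abs_mult)
        ultimately show "\<kappa> / 2 \<le> \<sigma> * kh r" unfolding right_diff_distrib by linarith
      qed
    qed
  qed (use that ballD[of s] ballD[of t] in auto)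
  define p where "p = \<xi> - R / 2" define q where "q = \<xi> + R / 2"
  have pq: "p \<in> ball \<xi> R" "q \<in> ball \<xi> R" "\<xi> \<in> ball \<xi> R" using R by (auto simp: p_def q_def dist_real_def)
  have c2: "\<bar>\<sigma> * prim k t - \<sigma> * prim kh t\<bar> \<le> \<kappa> * R / 4" if "t \<in> ball \<xi> R" for t
    using close[of t] ballD[OF that] \<sigma> by (simp add: right_diff_distrib[symmetric] abs_mult)
  have \<kappa>R: "0 < \<kappa> * R" using \<kappa> R by simp
  have "\<kappa> * (R / 2) \<le> - (\<sigma> * prim k p)" using up[OF pq(1,3)] R root by (simp add: p_def)
  then have "\<sigma> * prim kh p \<le> 0" using c2[OF pq(1)] \<kappa>R unfolding abs_le_iff by simp
  moreover have "\<kappa> * (R / 2) \<le> \<sigma> * prim k q" using up[OF pq(3,2)] R root by (simp add: q_def)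
  then have "0 \<le> \<sigma> * prim kh q" using c2[OF pq(2)] \<kappa>R unfolding abs_le_iff by simp
  moreover have "continuous_on {p..q} (\<lambda>t. \<sigma> * prim kh t)" by (intro continuous_intros continuous_prim kh)
  ultimately obtain r where r: "p \<le> r" "r \<le> q" "\<sigma> * prim kh r = 0"
    using IVT'[of "\<lambda>t. \<sigma> * prim kh t" p 0 q] R by (auto simp: p_def q_def)
  have rb: "r \<in> ball \<xi> R" using between[OF pq(1,2) r(1,2)] .
  have r0: "prim kh r = 0" using r(3) \<sigma> by auto
  have uniq: "t = r" if t: "t \<in> ball \<xi> R" "prim kh t = 0" for t
  proof (rule ccontr)
    assume "t \<noteq> r"
    then consider "t < r" | "r < t" by linarith
    then show False
    proof cases
      case 1 then show False using uph[OF t(1) rb] t(2) r0 \<kappa> by (simp add: mult_le_0_iff)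
    next
      case 2 then show False using uph[OF rb t(1)] t(2) r0 \<kappa> by (simp add: mult_le_0_iff)
    qed
  qed
  have "\<kappa> * \<bar>\<xi> - r\<bar> \<le> \<bar>\<sigma> * prim k r\<bar>"
  proof (cases "\<xi> \<le> r")
    case True then show ?thesis using up[OF pq(3) rb] root by auto
  next
    case False
    then show ?thesis using up[OF rb pq(3)] root by auto
  qed
  then have "\<kappa> * \<bar>\<xi> - r\<bar> \<le> \<bar>prim k r - prim kh r\<bar>" using \<sigma> r0 by (simp add: abs_mult)
  moreover have "{t \<in> ball \<xi> R. prim kh t = 0} = {r}"
  proof (intro set_eqI iffI)
    fix t assume "t \<in> {t \<in> ball \<xi> R. prim kh t = 0}"
    then show "t \<in> {r}" using uniq[of t] unfolding mem_Collect_eq by blast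
  next
    fix t assume "t \<in> {r}"
    then show "t \<in> {t \<in> ball \<xi> R. prim kh t = 0}" using rb r0 unfolding mem_Collect_eq by blast
  qed
  ultimately show ?thesis by blast
qed

text \<open>
  Where the switching function attains its bound it has an interior extremum.
\<close>

lemma critical_point:
  assumes k: "integrable leb_\<Omega> k" and bnd: "\<And>t. t \<in> \<Omega> \<Longrightarrow> \<bar>prim (prim k) t\<bar> \<le> \<alpha>"
    and y: "y \<in> \<Omega>" "\<bar>prim (prim k) y\<bar> = \<alpha>"
  shows "prim k y = 0"
proof -
  have der: "(prim (prim k) has_real_derivative prim k y) (at y)"
    by (rule prim_has_derivative[OF continuous_prim[OF k]]) (use y in auto)
  define e where "e = min y (1 - y)"
  have e: "0 < e" and near: "\<And>t. \<bar>y - t\<bar> < e \<Longrightarrow> t \<in> \<Omega>" using y by (auto simp: e_def)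
  show ?thesis
  proof (cases "0 \<le> prim (prim k) y")
    case True
    show ?thesis
      by (rule DERIV_local_max[OF der e]) (use bnd near y(2) True in \<open>fastforce simp: abs_le_iff\<close>)
  next
    case False
    show ?thesis
    proof (rule DERIV_local_min[OF der e], intro allI impI)
      fix t assume "\<bar>y - t\<bar> < e"
      from bnd[OF near[OF this]] show "prim (prim k) y \<le> prim (prim k) t" using y(2) False by linarith
    qed
  qed
qed

lemma continuous_AE_eq:
  fixes u v :: "real \<Rightarrow> real"
  assumes u: "continuous_on {0..1} u" and v: "continuous_on {0..1} v" and ae: "AE t in leb_\<Omega>. u t = v t"
    and t: "t \<in> \<Omega>"
  shows "u t = v t"
proof -
  have "prim u = prim v" by (rule prim_cong_AE[OF ess_bounded_measurable[OF ess_bounded_cont[OF u]] ae])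
  then show ?thesis
    using DERIV_unique[OF prim_has_derivative[OF u, of t]] prim_has_derivative[OF v, of t] t by auto
qed

lemma finite_positive_lower_bound:
  fixes f :: "'a \<Rightarrow> real"
  assumes "finite I" "\<And>i. i \<in> I \<Longrightarrow> 0 < f i" obtains e where "0 < e" "\<And>i. i \<in> I \<Longrightarrow> e \<le> f i"
proof -
  have "\<exists>e>0. \<forall>i\<in>I. e \<le> f i"
    using assms
  proof (induction I rule: finite_induct)
    case empty show ?case by (intro exI[of _ 1]) auto
  next
    case (insert i I)
    then obtain e where "0 < e" "\<forall>j\<in>I. e \<le> f j" by auto
    then show ?case using insert.prems[of i] by (intro exI[of _ "min e (f i)"]) force
  qed
  then show thesis using that by blast
qed

lemma in_Linf_bound:
  assumes "in_Linf f" obtains B where "f \<in> borel_measurable leb_\<Omega>" "AE t in leb_\<Omega>. \<bar>f t\<bar> \<le> B"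
proof -
  have f: "f \<in> borel_measurable leb_\<Omega>" and fin: "Linf_norm f < \<infinity>" using assms by (auto simp: in_Linf_def)
  obtain B where B: "Linf_norm f \<le> ereal B"
    using fin by (cases "Linf_norm f") auto
  have "AE t in leb_\<Omega>. ereal \<bar>f t\<bar> \<le> Linf_norm f" unfolding Linf_norm_def by (rule esssup_AE)
  then have "AE t in leb_\<Omega>. \<bar>f t\<bar> \<le> B"
  proof eventually_elim
    fix t assume "ereal \<bar>f t\<bar> \<le> Linf_norm f"
    then have "ereal \<bar>f t\<bar> \<le> ereal B" using B by (rule order_trans)
    then show "\<bar>f t\<bar> \<le> B" by simp
  qed
  then show thesis using f that by blast
qed

text \<open>
  If \<open>s\<close> exceeds \<open>h\<^sup>2\<close>, it absorbs the other summand, and one factor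
  \<open>s\<close> cancels.
\<close>

lemma quadratic_absorb:
  fixes s A h :: real
  assumes "0 \<le> s" "0 \<le> A" "s\<^sup>2 \<le> A * h\<^sup>2 * (h\<^sup>2 + s)" shows "s \<le> (2 * A + 1) * h\<^sup>2"
proof (cases "s \<le> h\<^sup>2")
  case True
  have "0 \<le> 2 * A * h\<^sup>2" using assms by simp
  with True show ?thesis by (simp add: distrib_right)
next
  case False
  then have sp: "0 < s" using zero_le_power2[of h] by linarith
  have "s * s \<le> A * h\<^sup>2 * (2 * s)"
  proof -
    have "A * h\<^sup>2 * (h\<^sup>2 + s) \<le> A * h\<^sup>2 * (2 * s)" using False assms(2) by (intro mult_left_mono) auto
    then show ?thesis using assms(3) by (simp add: power2_eq_square)
  qed
  then have "s * s \<le> (2 * A * h\<^sup>2) * s" by (simp add: ac_simps)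
  then have "s \<le> 2 * A * h\<^sup>2" using sp by simp
  then show ?thesis using zero_le_power2[of h] unfolding distrib_right by linarith
qed

section \<open>The error estimate\<close>

theorem corollary5:
  fixes a d\<^sub>0 u\<^sub>d qb zb :: "real \<Rightarrow> real" and \<alpha> \<nu> :: real
    and m :: nat and xb :: "nat \<Rightarrow> real"
  assumes "0 < \<alpha>" and "in_Linf u\<^sub>d"
    and "\<exists>L. L-lipschitz_on {0..1} a"
    and "0 < \<nu>" and "\<forall>t\<in>{0..1}. \<nu> \<le> a t"
    and "in_Linf d\<^sub>0" and "AE t in leb_\<Omega>. 0 \<le> d\<^sub>0 t"
    and "optimal_control a d\<^sub>0 H10 u\<^sub>d \<alpha> qb"
    and "adjoint_state a d\<^sub>0 H10 u\<^sub>d qb zb" and "continuous_on {0..1} zb"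
    and "bij_betw xb {1..m} {t \<in> \<Omega>. \<bar>integral {0..t} zb\<bar> = \<alpha>}"
    and "\<forall>i\<in>{1..m}. deriv zb (xb i) \<noteq> 0"
  shows "\<exists>ab cb R.
    (AE t in leb_\<Omega>. qb t = step_fun m ab cb xb t) \<and>
    0 < R \<and>
    (\<forall>i\<in>{1..m}. ball (xb i) R \<subseteq> \<Omega>) \<and>
    disjoint_family_on (\<lambda>i. ball (xb i) R) {1..m} \<and>
    (\<exists>\<kappa>>0. \<forall>i\<in>{1..m}. \<forall>t\<in>ball (xb i) R. \<kappa> \<le> \<bar>deriv zb t\<bar>) \<and>
    (\<exists>C>0. \<exists>h\<^sub>0>0. \<forall>l x. grid l x \<and> mesh_width l x \<le> h\<^sub>0 \<longrightarrow>
      (\<forall>qh zh. optimal_control a d\<^sub>0 (Vh l x) u\<^sub>d \<alpha> qh \<and>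
               adjoint_state a d\<^sub>0 (Vh l x) u\<^sub>d qh zh \<longrightarrow>
        (\<exists>ah ch xh.
          (\<forall>i\<in>{1..m}. {t \<in> ball (xb i) R. zh t = 0} = {xh i}) \<and>
          (AE t in leb_\<Omega>. qh t = step_fun m ah ch xh t) \<and>
          (\<Sum>i=1..m. \<bar>xb i - xh i\<bar>) \<le> C * (mesh_width l x)\<^sup>2 \<and>
          (\<Sum>i=1..m. \<bar>cb i - ch i\<bar>) \<le> C * (mesh_width l x)\<^sup>2 \<and>
          \<bar>ab - ah\<bar> \<le> C * (mesh_width l x)\<^sup>2 \<and>
          L1_norm (\<lambda>t. qb t - qh t) \<le> C * (mesh_width l x)\<^sup>2 \<and>
          Linf_norm (\<lambda>t. zb t - zh t) \<le> ereal (C * (mesh_width l x)\<^sup>2))))"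
proof -
  obtain L where L: "L-lipschitz_on {0..1} a" using assms(3) by blast
  obtain U where U: "u\<^sub>d \<in> borel_measurable leb_\<Omega>" "AE t in leb_\<Omega>. \<bar>u\<^sub>d t\<bar> \<le> U" by (rule in_Linf_bound[OF assms(2)])
  obtain D where D: "d\<^sub>0 \<in> borel_measurable leb_\<Omega>" "AE t in leb_\<Omega>. \<bar>d\<^sub>0 t\<bar> \<le> D" by (rule in_Linf_bound[OF assms(6)])
  have "\<exists>A. \<forall>t\<in>{0..1}. \<bar>a t\<bar> \<le> A"
    using compact_imp_bounded[OF compact_continuous_image[OF lipschitz_on_continuous_on[OF L]]] by (auto simp: bounded_iff)
  then obtain A where A: "\<forall>t\<in>{0..1}. \<bar>a t\<bar> \<le> A" by blast
  interpret control_problem a d\<^sub>0 L A \<nu> D u\<^sub>d \<alpha> U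
  proof
    show "AE t in leb_\<Omega>. d\<^sub>0 t \<le> D" using D(2) by eventually_elim auto
    show "a t \<le> A" if "t \<in> {0..1}" for t using A that by force
  qed (use assms L U D in auto)
  interpret c: trial_space a d\<^sub>0 L A \<nu> D H10 H by (rule trial_space_H10)
  note opt = assms(8)
  have qbBV: "qb \<in> BV" using opt by (simp add: optimal_control_def)
  note qbb = BV_ess_bounded[OF qbBV]
  obtain g0 where g0: "sol H qb g0" using c.sol_exists[OF qbb] by blast
  have f0b: "ess_bounded (\<lambda>t. prim g0 t - u\<^sub>d t)" by (intro ess_bounded_diff c.sol_prim_bounded[OF g0] ud)
  obtain F0 where F0: "AE t in leb_\<Omega>. \<bar>prim g0 t - u\<^sub>d t\<bar> \<le> F0" using f0b by (auto simp: ess_bounded_def)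
  obtain k0 where k0: "sol H (\<lambda>t. prim g0 t - u\<^sub>d t) k0" "continuous_on {0..1} k0"
    and k0_lip: "\<forall>s\<in>{0..1}. \<forall>t\<in>{0..1}. \<bar>k0 s - k0 t\<bar> \<le> C2 * F0 * \<bar>s - t\<bar>"
    using sol_H_lipschitz[OF f0b F0] by (elim exE conjE) (rule that)
  have k0i: "integrable leb_\<Omega> k0" by (rule H_D(3)[OF c.sol_H[OF k0(1)]])
  have zb: "zb t = prim k0 t" if t: "t \<in> \<Omega>" for t
  proof -
    obtain k where k: "hrep zb k" "sol H (\<lambda>t. prim g0 t - u\<^sub>d t) k" using c.adjoint_sol[OF qbb ud assms(9) g0] by blast
    have "prim k = prim k0" by (rule c.sols_unique[OF k(2) k0(1) f0b])
    then have "AE t in leb_\<Omega>. zb t = prim k0 t" using k(1) by (simp add: hrep_def)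
    then show ?thesis by (rule continuous_AE_eq[OF assms(10) continuous_prim[OF k0i] _ t])
  qed
  have dzb: "deriv zb t = k0 t" if t: "t \<in> \<Omega>" for t
  proof (rule DERIV_imp_deriv)
    have "(prim k0 has_real_derivative k0 t) (at t)" by (rule prim_has_derivative[OF k0(2)]) (use t in auto)
    then show "(zb has_real_derivative k0 t) (at t)"
    proof (rule DERIV_cong_ev[THEN iffD1, rotated -1])
      have "\<forall>\<^sub>F u in nhds t. u \<in> \<Omega>" using t by (intro eventually_nhds_in_open) auto
      then show "\<forall>\<^sub>F u in nhds t. prim k0 u = zb u" by eventually_elim (simp add: zb)
    qed auto
  qed
  define \<Phi> where "\<Phi> = prim (prim k0)"
  have z0b: "ess_bounded (prim k0)" by (rule c.sol_prim_bounded[OF k0(1)])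
  note z0i = ess_bounded_integrable[OF z0b]
  have \<Phi>_eq: "integral {0..t} zb = \<Phi> t" if t: "t \<in> \<Omega>" for t
  proof -
    have "prim zb = \<Phi>" unfolding \<Phi>_def by (rule prim_cong) (simp add: zb)
    then show ?thesis using prim_eq_integral[OF ess_bounded_integrable[OF ess_bounded_cont[OF assms(10)]], of t] t by simp
  qed
  have zeros: "{t \<in> \<Omega>. \<bar>\<Phi> t\<bar> = \<alpha>} = xb ` {1..m}"
  proof -
    have "xb ` {1..m} = {t \<in> \<Omega>. \<bar>integral {0..t} zb\<bar> = \<alpha>}" using assms(11) by (simp add: bij_betw_def)
    then show ?thesis using \<Phi>_eq by auto
  qed
  have inj: "inj_on xb {1..m}" using assms(11) by (simp add: bij_betw_def)
  have xb\<Omega>: "xb ` {1..m} \<subseteq> \<Omega>" unfolding zeros[symmetric] by auto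
  have xbi: "xb i \<in> \<Omega>" "\<bar>\<Phi> (xb i)\<bar> = \<alpha>" if "i \<in> {1..m}" for i using zeros that by blast+
  have \<Phi>_bound: "\<bar>\<Phi> t\<bar> \<le> \<alpha>" if "t \<in> \<Omega>" for t
    unfolding \<Phi>_def by (rule c.switching_function_bound[OF opt ud \<alpha> g0 k0(1) that])
  have root0: "prim k0 (xb i) = 0" if "i \<in> {1..m}" for i
    by (rule critical_point[OF k0i _ xbi(1)[OF that]]) (use \<Phi>_bound xbi(2)[OF that] in \<open>auto simp: \<Phi>_def\<close>)
  have k0_ne: "k0 (xb i) \<noteq> 0" if "i \<in> {1..m}" for i using assms(12) dzb[OF xbi(1)[OF that]] that by auto
  have zeros': "{t \<in> \<Omega>. \<bar>prim (prim k0) t\<bar> = \<alpha>} \<subseteq> xb ` {1..m}" using zeros unfolding \<Phi>_def by (rule equalityD1)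
  obtain ab cb where qb_step: "AE t in leb_\<Omega>. qb t = step_fun m ab cb xb t"
    using c.optimal_control_structure[OF opt ud \<alpha> g0 k0(1)] inj xb\<Omega> zeros' by blast
  obtain \<kappa> where \<kappa>: "0 < \<kappa>" "\<And>i. i \<in> {1..m} \<Longrightarrow> \<kappa> \<le> \<bar>k0 (xb i)\<bar> / 2"
    by (rule finite_positive_lower_bound[of "{1..m}" "\<lambda>i. \<bar>k0 (xb i)\<bar> / 2"]) (use k0_ne in auto)
  obtain r1 where r1: "0 < r1" "\<And>i. i \<in> {1..m} \<Longrightarrow> r1 \<le> min (xb i) (1 - xb i)"
    by (rule finite_positive_lower_bound[of "{1..m}" "\<lambda>i. min (xb i) (1 - xb i)"]) (use xbi(1) in auto)
  obtain r2 where r2: "0 < r2" "\<And>p. p \<in> {(i, j). i \<in> {1..m} \<and> j \<in> {1..m} \<and> i \<noteq> j} \<Longrightarrow> r2 \<le> (case p of (i, j) \<Rightarrow> \<bar>xb i - xb j\<bar>)"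
  proof (rule finite_positive_lower_bound[of "{(i, j). i \<in> {1..m} \<and> j \<in> {1..m} \<and> i \<noteq> j}" "\<lambda>(i, j). \<bar>xb i - xb j\<bar>"])
    show "finite {(i, j). i \<in> {1..m} \<and> j \<in> {1..m} \<and> i \<noteq> j}"
      by (rule finite_subset[of _ "{1..m} \<times> {1..m}"]) auto
    fix p assume "p \<in> {(i, j). i \<in> {1..m} \<and> j \<in> {1..m} \<and> i \<noteq> j}"
    then obtain i j where p: "p = (i, j)" "i \<in> {1..m}" "j \<in> {1..m}" "i \<noteq> j" by blast
    have "xb i \<noteq> xb j" using p inj_onD[OF inj] by metis
    then show "0 < (case p of (i, j) \<Rightarrow> \<bar>xb i - xb j\<bar>)" by (simp add: p(1))
  qed (rule that)
  define \<Lambda> where "\<Lambda> = \<bar>C2 * F0\<bar> + 1"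
  have \<Lambda>: "0 < \<Lambda>" "C2 * F0 \<le> \<Lambda>" by (auto simp: \<Lambda>_def)
  \<comment> \<open>The three terms keep the balls in the domain, pairwise disjoint, and so small that the Lipschitz
    continuous derivative of the adjoint state keeps half of its modulus.\<close>
  define R where "R = min r1 (min (r2 / 2) (\<kappa> / \<Lambda>))"
  have R: "0 < R" "R \<le> r1" "R \<le> r2 / 2" "R \<le> \<kappa> / \<Lambda>"
  proof -
    show "0 < R" using r1(1) r2(1) \<kappa>(1) \<Lambda>(1) by (simp add: R_def)
    show "R \<le> r1" unfolding R_def by linarith
    show "R \<le> r2 / 2" unfolding R_def by linarith
    show "R \<le> \<kappa> / \<Lambda>" unfolding R_def by linarith
  qed
  have balls: "ball (xb i) R \<subseteq> \<Omega>" if "i \<in> {1..m}" for i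
    using r1(2)[OF that] R(2) by (auto simp: dist_real_def abs_if split: if_splits)
  have disj: "ball (xb i) R \<inter> ball (xb j) R = {}" if "i \<in> {1..m}" "j \<in> {1..m}" "i \<noteq> j" for i j
  proof -
    have "2 * R \<le> \<bar>xb i - xb j\<bar>" using r2(2)[of "(i, j)"] that R(3) by simp
    then show ?thesis unfolding disjoint_iff mem_ball dist_real_def by force
  qed
  define \<sigma> where "\<sigma> i = sgn (k0 (xb i))" for i
  have \<sigma>: "\<bar>\<sigma> i\<bar> = 1" if "i \<in> {1..m}" for i using k0_ne[OF that] by (simp add: \<sigma>_def sgn_if)
  have k0_lower: "\<kappa> \<le> \<sigma> i * k0 t" if i: "i \<in> {1..m}" and t: "t \<in> ball (xb i) R" for i t
  proof -
    have t\<Omega>: "t \<in> {0..1}" "xb i \<in> {0..1}" using balls[OF i] t xbi(1)[OF i] by auto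
    have "\<bar>k0 t - k0 (xb i)\<bar> \<le> C2 * F0 * \<bar>t - xb i\<bar>" using k0_lip t\<Omega> by blast
    also have "\<dots> \<le> \<Lambda> * \<bar>t - xb i\<bar>" using \<Lambda> by (intro mult_right_mono) auto
    also have "\<dots> \<le> \<Lambda> * (\<kappa> / \<Lambda>)" using t R(4) \<Lambda> by (intro mult_left_mono) (auto simp: dist_real_def)
    also have "\<dots> = \<kappa>" using \<Lambda> by simp
    finally have "\<bar>\<sigma> i * (k0 t - k0 (xb i))\<bar> \<le> \<kappa>" using \<sigma>[OF i] by (simp add: abs_mult)
    moreover have "\<sigma> i * k0 (xb i) = \<bar>k0 (xb i)\<bar>" by (simp add: \<sigma>_def sgn_if)
    ultimately show ?thesis using \<kappa>(2)[OF i] unfolding right_diff_distrib by linarith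
  qed
  \<comment> \<open>Away from the balls the modulus of the switching function stays below \<open>\<alpha>\<close> by a fixed gap \<open>\<epsilon>\<close>. The end points need an argument of their own, as they lie outside the open domain.\<close>
  define K where "K = {0..1} - (\<Union>i\<in>{1..m}. ball (xb i) R)"
  obtain \<epsilon> where \<epsilon>: "0 < \<epsilon>" "\<And>t. t \<in> K \<Longrightarrow> \<bar>\<Phi> t\<bar> \<le> \<alpha> - \<epsilon>"
  proof (cases "K = {}")
    case True
    then show thesis using that[of 1] by simp
  next
    case False
    have "compact K" unfolding K_def by (intro compact_diff open_UN) auto
    moreover have "continuous_on K (\<lambda>t. \<bar>\<Phi> t\<bar>)" unfolding \<Phi>_def by (intro continuous_intros continuous_prim z0i)
    ultimately obtain t0 where t0: "t0 \<in> K" "\<And>t. t \<in> K \<Longrightarrow> \<bar>\<Phi> t\<bar> \<le> \<bar>\<Phi> t0\<bar>"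
      using continuous_attains_sup[OF _ False] by blast
    have "\<bar>\<Phi> t0\<bar> < \<alpha>"
    proof (cases "t0 \<in> \<Omega>")
      case True
      have "t0 \<notin> xb ` {1..m}" using t0(1) R(1) by (auto simp: K_def)
      then have "\<bar>\<Phi> t0\<bar> \<noteq> \<alpha>" using True zeros by blast
      then show ?thesis using \<Phi>_bound[OF True] by simp
    next
      case False
      then have "t0 = 0 \<or> t0 = 1" using t0(1) by (auto simp: K_def)
      moreover have "\<Phi> 0 = 0" "\<Phi> 1 = 0"
        using c.adjoint_mean_zero[OF opt ud \<alpha> g0 k0(1)] by (auto simp: \<Phi>_def prim_0 prim_1)
      ultimately show ?thesis using \<alpha> by auto
    qed
    then show thesis using t0(2) by (intro that[of "\<alpha> - \<bar>\<Phi> t0\<bar>"]) auto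
  qed
  obtain C h1 where C: "0 < C" "0 < h1" "h1 \<le> 1"
    and conv: "\<And>l x qh gh kh g\<delta> h s D1. grid l x \<Longrightarrow> mesh_width l x \<le> h1 \<Longrightarrow> optimal_control a d\<^sub>0 (Vh l x) u\<^sub>d \<alpha> qh \<Longrightarrow>
      sol (mesh.pwc l x) qh gh \<Longrightarrow> sol (mesh.pwc l x) (\<lambda>t. prim gh t - u\<^sub>d t) kh \<Longrightarrow>
      sol H (\<lambda>t. qb t - qh t) g\<delta> \<Longrightarrow> h = mesh_width l x \<Longrightarrow> s = (LINT t|leb_\<Omega>. \<bar>prim g\<delta> t\<bar>) \<Longrightarrow>
      D1 = (LINT t|leb_\<Omega>. \<bar>qb t - qh t\<bar>) \<Longrightarrow>
      s\<^sup>2 \<le> C * h\<^sup>2 * (D1 + s) \<and> (\<forall>t\<in>{0..1}. \<bar>prim k0 t - prim kh t\<bar> \<le> C * (h\<^sup>2 + s)) \<and>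
      (AE t in leb_\<Omega>. \<bar>k0 t - kh t\<bar> \<le> C * (h + s)) \<and> s \<le> C * h \<and> deriv_tv qh \<le> C"
    by (rule convergence[OF opt g0 k0(1)]) blast
  obtain N where N: "0 < N" and Nineq: "\<And>b c g. sol H (step_fun m b c xb) g \<Longrightarrow>
      \<bar>b\<bar> + (\<Sum>i=1..m. \<bar>c i\<bar>) \<le> N * (LINT t|leb_\<Omega>. \<bar>prim g t\<bar>)"
    by (rule step_fun_norm_equivalence[OF inj xb\<Omega>]) blast
  \<comment> \<open>The accuracy that the root argument and the gap \<open>\<epsilon>\<close> of the switching function
    require.\<close>
  define \<theta> where "\<theta> = min (\<kappa> / 2) (min (\<kappa> * R / 4) (\<epsilon> / 2))"
  have \<theta>: "0 < \<theta>" "\<theta> \<le> \<kappa> / 2" "\<theta> \<le> \<kappa> * R / 4" "\<theta> \<le> \<epsilon> / 2" using \<kappa> R \<epsilon> by (auto simp: \<theta>_def)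
  \<comment> \<open>As \<open>s \<le> C * h\<close>, this makes \<open>C * (h + s)\<close> at most \<open>\<theta>\<close>.\<close>
  define h2 where "h2 = min h1 (\<theta> / (C * (1 + C)))"
  have h2: "0 < h2" using C \<theta> by (auto simp: h2_def)
  \<comment> \<open>Factors of \<open>h\<^sup>2 + s\<close>: \<open>P1\<close> for the jump points, \<open>P\<close> for the
    effect of moving them, \<open>T0\<close> for the coefficients; \<open>M\<close> finally bounds
    \<open>h\<^sup>2 + s\<close> by \<open>h\<^sup>2\<close>.\<close>
  define P1 where "P1 = real m * C / \<kappa>"
  define P where "P = C * P1"
  define T0 where "T0 = N * (1 + P / \<nu>)"
  define A0 where "A0 = C * (T0 + P + 1)"
  define M where "M = 2 * A0 + 1 + 1"
  have nn: "0 \<le> P1" "0 \<le> P" "0 \<le> T0" "0 \<le> A0" "0 < M"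
  proof -
    show "0 \<le> P1" using C \<kappa> by (simp add: P1_def)
    then show P: "0 \<le> P" using C by (simp add: P_def)
    then show T: "0 \<le> T0" using N \<nu> by (simp add: T0_def)
    then show "0 \<le> A0" using P C by (simp add: A0_def)
    then show "0 < M" by (simp add: M_def)
  qed
  define Cf where "Cf = (P1 + T0 + (T0 + P) + C) * M"
  have Cf: "0 < Cf" using nn C by (simp add: Cf_def add_nonneg_pos)
  show ?thesis
  proof (rule exI[of _ ab], rule exI[of _ cb], rule exI[of _ R], intro conjI)
    show "AE t in leb_\<Omega>. qb t = step_fun m ab cb xb t" by (rule qb_step)
    show "0 < R" by (rule R)
    show "\<forall>i\<in>{1..m}. ball (xb i) R \<subseteq> \<Omega>" using balls by blast
    show "disjoint_family_on (\<lambda>i. ball (xb i) R) {1..m}" unfolding disjoint_family_on_def using disj by blast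
    show "\<exists>\<kappa>>0. \<forall>i\<in>{1..m}. \<forall>t\<in>ball (xb i) R. \<kappa> \<le> \<bar>deriv zb t\<bar>"
    proof (intro exI[of _ \<kappa>] conjI ballI \<kappa>(1))
      fix i t assume i: "i \<in> {1..m}" and t: "t \<in> ball (xb i) R"
      have "t \<in> \<Omega>" using balls[OF i] t by blast
      moreover have "\<sigma> i * k0 t \<le> \<bar>k0 t\<bar>" using \<sigma>[OF i] by (metis abs_ge_self abs_mult mult_1)
      ultimately show "\<kappa> \<le> \<bar>deriv zb t\<bar>" using k0_lower[OF i t] dzb by auto
    qed
    show "\<exists>C>0. \<exists>h\<^sub>0>0. \<forall>l x. grid l x \<and> mesh_width l x \<le> h\<^sub>0 \<longrightarrow>
      (\<forall>qh zh. optimal_control a d\<^sub>0 (Vh l x) u\<^sub>d \<alpha> qh \<and>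
               adjoint_state a d\<^sub>0 (Vh l x) u\<^sub>d qh zh \<longrightarrow>
        (\<exists>ah ch xh.
          (\<forall>i\<in>{1..m}. {t \<in> ball (xb i) R. zh t = 0} = {xh i}) \<and>
          (AE t in leb_\<Omega>. qh t = step_fun m ah ch xh t) \<and>
          (\<Sum>i=1..m. \<bar>xb i - xh i\<bar>) \<le> C * (mesh_width l x)\<^sup>2 \<and>
          (\<Sum>i=1..m. \<bar>cb i - ch i\<bar>) \<le> C * (mesh_width l x)\<^sup>2 \<and>
          \<bar>ab - ah\<bar> \<le> C * (mesh_width l x)\<^sup>2 \<and>
          L1_norm (\<lambda>t. qb t - qh t) \<le> C * (mesh_width l x)\<^sup>2 \<and>
          Linf_norm (\<lambda>t. zb t - zh t) \<le> ereal (C * (mesh_width l x)\<^sup>2)))"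
    proof (rule exI[of _ Cf], rule conjI[OF Cf], rule exI[of _ h2], rule conjI[OF h2], intro allI impI, elim conjE)
      fix l x qh zh
      assume grid: "grid l x" and hm: "mesh_width l x \<le> h2"
        and opth: "optimal_control a d\<^sub>0 (Vh l x) u\<^sub>d \<alpha> qh" and adjh: "adjoint_state a d\<^sub>0 (Vh l x) u\<^sub>d qh zh"
      interpret mesh l x by standard fact
      interpret t: trial_space a d\<^sub>0 L A \<nu> D "Vh l x" pwc by (rule trial_space_Vh[OF grid])
      define h where "h = mesh_width l x"
      have h: "0 < h" "h \<le> 1" "h \<le> h1" "h \<le> \<theta> / (C * (1 + C))"
        using mesh_width_pos mesh_width_le_1 hm by (auto simp: h_def h2_def)
      have hsq: "h\<^sup>2 \<le> h" using h by (simp add: power2_eq_square)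
      have qhBV: "qh \<in> BV" using opth by (simp add: optimal_control_def)
      note qhb = BV_ess_bounded[OF qhBV]
      obtain gh where gh: "sol pwc qh gh" using t.sol_exists[OF qhb] by blast
      obtain kh where kh: "hrep zh kh" "sol pwc (\<lambda>t. prim gh t - u\<^sub>d t) kh"
        using t.adjoint_sol[OF qhb ud adjh gh] by blast
      have \<delta>b: "ess_bounded (\<lambda>t. qb t - qh t)" by (intro ess_bounded_diff qbb qhb)
      note \<delta>i = ess_bounded_integrable[OF \<delta>b]
      obtain g\<delta> where g\<delta>: "sol H (\<lambda>t. qb t - qh t) g\<delta>" using c.sol_exists[OF \<delta>b] by blast
      define s where "s = (LINT t|leb_\<Omega>. \<bar>prim g\<delta> t\<bar>)"
      define D1 where "D1 = (LINT t|leb_\<Omega>. \<bar>qb t - qh t\<bar>)"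
      have s0: "0 \<le> s" by (simp add: s_def)
      from conv[OF grid _ opth gh kh(2) g\<delta> h_def s_def D1_def] h(3)
      have sq: "s\<^sup>2 \<le> C * h\<^sup>2 * (D1 + s)" and zclose: "\<And>t. t \<in> {0..1} \<Longrightarrow> \<bar>prim k0 t - prim kh t\<bar> \<le> C * (h\<^sup>2 + s)"
        and kclose: "AE t in leb_\<Omega>. \<bar>k0 t - kh t\<bar> \<le> C * (h + s)" and sh: "s \<le> C * h" and tv: "deriv_tv qh \<le> C"
        unfolding h_def[symmetric] by blast+
      have small: "C * (h + s) \<le> \<theta>"
      proof -
        have "C * (h + s) \<le> C * (h + C * h)" using sh C by simp
        also have "\<dots> = C * (1 + C) * h" by (simp add: algebra_simps)
        also have "\<dots> \<le> C * (1 + C) * (\<theta> / (C * (1 + C)))" using h(4) C by (intro mult_left_mono) auto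
        also have "\<dots> = \<theta>" using C by simp
        finally show ?thesis .
      qed
      have small2: "C * (h\<^sup>2 + s) \<le> \<theta>"
      proof -
        have "C * (h\<^sup>2 + s) \<le> C * (h + s)" using hsq C by simp
        then show ?thesis using small by linarith
      qed
      have khi: "integrable leb_\<Omega> kh" by (rule H_D(3)[OF t.sol_H[OF kh(2)]])
      have zhb: "ess_bounded (prim kh)" by (rule t.sol_prim_bounded[OF kh(2)])
      note zhi = ess_bounded_integrable[OF zhb]
      have zhV: "zh \<in> Vh l x" using adjh by (simp add: adjoint_state_def)
      have zh: "zh t = prim kh t" if t: "t \<in> \<Omega>" for t
      proof -
        have "continuous_on {0..1} zh" using zhV by (simp add: Vh_def)
        moreover have "AE t in leb_\<Omega>. zh t = prim kh t" using kh(1) by (simp add: hrep_def)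
        ultimately show ?thesis by (rule continuous_AE_eq[OF _ continuous_prim[OF khi] _ t])
      qed
      have "\<forall>i. \<exists>r. i \<in> {1..m} \<longrightarrow> {t \<in> ball (xb i) R. prim kh t = 0} = {r} \<and> \<kappa> * \<bar>xb i - r\<bar> \<le> \<bar>prim k0 r - prim kh r\<bar>"
      proof
        fix i
        show "\<exists>r. i \<in> {1..m} \<longrightarrow> {t \<in> ball (xb i) R. prim kh t = 0} = {r} \<and> \<kappa> * \<bar>xb i - r\<bar> \<le> \<bar>prim k0 r - prim kh r\<bar>"
        proof (cases "i \<in> {1..m}")
          case True
          have "AE t in leb_\<Omega>. \<bar>k0 t - kh t\<bar> \<le> \<kappa> / 2" using kclose by eventually_elim (use small \<theta> in linarith)
          moreover have "\<bar>prim k0 t - prim kh t\<bar> \<le> \<kappa> * R / 4" if "t \<in> {0..1}" for t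
            using zclose[OF that] small2 \<theta> by linarith
          ultimately show ?thesis
            using perturbed_root[OF k0i khi R(1) balls[OF True] \<kappa>(1) \<sigma>[OF True] k0_lower[OF True] _ _ root0[OF True]] by blast
        qed auto
      qed
      then obtain xh where xhP: "\<forall>i. i \<in> {1..m} \<longrightarrow> {t \<in> ball (xb i) R. prim kh t = 0} = {xh i} \<and>
          \<kappa> * \<bar>xb i - xh i\<bar> \<le> \<bar>prim k0 (xh i) - prim kh (xh i)\<bar>"
        using choice[of "\<lambda>i r. i \<in> {1..m} \<longrightarrow> {t \<in> ball (xb i) R. prim kh t = 0} = {r} \<and>
          \<kappa> * \<bar>xb i - r\<bar> \<le> \<bar>prim k0 r - prim kh r\<bar>"] by blast
      have xh: "{t \<in> ball (xb i) R. prim kh t = 0} = {xh i}"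
        and xh_close: "\<kappa> * \<bar>xb i - xh i\<bar> \<le> \<bar>prim k0 (xh i) - prim kh (xh i)\<bar>" if "i \<in> {1..m}" for i
        using xhP that by simp_all
      have xh_ball: "xh i \<in> ball (xb i) R" if "i \<in> {1..m}" for i using xh[OF that] by blast
      have xh\<Omega>: "xh i \<in> \<Omega>" if "i \<in> {1..m}" for i using xh_ball[OF that] balls[OF that] by blast
      have xh_inj: "inj_on xh {1..m}"
      proof (rule inj_onI, rule ccontr)
        fix i j assume ij: "i \<in> {1..m}" "j \<in> {1..m}" "xh i = xh j" "i \<noteq> j"
        then show False using disj[OF ij(1,2,4)] xh_ball[OF ij(1)] xh_ball[OF ij(2)] by auto
      qed
      have \<Phi>h_bound: "\<bar>prim (prim kh) t\<bar> \<le> \<alpha>" if "t \<in> \<Omega>" for t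
        by (rule t.switching_function_bound[OF opth ud \<alpha> gh kh(2) that])
      \<comment> \<open>The discrete switching function attains its bound only at roots of the discrete adjoint state, and by
        the gap only inside the balls.\<close>
      have sub: "{t \<in> \<Omega>. \<bar>prim (prim kh) t\<bar> = \<alpha>} \<subseteq> xh ` {1..m}"
      proof
        fix y assume "y \<in> {t \<in> \<Omega>. \<bar>prim (prim kh) t\<bar> = \<alpha>}"
        then have y: "y \<in> \<Omega>" "\<bar>prim (prim kh) y\<bar> = \<alpha>" by auto
        have yz: "prim kh y = 0" by (rule critical_point[OF khi \<Phi>h_bound y])
        have "\<bar>\<Phi> y - prim (prim kh) y\<bar> = \<bar>prim (\<lambda>t. prim k0 t - prim kh t) y\<bar>"
          unfolding \<Phi>_def by (simp add: prim_diff[OF z0i zhi])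
        also have "\<dots> \<le> (LINT t|leb_\<Omega>. \<bar>prim k0 t - prim kh t\<bar>)"
          by (rule prim_bound_integral) (use z0i zhi in auto)
        also have "\<dots> \<le> C * (h\<^sup>2 + s)"
          by (rule integral_abs_le_const) (use z0i zhi zclose in \<open>auto intro!: AE_leb_\<Omega>I\<close>)
        finally have "\<bar>\<Phi> y - prim (prim kh) y\<bar> \<le> \<epsilon> / 2" using small2 \<theta> by linarith
        then have "\<not> \<bar>\<Phi> y\<bar> \<le> \<alpha> - \<epsilon>" using y(2) \<epsilon>(1) by linarith
        then have "y \<notin> K" using \<epsilon>(2) by blast
        then obtain i where i: "i \<in> {1..m}" "y \<in> ball (xb i) R" using y(1) unfolding K_def by fastforce
        then have "y = xh i" using xh[OF i(1)] yz by blast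
        then show "y \<in> xh ` {1..m}" using i(1) by blast
      qed
      have xhsub: "xh ` {1..m} \<subseteq> \<Omega>" using xh\<Omega> by blast
      from t.optimal_control_structure[OF opth ud \<alpha> gh kh(2)] xh_inj xhsub sub
      obtain ah ch where qh_step: "AE t in leb_\<Omega>. qh t = step_fun m ah ch xh t"
        and ch: "\<forall>i\<in>{1..m}. \<bar>ch i\<bar> \<le> deriv_tv qh" by blast
      define X where "X = (\<Sum>i=1..m. \<bar>xb i - xh i\<bar>)"
      have X: "X \<le> P1 * (h\<^sup>2 + s)"
      proof -
        have "X \<le> (\<Sum>i=1..m. C * (h\<^sup>2 + s) / \<kappa>)" unfolding X_def
        proof (rule sum_mono)
          fix i assume i: "i \<in> {1..m}"
          have "xh i \<in> {0..1}" using xh\<Omega>[OF i] by auto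
          then have "\<kappa> * \<bar>xb i - xh i\<bar> \<le> C * (h\<^sup>2 + s)" using xh_close[OF i] zclose[of "xh i"] by linarith
          then show "\<bar>xb i - xh i\<bar> \<le> C * (h\<^sup>2 + s) / \<kappa>" using \<kappa>(1) by (simp add: pos_le_divide_eq mult.commute)
        qed
        then show ?thesis by (simp add: P1_def)
      qed
      \<comment> \<open>Freezing the jumps at those of the continuous control leaves a remainder \<open>\<omega>\<close> that is bounded by the distance of the jumps.\<close>
      define \<omega> where "\<omega> t = (qb t - qh t) - step_fun m (ab - ah) (\<lambda>i. cb i - ch i) xb t" for t
      have \<omega>b: "ess_bounded \<omega>" unfolding \<omega>_def[abs_def] by (intro ess_bounded_diff \<delta>b ess_bounded_step_fun)
      have \<omega>1: "(LINT t|leb_\<Omega>. \<bar>\<omega> t\<bar>) \<le> P * (h\<^sup>2 + s)"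
      proof -
        have jb: "ess_bounded (\<lambda>t. C * \<bar>indicator {xb i<..<1} t - indicator {xh i<..<1} t\<bar>)" for i
          by (intro ess_bounded_mult ess_bounded_const ess_bounded_abs ess_bounded_diff ess_bounded_indicator) auto
        have "(LINT t|leb_\<Omega>. \<bar>\<omega> t\<bar>) \<le> (LINT t|leb_\<Omega>. (\<Sum>i=1..m. C * \<bar>indicator {xb i<..<1} t - indicator {xh i<..<1} t\<bar>))"
        proof (rule integral_mono_AE)
          show "AE t in leb_\<Omega>. \<bar>\<omega> t\<bar> \<le> (\<Sum>i=1..m. C * \<bar>indicator {xb i<..<1} t - indicator {xh i<..<1} t\<bar>)"
            using qb_step qh_step
          proof eventually_elim
            fix t assume "qb t = step_fun m ab cb xb t" "qh t = step_fun m ah ch xh t"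
            then have "\<omega> t = (\<Sum>i=1..m. ch i * (indicator {xb i<..<1} t - indicator {xh i<..<1} t))"
              by (simp add: \<omega>_def step_fun_def sum_subtractf left_diff_distrib right_diff_distrib)
            also have "\<bar>\<dots>\<bar> \<le> (\<Sum>i=1..m. \<bar>ch i * (indicator {xb i<..<1} t - indicator {xh i<..<1} t)\<bar>)" by (rule sum_abs)
            also have "\<dots> \<le> (\<Sum>i=1..m. C * \<bar>indicator {xb i<..<1} t - indicator {xh i<..<1} t\<bar>)"
              unfolding abs_mult using ch tv by (intro sum_mono mult_right_mono) force+
            finally show "\<bar>\<omega> t\<bar> \<le> (\<Sum>i=1..m. C * \<bar>indicator {xb i<..<1} t - indicator {xh i<..<1} t\<bar>)" .
          qed
          show "integrable leb_\<Omega> (\<lambda>t. \<Sum>i=1..m. C * \<bar>indicator {xb i<..<1} t - indicator {xh i<..<1} t\<bar>)"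
            by (intro ess_bounded_integrable ess_bounded_sum jb)
        qed (use ess_bounded_integrable[OF \<omega>b] in auto)
        also have "\<dots> = (\<Sum>i=1..m. LINT t|leb_\<Omega>. C * \<bar>indicator {xb i<..<1} t - indicator {xh i<..<1} t\<bar>)"
          by (rule Bochner_Integration.integral_sum) (rule ess_bounded_integrable[OF jb])
        also have "\<dots> = (\<Sum>i=1..m. C * \<bar>xb i - xh i\<bar>)"
          by (intro sum.cong refl) (simp only: integral_mult_right_zero integral_jump_diff[OF xbi(1) xh\<Omega>])
        also have "\<dots> = C * X" by (simp add: X_def sum_distrib_left)
        also have "\<dots> \<le> C * (P1 * (h\<^sup>2 + s))" using X C by simp
        finally show ?thesis by (simp add: P_def mult.assoc)
      qed
      obtain g\<omega> where g\<omega>: "sol H \<omega> g\<omega>" using c.sol_exists[OF \<omega>b] by blast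
      define gt where "gt t = 1 * g\<delta> t + (- 1) * g\<omega> t" for t
      have "sol H (\<lambda>t. 1 * (qb t - qh t) + (- 1) * \<omega> t) gt" unfolding gt_def[abs_def]
        by (rule c.sols_comb[OF g\<delta> g\<omega> \<delta>b \<omega>b])
      moreover have "(\<lambda>t. 1 * (qb t - qh t) + (- 1) * \<omega> t) = step_fun m (ab - ah) (\<lambda>i. cb i - ch i) xb"
        by (auto simp: \<omega>_def)
      ultimately have gt: "sol H (step_fun m (ab - ah) (\<lambda>i. cb i - ch i) xb) gt" by simp
      define T where "T = \<bar>ab - ah\<bar> + (\<Sum>i=1..m. \<bar>cb i - ch i\<bar>)"
      have T: "T \<le> T0 * (h\<^sup>2 + s)"
      proof -
        note ys = c.sol_prim_bounded[OF g\<delta>] c.sol_prim_bounded[OF g\<omega>] c.sol_prim_bounded[OF gt]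
        have pgt: "prim gt t = prim g\<delta> t - prim g\<omega> t" for t
          unfolding gt_def using prim_diff[OF H_D(3)[OF c.sol_H[OF g\<delta>]] H_D(3)[OF c.sol_H[OF g\<omega>]], of t] by simp
        have "(LINT t|leb_\<Omega>. \<bar>prim gt t\<bar>) \<le> (LINT t|leb_\<Omega>. \<bar>prim g\<delta> t\<bar> + P * (h\<^sup>2 + s) / \<nu>)"
        proof (rule integral_mono_AE)
          show "AE t in leb_\<Omega>. \<bar>prim gt t\<bar> \<le> \<bar>prim g\<delta> t\<bar> + P * (h\<^sup>2 + s) / \<nu>"
          proof (rule AE_I2)
            fix t
            have "\<bar>prim g\<omega> t\<bar> \<le> P * (h\<^sup>2 + s) / \<nu>"
              using energy_sup[OF subset_refl g\<omega> ess_bounded_integrable[OF \<omega>b], of t] divide_right_mono[OF \<omega>1, of \<nu>] \<nu> by linarith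
            then show "\<bar>prim gt t\<bar> \<le> \<bar>prim g\<delta> t\<bar> + P * (h\<^sup>2 + s) / \<nu>" unfolding pgt by linarith
          qed
        qed (use ys in \<open>auto intro!: ess_bounded_integrable\<close>)
        also have "\<dots> = s + P * (h\<^sup>2 + s) / \<nu>" using ess_bounded_integrable[OF ess_bounded_abs[OF ys(1)]] leb.prob_space by (simp add: s_def)
        also have "\<dots> \<le> (h\<^sup>2 + s) + P * (h\<^sup>2 + s) / \<nu>" by simp
        also have "\<dots> = (1 + P / \<nu>) * (h\<^sup>2 + s)" by (simp add: distrib_right)
        finally have "N * (LINT t|leb_\<Omega>. \<bar>prim gt t\<bar>) \<le> N * ((1 + P / \<nu>) * (h\<^sup>2 + s))" using N by simp
        then show ?thesis unfolding T_def T0_def using Nineq[OF gt] by (simp add: mult.assoc)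
      qed
      have D1: "D1 \<le> (T0 + P) * (h\<^sup>2 + s)"
      proof -
        have "D1 \<le> (LINT t|leb_\<Omega>. T + \<bar>\<omega> t\<bar>)" unfolding D1_def
        proof (rule integral_mono_AE)
          show "AE t in leb_\<Omega>. \<bar>qb t - qh t\<bar> \<le> T + \<bar>\<omega> t\<bar>"
          proof (rule AE_I2)
            fix t
            have "\<bar>\<Sum>i=1..m. (cb i - ch i) * indicator {xb i<..<1} t\<bar> \<le> (\<Sum>i=1..m. \<bar>(cb i - ch i) * indicator {xb i<..<1} t\<bar>)"
              by (rule sum_abs)
            also have "\<dots> \<le> (\<Sum>i=1..m. \<bar>cb i - ch i\<bar>)" by (intro sum_mono) (auto simp: indicator_def)
            finally have "\<bar>step_fun m (ab - ah) (\<lambda>i. cb i - ch i) xb t\<bar> \<le> T" unfolding step_fun_def T_def by linarith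
            then show "\<bar>qb t - qh t\<bar> \<le> T + \<bar>\<omega> t\<bar>" unfolding \<omega>_def by linarith
          qed
        qed (use \<delta>i ess_bounded_integrable[OF \<omega>b] in auto)
        also have "\<dots> = T + (LINT t|leb_\<Omega>. \<bar>\<omega> t\<bar>)" using ess_bounded_integrable[OF \<omega>b] leb.prob_space by simp
        also have "\<dots> \<le> T0 * (h\<^sup>2 + s) + P * (h\<^sup>2 + s)" using T \<omega>1 by linarith
        finally show ?thesis by (simp add: distrib_right)
      qed
      have sM: "h\<^sup>2 + s \<le> M * h\<^sup>2"
      proof -
        have "s\<^sup>2 \<le> C * h\<^sup>2 * (D1 + s)" by (rule sq)
        also have "\<dots> \<le> C * h\<^sup>2 * ((T0 + P + 1) * (h\<^sup>2 + s))"
        proof (rule mult_left_mono)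
          have "D1 + s \<le> (T0 + P) * (h\<^sup>2 + s) + (h\<^sup>2 + s)" using D1 zero_le_power2[of h] by linarith
          then show "D1 + s \<le> (T0 + P + 1) * (h\<^sup>2 + s)" by (simp add: distrib_right)
        qed (use C in auto)
        also have "\<dots> = A0 * h\<^sup>2 * (h\<^sup>2 + s)" by (simp add: A0_def ac_simps)
        finally have "s \<le> (2 * A0 + 1) * h\<^sup>2" by (rule quadratic_absorb[OF s0 nn(4)])
        then show ?thesis by (simp add: M_def distrib_right)
      qed
      have final: "p * (h\<^sup>2 + s) \<le> Cf * h\<^sup>2" if p: "0 \<le> p" "p \<le> P1 + T0 + (T0 + P) + C" for p
      proof -
        have "p * (h\<^sup>2 + s) \<le> p * (M * h\<^sup>2)" using sM p by (intro mult_left_mono) auto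
        also have "\<dots> \<le> (P1 + T0 + (T0 + P) + C) * (M * h\<^sup>2)" using p nn by (intro mult_right_mono) auto
        finally show ?thesis by (simp add: Cf_def mult.assoc)
      qed
      show "\<exists>ah ch xh.
          (\<forall>i\<in>{1..m}. {t \<in> ball (xb i) R. zh t = 0} = {xh i}) \<and>
          (AE t in leb_\<Omega>. qh t = step_fun m ah ch xh t) \<and>
          (\<Sum>i=1..m. \<bar>xb i - xh i\<bar>) \<le> Cf * (mesh_width l x)\<^sup>2 \<and>
          (\<Sum>i=1..m. \<bar>cb i - ch i\<bar>) \<le> Cf * (mesh_width l x)\<^sup>2 \<and>
          \<bar>ab - ah\<bar> \<le> Cf * (mesh_width l x)\<^sup>2 \<and>
          L1_norm (\<lambda>t. qb t - qh t) \<le> Cf * (mesh_width l x)\<^sup>2 \<and>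
          Linf_norm (\<lambda>t. zb t - zh t) \<le> ereal (Cf * (mesh_width l x)\<^sup>2)"
        unfolding h_def[symmetric]
      proof (rule exI[of _ ah], rule exI[of _ ch], rule exI[of _ xh], intro conjI ballI)
        fix i assume i: "i \<in> {1..m}"
        have "{t \<in> ball (xb i) R. zh t = 0} = {t \<in> ball (xb i) R. prim kh t = 0}" using zh balls[OF i] by auto
        then show "{t \<in> ball (xb i) R. zh t = 0} = {xh i}" using xh[OF i] by simp
      next
        show "AE t in leb_\<Omega>. qh t = step_fun m ah ch xh t" by (rule qh_step)
        show "(\<Sum>i=1..m. \<bar>xb i - xh i\<bar>) \<le> Cf * h\<^sup>2" using X final[of P1] nn C by (simp add: X_def)
        have Tf: "T \<le> Cf * h\<^sup>2" using T final[of T0] nn C by simp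
        show "(\<Sum>i=1..m. \<bar>cb i - ch i\<bar>) \<le> Cf * h\<^sup>2" using Tf unfolding T_def by linarith
        have "0 \<le> (\<Sum>i=1..m. \<bar>cb i - ch i\<bar>)" by (intro sum_nonneg) auto
        then show "\<bar>ab - ah\<bar> \<le> Cf * h\<^sup>2" using Tf unfolding T_def by linarith
        show "L1_norm (\<lambda>t. qb t - qh t) \<le> Cf * h\<^sup>2" using D1 final[of "T0 + P"] nn C by (simp add: L1_norm_def D1_def)
        show "Linf_norm (\<lambda>t. zb t - zh t) \<le> ereal (Cf * h\<^sup>2)" unfolding Linf_norm_def
        proof (rule esssup_I)
          have "ess_bounded (\<lambda>t. \<bar>zb t - zh t\<bar>)"
            using hrep_ess_bounded[OF kh(1)] ess_bounded_cont[OF assms(10)] by auto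
          then show "(\<lambda>t. ereal \<bar>zb t - zh t\<bar>) \<in> borel_measurable leb_\<Omega>" by (auto dest: ess_bounded_measurable)
          show "AE t in leb_\<Omega>. ereal \<bar>zb t - zh t\<bar> \<le> ereal (Cf * h\<^sup>2)"
          proof (rule AE_leb_\<Omega>I)
            fix t :: real assume "0 < t" "t < 1"
            then have t: "t \<in> \<Omega>" "t \<in> {0..1}" by auto
            have "\<bar>zb t - zh t\<bar> \<le> C * (h\<^sup>2 + s)" using zclose[OF t(2)] by (simp add: zb[OF t(1)] zh[OF t(1)])
            then show "ereal \<bar>zb t - zh t\<bar> \<le> ereal (Cf * h\<^sup>2)" using final[of C] nn C by simp
          qed
        qed
      qed
    qed
  qed
qed

end
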